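(* (i) Let $\mathcal{C}$ be an abelian category, let $\mathcal{M}\in\mathcal{C}$, and suppose that $A=\operatorname{End}_{\mathcal{C}}(\mathcal{M})$ is right noetherian. If $\mathcal{F}$ is a Gabriel topology on $A$ such that $\mathcal{M}$ is $\mathcal{F}$-ample, then $A$ is $\mathcal{F}$-closed (as a right $A$-module), and there is an equivalence of categories $\mathcal{C}\simeq \text{mod-}A/\mathcal{F}$. (ii) Conversely, let $A$ be a right noetherian ring and let $\mathcal{F}$ be a Gabriel topology on $A$ such that $A$ is $\mathcal{F}$-closed. Then $\pi(A)$ is $\mathcal{F}$-ample in $\text{mod-}A/\mathcal{F}$ (where $\mathcal F$ is regarded as a Gabriel topology on $\operatorname{End}(\pi(A))$ via the canonical ring isomorphism $A\cong\operatorname{End}(\pi(A))$, which exists because $A$ is $\mathcal F$-closed).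
   Context: Rings are associative with unit and modules are right modules. A Gabriel topology $\mathcal{F}$ on a ring $A$ is a nonempty set of right ideals, closed under larger right ideals and finite intersections, such that $(I:a)=\{x\in A\mid ax\in I\}\in\mathcal{F}$ whenever $I\in\mathcal{F}$, $a\in A$, and such that a right ideal $I$ is in $\mathcal{F}$ whenever there is $J\in\mathcal{F}$ with $(I:a)\in\mathcal{F}$ for all $a\in J$. An $A$-module $X$ is $\mathcal{F}$-torsion if every element of $X$ is annihilated by some $I\in\mathcal{F}$. $\text{Mod-}A/\mathcal{F}$ is the quotient category of the category $\text{Mod-}A$ of all $A$-modules by the Serre subcategory of $\mathcal{F}$-torsion modules; $\pi\colon\text{Mod-}A\to\text{Mod-}A/\mathcal{F}$ is the quotient functor and $\omega$ is its right adjoint. An $A$-module $X$ is $\mathcal{F}$-closed if the unit $X\to\omega\pi(X)$ is an isomorphism. If $A$ is right noetherian, $\text{mod-}A/\mathcal{F}$ is the quotient category of the category $\text{mod-}A$ of finitely generated $A$-modules by the finitely generated $\mathcal{F}$-torsion modules; it is a full subcategory of $\text{Mod-}A/\mathcal{F}$. Let $\mathcal{C}$ be an abelian category, $\mathcal{M}\in\mathcal{C}$, $B=\operatorname{End}_{\mathcal{C}}(\mathcal{M})$, and $\mathcal{G}$ a Gabriel topology on $B$; $\operatorname{Hom}_{\mathcal{C}}(\mathcal{M},\mathcal{X})$ is a right $B$-module by composition. $\mathcal{M}$ is called $\mathcal{G}$-ample if: (a) it is a finite generator: every $\mathcal{X}\in\mathcal{C}$ admits an epimorphism $\mathcal{M}^{\oplus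 r}\to\mathcal{X}$ for some $r\in\mathbb{N}$; (b) it is finitely $\mathcal{G}$-self-generated: for every $J\in\mathcal{G}$ there exist $f_1,\dots,f_r\in J$ such that $(f_i)\colon\mathcal{M}^{\oplus r}\to\mathcal{M}$ is an epimorphism; (c) it is $\mathcal{G}$-projective: for every epimorphism $\mathcal{X}\to\mathcal{Y}$ in $\mathcal{C}$ the $B$-module $\operatorname{coker}(\operatorname{Hom}_{\mathcal{C}}(\mathcal{M},\mathcal{X})\to\operatorname{Hom}_{\mathcal{C}}(\mathcal{M},\mathcal{Y}))$ is $\mathcal{G}$-torsion. *)

theory Defs
  imports "HOL-Algebra.QuotRing"
begin

section \<open>Right modules\<close>

text \<open>As in \<open>HOL-Algebra.Module\<close>, a module record extends the ring record in order to reuse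
  the additive structure; the fields \<^const>\<open>mult\<close> and \<^const>\<open>one\<close> carry no meaning. The scalar
  acts from the right: \<open>x \<triangleleft>\<^bsub>X\<^esub> a\<close> is $x a$.\<close>

record ('a, 'u) rmodule = "'u ring" +
  act :: "'u \<Rightarrow> 'a \<Rightarrow> 'u" (infixl "\<triangleleft>\<index>" 70)

locale right_module = A?: ring A + X?: abelian_group X for A (structure) and X (structure) +
  assumes act_closed: "\<lbrakk>x \<in> carrier X; a \<in> carrier A\<rbrakk> \<Longrightarrow> x \<triangleleft>\<^bsub>X\<^esub> a \<in> carrier X"
    and act_add_left: "\<lbrakk>x \<in> carrier X; y \<in> carrier X; a \<in> carrier A\<rbrakk>
          \<Longrightarrow> (x \<oplus>\<^bsub>X\<^esub> y) \<triangleleft>\<^bsub>X\<^esub> a = (x \<triangleleft>\<^bsub>X\<^esub> a) \<oplus>\<^bsub>X\<^esub> (y \<triangleleft>\<^bsub>X\<^esub> a)"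
    and act_add_right: "\<lbrakk>x \<in> carrier X; a \<in> carrier A; b \<in> carrier A\<rbrakk>
          \<Longrightarrow> x \<triangleleft>\<^bsub>X\<^esub> (a \<oplus>\<^bsub>A\<^esub> b) = (x \<triangleleft>\<^bsub>X\<^esub> a) \<oplus>\<^bsub>X\<^esub> (x \<triangleleft>\<^bsub>X\<^esub> b)"
    and act_assoc: "\<lbrakk>x \<in> carrier X; a \<in> carrier A; b \<in> carrier A\<rbrakk>
          \<Longrightarrow> x \<triangleleft>\<^bsub>X\<^esub> (a \<otimes>\<^bsub>A\<^esub> b) = (x \<triangleleft>\<^bsub>X\<^esub> a) \<triangleleft>\<^bsub>X\<^esub> b"
    and act_one: "x \<in> carrier X \<Longrightarrow> x \<triangleleft>\<^bsub>X\<^esub> \<one>\<^bsub>A\<^esub> = x"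

definition submodule :: "'a ring \<Rightarrow> ('a, 'u) rmodule \<Rightarrow> 'u set \<Rightarrow> bool" where
  "submodule A X N \<longleftrightarrow> additive_subgroup N X \<and>
     (\<forall>x\<in>N. \<forall>a\<in>carrier A. x \<triangleleft>\<^bsub>X\<^esub> a \<in> N)"

definition quot_module :: "('a, 'u) rmodule \<Rightarrow> 'u set \<Rightarrow> ('a, 'u set) rmodule" where
  "quot_module X N = \<lparr>carrier = a_rcosets\<^bsub>X\<^esub> N, mult = undefined, one = undefined,
     zero = N, add = set_add X, act = (\<lambda>K a. \<Union>x\<in>K. N +>\<^bsub>X\<^esub> (x \<triangleleft>\<^bsub>X\<^esub> a))\<rparr>"

definition fin_gen :: "'a ring \<Rightarrow> ('a, 'u) rmodule \<Rightarrow> bool" where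
  "fin_gen A X \<longleftrightarrow> (\<exists>S. finite S \<and> S \<subseteq> carrier X \<and>
     (\<forall>N. submodule A X N \<and> S \<subseteq> N \<longrightarrow> N = carrier X))"

definition regular_module :: "'a ring \<Rightarrow> ('a, 'a) rmodule" where
  "regular_module A = \<lparr>carrier = carrier A, mult = mult A, one = one A,
     zero = zero A, add = add A, act = mult A\<rparr>"

definition right_ideal :: "'a ring \<Rightarrow> 'a set \<Rightarrow> bool" where
  "right_ideal A I \<longleftrightarrow> submodule A (regular_module A) I"

definition right_noetherian :: "'a ring \<Rightarrow> bool" where
  "right_noetherian A \<longleftrightarrow> ring A \<and>
     (\<forall>I. right_ideal A I \<longrightarrow> fin_gen A ((regular_module A)\<lparr>carrier := I\<rparr>))"

text \<open>The copy of a module along a map \<open>e\<close> that is injective on its carrier.\<close>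

definition transport_module :: "('u \<Rightarrow> 'v) \<Rightarrow> ('a, 'u) rmodule \<Rightarrow> ('a, 'v) rmodule" where
  "transport_module e X = (let d = inv_into (carrier X) e in
     \<lparr>carrier = e ` carrier X, mult = undefined, one = undefined, zero = e \<zero>\<^bsub>X\<^esub>,
      add = (\<lambda>x y. e (d x \<oplus>\<^bsub>X\<^esub> d y)), act = (\<lambda>x a. e (d x \<triangleleft>\<^bsub>X\<^esub> a))\<rparr>)"


section \<open>Gabriel topologies\<close>

definition ideal_colon :: "'a ring \<Rightarrow> 'a set \<Rightarrow> 'a \<Rightarrow> 'a set" where
  "ideal_colon A I a = {x \<in> carrier A. a \<otimes>\<^bsub>A\<^esub> x \<in> I}"

definition gabriel_topology :: "'a ring \<Rightarrow> 'a set set \<Rightarrow> bool" where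
  "gabriel_topology A F \<longleftrightarrow>
     F \<noteq> {} \<and> (\<forall>I\<in>F. right_ideal A I) \<and>
     (\<forall>I\<in>F. \<forall>J. right_ideal A J \<and> I \<subseteq> J \<longrightarrow> J \<in> F) \<and>
     (\<forall>I\<in>F. \<forall>J\<in>F. I \<inter> J \<in> F) \<and>
     (\<forall>I\<in>F. \<forall>a\<in>carrier A. ideal_colon A I a \<in> F) \<and>
     (\<forall>I. \<forall>J\<in>F. right_ideal A I \<and> (\<forall>a\<in>J. ideal_colon A I a \<in> F) \<longrightarrow> I \<in> F)"

definition torsion_module :: "'a set set \<Rightarrow> ('a, 'u) rmodule \<Rightarrow> bool" where
  "torsion_module F X \<longleftrightarrow> (\<forall>x\<in>carrier X. \<exists>I\<in>F. \<forall>a\<in>I. x \<triangleleft>\<^bsub>X\<^esub> a = \<zero>\<^bsub>X\<^esub>)"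


section \<open>Categories, functors, adjunctions, equivalences\<close>

record ('o, 'm) cat =
  Obj :: "'o set"
  Arr :: "'m set"
  Dom :: "'m \<Rightarrow> 'o"
  Cod :: "'m \<Rightarrow> 'o"
  Ident :: "'o \<Rightarrow> 'm"
  Comp :: "'m \<Rightarrow> 'm \<Rightarrow> 'm" (infixr "\<cdot>\<index>" 70)

definition hom_set :: "('o, 'm, 'z) cat_scheme \<Rightarrow> 'o \<Rightarrow> 'o \<Rightarrow> 'm set" where
  "hom_set C X Y = {f \<in> Arr C. Dom C f = X \<and> Cod C f = Y}"

locale category =
  fixes C :: "('o, 'm, 'z) cat_scheme" (structure)
  assumes Dom_in: "f \<in> Arr C \<Longrightarrow> Dom C f \<in> Obj C"
    and Cod_in: "f \<in> Arr C \<Longrightarrow> Cod C f \<in> Obj C"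
    and Ident_in: "X \<in> Obj C \<Longrightarrow> Ident C X \<in> hom_set C X X"
    and Comp_in: "\<lbrakk>f \<in> hom_set C X Y; g \<in> hom_set C Y Z\<rbrakk> \<Longrightarrow> g \<cdot> f \<in> hom_set C X Z"
    and Ident_left: "f \<in> hom_set C X Y \<Longrightarrow> Ident C Y \<cdot> f = f"
    and Ident_right: "f \<in> hom_set C X Y \<Longrightarrow> f \<cdot> Ident C X = f"
    and Comp_assoc: "\<lbrakk>f \<in> hom_set C W X; g \<in> hom_set C X Y; h \<in> hom_set C Y Z\<rbrakk>
          \<Longrightarrow> (h \<cdot> g) \<cdot> f = h \<cdot> (g \<cdot> f)"

definition full_subcat :: "('o, 'm, 'z) cat_scheme \<Rightarrow> 'o set \<Rightarrow> ('o, 'm, 'z) cat_scheme" where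
  "full_subcat C S = C\<lparr>Obj := Obj C \<inter> S, Arr := {f \<in> Arr C. Dom C f \<in> S \<and> Cod C f \<in> S}\<rparr>"

definition is_mono :: "('o, 'm, 'z) cat_scheme \<Rightarrow> 'm \<Rightarrow> bool" where
  "is_mono C f \<longleftrightarrow> f \<in> Arr C \<and> (\<forall>g\<in>Arr C. \<forall>h\<in>Arr C.
     Dom C g = Dom C h \<and> Cod C g = Dom C f \<and> Cod C h = Dom C f \<and> f \<cdot>\<^bsub>C\<^esub> g = f \<cdot>\<^bsub>C\<^esub> h \<longrightarrow> g = h)"

definition is_epi :: "('o, 'm, 'z) cat_scheme \<Rightarrow> 'm \<Rightarrow> bool" where
  "is_epi C f \<longleftrightarrow> f \<in> Arr C \<and> (\<forall>g\<in>Arr C. \<forall>h\<in>Arr C.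
     Cod C g = Cod C h \<and> Dom C g = Cod C f \<and> Dom C h = Cod C f \<and> g \<cdot>\<^bsub>C\<^esub> f = h \<cdot>\<^bsub>C\<^esub> f \<longrightarrow> g = h)"

definition is_iso :: "('o, 'm, 'z) cat_scheme \<Rightarrow> 'm \<Rightarrow> bool" where
  "is_iso C f \<longleftrightarrow> f \<in> Arr C \<and> (\<exists>g\<in>hom_set C (Cod C f) (Dom C f).
     g \<cdot>\<^bsub>C\<^esub> f = Ident C (Dom C f) \<and> f \<cdot>\<^bsub>C\<^esub> g = Ident C (Cod C f))"

definition is_coproduct :: "('o, 'm, 'z) cat_scheme \<Rightarrow> nat \<Rightarrow> (nat \<Rightarrow> 'o) \<Rightarrow> 'o \<Rightarrow> (nat \<Rightarrow> 'm) \<Rightarrow> bool"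
  where "is_coproduct C r X P j \<longleftrightarrow> P \<in> Obj C \<and> (\<forall>i<r. j i \<in> hom_set C (X i) P) \<and>
     (\<forall>Y\<in>Obj C. \<forall>f. (\<forall>i<r. f i \<in> hom_set C (X i) Y) \<longrightarrow>
        (\<exists>!h. h \<in> hom_set C P Y \<and> (\<forall>i<r. h \<cdot>\<^bsub>C\<^esub> j i = f i)))"

record ('o, 'm, 'p, 'n) cfunctor =
  obj_map :: "'o \<Rightarrow> 'p"
  arr_map :: "'m \<Rightarrow> 'n"

definition is_functor ::
  "('o, 'm, 'z) cat_scheme \<Rightarrow> ('p, 'n, 'y) cat_scheme \<Rightarrow> ('o, 'm, 'p, 'n) cfunctor \<Rightarrow> bool" where
  "is_functor C D T \<longleftrightarrow> category C \<and> category D \<and>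
     (\<forall>X\<in>Obj C. obj_map T X \<in> Obj D \<and> arr_map T (Ident C X) = Ident D (obj_map T X)) \<and>
     (\<forall>f\<in>Arr C. arr_map T f \<in> hom_set D (obj_map T (Dom C f)) (obj_map T (Cod C f))) \<and>
     (\<forall>f\<in>Arr C. \<forall>g\<in>Arr C. Dom C g = Cod C f \<longrightarrow>
        arr_map T (g \<cdot>\<^bsub>C\<^esub> f) = arr_map T g \<cdot>\<^bsub>D\<^esub> arr_map T f)"

definition id_functor :: "('o, 'm, 'o, 'm) cfunctor" where
  "id_functor = \<lparr>obj_map = id, arr_map = id\<rparr>"

definition comp_functor ::
  "('p, 'n, 'q, 'l) cfunctor \<Rightarrow> ('o, 'm, 'p, 'n) cfunctor \<Rightarrow> ('o, 'm, 'q, 'l) cfunctor" where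
  "comp_functor T S = \<lparr>obj_map = obj_map T \<circ> obj_map S, arr_map = arr_map T \<circ> arr_map S\<rparr>"

definition nat_trans ::
  "('o, 'm, 'z) cat_scheme \<Rightarrow> ('p, 'n, 'y) cat_scheme \<Rightarrow> ('o, 'm, 'p, 'n) cfunctor \<Rightarrow>
   ('o, 'm, 'p, 'n) cfunctor \<Rightarrow> ('o \<Rightarrow> 'n) \<Rightarrow> bool" where
  "nat_trans C D S T \<eta> \<longleftrightarrow> is_functor C D S \<and> is_functor C D T \<and>
     (\<forall>X\<in>Obj C. \<eta> X \<in> hom_set D (obj_map S X) (obj_map T X)) \<and>
     (\<forall>f\<in>Arr C. \<eta> (Cod C f) \<cdot>\<^bsub>D\<^esub> arr_map S f = arr_map T f \<cdot>\<^bsub>D\<^esub> \<eta> (Dom C f))"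

definition nat_iso ::
  "('o, 'm, 'z) cat_scheme \<Rightarrow> ('p, 'n, 'y) cat_scheme \<Rightarrow> ('o, 'm, 'p, 'n) cfunctor \<Rightarrow>
   ('o, 'm, 'p, 'n) cfunctor \<Rightarrow> ('o \<Rightarrow> 'n) \<Rightarrow> bool" where
  "nat_iso C D S T \<eta> \<longleftrightarrow> nat_trans C D S T \<eta> \<and> (\<forall>X\<in>Obj C. is_iso D (\<eta> X))"

definition equivalent_cats :: "('o, 'm, 'z) cat_scheme \<Rightarrow> ('p, 'n, 'y) cat_scheme \<Rightarrow> bool" where
  "equivalent_cats C D \<longleftrightarrow> (\<exists>S T \<eta> \<epsilon>. is_functor C D S \<and> is_functor D C T \<and>
     nat_iso C C id_functor (comp_functor T S) \<eta> \<and> nat_iso D D (comp_functor S T) id_functor \<epsilon>)"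

text \<open>\<open>R\<close> is right adjoint to \<open>L\<close> with unit \<open>\<eta>\<close> and counit \<open>\<epsilon>\<close>.\<close>

definition adjunction ::
  "('o, 'm, 'z) cat_scheme \<Rightarrow> ('p, 'n, 'y) cat_scheme \<Rightarrow> ('o, 'm, 'p, 'n) cfunctor \<Rightarrow>
   ('p, 'n, 'o, 'm) cfunctor \<Rightarrow> ('o \<Rightarrow> 'm) \<Rightarrow> ('p \<Rightarrow> 'n) \<Rightarrow> bool" where
  "adjunction C D L R \<eta> \<epsilon> \<longleftrightarrow> is_functor C D L \<and> is_functor D C R \<and>
     nat_trans C C id_functor (comp_functor R L) \<eta> \<and>
     nat_trans D D (comp_functor L R) id_functor \<epsilon> \<and>
     (\<forall>X\<in>Obj C. \<epsilon> (obj_map L X) \<cdot>\<^bsub>D\<^esub> arr_map L (\<eta> X) = Ident D (obj_map L X)) \<and>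
     (\<forall>Y\<in>Obj D. arr_map R (\<epsilon> Y) \<cdot>\<^bsub>C\<^esub> \<eta> (obj_map R Y) = Ident C (obj_map R Y))"


section \<open>Abelian categories\<close>

record ('o, 'm) addcat = "('o, 'm) cat" +
  Zero :: "'o \<Rightarrow> 'o \<Rightarrow> 'm"
  Add :: "'m \<Rightarrow> 'm \<Rightarrow> 'm"

definition End_ring :: "('o, 'm) addcat \<Rightarrow> 'o \<Rightarrow> 'm ring" where
  "End_ring C M = \<lparr>carrier = hom_set C M M, mult = Comp C, one = Ident C M,
     zero = Zero C M M, add = Add C\<rparr>"

text \<open>The hom-set from \<open>M\<close> to \<open>X\<close> as a right module over \<open>End_ring C M\<close>.\<close>

definition hom_module :: "('o, 'm) addcat \<Rightarrow> 'o \<Rightarrow> 'o \<Rightarrow> ('m, 'm) rmodule" where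
  "hom_module C M X = \<lparr>carrier = hom_set C M X, mult = undefined, one = undefined,
     zero = Zero C M X, add = Add C, act = Comp C\<rparr>"

locale preadditive_category = category C for C :: "('o, 'm) addcat" (structure) +
  assumes hom_abelian_group: "\<lbrakk>X \<in> Obj C; Y \<in> Obj C\<rbrakk> \<Longrightarrow> abelian_group (hom_module C X Y)"
    and Comp_Add_right: "\<lbrakk>f \<in> hom_set C X Y; f' \<in> hom_set C X Y; g \<in> hom_set C Y Z\<rbrakk>
          \<Longrightarrow> g \<cdot> Add C f f' = Add C (g \<cdot> f) (g \<cdot> f')"
    and Comp_Add_left: "\<lbrakk>f \<in> hom_set C X Y; g \<in> hom_set C Y Z; g' \<in> hom_set C Y Z\<rbrakk>
          \<Longrightarrow> Add C g g' \<cdot> f = Add C (g \<cdot> f) (g' \<cdot> f)"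

definition is_kernel :: "('o, 'm) addcat \<Rightarrow> 'm \<Rightarrow> 'm \<Rightarrow> bool" where
  "is_kernel C f k \<longleftrightarrow> f \<in> Arr C \<and> k \<in> Arr C \<and> Cod C k = Dom C f \<and>
     f \<cdot>\<^bsub>C\<^esub> k = Zero C (Dom C k) (Cod C f) \<and>
     (\<forall>g\<in>Arr C. Cod C g = Dom C f \<and> f \<cdot>\<^bsub>C\<^esub> g = Zero C (Dom C g) (Cod C f) \<longrightarrow>
        (\<exists>!h. h \<in> hom_set C (Dom C g) (Dom C k) \<and> k \<cdot>\<^bsub>C\<^esub> h = g))"

definition is_cokernel :: "('o, 'm) addcat \<Rightarrow> 'm \<Rightarrow> 'm \<Rightarrow> bool" where
  "is_cokernel C f q \<longleftrightarrow> f \<in> Arr C \<and> q \<in> Arr C \<and> Dom C q = Cod C f \<and>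
     q \<cdot>\<^bsub>C\<^esub> f = Zero C (Dom C f) (Cod C q) \<and>
     (\<forall>g\<in>Arr C. Dom C g = Cod C f \<and> g \<cdot>\<^bsub>C\<^esub> f = Zero C (Dom C f) (Cod C g) \<longrightarrow>
        (\<exists>!h. h \<in> hom_set C (Cod C q) (Cod C g) \<and> h \<cdot>\<^bsub>C\<^esub> q = g))"

text \<open>The empty coproduct is the zero object.\<close>

locale abelian_category = preadditive_category C for C :: "('o, 'm) addcat" (structure) +
  assumes finite_coproducts:
      "(\<And>i. i < r \<Longrightarrow> X i \<in> Obj C) \<Longrightarrow> \<exists>P j. is_coproduct C r X P j"
    and kernels: "f \<in> Arr C \<Longrightarrow> \<exists>k. is_kernel C f k"
    and cokernels: "f \<in> Arr C \<Longrightarrow> \<exists>q. is_cokernel C f q"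
    and mono_normal: "is_mono C f \<Longrightarrow> \<exists>g. is_kernel C g f"
    and epi_normal: "is_epi C f \<Longrightarrow> \<exists>g. is_cokernel C g f"


section \<open>Ampleness\<close>

definition finite_generator :: "('o, 'm) addcat \<Rightarrow> 'o \<Rightarrow> bool" where
  "finite_generator C M \<longleftrightarrow> (\<forall>X\<in>Obj C. \<exists>r P j p.
     is_coproduct C r (\<lambda>_. M) P j \<and> p \<in> hom_set C P X \<and> is_epi C p)"

definition finitely_self_generated :: "('o, 'm) addcat \<Rightarrow> 'o \<Rightarrow> 'm set set \<Rightarrow> bool" where
  "finitely_self_generated C M G \<longleftrightarrow> (\<forall>J\<in>G. \<exists>r f P j p. (\<forall>i<r. f i \<in> J) \<and>
     is_coproduct C r (\<lambda>_. M) P j \<and> p \<in> hom_set C P M \<and> (\<forall>i<r. p \<cdot>\<^bsub>C\<^esub> j i = f i) \<and> is_epi C p)"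

definition G_projective :: "('o, 'm) addcat \<Rightarrow> 'o \<Rightarrow> 'm set set \<Rightarrow> bool" where
  "G_projective C M G \<longleftrightarrow> (\<forall>X\<in>Obj C. \<forall>Y\<in>Obj C. \<forall>p\<in>hom_set C X Y. is_epi C p \<longrightarrow>
     torsion_module G (quot_module (hom_module C M Y) ((\<lambda>g. p \<cdot>\<^bsub>C\<^esub> g) ` hom_set C M X)))"

definition ample :: "('o, 'm) addcat \<Rightarrow> 'o \<Rightarrow> 'm set set \<Rightarrow> bool" where
  "ample C M G \<longleftrightarrow> finite_generator C M \<and> finitely_self_generated C M G \<and> G_projective C M G"


section \<open>Quotients by Serre subcategories\<close>

text \<open>For an abelian category \<open>C\<close> and a Serre subcategory with object set \<open>S\<close>, the quotient
  \<open>C/S\<close> is the localization of \<open>C\<close> at the arrows with kernel and cokernel in \<open>S\<close>. These admit a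
  calculus of right fractions, so an arrow from \<open>X\<close> to \<open>Y\<close> in \<open>C/S\<close> is an equivalence class of
  roofs \<open>X \<leftarrow> W \<rightarrow> Y\<close>, written as pairs \<open>(s, f)\<close> and read as $f s^{-1}$.\<close>

definition S_iso :: "('o, 'm) addcat \<Rightarrow> 'o set \<Rightarrow> 'm \<Rightarrow> bool" where
  "S_iso C S s \<longleftrightarrow> (\<exists>k q. is_kernel C s k \<and> is_cokernel C s q \<and> Dom C k \<in> S \<and> Cod C q \<in> S)"

definition roofs :: "('o, 'm) addcat \<Rightarrow> 'o set \<Rightarrow> ('m \<times> 'm) set" where
  "roofs C S = {(s, f). s \<in> Arr C \<and> f \<in> Arr C \<and> Dom C s = Dom C f \<and> S_iso C S s}"

definition roof_rel :: "('o, 'm) addcat \<Rightarrow> 'o set \<Rightarrow> (('m \<times> 'm) \<times> ('m \<times> 'm)) set" where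
  "roof_rel C S = {((s, f), (t, g)). (s, f) \<in> roofs C S \<and> (t, g) \<in> roofs C S \<and>
     Cod C s = Cod C t \<and> Cod C f = Cod C g \<and>
     (\<exists>u\<in>Arr C. \<exists>v\<in>Arr C. Dom C u = Dom C v \<and> Cod C u = Dom C s \<and> Cod C v = Dom C t \<and>
        s \<cdot>\<^bsub>C\<^esub> u = t \<cdot>\<^bsub>C\<^esub> v \<and> f \<cdot>\<^bsub>C\<^esub> u = g \<cdot>\<^bsub>C\<^esub> v \<and> S_iso C S (s \<cdot>\<^bsub>C\<^esub> u))}"

abbreviation roof_class :: "('o, 'm) addcat \<Rightarrow> 'o set \<Rightarrow> 'm \<Rightarrow> 'm \<Rightarrow> ('m \<times> 'm) set" where
  "roof_class C S s f \<equiv> roof_rel C S `` {(s, f)}"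

text \<open>The composite of \<open>(s, f)\<close> followed by \<open>(t, g)\<close> is \<open>(s u, g v)\<close> for any square
  \<open>f u = t v\<close> with \<open>u\<close> inverted. Any two arrows with common source and target have
  representatives \<open>(s, f)\<close>, \<open>(s, g)\<close> with a common denominator, and their sum is \<open>(s, f + g)\<close>.
  In both cases all choices give the same class, so the unions below are single classes.\<close>

definition serre_quotient :: "('o, 'm) addcat \<Rightarrow> 'o set \<Rightarrow> ('o, ('m \<times> 'm) set) addcat" where
  "serre_quotient C S =
     \<lparr>Obj = Obj C,
      Arr = roofs C S // roof_rel C S,
      Dom = (\<lambda>\<Phi>. Cod C (fst (SOME r. r \<in> \<Phi>))),
      Cod = (\<lambda>\<Phi>. Cod C (snd (SOME r. r \<in> \<Phi>))),
      Ident = (\<lambda>X. roof_class C S (Ident C X) (Ident C X)),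
      Comp = (\<lambda>\<Psi> \<Phi>. \<Union> {roof_class C S (s \<cdot>\<^bsub>C\<^esub> u) (g \<cdot>\<^bsub>C\<^esub> v) | s f t g u v.
         (s, f) \<in> \<Phi> \<and> (t, g) \<in> \<Psi> \<and> u \<in> Arr C \<and> v \<in> Arr C \<and> Dom C u = Dom C v \<and>
         Cod C u = Dom C f \<and> Cod C v = Dom C t \<and> f \<cdot>\<^bsub>C\<^esub> u = t \<cdot>\<^bsub>C\<^esub> v \<and> S_iso C S u}),
      Zero = (\<lambda>X Y. roof_class C S (Ident C X) (Zero C X Y)),
      Add = (\<lambda>\<Phi> \<Psi>. \<Union> {roof_class C S s (Add C f g) | s f g. (s, f) \<in> \<Phi> \<and> (s, g) \<in> \<Psi>})\<rparr>"

definition quotient_functor ::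
  "('o, 'm) addcat \<Rightarrow> 'o set \<Rightarrow> ('o, 'm, 'o, ('m \<times> 'm) set) cfunctor" where
  "quotient_functor C S = \<lparr>obj_map = id, arr_map = (\<lambda>f. roof_class C S (Ident C (Dom C f)) f)\<rparr>"


section \<open>Module categories and their quotients\<close>

text \<open>The type \<open>'u\<close> of carriers plays the role of the universe: objects are the right modules
  whose carrier is a subset of \<open>'u\<close>. An arrow is a linear map together with its source and target;
  maps are made \<^const>\<open>extensional\<close> so that equal maps are equal arrows.\<close>

type_synonym ('a, 'u) rmod_arr = "('a, 'u) rmodule \<times> ('a, 'u) rmodule \<times> ('u \<Rightarrow> 'u)"

type_synonym ('a, 'u) rmod_cat = "(('a, 'u) rmodule, ('a, 'u) rmod_arr) addcat"

type_synonym ('a, 'u) rmod_quot_cat =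
  "(('a, 'u) rmodule, (('a, 'u) rmod_arr \<times> ('a, 'u) rmod_arr) set) addcat"

definition linear_maps ::
  "'a ring \<Rightarrow> ('a, 'u) rmodule \<Rightarrow> ('a, 'v) rmodule \<Rightarrow> ('u \<Rightarrow> 'v) set" where
  "linear_maps A X Y = {h \<in> carrier X \<rightarrow>\<^sub>E carrier Y.
     (\<forall>x\<in>carrier X. \<forall>y\<in>carrier X. h (x \<oplus>\<^bsub>X\<^esub> y) = h x \<oplus>\<^bsub>Y\<^esub> h y) \<and>
     (\<forall>x\<in>carrier X. \<forall>a\<in>carrier A. h (x \<triangleleft>\<^bsub>X\<^esub> a) = h x \<triangleleft>\<^bsub>Y\<^esub> a)}"

definition Mod_cat :: "'a ring \<Rightarrow> ('a, 'u) rmod_cat" where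
  "Mod_cat A =
     \<lparr>Obj = {X. right_module A X},
      Arr = {(X, Y, h). right_module A X \<and> right_module A Y \<and> h \<in> linear_maps A X Y},
      Dom = (\<lambda>(X, Y, h). X),
      Cod = (\<lambda>(X, Y, h). Y),
      Ident = (\<lambda>X. (X, X, \<lambda>x\<in>carrier X. x)),
      Comp = (\<lambda>(Y', Z, h) (X, Y, g). (X, Z, \<lambda>x\<in>carrier X. h (g x))),
      Zero = (\<lambda>X Y. (X, Y, \<lambda>x\<in>carrier X. \<zero>\<^bsub>Y\<^esub>)),
      Add = (\<lambda>(X, Y, g) (X', Y', h). (X, Y, \<lambda>x\<in>carrier X. g x \<oplus>\<^bsub>Y\<^esub> h x))\<rparr>"

definition fgmod_cat :: "'a ring \<Rightarrow> ('a, 'u) rmod_cat" where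
  "fgmod_cat A = full_subcat (Mod_cat A) {X. fin_gen A X}"

definition Mod_quot :: "'a ring \<Rightarrow> 'a set set \<Rightarrow> ('a, 'u) rmod_quot_cat" where
  "Mod_quot A F = serre_quotient (Mod_cat A) {X \<in> Obj (Mod_cat A). torsion_module F X}"

definition fgmod_quot :: "'a ring \<Rightarrow> 'a set set \<Rightarrow> ('a, 'u) rmod_quot_cat" where
  "fgmod_quot A F = serre_quotient (fgmod_cat A) {X \<in> Obj (fgmod_cat A). torsion_module F X}"

definition Mod_pi :: "'a ring \<Rightarrow> 'a set set \<Rightarrow>
    (('a, 'u) rmodule, ('a, 'u) rmod_arr, ('a, 'u) rmodule,
     (('a, 'u) rmod_arr \<times> ('a, 'u) rmod_arr) set) cfunctor" where
  "Mod_pi A F = quotient_functor (Mod_cat A) {X \<in> Obj (Mod_cat A). torsion_module F X}"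

definition fgmod_pi :: "'a ring \<Rightarrow> 'a set set \<Rightarrow>
    (('a, 'u) rmodule, ('a, 'u) rmod_arr, ('a, 'u) rmodule,
     (('a, 'u) rmod_arr \<times> ('a, 'u) rmod_arr) set) cfunctor" where
  "fgmod_pi A F = quotient_functor (fgmod_cat A) {X \<in> Obj (fgmod_cat A). torsion_module F X}"

definition F_closed :: "'a ring \<Rightarrow> 'a set set \<Rightarrow> ('a, 'u) rmodule \<Rightarrow> bool" where
  "F_closed A F X \<longleftrightarrow> X \<in> Obj (Mod_cat A) \<and>
     (\<exists>\<omega> \<eta> \<epsilon>. adjunction (Mod_cat A) (Mod_quot A F) (Mod_pi A F) \<omega> \<eta> \<epsilon> \<and> is_iso (Mod_cat A) (\<eta> X))"

text \<open>\<open>reg e A\<close> is the module \<open>A\<close> over itself, placed in the universe \<open>'u\<close> by an injection \<open>e\<close>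
  of its carrier. For \<open>a\<close> in \<open>A\<close>, \<open>left_mult e A a\<close> is the endomorphism \<open>x \<mapsto> a x\<close> of this module,
  and \<open>canonical_map e A F a\<close> is its image in the endomorphism ring of \<open>\<pi> A\<close>.\<close>

definition reg :: "('a \<Rightarrow> 'u) \<Rightarrow> 'a ring \<Rightarrow> ('a, 'u) rmodule" where
  "reg e A = transport_module e (regular_module A)"

definition left_mult :: "('a \<Rightarrow> 'u) \<Rightarrow> 'a ring \<Rightarrow> 'a \<Rightarrow> ('a, 'u) rmod_arr" where
  "left_mult e A a = (reg e A, reg e A,
     \<lambda>x\<in>carrier (reg e A). e (a \<otimes>\<^bsub>A\<^esub> inv_into (carrier A) e x))"

definition canonical_map ::
  "('a \<Rightarrow> 'u) \<Rightarrow> 'a ring \<Rightarrow> 'a set set \<Rightarrow> 'a \<Rightarrow> (('a, 'u) rmod_arr \<times> ('a, 'u) rmod_arr) set" where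
  "canonical_map e A F a = arr_map (fgmod_pi A F) (left_mult e A a)"

text \<open>A universe for modules over \<open>A\<close>: infinite and at least as large as \<open>A\<close>, so that it contains
  a copy of every finitely generated module.\<close>

definition universe_embedding :: "'a ring \<Rightarrow> ('a \<Rightarrow> 'u) \<Rightarrow> bool" where
  "universe_embedding A e \<longleftrightarrow> infinite (UNIV :: 'u set) \<and> inj_on e (carrier A)"

end

theory Submission
  imports Defs
begin

text \<open>Arrows of \<open>Mod-A/F\<close> and \<open>mod-A/F\<close> are classes of roofs. Sending a roof
  \<open>(s, f)\<close> from \<open>X\<close> to \<open>Y\<close> to the \<open>F\<close>-saturation of \<open>{(s w, f w)}\<close> in \<open>X \<times> Y\<close>
  identifies them with the saturated linear relations whose domain is dense in \<open>X\<close> and in which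
  \<open>0\<close> is related to torsion elements only. Two such relations are equal as soon as one contains
  the other, so the calculus of fractions reduces to inclusions between relations.

  The right adjoint of \<open>\<pi>\<close> sends \<open>Y\<close> to the module of morphisms from \<open>A\<close> to \<open>Y\<close> in the quotient.
  Hence \<open>A\<close> is \<open>F\<close>-closed iff \<open>A\<close> is torsion-free and every morphism from \<open>A\<close> to \<open>A\<close> in the
  quotient is given by left multiplication, and the second part is a computation with relations.
  In the first part, \<open>F\<close>-self-generation makes the modules \<open>Hom(M, X)\<close> torsion-free, and a linear map
  from a finitely generated dense submodule of \<open>Hom(M, X)\<close> to \<open>Hom(M, Y)\<close> extends to a morphism
  \<open>X \<rightarrow> Y\<close>, because \<open>X\<close> is a cokernel of a map between objects generated by \<open>M\<close>; this makes
  \<open>X \<mapsto> Hom(M, X)\<close> fully faithful. Finite presentations and \<open>F\<close>-projectivity make it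
  essentially surjective.\<close>

subsection \<open>Modules, products and transport\<close>

text \<open>Two features of the setting shape the proof. First, modules live in a fixed type
  \<open>'u\<close>, so every construction has to be copied back into it. Submodules of products are
  carried along an injection of \<open>'u \<times> 'u\<close> into \<open>'u\<close>, available
  because \<open>'u\<close> is infinite; quotients are formed on chosen representatives. But
  morphisms from A to Y are sets of pairs, and it is the noetherian hypothesis that bounds their
  number, so that they form a module of the same universe and the right adjoint exists. Second, the
  same roof calculus serves all modules (to speak of closedness) and finitely generated ones (the
  quotient category of the theorem). It is therefore developed for a class of modules closed under
  jointly injective pairs of maps into members and under epimorphic images. Finally, closedness of X
  asks for some adjunction with invertible unit at X, so the adjoint can be built to suit X: its
  value at X is X itself, with the identity as counit.\<close>

definition prod_mod :: "('a, 'x) rmodule \<Rightarrow> ('a, 'y) rmodule \<Rightarrow> ('a, 'x \<times> 'y) rmodule" where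
  "prod_mod X Y = \<lparr>carrier = carrier X \<times> carrier Y, mult = undefined, one = undefined,
     zero = (\<zero>\<^bsub>X\<^esub>, \<zero>\<^bsub>Y\<^esub>), add = (\<lambda>p q. (fst p \<oplus>\<^bsub>X\<^esub> fst q, snd p \<oplus>\<^bsub>Y\<^esub> snd q)),
     act = (\<lambda>p a. (fst p \<triangleleft>\<^bsub>X\<^esub> a, snd p \<triangleleft>\<^bsub>Y\<^esub> a))\<rparr>"

lemma prod_mod_simps [simp]:
  "carrier (prod_mod X Y) = carrier X \<times> carrier Y"
  "zero (prod_mod X Y) = (\<zero>\<^bsub>X\<^esub>, \<zero>\<^bsub>Y\<^esub>)"
  "(x, y) \<oplus>\<^bsub>prod_mod X Y\<^esub> (x', y') = (x \<oplus>\<^bsub>X\<^esub> x', y \<oplus>\<^bsub>Y\<^esub> y')"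
  "(x, y) \<triangleleft>\<^bsub>prod_mod X Y\<^esub> a = (x \<triangleleft>\<^bsub>X\<^esub> a, y \<triangleleft>\<^bsub>Y\<^esub> a)"
  by (simp_all add: prod_mod_def)

locale right_modules = ring R for R :: "'a ring" (structure)
begin

abbreviation rmod :: "('a, 'u) rmodule \<Rightarrow> bool" where
  "rmod X \<equiv> right_module R X"

context
  fixes X :: "('a, 'u) rmodule"
  assumes X: "rmod X"
begin

interpretation X: right_module R X by (rule X)

lemma rmod_simps [simp]:
  "\<lbrakk>x \<in> carrier X; y \<in> carrier X\<rbrakk> \<Longrightarrow> x \<oplus>\<^bsub>X\<^esub> y \<in> carrier X"
  "\<zero>\<^bsub>X\<^esub> \<in> carrier X"
  "x \<in> carrier X \<Longrightarrow> \<ominus>\<^bsub>X\<^esub> x \<in> carrier X"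
  "\<lbrakk>x \<in> carrier X; a \<in> carrier R\<rbrakk> \<Longrightarrow> x \<triangleleft>\<^bsub>X\<^esub> a \<in> carrier X"
  "x \<in> carrier X \<Longrightarrow> x \<triangleleft>\<^bsub>X\<^esub> \<one> = x"
  "x \<in> carrier X \<Longrightarrow> x \<oplus>\<^bsub>X\<^esub> \<zero>\<^bsub>X\<^esub> = x"
  "x \<in> carrier X \<Longrightarrow> \<zero>\<^bsub>X\<^esub> \<oplus>\<^bsub>X\<^esub> x = x"
  "x \<in> carrier X \<Longrightarrow> x \<oplus>\<^bsub>X\<^esub> (\<ominus>\<^bsub>X\<^esub> x) = \<zero>\<^bsub>X\<^esub>"
  "x \<in> carrier X \<Longrightarrow> (\<ominus>\<^bsub>X\<^esub> x) \<oplus>\<^bsub>X\<^esub> x = \<zero>\<^bsub>X\<^esub>"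
  "\<lbrakk>x \<in> carrier X; y \<in> carrier X\<rbrakk> \<Longrightarrow> (x \<oplus>\<^bsub>X\<^esub> (\<ominus>\<^bsub>X\<^esub> y)) \<oplus>\<^bsub>X\<^esub> y = x"
  "\<lbrakk>x \<in> carrier X; y \<in> carrier X\<rbrakk> \<Longrightarrow> (x \<oplus>\<^bsub>X\<^esub> y) \<oplus>\<^bsub>X\<^esub> (\<ominus>\<^bsub>X\<^esub> y) = x"
  by (auto simp: X.act_closed X.act_one X.r_neg X.l_neg X.a_assoc)

lemma rmod_ac:
  "\<lbrakk>x \<in> carrier X; y \<in> carrier X; z \<in> carrier X\<rbrakk>
    \<Longrightarrow> (x \<oplus>\<^bsub>X\<^esub> y) \<oplus>\<^bsub>X\<^esub> z = x \<oplus>\<^bsub>X\<^esub> (y \<oplus>\<^bsub>X\<^esub> z)"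
  "\<lbrakk>x \<in> carrier X; y \<in> carrier X\<rbrakk> \<Longrightarrow> x \<oplus>\<^bsub>X\<^esub> y = y \<oplus>\<^bsub>X\<^esub> x"
  "\<lbrakk>x \<in> carrier X; y \<in> carrier X; z \<in> carrier X\<rbrakk>
    \<Longrightarrow> x \<oplus>\<^bsub>X\<^esub> (y \<oplus>\<^bsub>X\<^esub> z) = y \<oplus>\<^bsub>X\<^esub> (x \<oplus>\<^bsub>X\<^esub> z)"
  by (simp_all add: X.a_ac)

lemma rmod_act:
  "\<lbrakk>x \<in> carrier X; y \<in> carrier X; a \<in> carrier R\<rbrakk>
    \<Longrightarrow> (x \<oplus>\<^bsub>X\<^esub> y) \<triangleleft>\<^bsub>X\<^esub> a = (x \<triangleleft>\<^bsub>X\<^esub> a) \<oplus>\<^bsub>X\<^esub> (y \<triangleleft>\<^bsub>X\<^esub> a)"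
  "\<lbrakk>x \<in> carrier X; a \<in> carrier R; b \<in> carrier R\<rbrakk>
    \<Longrightarrow> x \<triangleleft>\<^bsub>X\<^esub> (a \<oplus> b) = (x \<triangleleft>\<^bsub>X\<^esub> a) \<oplus>\<^bsub>X\<^esub> (x \<triangleleft>\<^bsub>X\<^esub> b)"
  "\<lbrakk>x \<in> carrier X; a \<in> carrier R; b \<in> carrier R\<rbrakk>
    \<Longrightarrow> x \<triangleleft>\<^bsub>X\<^esub> (a \<otimes> b) = (x \<triangleleft>\<^bsub>X\<^esub> a) \<triangleleft>\<^bsub>X\<^esub> b"
  by (simp_all add: X.act_add_left X.act_add_right X.act_assoc)

lemma rmod_cancel: "\<lbrakk>x \<oplus>\<^bsub>X\<^esub> y = x; x \<in> carrier X; y \<in> carrier X\<rbrakk> \<Longrightarrow> y = \<zero>\<^bsub>X\<^esub>"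
  by (simp add: X.add.l_cancel_one)

lemma rmod_zero_act [simp]: "a \<in> carrier R \<Longrightarrow> \<zero>\<^bsub>X\<^esub> \<triangleleft>\<^bsub>X\<^esub> a = \<zero>\<^bsub>X\<^esub>"
  by (rule rmod_cancel[of "\<zero>\<^bsub>X\<^esub> \<triangleleft>\<^bsub>X\<^esub> a"]) (simp_all add: rmod_act(1)[symmetric])

lemma rmod_act_zero [simp]: "x \<in> carrier X \<Longrightarrow> x \<triangleleft>\<^bsub>X\<^esub> \<zero> = \<zero>\<^bsub>X\<^esub>"
  by (rule rmod_cancel[of "x \<triangleleft>\<^bsub>X\<^esub> \<zero>"]) (simp_all add: rmod_act(2)[symmetric])

lemma rmod_neg_act [simp]:
  assumes "x \<in> carrier X" "a \<in> carrier R"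
  shows "(\<ominus>\<^bsub>X\<^esub> x) \<triangleleft>\<^bsub>X\<^esub> a = \<ominus>\<^bsub>X\<^esub> (x \<triangleleft>\<^bsub>X\<^esub> a)"
  using assms rmod_act(1)[of "\<ominus>\<^bsub>X\<^esub> x" x a] by (simp add: X.minus_equality)

lemma rmod_act_neg_one: "x \<in> carrier X \<Longrightarrow> x \<triangleleft>\<^bsub>X\<^esub> (\<ominus> \<one>) = \<ominus>\<^bsub>X\<^esub> x"
  using rmod_act(2)[of x "\<ominus> \<one>" \<one>] by (simp add: X.minus_equality l_neg)

lemma rmod_diff_zero:
  "\<lbrakk>x \<in> carrier X; y \<in> carrier X\<rbrakk> \<Longrightarrow> x \<oplus>\<^bsub>X\<^esub> (\<ominus>\<^bsub>X\<^esub> y) = \<zero>\<^bsub>X\<^esub> \<longleftrightarrow> x = y"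
  by (metis rmod_simps(2,7,8,10))

text \<open>Negatives come for free: -x is x acted on by the negative of the unit.\<close>

lemma submodule_iff:
  "submodule R X N \<longleftrightarrow> N \<subseteq> carrier X \<and> \<zero>\<^bsub>X\<^esub> \<in> N \<and> (\<forall>x\<in>N. \<forall>y\<in>N. x \<oplus>\<^bsub>X\<^esub> y \<in> N) \<and>
     (\<forall>x\<in>N. \<forall>a\<in>carrier R. x \<triangleleft>\<^bsub>X\<^esub> a \<in> N)" (is "?L \<longleftrightarrow> ?R")
proof
  assume ?L
  then interpret additive_subgroup N X by (simp add: submodule_def)
  show ?R using \<open>?L\<close> a_subset by (auto simp: submodule_def)
next
  assume r: ?R
  have "additive_subgroup N X"
  proof (rule additive_subgroupI, rule X.add.subgroupI)
    fix x assume "x \<in> N"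
    with r show "\<ominus>\<^bsub>X\<^esub> x \<in> N"
      using rmod_act_neg_one[of x] by (metis add.inv_closed one_closed subsetD)
  qed (use r in auto)
  then show ?L using r by (simp add: submodule_def)
qed

lemma submoduleI:
  assumes "N \<subseteq> carrier X" "\<zero>\<^bsub>X\<^esub> \<in> N" "\<And>x y. \<lbrakk>x \<in> N; y \<in> N\<rbrakk> \<Longrightarrow> x \<oplus>\<^bsub>X\<^esub> y \<in> N"
    "\<And>x a. \<lbrakk>x \<in> N; a \<in> carrier R\<rbrakk> \<Longrightarrow> x \<triangleleft>\<^bsub>X\<^esub> a \<in> N"
  shows "submodule R X N"
  using assms by (auto simp: submodule_iff)

lemma submoduleD:
  assumes "submodule R X N"
  shows "x \<in> N \<Longrightarrow> x \<in> carrier X" "\<zero>\<^bsub>X\<^esub> \<in> N" "\<lbrakk>x \<in> N; y \<in> N\<rbrakk> \<Longrightarrow> x \<oplus>\<^bsub>X\<^esub> y \<in> N"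
    "\<lbrakk>x \<in> N; a \<in> carrier R\<rbrakk> \<Longrightarrow> x \<triangleleft>\<^bsub>X\<^esub> a \<in> N"
  using assms by (auto simp: submodule_iff)

lemma submodule_neg: "\<lbrakk>submodule R X N; x \<in> N\<rbrakk> \<Longrightarrow> \<ominus>\<^bsub>X\<^esub> x \<in> N"
  using submoduleD(1,4)[of N x] rmod_act_neg_one[of x] by (metis add.inv_closed one_closed)

lemma submodule_diff:
  "\<lbrakk>submodule R X N; x \<in> N; y \<in> N\<rbrakk> \<Longrightarrow> x \<oplus>\<^bsub>X\<^esub> (\<ominus>\<^bsub>X\<^esub> y) \<in> N"
  by (intro submoduleD(3) submodule_neg)

lemma submodule_carrier: "submodule R X (carrier X)"
  by (rule submoduleI) auto

lemma submodule_zero: "submodule R X {\<zero>\<^bsub>X\<^esub>}"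
  by (rule submoduleI) auto

lemma submodule_Int: "\<lbrakk>submodule R X N; submodule R X N'\<rbrakk> \<Longrightarrow> submodule R X (N \<inter> N')"
  by (auto simp: submodule_iff)

lemma rmod_restrict: "submodule R X N \<Longrightarrow> rmod (X\<lparr>carrier := N\<rparr>)"
proof -
  assume N: "submodule R X N"
  have "\<exists>y\<in>N. x \<oplus>\<^bsub>X\<^esub> y = \<zero>\<^bsub>X\<^esub>" if "x \<in> N" for x
    using that submodule_neg[OF N] submoduleD(1)[OF N] rmod_simps(8) by blast
  then have "abelian_group (X\<lparr>carrier := N\<rparr>)"
    using submoduleD[OF N] by (intro abelian_groupI) (auto simp: rmod_ac)
  then show ?thesis
    using submoduleD[OF N] by (simp add: right_module_def right_module_axioms_def rmod_act ring_axioms)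
qed

end

lemma submodule_restrict_iff:
  assumes X: "rmod X" and N: "submodule R X N"
  shows "submodule R (X\<lparr>carrier := N\<rparr>) L \<longleftrightarrow> submodule R X L \<and> L \<subseteq> N"
  unfolding submodule_iff[OF X] submodule_iff[OF rmod_restrict[OF assms]]
  using submoduleD[OF assms] by auto

lemma rmodI:
  fixes X :: "('a, 'u) rmodule"
  assumes "\<And>x y. \<lbrakk> x \<in> carrier X; y \<in> carrier X \<rbrakk> \<Longrightarrow> x \<oplus>\<^bsub>X\<^esub> y \<in> carrier X"
    "\<zero>\<^bsub>X\<^esub> \<in> carrier X"
    "\<And>x y z. \<lbrakk> x \<in> carrier X; y \<in> carrier X; z \<in> carrier X \<rbrakk>
      \<Longrightarrow> (x \<oplus>\<^bsub>X\<^esub> y) \<oplus>\<^bsub>X\<^esub> z = x \<oplus>\<^bsub>X\<^esub> (y \<oplus>\<^bsub>X\<^esub> z)"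
    "\<And>x y. \<lbrakk> x \<in> carrier X; y \<in> carrier X \<rbrakk> \<Longrightarrow> x \<oplus>\<^bsub>X\<^esub> y = y \<oplus>\<^bsub>X\<^esub> x"
    "\<And>x. x \<in> carrier X \<Longrightarrow> \<zero>\<^bsub>X\<^esub> \<oplus>\<^bsub>X\<^esub> x = x"
    "\<And>x. x \<in> carrier X \<Longrightarrow> \<exists>y \<in> carrier X. y \<oplus>\<^bsub>X\<^esub> x = \<zero>\<^bsub>X\<^esub>"
    "\<And>x a. \<lbrakk>x \<in> carrier X; a \<in> carrier R\<rbrakk> \<Longrightarrow> x \<triangleleft>\<^bsub>X\<^esub> a \<in> carrier X"
    "\<And>x y a. \<lbrakk>x \<in> carrier X; y \<in> carrier X; a \<in> carrier R\<rbrakk>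
          \<Longrightarrow> (x \<oplus>\<^bsub>X\<^esub> y) \<triangleleft>\<^bsub>X\<^esub> a = (x \<triangleleft>\<^bsub>X\<^esub> a) \<oplus>\<^bsub>X\<^esub> (y \<triangleleft>\<^bsub>X\<^esub> a)"
    "\<And>x a b. \<lbrakk>x \<in> carrier X; a \<in> carrier R; b \<in> carrier R\<rbrakk>
          \<Longrightarrow> x \<triangleleft>\<^bsub>X\<^esub> (a \<oplus> b) = (x \<triangleleft>\<^bsub>X\<^esub> a) \<oplus>\<^bsub>X\<^esub> (x \<triangleleft>\<^bsub>X\<^esub> b)"
    "\<And>x a b. \<lbrakk>x \<in> carrier X; a \<in> carrier R; b \<in> carrier R\<rbrakk>
          \<Longrightarrow> x \<triangleleft>\<^bsub>X\<^esub> (a \<otimes> b) = (x \<triangleleft>\<^bsub>X\<^esub> a) \<triangleleft>\<^bsub>X\<^esub> b"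
    "\<And>x. x \<in> carrier X \<Longrightarrow> x \<triangleleft>\<^bsub>X\<^esub> \<one> = x"
  shows "rmod X"
  using assms by (intro right_module.intro ring_axioms abelian_groupI right_module_axioms.intro) auto

lemma rmod_regular [simp]: "rmod (regular_module R)"
  unfolding regular_module_def
  by (rule rmodI) (auto simp: a_ac l_distr r_distr m_assoc intro: l_neg bexI)

lemma regular_module_simps [simp]:
  "carrier (regular_module S) = carrier S" "zero (regular_module S) = zero S"
  "add (regular_module S) = add S" "act (regular_module S) = mult S"
  by (simp_all add: regular_module_def)

lemma rmod_prod [simp]:
  assumes [simp]: "rmod X" "rmod Y"
  shows "rmod (prod_mod X Y)"
proof (rule rmodI, goal_cases)
  case (6 p)
  then show ?case by (intro bexI[of _ "(\<ominus>\<^bsub>X\<^esub> fst p, \<ominus>\<^bsub>Y\<^esub> snd p)"]) auto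
qed (auto simp: rmod_ac rmod_act)

lemma prod_mod_neg [simp]:
  assumes [simp]: "rmod X" "rmod Y" and xy: "x \<in> carrier X" "y \<in> carrier Y"
  shows "\<ominus>\<^bsub>prod_mod X Y\<^esub> (x, y) = (\<ominus>\<^bsub>X\<^esub> x, \<ominus>\<^bsub>Y\<^esub> y)"
  using xy rmod_act_neg_one[of "prod_mod X Y" "(x, y)"]
  by (simp add: rmod_act_neg_one)

text \<open>Leaves out the extensionality demanded by \<open>linear_maps\<close>, so that plain
  lambda terms and composites qualify; extensionality is restored when an arrow is formed.\<close>

definition linear :: "('a, 'x) rmodule \<Rightarrow> ('a, 'y) rmodule \<Rightarrow> ('x \<Rightarrow> 'y) \<Rightarrow> bool" where
  "linear X Y h \<longleftrightarrow> (\<forall>x\<in>carrier X. h x \<in> carrier Y) \<and>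
     (\<forall>x\<in>carrier X. \<forall>y\<in>carrier X. h (x \<oplus>\<^bsub>X\<^esub> y) = h x \<oplus>\<^bsub>Y\<^esub> h y) \<and>
     (\<forall>x\<in>carrier X. \<forall>a\<in>carrier R. h (x \<triangleleft>\<^bsub>X\<^esub> a) = h x \<triangleleft>\<^bsub>Y\<^esub> a)"

lemma linear_maps_iff: "h \<in> linear_maps R X Y \<longleftrightarrow> linear X Y h \<and> h \<in> extensional (carrier X)"
  by (auto simp: linear_maps_def linear_def PiE_def)

lemma linearD:
  assumes "linear X Y h"
  shows "x \<in> carrier X \<Longrightarrow> h x \<in> carrier Y"
    "\<lbrakk>x \<in> carrier X; y \<in> carrier X\<rbrakk> \<Longrightarrow> h (x \<oplus>\<^bsub>X\<^esub> y) = h x \<oplus>\<^bsub>Y\<^esub> h y"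
    "\<lbrakk>x \<in> carrier X; a \<in> carrier R\<rbrakk> \<Longrightarrow> h (x \<triangleleft>\<^bsub>X\<^esub> a) = h x \<triangleleft>\<^bsub>Y\<^esub> a"
  using assms by (auto simp: linear_def)

lemma linear_zero:
  assumes h: "linear X Y h" and [simp]: "rmod X" "rmod Y"
  shows "h \<zero>\<^bsub>X\<^esub> = \<zero>\<^bsub>Y\<^esub>"
proof (rule rmod_cancel[OF assms(3)])
  show "h \<zero>\<^bsub>X\<^esub> \<oplus>\<^bsub>Y\<^esub> h \<zero>\<^bsub>X\<^esub> = h \<zero>\<^bsub>X\<^esub>"
    using linearD(2)[OF h, of "\<zero>\<^bsub>X\<^esub>" "\<zero>\<^bsub>X\<^esub>"] by simp
qed (use linearD(1)[OF h] in auto)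

lemma linear_neg:
  assumes "linear X Y h" "rmod X" "rmod Y" "x \<in> carrier X"
  shows "h (\<ominus>\<^bsub>X\<^esub> x) = \<ominus>\<^bsub>Y\<^esub> (h x)"
  using linearD(3)[OF assms(1,4), of "\<ominus> \<one>"] linearD(1)[OF assms(1,4)] assms(2-)
  by (simp add: rmod_act_neg_one)

lemma linear_comp: "\<lbrakk>linear X Y f; linear Y Z g\<rbrakk> \<Longrightarrow> linear X Z (\<lambda>x. g (f x))"
  by (simp add: linear_def)

lemma linear_cong: "(\<And>x. x \<in> carrier X \<Longrightarrow> f x = g x) \<Longrightarrow> rmod X \<Longrightarrow> linear X Y f \<longleftrightarrow> linear X Y g"
  by (simp add: linear_def)

lemma linear_restrict [simp]: "rmod X \<Longrightarrow> linear X Y (restrict f (carrier X)) \<longleftrightarrow> linear X Y f"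
  by (rule linear_cong) auto

lemma submodule_vimage:
  assumes "linear X Y h" and [simp]: "rmod X" "rmod Y" and "submodule R Y N"
  shows "submodule R X {x \<in> carrier X. h x \<in> N}"
  using submoduleD[OF _ assms(4)] linearD[OF assms(1)] linear_zero[OF assms(1)]
  by (intro submoduleI) auto

lemma submodule_image:
  assumes "linear X Y h" and [simp]: "rmod X" "rmod Y" and "submodule R X N"
  shows "submodule R Y (h ` N)"
proof (rule submoduleI)
  show "\<zero>\<^bsub>Y\<^esub> \<in> h ` N"
    using linear_zero[OF assms(1)] submoduleD(2)[OF _ assms(4)] by force
qed (use submoduleD[OF _ assms(4)] linearD[OF assms(1)] in \<open>auto simp: image_iff; metis\<close>)+

lemma linear_inj_iff:
  assumes "linear X Y h" and [simp]: "rmod X" "rmod Y"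
  shows "inj_on h (carrier X) \<longleftrightarrow> (\<forall>x\<in>carrier X. h x = \<zero>\<^bsub>Y\<^esub> \<longrightarrow> x = \<zero>\<^bsub>X\<^esub>)"
proof
  assume "inj_on h (carrier X)"
  then show "\<forall>x\<in>carrier X. h x = \<zero>\<^bsub>Y\<^esub> \<longrightarrow> x = \<zero>\<^bsub>X\<^esub>"
    using linear_zero[OF assms] by (metis assms(2) inj_onD rmod_simps(2))
next
  assume *: "\<forall>x\<in>carrier X. h x = \<zero>\<^bsub>Y\<^esub> \<longrightarrow> x = \<zero>\<^bsub>X\<^esub>"
  show "inj_on h (carrier X)"
  proof (rule inj_onI)
    fix x y assume xy: "x \<in> carrier X" "y \<in> carrier X" "h x = h y"
    have "h (x \<oplus>\<^bsub>X\<^esub> (\<ominus>\<^bsub>X\<^esub> y)) = \<zero>\<^bsub>Y\<^esub>"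
      using xy linearD[OF assms(1)] by (simp add: linear_neg[OF assms(1)])
    then show "x = y" using * xy rmod_diff_zero[of X x y] by simp
  qed
qed

lemma transport_module_simps:
  "carrier (transport_module e X) = e ` carrier X"
  "zero (transport_module e X) = e \<zero>\<^bsub>X\<^esub>"
  "\<lbrakk>inj_on e (carrier X); x \<in> carrier X; y \<in> carrier X\<rbrakk>
    \<Longrightarrow> e x \<oplus>\<^bsub>transport_module e X\<^esub> e y = e (x \<oplus>\<^bsub>X\<^esub> y)"
  "\<lbrakk>inj_on e (carrier X); x \<in> carrier X\<rbrakk>
    \<Longrightarrow> e x \<triangleleft>\<^bsub>transport_module e X\<^esub> a = e (x \<triangleleft>\<^bsub>X\<^esub> a)"
  by (simp_all add: transport_module_def Let_def)

lemma rmod_transport: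
  assumes e: "inj_on e (carrier X)" and [simp]: "rmod X"
  shows "rmod (transport_module e X)"
proof (rule rmodI, goal_cases)
  case (6 x)
  then obtain x' where x: "x = e x'" "x' \<in> carrier X" by (auto simp: transport_module_simps)
  show ?case
    by (rule bexI[of _ "e (\<ominus>\<^bsub>X\<^esub> x')"]) (use e x in \<open>auto simp: transport_module_simps\<close>)
qed (use e in \<open>auto simp: transport_module_simps rmod_ac rmod_act\<close>)

lemma linear_transport:
  assumes e: "inj_on e (carrier X)" and [simp]: "rmod X"
  shows "linear X (transport_module e X) e"
    "linear (transport_module e X) X (inv_into (carrier X) e)"
  using e by (auto simp: linear_def transport_module_simps)

text \<open>Interface to copies of submodules in another type: later proofs see only the injective
  linear map \<open>d\<close> with image N, never the transported operations. It serves for kernels,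
  for relations coded as modules, and for dense submodules of Hom(M, X).\<close>

lemma subset_transport:
  assumes X [simp]: "rmod X" and N: "submodule R X N" and e: "inj_on e N"
  obtains W d where "rmod W" "linear W X d" "bij_betw d (carrier W) N" "carrier W = e ` N"
proof
  let ?N = "X\<lparr>carrier := N\<rparr>"
  have [simp]: "rmod ?N" by (rule rmod_restrict[OF X N])
  show "rmod (transport_module e ?N)" by (rule rmod_transport) (use e in auto)
  have "linear (transport_module e ?N) ?N (inv_into N e)"
    using linear_transport(2)[of e ?N] e by simp
  then show "linear (transport_module e ?N) X (inv_into N e)"
    using submoduleD(1)[OF X N] by (auto simp: linear_def)
  show "bij_betw (inv_into N e) (carrier (transport_module e ?N)) N"
    using e by (simp add: transport_module_simps bij_betw_inv_into inj_on_imp_bij_betw)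
  show "carrier (transport_module e ?N) = e ` N" by (simp add: transport_module_simps)
qed

end

subsection \<open>Saturation with respect to a Gabriel topology\<close>

lemma (in right_modules) rel_submodule_iff:
  assumes "rmod X" "rmod Y"
  shows "submodule R (prod_mod X Y) G \<longleftrightarrow>
    (\<forall>x y. (x, y) \<in> G \<longrightarrow> x \<in> carrier X \<and> y \<in> carrier Y) \<and> (\<zero>\<^bsub>X\<^esub>, \<zero>\<^bsub>Y\<^esub>) \<in> G \<and>
    (\<forall>x y x' y'. (x, y) \<in> G \<longrightarrow> (x', y') \<in> G \<longrightarrow> (x \<oplus>\<^bsub>X\<^esub> x', y \<oplus>\<^bsub>Y\<^esub> y') \<in> G) \<and>
    (\<forall>x y a. (x, y) \<in> G \<longrightarrow> a \<in> carrier R \<longrightarrow> (x \<triangleleft>\<^bsub>X\<^esub> a, y \<triangleleft>\<^bsub>Y\<^esub> a) \<in> G)"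
  unfolding submodule_iff[OF rmod_prod[OF assms]]
  by (simp add: subset_iff Ball_def split_paired_All)

lemma (in right_modules) rel_submoduleD:
  assumes "submodule R (prod_mod X Y) G" "rmod X" "rmod Y"
  shows "(x, y) \<in> G \<Longrightarrow> x \<in> carrier X" "(x, y) \<in> G \<Longrightarrow> y \<in> carrier Y"
    "(\<zero>\<^bsub>X\<^esub>, \<zero>\<^bsub>Y\<^esub>) \<in> G"
    "\<lbrakk>(x, y) \<in> G; (x', y') \<in> G\<rbrakk> \<Longrightarrow> (x \<oplus>\<^bsub>X\<^esub> x', y \<oplus>\<^bsub>Y\<^esub> y') \<in> G"
    "\<lbrakk>(x, y) \<in> G; a \<in> carrier R\<rbrakk> \<Longrightarrow> (x \<triangleleft>\<^bsub>X\<^esub> a, y \<triangleleft>\<^bsub>Y\<^esub> a) \<in> G"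
  using assms(1) by (auto simp: rel_submodule_iff[OF assms(2,3)])

lemma (in right_modules) rel_submodule_neg:
  assumes "submodule R (prod_mod X Y) G" "rmod X" "rmod Y" "(x, y) \<in> G"
  shows "(\<ominus>\<^bsub>X\<^esub> x, \<ominus>\<^bsub>Y\<^esub> y) \<in> G"
  using submodule_neg[OF rmod_prod assms(1,4)] assms rel_submoduleD(1,2)[OF assms(1-4)] by simp

lemma (in right_modules) submodule_Domain:
  assumes "submodule R (prod_mod X Y) G" "rmod X" "rmod Y"
  shows "submodule R X (Domain G)"
  using rel_submoduleD[OF assms] by (intro submoduleI assms) (auto simp: Domain_iff; blast)+

lemma (in right_modules) submodule_converse:
  assumes "submodule R (prod_mod X Y) G" "rmod X" "rmod Y"
  shows "submodule R (prod_mod Y X) (G\<inverse>)"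
  using rel_submoduleD[OF assms] by (auto simp: rel_submodule_iff assms)

lemma (in right_modules) submodule_relcomp:
  assumes G: "submodule R (prod_mod X Y) G" and H: "submodule R (prod_mod Y Z) H"
    and [simp]: "rmod X" "rmod Y" "rmod Z"
  shows "submodule R (prod_mod X Z) (G O H)"
  using rel_submoduleD[OF G] rel_submoduleD[OF H]
  by (simp add: rel_submodule_iff relcomp_unfold) (metis (no_types, lifting))

lemma (in right_modules) submodule_colon:
  assumes "rmod X" "submodule R X N" "x \<in> carrier X"
  shows "submodule R (regular_module R) {a \<in> carrier R. x \<triangleleft>\<^bsub>X\<^esub> a \<in> N}"
  using submoduleD[OF assms(1,2)] assms by (intro submoduleI) (auto simp: rmod_act)

locale gabriel = right_modules A for A :: "'a ring" (structure) +
  fixes F :: "'a set set"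
  assumes gabriel: "gabriel_topology A F"
begin

lemmas gabriel_unfolded = gabriel[unfolded gabriel_topology_def right_ideal_def ideal_colon_def]

lemma F_ideal: "I \<in> F \<Longrightarrow> submodule A (regular_module A) I"
  by (rule bspec[OF gabriel_unfolded[THEN conjunct2, THEN conjunct1]])

lemma F_carrierD: "\<lbrakk>I \<in> F; a \<in> I\<rbrakk> \<Longrightarrow> a \<in> carrier A"
  using submoduleD(1)[OF rmod_regular F_ideal] by simp

lemma F_upward: "\<lbrakk>I \<in> F; I \<subseteq> J; submodule A (regular_module A) J\<rbrakk> \<Longrightarrow> J \<in> F"
  using gabriel_unfolded[THEN conjunct2, THEN conjunct2, THEN conjunct1] by blast

lemma F_Int: "\<lbrakk>I \<in> F; J \<in> F\<rbrakk> \<Longrightarrow> I \<inter> J \<in> F"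
  using gabriel_unfolded[THEN conjunct2, THEN conjunct2, THEN conjunct2, THEN conjunct1] by blast

lemma F_colon: "\<lbrakk>I \<in> F; a \<in> carrier A\<rbrakk> \<Longrightarrow> {b \<in> carrier A. a \<otimes> b \<in> I} \<in> F"
  using gabriel_unfolded[THEN conjunct2, THEN conjunct2, THEN conjunct2, THEN conjunct2, THEN conjunct1]
  by blast

lemma F_local:
  "\<lbrakk>J \<in> F; submodule A (regular_module A) I; \<And>a. a \<in> J \<Longrightarrow> {b \<in> carrier A. a \<otimes> b \<in> I} \<in> F\<rbrakk>
    \<Longrightarrow> I \<in> F"
  using gabriel_unfolded[THEN conjunct2, THEN conjunct2, THEN conjunct2, THEN conjunct2, THEN conjunct2]
  by blast

lemma F_carrier: "carrier A \<in> F"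
proof -
  obtain I where "I \<in> F" using gabriel_unfolded[THEN conjunct1] by blast
  then show ?thesis
    using F_upward[of I "carrier A"] F_carrierD[of I] submodule_carrier[OF rmod_regular] by force
qed

text \<open>For a submodule N this is the preimage in X of the torsion part of X/N.\<close>

definition sat :: "('a, 'x) rmodule \<Rightarrow> 'x set \<Rightarrow> 'x set" where
  "sat X N = {x \<in> carrier X. \<exists>I\<in>F. \<forall>a\<in>I. x \<triangleleft>\<^bsub>X\<^esub> a \<in> N}"

text \<open>The largest ideal that can serve as a witness is (N : x), so upward closure of F turns
  the existential into one membership.\<close>

lemma sat_iff:
  assumes "rmod X" "submodule A X N"
  shows "x \<in> sat X N \<longleftrightarrow> x \<in> carrier X \<and> {a \<in> carrier A. x \<triangleleft>\<^bsub>X\<^esub> a \<in> N} \<in> F"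
proof
  assume "x \<in> sat X N"
  then obtain I where "x \<in> carrier X" "I \<in> F" "\<forall>a\<in>I. x \<triangleleft>\<^bsub>X\<^esub> a \<in> N" by (auto simp: sat_def)
  moreover from this have "I \<subseteq> {a \<in> carrier A. x \<triangleleft>\<^bsub>X\<^esub> a \<in> N}" using F_carrierD by auto
  ultimately show "x \<in> carrier X \<and> {a \<in> carrier A. x \<triangleleft>\<^bsub>X\<^esub> a \<in> N} \<in> F"
    using F_upward submodule_colon[OF assms] by blast
next
  assume "x \<in> carrier X \<and> {a \<in> carrier A. x \<triangleleft>\<^bsub>X\<^esub> a \<in> N} \<in> F"
  then show "x \<in> sat X N"
    unfolding sat_def by (intro CollectI conjI bexI[of _ "{a \<in> carrier A. x \<triangleleft>\<^bsub>X\<^esub> a \<in> N}"]) auto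
qed

lemma satI: "\<lbrakk>x \<in> carrier X; I \<in> F; \<And>a. a \<in> I \<Longrightarrow> x \<triangleleft>\<^bsub>X\<^esub> a \<in> N\<rbrakk> \<Longrightarrow> x \<in> sat X N"
  by (auto simp: sat_def)

lemma satE:
  assumes "x \<in> sat X N"
  obtains I where "x \<in> carrier X" "I \<in> F" "\<And>a. a \<in> I \<Longrightarrow> a \<in> carrier A" "\<And>a. a \<in> I \<Longrightarrow> x \<triangleleft>\<^bsub>X\<^esub> a \<in> N"
  using assms F_carrierD by (auto simp: sat_def)

lemma sat_mono: "N \<subseteq> N' \<Longrightarrow> sat X N \<subseteq> sat X N'"
  by (force simp: sat_def)

lemma sat_carrier: "x \<in> sat X N \<Longrightarrow> x \<in> carrier X"
  by (simp add: sat_def)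

context
  fixes X :: "('a, 'x) rmodule" and N :: "'x set"
  assumes X [simp]: "rmod X" and N: "submodule A X N"
begin

lemma subset_sat: "N \<subseteq> sat X N"
  using submoduleD[OF X N] F_carrier by (auto intro: satI)

text \<open>Sums use closure of F under intersections, scalars the axiom that (I : a) is in
  F.\<close>

lemma submodule_sat: "submodule A X (sat X N)"
proof (rule submoduleI[OF X])
  show "\<zero>\<^bsub>X\<^esub> \<in> sat X N" using subset_sat submoduleD(2)[OF X N] by auto
next
  fix x y assume "x \<in> sat X N" "y \<in> sat X N"
  then obtain I J where "x \<in> carrier X" "I \<in> F" "\<And>a. a \<in> I \<Longrightarrow> x \<triangleleft>\<^bsub>X\<^esub> a \<in> N"
    and "y \<in> carrier X" "J \<in> F" "\<And>a. a \<in> J \<Longrightarrow> y \<triangleleft>\<^bsub>X\<^esub> a \<in> N"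
    by (auto elim!: satE)
  then show "x \<oplus>\<^bsub>X\<^esub> y \<in> sat X N"
    using submoduleD(3)[OF X N] F_carrierD
    by (intro satI[of _ _ "I \<inter> J"]) (auto intro: F_Int simp: rmod_act)
next
  fix x a assume "x \<in> sat X N" and a: "a \<in> carrier A"
  then have x: "x \<in> carrier X" and "{a \<in> carrier A. x \<triangleleft>\<^bsub>X\<^esub> a \<in> N} \<in> F"
    by (auto simp: sat_iff[OF X N])
  from F_colon[OF this(2) a] show "x \<triangleleft>\<^bsub>X\<^esub> a \<in> sat X N"
    using x a by (auto intro!: satI simp: rmod_act)
qed (auto simp: sat_def)

text \<open>The transitivity axiom of a Gabriel topology in elementwise form: ((N : x) : a) equals
  (N : xa), so if xa is saturated over N for every a in some J in F, then (N : x) itself is in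
  F.\<close>

lemma satI_local:
  assumes x: "x \<in> carrier X" and J: "J \<in> F" "\<And>a. a \<in> J \<Longrightarrow> x \<triangleleft>\<^bsub>X\<^esub> a \<in> sat X N"
  shows "x \<in> sat X N"
proof -
  have "{a \<in> carrier A. x \<triangleleft>\<^bsub>X\<^esub> a \<in> N} \<in> F"
  proof (rule F_local[OF J(1) submodule_colon[OF X N x]])
    fix a assume a: "a \<in> J"
    then have [simp]: "a \<in> carrier A" using F_carrierD J by auto
    have "{b \<in> carrier A. a \<otimes> b \<in> {a \<in> carrier A. x \<triangleleft>\<^bsub>X\<^esub> a \<in> N}}
        = {b \<in> carrier A. (x \<triangleleft>\<^bsub>X\<^esub> a) \<triangleleft>\<^bsub>X\<^esub> b \<in> N}"
      using x by (auto simp: rmod_act)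
    then show "{b \<in> carrier A. a \<otimes> b \<in> {a \<in> carrier A. x \<triangleleft>\<^bsub>X\<^esub> a \<in> N}} \<in> F"
      using J(2)[OF a] by (simp add: sat_iff[OF X N])
  qed
  then show ?thesis using x by (simp add: sat_iff[OF X N])
qed

end

lemma sat_sat:
  assumes "rmod X" "submodule A X N"
  shows "sat X (sat X N) = sat X N"
  using satI_local[OF assms] subset_sat[OF assms(1) submodule_sat[OF assms]]
  by (auto elim!: satE)

lemma sat_least: "\<lbrakk>rmod X; submodule A X N; N' \<subseteq> sat X N\<rbrakk> \<Longrightarrow> sat X N' \<subseteq> sat X N"
  using sat_mono sat_sat by metis

abbreviation tors :: "('a, 'x) rmodule \<Rightarrow> 'x set" where
  "tors X \<equiv> sat X {\<zero>\<^bsub>X\<^esub>}"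

text \<open>For a submodule N this says that X/N is torsion.\<close>

definition dense :: "('a, 'x) rmodule \<Rightarrow> 'x set \<Rightarrow> bool" where
  "dense X N \<longleftrightarrow> carrier X \<subseteq> sat X N"

lemma denseE:
  assumes "dense X N" "x \<in> carrier X"
  obtains I where "I \<in> F" "\<And>a. a \<in> I \<Longrightarrow> a \<in> carrier A" "\<And>a. a \<in> I \<Longrightarrow> x \<triangleleft>\<^bsub>X\<^esub> a \<in> N"
  using assms by (auto simp: dense_def elim: satE dest!: subsetD)

lemma dense_mono: "\<lbrakk>dense X N; N \<subseteq> N'\<rbrakk> \<Longrightarrow> dense X N'"
  unfolding dense_def by (rule order_trans[OF _ sat_mono])

lemma dense_sat: "\<lbrakk>dense X N; submodule A X L; rmod X; N \<subseteq> sat X L\<rbrakk> \<Longrightarrow> dense X L"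
  unfolding dense_def by (metis order_trans sat_least)

lemma dense_Int:
  assumes "dense X N" "dense X N'"
  shows "dense X (N \<inter> N')"
  unfolding dense_def
proof
  fix x assume "x \<in> carrier X"
  then obtain I J where "I \<in> F" "\<And>a. a \<in> I \<Longrightarrow> x \<triangleleft>\<^bsub>X\<^esub> a \<in> N" "J \<in> F" "\<And>a. a \<in> J \<Longrightarrow> x \<triangleleft>\<^bsub>X\<^esub> a \<in> N'"
    using subsetD[OF assms(1)[unfolded dense_def]] subsetD[OF assms(2)[unfolded dense_def]]
    by (metis satE)
  then show "x \<in> sat X (N \<inter> N')"
    using \<open>x \<in> carrier X\<close> by (intro satI[of _ _ "I \<inter> J"]) (auto intro: F_Int)
qed

text \<open>Forwards, the unit is saturated over I and (I : 1) is I; backwards, every (I : a) is in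
  F.\<close>

lemma dense_regular_iff:
  assumes I: "submodule A (regular_module A) I"
  shows "dense (regular_module A) I \<longleftrightarrow> I \<in> F"
proof
  assume "dense (regular_module A) I"
  then have "\<one> \<in> sat (regular_module A) I" by (auto simp: dense_def)
  then have "{a \<in> carrier A. a \<in> I} \<in> F"
    by (simp add: sat_iff[OF rmod_regular I] cong: conj_cong)
  then show "I \<in> F" using submoduleD(1)[OF rmod_regular I] by (simp add: Collect_conj_eq Int_absorb1 subset_iff)
next
  assume "I \<in> F"
  then show "dense (regular_module A) I"
    using F_colon[of I] by (auto simp: dense_def sat_iff[OF rmod_regular I])
qed

lemma linear_sat:
  assumes h: "linear X Y h" and "h ` N \<subseteq> N'" and x: "x \<in> sat X N"
  shows "h x \<in> sat Y N'"
proof -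
  obtain I where I: "x \<in> carrier X" "I \<in> F" "\<And>a. a \<in> I \<Longrightarrow> a \<in> carrier A"
    "\<And>a. a \<in> I \<Longrightarrow> x \<triangleleft>\<^bsub>X\<^esub> a \<in> N"
    using x by (rule satE) blast
  show ?thesis
  proof (rule satI[OF _ I(2)])
    fix a assume "a \<in> I"
    then have "h (x \<triangleleft>\<^bsub>X\<^esub> a) = h x \<triangleleft>\<^bsub>Y\<^esub> a" using I linearD(3)[OF h] by blast
    then show "h x \<triangleleft>\<^bsub>Y\<^esub> a \<in> N'" using I(4)[OF \<open>a \<in> I\<close>] assms(2) by auto
  qed (use I linearD(1)[OF h] in blast)
qed

lemma torsion_module_iff: "torsion_module F X \<longleftrightarrow> carrier X \<subseteq> tors X"
  by (auto simp: torsion_module_def sat_def)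


subsection \<open>Morphisms of the quotient category as saturated linear relations\<close>

text \<open>Saturation is left out here, because composites and sums are first formed as plain
  relations and saturated afterwards.\<close>

definition pre_mor :: "('a, 'x) rmodule \<Rightarrow> ('a, 'y) rmodule \<Rightarrow> ('x \<times> 'y) set \<Rightarrow> bool" where
  "pre_mor X Y G \<longleftrightarrow> submodule A (prod_mod X Y) G \<and> dense X (Domain G) \<and>
     (\<forall>y. (\<zero>\<^bsub>X\<^esub>, y) \<in> G \<longrightarrow> y \<in> tors Y)"

definition qmor :: "('a, 'x) rmodule \<Rightarrow> ('a, 'y) rmodule \<Rightarrow> ('x \<times> 'y) set \<Rightarrow> bool" where
  "qmor X Y G \<longleftrightarrow> pre_mor X Y G \<and> sat (prod_mod X Y) G \<subseteq> G"

lemma sat_prod_iff: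
  "(x, y) \<in> sat (prod_mod X Y) G \<longleftrightarrow> x \<in> carrier X \<and> y \<in> carrier Y \<and>
    (\<exists>I\<in>F. \<forall>a\<in>I. (x \<triangleleft>\<^bsub>X\<^esub> a, y \<triangleleft>\<^bsub>Y\<^esub> a) \<in> G)"
  by (auto simp: sat_def)

lemma qmor_closedI:
  "\<lbrakk>qmor X Y G; I \<in> F; \<And>a. a \<in> I \<Longrightarrow> (x \<triangleleft>\<^bsub>X\<^esub> a, y \<triangleleft>\<^bsub>Y\<^esub> a) \<in> G; x \<in> carrier X; y \<in> carrier Y\<rbrakk>
    \<Longrightarrow> (x, y) \<in> G"
  using subsetD[of "sat (prod_mod X Y) G" G "(x, y)"] unfolding qmor_def sat_prod_iff by blast

definition graph :: "('a, 'x) rmodule \<Rightarrow> ('x \<Rightarrow> 'y) \<Rightarrow> ('x \<times> 'y) set" where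
  "graph X h = {(x, h x) | x. x \<in> carrier X}"

lemma graph_iff: "(x, y) \<in> graph X h \<longleftrightarrow> x \<in> carrier X \<and> y = h x"
  by (auto simp: graph_def)

lemma pre_morD: "pre_mor X Y G \<Longrightarrow> submodule A (prod_mod X Y) G"
  by (simp add: pre_mor_def)

lemma qmor_pre: "qmor X Y G \<Longrightarrow> pre_mor X Y G"
  by (simp add: qmor_def)

context
  fixes X :: "('a, 'x) rmodule" and Y :: "('a, 'y) rmodule"
  assumes X [simp]: "rmod X" and Y [simp]: "rmod Y"
begin

lemma pre_mor_subset_sat: "pre_mor X Y G \<Longrightarrow> G \<subseteq> sat (prod_mod X Y) G"
  by (rule subset_sat) (auto dest: pre_morD)

text \<open>A new value y at 0 is carried by an ideal in F to old values at 0, which are torsion; by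
  locality y is torsion too.\<close>

lemma qmor_sat:
  assumes G: "pre_mor X Y G"
  shows "qmor X Y (sat (prod_mod X Y) G)"
proof -
  note G' = pre_morD[OF G]
  have "y \<in> tors Y" if y: "(\<zero>\<^bsub>X\<^esub>, y) \<in> sat (prod_mod X Y) G" for y
  proof -
    obtain I where I: "y \<in> carrier Y" "I \<in> F" "\<And>a. a \<in> I \<Longrightarrow> (\<zero>\<^bsub>X\<^esub> \<triangleleft>\<^bsub>X\<^esub> a, y \<triangleleft>\<^bsub>Y\<^esub> a) \<in> G"
      using y unfolding sat_prod_iff by blast
    then have "y \<triangleleft>\<^bsub>Y\<^esub> a \<in> tors Y" if "a \<in> I" for a
      using that G F_carrierD[OF I(2) that] by (force simp: pre_mor_def)
    then show ?thesis using satI_local[OF Y submodule_zero[OF Y] I(1,2)] by blast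
  qed
  moreover have "dense X (Domain (sat (prod_mod X Y) G))"
    using G pre_mor_subset_sat[OF G] by (auto simp: pre_mor_def intro: dense_mono)
  ultimately show ?thesis
    using G' by (auto simp: qmor_def pre_mor_def submodule_sat sat_sat)
qed

text \<open>Morphisms that agree on a dense domain are equal, so every identity between morphisms
  reduces to an inclusion of relations.\<close>

lemma qmor_eq_sat:
  assumes H: "pre_mor X Y H" and G: "qmor X Y G" and "H \<subseteq> G"
  shows "G = sat (prod_mod X Y) H"
proof
  show "sat (prod_mod X Y) H \<subseteq> G"
    using sat_mono[OF \<open>H \<subseteq> G\<close>] G by (auto simp: qmor_def)
  note GD = rel_submoduleD[OF pre_morD[OF qmor_pre[OF G]] X Y]
  note H' = pre_morD[OF H]
  note HD = rel_submoduleD[OF submodule_sat[OF rmod_prod[OF X Y] H'] X Y]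
  show "G \<subseteq> sat (prod_mod X Y) H"
  proof clarify
    fix x y assume xy: "(x, y) \<in> G"
    then have [simp]: "x \<in> carrier X" "y \<in> carrier Y" using GD by auto
    obtain I where I: "I \<in> F" "\<And>a. a \<in> I \<Longrightarrow> x \<triangleleft>\<^bsub>X\<^esub> a \<in> Domain H"
      using H \<open>x \<in> carrier X\<close> unfolding pre_mor_def by (meson denseE)
    have *: "(x \<triangleleft>\<^bsub>X\<^esub> a, y \<triangleleft>\<^bsub>Y\<^esub> a) \<in> sat (prod_mod X Y) H" if a: "a \<in> I" for a
    proof -
      have [simp]: "a \<in> carrier A" using F_carrierD I a by auto
      obtain z where z: "(x \<triangleleft>\<^bsub>X\<^esub> a, z) \<in> H" using I(2)[OF a] by auto
      then have zG: "(x \<triangleleft>\<^bsub>X\<^esub> a, z) \<in> G" using assms by auto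
      then have [simp]: "z \<in> carrier Y" using GD by auto
      \<comment> \<open>Two values of G at the same point differ by a value at 0, which is torsion.
        The saturation of H contains all pairs of 0 with a torsion element, so it absorbs the
        difference.\<close>
      let ?w = "(\<ominus>\<^bsub>Y\<^esub> z) \<oplus>\<^bsub>Y\<^esub> (y \<triangleleft>\<^bsub>Y\<^esub> a)"
      have "((\<ominus>\<^bsub>X\<^esub> (x \<triangleleft>\<^bsub>X\<^esub> a)) \<oplus>\<^bsub>X\<^esub> (x \<triangleleft>\<^bsub>X\<^esub> a), ?w) \<in> G"
        using GD(4)[OF rel_submodule_neg[OF pre_morD[OF qmor_pre[OF G]] X Y zG] GD(5)[OF xy \<open>a \<in> carrier A\<close>]] .
      then have "?w \<in> tors Y" using G by (simp add: qmor_def pre_mor_def)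
      then obtain J where J: "J \<in> F" "\<And>b. b \<in> J \<Longrightarrow> ?w \<triangleleft>\<^bsub>Y\<^esub> b = \<zero>\<^bsub>Y\<^esub>" by (auto elim!: satE)
      then have "(\<zero>\<^bsub>X\<^esub>, ?w) \<in> sat (prod_mod X Y) H"
        unfolding sat_prod_iff using J(1) rel_submoduleD(3)[OF H' X Y] F_carrierD[OF J(1)]
        by (intro conjI bexI[of _ J] ballI) (simp_all add: J(2))
      from HD(4)[OF subsetD[OF pre_mor_subset_sat[OF H] z] this]
      have "(x \<triangleleft>\<^bsub>X\<^esub> a, z \<oplus>\<^bsub>Y\<^esub> ?w) \<in> sat (prod_mod X Y) H" by simp
      moreover have "z \<oplus>\<^bsub>Y\<^esub> ?w = y \<triangleleft>\<^bsub>Y\<^esub> a"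
        by (simp add: rmod_ac(1)[OF Y, symmetric])
      ultimately show ?thesis by simp
    qed
    show "(x, y) \<in> sat (prod_mod X Y) H"
      by (rule satI_local[OF rmod_prod[OF X Y] H' _ I(1)]) (simp_all add: *)
  qed
qed

text \<open>In applications H is a plain composite, sum or restricted graph lying inside both
  sides.\<close>

lemma qmor_eqI: "\<lbrakk>pre_mor X Y H; qmor X Y G; qmor X Y G'; H \<subseteq> G; H \<subseteq> G'\<rbrakk> \<Longrightarrow> G = G'"
  using qmor_eq_sat by blast

lemma qmor_subset_eq: "\<lbrakk>qmor X Y G; qmor X Y G'; G \<subseteq> G'\<rbrakk> \<Longrightarrow> G = G'"
  using qmor_eqI[of G G G'] qmor_pre by blast

lemma sat_qmor: "qmor X Y G \<Longrightarrow> sat (prod_mod X Y) G = G"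
  using qmor_eq_sat[of G G] qmor_pre by blast

lemma pre_mor_graph:
  assumes h: "linear X Y h"
  shows "pre_mor X Y (graph X h)"
proof -
  have "Domain (graph X h) = carrier X" by (auto simp: graph_def)
  moreover have "dense X (carrier X)"
    using subset_sat[OF X submodule_carrier[OF X]] by (simp add: dense_def)
  moreover have "\<zero>\<^bsub>Y\<^esub> \<in> tors Y" using subset_sat[OF Y submodule_zero[OF Y]] by auto
  ultimately show ?thesis
    using linearD[OF h] linear_zero[OF h]
    by (auto simp: pre_mor_def rel_submodule_iff graph_def)
qed

end

end

context gabriel
begin

abbreviation qgraph :: "('a, 'x) rmodule \<Rightarrow> ('a, 'y) rmodule \<Rightarrow> ('x \<Rightarrow> 'y) \<Rightarrow> ('x \<times> 'y) set" where
  "qgraph X Y h \<equiv> sat (prod_mod X Y) (graph X h)"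

abbreviation qcomp :: "('a, 'x) rmodule \<Rightarrow> ('a, 'z) rmodule \<Rightarrow> ('x \<times> 'y) set \<Rightarrow> ('y \<times> 'z) set \<Rightarrow> ('x \<times> 'z) set" where
  "qcomp X Z G H \<equiv> sat (prod_mod X Z) (G O H)"

text \<open>Both conditions follow by locality. If (x, y) is in G, an ideal moving y into the domain
  of H moves x into the domain of the composite. A value z at 0 passes through a torsion y, so an
  ideal in F sends z to values of H at 0, which are torsion.\<close>

lemma pre_mor_comp:
  fixes X :: "('a, 'x) rmodule" and Y :: "('a, 'y) rmodule" and Z :: "('a, 'z) rmodule"
  assumes [simp]: "rmod X" "rmod Y" "rmod Z" and G: "pre_mor X Y G" and H: "pre_mor Y Z H"
  shows "pre_mor X Z (G O H)"
proof -
  note GD = rel_submoduleD[OF pre_morD[OF G] assms(1,2)]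
  note HD = rel_submoduleD[OF pre_morD[OF H] assms(2,3)]
  have sub: "submodule A (prod_mod X Z) (G O H)"
    by (rule submodule_relcomp[OF pre_morD[OF G] pre_morD[OF H]]) auto
  have dG: "dense X (Domain G)" and dH: "dense Y (Domain H)"
    using G H by (simp_all add: pre_mor_def)
  have "dense X (Domain (G O H))"
  proof (rule dense_sat[OF dG submodule_Domain[OF sub]])
    show "Domain G \<subseteq> sat X (Domain (G O H))"
    proof clarify
      fix x y assume xy: "(x, y) \<in> G"
      obtain I where I: "I \<in> F" "\<And>a. a \<in> I \<Longrightarrow> a \<in> carrier A" "\<And>a. a \<in> I \<Longrightarrow> y \<triangleleft>\<^bsub>Y\<^esub> a \<in> Domain H"
        using denseE[OF dH GD(2)[OF xy]] by blast
      show "x \<in> sat X (Domain (G O H))"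
        by (rule satI[OF GD(1)[OF xy] I(1)]) (use GD(5)[OF xy] I in blast)
    qed
  qed auto
  moreover have "z \<in> tors Z" if z: "(\<zero>\<^bsub>X\<^esub>, z) \<in> G O H" for z
  proof -
    obtain y where y: "(\<zero>\<^bsub>X\<^esub>, y) \<in> G" "(y, z) \<in> H" using z by auto
    then have "y \<in> tors Y" using G by (simp add: pre_mor_def)
    then obtain I where I: "I \<in> F" "\<And>a. a \<in> I \<Longrightarrow> a \<in> carrier A" "\<And>a. a \<in> I \<Longrightarrow> y \<triangleleft>\<^bsub>Y\<^esub> a = \<zero>\<^bsub>Y\<^esub>"
      by (auto elim!: satE)
    have "z \<triangleleft>\<^bsub>Z\<^esub> a \<in> tors Z" if "a \<in> I" for a
    proof -
      have "(\<zero>\<^bsub>Y\<^esub>, z \<triangleleft>\<^bsub>Z\<^esub> a) \<in> H" using HD(5)[OF y(2) I(2)[OF that]] I(3)[OF that] by simp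
      then show ?thesis using H by (simp add: pre_mor_def)
    qed
    then show ?thesis using satI_local[OF _ submodule_zero HD(2)[OF y(2)] I(1)] by simp
  qed
  ultimately show ?thesis using sub by (simp add: pre_mor_def)
qed

lemma qmor_comp:
  assumes "rmod X" "rmod Y" "rmod Z" "qmor X Y G" "qmor Y Z H"
  shows "qmor X Z (qcomp X Z G H)"
  using assms by (intro qmor_sat pre_mor_comp[of X Y Z] qmor_pre)

lemma relcomp_subset_qcomp:
  assumes "rmod X" "rmod Y" "rmod Z" "qmor X Y G" "qmor Y Z H"
  shows "G O H \<subseteq> qcomp X Z G H"
  using assms by (intro pre_mor_subset_sat pre_mor_comp[of X Y Z] qmor_pre)

lemma qmor_graph: "\<lbrakk>rmod X; rmod Y; linear X Y h\<rbrakk> \<Longrightarrow> qmor X Y (qgraph X Y h)"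
  by (intro qmor_sat pre_mor_graph)

lemma graph_subset_qgraph: "\<lbrakk>rmod X; rmod Y; linear X Y h\<rbrakk> \<Longrightarrow> graph X h \<subseteq> qgraph X Y h"
  by (intro pre_mor_subset_sat pre_mor_graph)

lemma qmor_eq_qgraph:
  "\<lbrakk>rmod X; rmod Y; linear X Y h; qmor X Y G; graph X h \<subseteq> G\<rbrakk> \<Longrightarrow> G = qgraph X Y h"
  by (intro qmor_eq_sat pre_mor_graph)

lemma linear_id: "linear X X (\<lambda>x. x)"
  by (simp add: linear_def)

context
  fixes W :: "('a, 'w) rmodule" and X :: "('a, 'x) rmodule" and Y :: "('a, 'y) rmodule" and Z :: "('a, 'z) rmodule"
  assumes W [simp]: "rmod W" and X [simp]: "rmod X" and Y [simp]: "rmod Y" and Z [simp]: "rmod Z"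
begin

text \<open>Composition of plain relations is associative, so both sides contain the triple
  composite, which is itself a pre-morphism.\<close>

lemma qcomp_assoc:
  assumes G: "qmor W X G" and H: "qmor X Y H" and K: "qmor Y Z K"
  shows "qcomp W Z (qcomp W Y G H) K = qcomp W Z G (qcomp X Z H K)"
proof (rule qmor_eqI[OF W Z, of "G O H O K"])
  show "pre_mor W Z (G O H O K)"
    using G H K by (intro pre_mor_comp[of W X Z] pre_mor_comp[of X Y Z] qmor_pre) auto
  show "qmor W Z (qcomp W Z (qcomp W Y G H) K)"
    by (rule qmor_comp[of W Y Z]; (rule qmor_comp[of W X Y])?) (use assms in auto)
  show "qmor W Z (qcomp W Z G (qcomp X Z H K))"
    by (rule qmor_comp[of W X Z]; (rule qmor_comp[of X Y Z])?) (use assms in auto)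
  have "G O H \<subseteq> qcomp W Y G H" using G H by (intro relcomp_subset_qcomp[of W X Y]) auto
  then have "G O H O K \<subseteq> qcomp W Y G H O K" by auto
  also have "\<dots> \<subseteq> qcomp W Z (qcomp W Y G H) K"
    using assms by (intro relcomp_subset_qcomp[of W Y Z] qmor_comp[of W X Y]) auto
  finally show "G O H O K \<subseteq> qcomp W Z (qcomp W Y G H) K" .
  have "H O K \<subseteq> qcomp X Z H K" using H K by (intro relcomp_subset_qcomp[of X Y Z]) auto
  then have "G O H O K \<subseteq> G O qcomp X Z H K" by auto
  also have "\<dots> \<subseteq> qcomp W Z G (qcomp X Z H K)"
    using assms by (intro relcomp_subset_qcomp[of W X Z] qmor_comp[of X Y Z]) auto
  finally show "G O H O K \<subseteq> qcomp W Z G (qcomp X Z H K)" .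
qed

end

context
  fixes X :: "('a, 'x) rmodule" and Y :: "('a, 'y) rmodule" and Z :: "('a, 'z) rmodule"
  assumes X [simp]: "rmod X" and Y [simp]: "rmod Y" and Z [simp]: "rmod Z"
begin

text \<open>After a genuine linear map the composite is already saturated: if h x a is related to z
  a for all a in an ideal of F, then H, being saturated, relates h x to z. This makes values of
  morphisms at elements explicit.\<close>

lemma
  assumes h: "linear X Y h" and H: "qmor Y Z H"
  shows qmor_graph_comp: "qmor X Z (graph X h O H)"
    and qcomp_qgraph_left: "qcomp X Z (qgraph X Y h) H = graph X h O H"
proof -
  have pre: "pre_mor X Z (graph X h O H)"
    using h qmor_pre[OF H] by (intro pre_mor_comp[of X Y Z] pre_mor_graph) auto
  have "(x, z) \<in> graph X h O H" if xz: "(x, z) \<in> sat (prod_mod X Z) (graph X h O H)" for x z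
  proof -
    from xz obtain I where I: "x \<in> carrier X" "z \<in> carrier Z" "I \<in> F"
      "\<forall>a\<in>I. (x \<triangleleft>\<^bsub>X\<^esub> a, z \<triangleleft>\<^bsub>Z\<^esub> a) \<in> graph X h O H" unfolding sat_prod_iff by blast
    have "(h x, z) \<in> H"
      by (rule qmor_closedI[OF H I(3)])
        (use I(1,2,4) F_carrierD[OF I(3)] linearD[OF h] in \<open>auto simp: graph_iff\<close>)
    then show ?thesis using I by (auto simp: graph_iff)
  qed
  then show q: "qmor X Z (graph X h O H)" using pre by (auto simp: qmor_def)
  show "qcomp X Z (qgraph X Y h) H = graph X h O H"
  proof (rule qmor_eqI[OF X Z pre _ q])
    show "qmor X Z (qcomp X Z (qgraph X Y h) H)"
      using h H by (intro qmor_comp[of X Y Z] qmor_graph) auto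
    have "graph X h O H \<subseteq> qgraph X Y h O H" using graph_subset_qgraph[OF X Y h] by auto
    also have "\<dots> \<subseteq> qcomp X Z (qgraph X Y h) H"
      using h H by (intro relcomp_subset_qcomp[of X Y Z] qmor_graph) auto
    finally show "graph X h O H \<subseteq> qcomp X Z (qgraph X Y h) H" .
  qed auto
qed

lemma qcomp_qgraph_qgraph:
  assumes h: "linear X Y h" and g: "linear Y Z g"
  shows "qcomp X Z (qgraph X Y h) (qgraph Y Z g) = qgraph X Z (\<lambda>x. g (h x))"
proof (rule qmor_eq_qgraph[OF X Z linear_comp[OF h g]])
  show "qmor X Z (qcomp X Z (qgraph X Y h) (qgraph Y Z g))"
    using h g by (intro qmor_comp[of X Y Z] qmor_graph) auto
  show "graph X (\<lambda>x. g (h x)) \<subseteq> qcomp X Z (qgraph X Y h) (qgraph Y Z g)"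
    using qcomp_qgraph_left[OF h qmor_graph[OF Y Z g]] graph_subset_qgraph[OF Y Z g] linearD(1)[OF h]
    by (fastforce simp: graph_iff)
qed

end

context
  fixes X :: "('a, 'x) rmodule" and Y :: "('a, 'y) rmodule"
  assumes X [simp]: "rmod X" and Y [simp]: "rmod Y"
begin

lemma qcomp_id_left:
  assumes G: "qmor X Y G"
  shows "qcomp X Y (qgraph X X (\<lambda>x. x)) G = G"
proof (rule sym, rule qmor_subset_eq[OF X Y G])
  show "qmor X Y (qcomp X Y (qgraph X X (\<lambda>x. x)) G)"
    using G by (intro qmor_comp[of X X Y] qmor_graph linear_id) auto
  have "G \<subseteq> qgraph X X (\<lambda>x. x) O G"
    using graph_subset_qgraph[OF X X linear_id] rel_submoduleD(1)[OF pre_morD[OF qmor_pre[OF G]] X Y]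
    by (fastforce simp: graph_iff)
  also have "\<dots> \<subseteq> qcomp X Y (qgraph X X (\<lambda>x. x)) G"
    using G by (intro relcomp_subset_qcomp[of X X Y] qmor_graph linear_id) auto
  finally show "G \<subseteq> qcomp X Y (qgraph X X (\<lambda>x. x)) G" .
qed

lemma qcomp_id_right:
  assumes G: "qmor X Y G"
  shows "qcomp X Y G (qgraph Y Y (\<lambda>x. x)) = G"
proof (rule sym, rule qmor_subset_eq[OF X Y G])
  show "qmor X Y (qcomp X Y G (qgraph Y Y (\<lambda>x. x)))"
    using G by (intro qmor_comp[of X Y Y] qmor_graph linear_id) auto
  have "G \<subseteq> G O qgraph Y Y (\<lambda>x. x)"
    using graph_subset_qgraph[OF Y Y linear_id] rel_submoduleD(2)[OF pre_morD[OF qmor_pre[OF G]] X Y]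
    by (fastforce simp: graph_iff)
  also have "\<dots> \<subseteq> qcomp X Y G (qgraph Y Y (\<lambda>x. x))"
    using G by (intro relcomp_subset_qcomp[of X Y Y] qmor_graph linear_id) auto
  finally show "G \<subseteq> qcomp X Y G (qgraph Y Y (\<lambda>x. x))" .
qed

text \<open>The diagonal of the domain of G is dense and lies both in the identity and in G followed
  by its converse. This produces inverses from relations that are morphisms in both
  directions.\<close>

lemma qmor_converse:
  assumes G: "pre_mor X Y G" "pre_mor Y X (G\<inverse>)"
  shows "qcomp X X (sat (prod_mod X Y) G) (sat (prod_mod Y X) (G\<inverse>)) = qgraph X X (\<lambda>x. x)"
proof -
  let ?H = "{(x, x) | x. x \<in> Domain G}"
  note GD = rel_submoduleD[OF pre_morD[OF G(1)] X Y]
  have dom: "submodule A X (Domain G)" by (rule submodule_Domain[OF pre_morD[OF G(1)] X Y])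
  have sub: "submodule A (prod_mod X X) ?H"
    using submoduleD[OF X dom] unfolding rel_submodule_iff[OF X X] by (auto simp del: Domain_iff)
  have "Domain ?H = Domain G" by auto
  then have "dense X (Domain ?H)" using G by (simp add: pre_mor_def)
  moreover have "\<zero>\<^bsub>X\<^esub> \<in> tors X" using subset_sat[OF X submodule_zero[OF X]] by auto
  ultimately have "pre_mor X X ?H" using sub by (auto simp: pre_mor_def)
  then show ?thesis
  proof (rule qmor_eqI[OF X X])
    show "qmor X X (qcomp X X (sat (prod_mod X Y) G) (sat (prod_mod Y X) (G\<inverse>)))"
      using G by (intro qmor_comp[of X Y X] qmor_sat) auto
    show "qmor X X (qgraph X X (\<lambda>x. x))" by (intro qmor_graph linear_id) auto
    show "?H \<subseteq> qgraph X X (\<lambda>x. x)"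
      using graph_subset_qgraph[OF X X linear_id] GD(1) by (force simp: graph_iff)
    have "?H \<subseteq> G O G\<inverse>" by auto
    also have "\<dots> \<subseteq> sat (prod_mod X Y) G O sat (prod_mod Y X) (G\<inverse>)"
      using pre_mor_subset_sat[OF X Y G(1)] pre_mor_subset_sat[OF Y X G(2)] by (rule relcomp_mono)
    also have "\<dots> \<subseteq> qcomp X X (sat (prod_mod X Y) G) (sat (prod_mod Y X) (G\<inverse>))"
      using G by (intro relcomp_subset_qcomp[of X Y X] qmor_sat) auto
    finally show "?H \<subseteq> qcomp X X (sat (prod_mod X Y) G) (sat (prod_mod Y X) (G\<inverse>))" .
  qed
qed

end


subsection \<open>The additive structure on morphisms\<close>

definition radd :: "('a, 'y) rmodule \<Rightarrow> ('x \<times> 'y) set \<Rightarrow> ('x \<times> 'y) set \<Rightarrow> ('x \<times> 'y) set" where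
  "radd Y G H = {(x, y \<oplus>\<^bsub>Y\<^esub> z) | x y z. (x, y) \<in> G \<and> (x, z) \<in> H}"

abbreviation qadd :: "('a, 'x) rmodule \<Rightarrow> ('a, 'y) rmodule \<Rightarrow> ('x \<times> 'y) set \<Rightarrow> ('x \<times> 'y) set \<Rightarrow> ('x \<times> 'y) set" where
  "qadd X Y G H \<equiv> sat (prod_mod X Y) (radd Y G H)"

lemma raddI: "\<lbrakk>(x, y) \<in> G; (x, z) \<in> H\<rbrakk> \<Longrightarrow> (x, y \<oplus>\<^bsub>Y\<^esub> z) \<in> radd Y G H"
  by (auto simp: radd_def)

lemma radd_mono: "\<lbrakk>G \<subseteq> G'; H \<subseteq> H'\<rbrakk> \<Longrightarrow> radd Y G H \<subseteq> radd Y G' H'"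
  by (force simp: radd_def)

definition hom_q :: "('a, 'x) rmodule \<Rightarrow> ('a, 'y) rmodule \<Rightarrow> ('x \<times> 'y) set ring" where
  "hom_q X Y = \<lparr>carrier = {G. qmor X Y G}, mult = undefined, one = undefined,
     zero = qgraph X Y (\<lambda>_. \<zero>\<^bsub>Y\<^esub>), add = qadd X Y\<rparr>"

context
  fixes X :: "('a, 'x) rmodule" and Y :: "('a, 'y) rmodule"
  assumes X [simp]: "rmod X" and Y [simp]: "rmod Y"
begin

lemma linear_const_zero: "linear X Y (\<lambda>_. \<zero>\<^bsub>Y\<^esub>)"
  by (simp add: linear_def)

text \<open>The sum lives on the common domain, which stays dense because F is closed under
  intersections; sums of torsion elements are torsion.\<close>

lemma pre_mor_radd:
  assumes G: "pre_mor X Y G" and H: "pre_mor X Y H"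
  shows "pre_mor X Y (radd Y G H)"
proof -
  note GD = rel_submoduleD[OF pre_morD[OF G] X Y]
  note HD = rel_submoduleD[OF pre_morD[OF H] X Y]
  have "submodule A (prod_mod X Y) (radd Y G H)"
    unfolding rel_submodule_iff[OF X Y]
  proof (intro conjI allI impI)
    show "(\<zero>\<^bsub>X\<^esub>, \<zero>\<^bsub>Y\<^esub>) \<in> radd Y G H" using raddI[OF GD(3) HD(3), of Y] by simp
  next
    fix x y x' y' assume "(x, y) \<in> radd Y G H" "(x', y') \<in> radd Y G H"
    then obtain u v u' v' where uv: "(x, u) \<in> G" "(x, v) \<in> H" "y = u \<oplus>\<^bsub>Y\<^esub> v"
      "(x', u') \<in> G" "(x', v') \<in> H" "y' = u' \<oplus>\<^bsub>Y\<^esub> v'" by (auto simp: radd_def)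
    then have "y \<oplus>\<^bsub>Y\<^esub> y' = (u \<oplus>\<^bsub>Y\<^esub> u') \<oplus>\<^bsub>Y\<^esub> (v \<oplus>\<^bsub>Y\<^esub> v')"
      using GD(2) HD(2) by (simp add: rmod_ac)
    then show "(x \<oplus>\<^bsub>X\<^esub> x', y \<oplus>\<^bsub>Y\<^esub> y') \<in> radd Y G H" using uv GD(4) HD(4) by (simp add: raddI)
  next
    fix x y a assume "(x, y) \<in> radd Y G H" and a: "a \<in> carrier A"
    then obtain u v where uv: "(x, u) \<in> G" "(x, v) \<in> H" "y = u \<oplus>\<^bsub>Y\<^esub> v" by (auto simp: radd_def)
    then show "(x \<triangleleft>\<^bsub>X\<^esub> a, y \<triangleleft>\<^bsub>Y\<^esub> a) \<in> radd Y G H"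
      using raddI[OF GD(5)[OF uv(1) a] HD(5)[OF uv(2) a], of Y] GD(2)[OF uv(1)] HD(2)[OF uv(2)] a
      by (simp add: rmod_act)
  qed (use GD(1,2) HD(2) in \<open>auto simp: radd_def\<close>)
  moreover have "dense X (Domain (radd Y G H))"
  proof -
    have "dense X (Domain G \<inter> Domain H)" using G H by (intro dense_Int) (auto simp: pre_mor_def)
    then show ?thesis by (rule dense_mono) (auto simp: radd_def)
  qed
  moreover have "y \<in> tors Y" if "(\<zero>\<^bsub>X\<^esub>, y) \<in> radd Y G H" for y
    using that G H submoduleD(3)[OF Y submodule_sat[OF Y submodule_zero[OF Y]]]
    by (auto simp: radd_def pre_mor_def)
  ultimately show ?thesis by (simp add: pre_mor_def)
qed

lemma qmor_add: "\<lbrakk>qmor X Y G; qmor X Y H\<rbrakk> \<Longrightarrow> qmor X Y (qadd X Y G H)"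
  by (intro qmor_sat pre_mor_radd qmor_pre X Y)

lemma radd_subset_qadd: "\<lbrakk>qmor X Y G; qmor X Y H\<rbrakk> \<Longrightarrow> radd Y G H \<subseteq> qadd X Y G H"
  by (intro pre_mor_subset_sat pre_mor_radd qmor_pre X Y)

lemma hom_q_group: "abelian_group (hom_q X Y)"
proof (rule abelian_groupI; unfold hom_q_def ring.simps partial_object.simps mem_Collect_eq)
  fix G H K assume G: "qmor X Y G" and H: "qmor X Y H" and K: "qmor X Y K"
  note GD = rel_submoduleD[OF pre_morD[OF qmor_pre[OF G]] X Y]
  note HD = rel_submoduleD[OF pre_morD[OF qmor_pre[OF H]] X Y]
  note KD = rel_submoduleD[OF pre_morD[OF qmor_pre[OF K]] X Y]
  show "qmor X Y (qadd X Y G H)" by (rule qmor_add[OF G H])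
  show "qadd X Y (qadd X Y G H) K = qadd X Y G (qadd X Y H K)"
  proof (rule qmor_eqI[OF X Y])
    show "pre_mor X Y (radd Y (radd Y G H) K)" using G H K by (intro pre_mor_radd qmor_pre)
    have "radd Y (radd Y G H) K \<subseteq> radd Y (qadd X Y G H) K"
      by (intro radd_mono radd_subset_qadd G H order_refl)
    then show "radd Y (radd Y G H) K \<subseteq> qadd X Y (qadd X Y G H) K"
      using radd_subset_qadd[OF qmor_add[OF G H] K] by blast
    have "radd Y (radd Y G H) K \<subseteq> radd Y G (radd Y H K)"
    proof clarify
      fix x y assume "(x, y) \<in> radd Y (radd Y G H) K"
      then obtain u v w where "(x, u) \<in> G" "(x, v) \<in> H" "(x, w) \<in> K" "y = (u \<oplus>\<^bsub>Y\<^esub> v) \<oplus>\<^bsub>Y\<^esub> w"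
        by (auto simp: radd_def)
      then show "(x, y) \<in> radd Y G (radd Y H K)"
        using GD(2) HD(2) KD(2) by (auto simp: rmod_ac(1) intro!: raddI)
    qed
    also have "\<dots> \<subseteq> radd Y G (qadd X Y H K)"
      by (intro radd_mono radd_subset_qadd H K order_refl)
    finally show "radd Y (radd Y G H) K \<subseteq> qadd X Y G (qadd X Y H K)"
      using radd_subset_qadd[OF G qmor_add[OF H K]] by blast
  qed (intro qmor_add G H K)+
  have "radd Y G H = radd Y H G"
    using GD(2) HD(2) rmod_ac(2)[OF Y] unfolding radd_def by blast
  then show "qadd X Y G H = qadd X Y H G" by simp
next
  show Z: "qmor X Y (qgraph X Y (\<lambda>_. \<zero>\<^bsub>Y\<^esub>))" by (intro qmor_graph linear_const_zero X Y)
  fix G assume G: "qmor X Y G"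
  note GD = rel_submoduleD[OF pre_morD[OF qmor_pre[OF G]] X Y]
  have "G \<subseteq> radd Y (qgraph X Y (\<lambda>_. \<zero>\<^bsub>Y\<^esub>)) G"
  proof clarify
    fix x y assume xy: "(x, y) \<in> G"
    then have "(x, \<zero>\<^bsub>Y\<^esub>) \<in> qgraph X Y (\<lambda>_. \<zero>\<^bsub>Y\<^esub>)"
      using graph_subset_qgraph[OF X Y linear_const_zero] GD(1) by (auto simp: graph_iff)
    from raddI[OF this xy, of Y] show "(x, y) \<in> radd Y (qgraph X Y (\<lambda>_. \<zero>\<^bsub>Y\<^esub>)) G"
      using GD(2)[OF xy] by simp
  qed
  then show "qadd X Y (qgraph X Y (\<lambda>_. \<zero>\<^bsub>Y\<^esub>)) G = G"
    using qmor_subset_eq[OF X Y G qmor_add[OF Z G]] radd_subset_qadd[OF Z G] by blast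
  \<comment> \<open>The additive inverse of G, before saturation: the image of G under negation of
    the second coordinate.\<close>
  let ?N = "{(x, \<ominus>\<^bsub>Y\<^esub> y) | x y. (x, y) \<in> G}"
  have sub: "submodule A (prod_mod X Y) ?N"
  proof -
    have "linear (prod_mod X Y) (prod_mod X Y) (\<lambda>p. (fst p, \<ominus>\<^bsub>Y\<^esub> (snd p)))"
      using rmod_act(1)[OF Y, of _ _ "\<ominus> \<one>"] by (auto simp: linear_def rmod_act_neg_one)
    then have "submodule A (prod_mod X Y) ((\<lambda>p. (fst p, \<ominus>\<^bsub>Y\<^esub> (snd p))) ` G)"
      by (rule submodule_image) (use pre_morD[OF qmor_pre[OF G]] in auto)
    moreover have "(\<lambda>p. (fst p, \<ominus>\<^bsub>Y\<^esub> (snd p))) ` G = ?N" by force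
    ultimately show ?thesis by simp
  qed
  have "Domain ?N = Domain G" by auto
  then have N: "pre_mor X Y ?N"
    using G sub submodule_neg[OF Y submodule_sat[OF Y submodule_zero[OF Y]]]
    by (auto simp: qmor_def pre_mor_def)
  show "\<exists>H\<in>{G. qmor X Y G}. qadd X Y H G = qgraph X Y (\<lambda>_. \<zero>\<^bsub>Y\<^esub>)"
  proof (rule bexI[of _ "sat (prod_mod X Y) ?N"])
    show "sat (prod_mod X Y) ?N \<in> {G. qmor X Y G}" using qmor_sat[OF X Y N] by simp
    \<comment> \<open>The sum of G and its negative is visibly zero only where G is defined, so the
      comparison is made on the zero map restricted to the dense domain of G.\<close>
    let ?H = "{(x, \<zero>\<^bsub>Y\<^esub>) | x. x \<in> Domain G}"
    have dom: "submodule A X (Domain G)"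
      by (rule submodule_Domain[OF pre_morD[OF qmor_pre[OF G]] X Y])
    have "submodule A (prod_mod X Y) ?H"
      using submoduleD[OF X dom] unfolding rel_submodule_iff[OF X Y] by (auto simp del: Domain_iff)
    moreover have "Domain ?H = Domain G" by auto
    moreover have "\<zero>\<^bsub>Y\<^esub> \<in> tors Y" using subset_sat[OF Y submodule_zero[OF Y]] by auto
    ultimately have "pre_mor X Y ?H" using G by (auto simp: pre_mor_def qmor_def)
    then show "qadd X Y (sat (prod_mod X Y) ?N) G = qgraph X Y (\<lambda>_. \<zero>\<^bsub>Y\<^esub>)"
    proof (rule qmor_eqI[OF X Y _ qmor_add[OF qmor_sat[OF X Y N] G] Z])
      show "?H \<subseteq> qgraph X Y (\<lambda>_. \<zero>\<^bsub>Y\<^esub>)"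
        using graph_subset_qgraph[OF X Y linear_const_zero] GD(1) by (force simp: graph_iff)
      have "?H \<subseteq> radd Y (sat (prod_mod X Y) ?N) G"
      proof clarify
        fix x y assume xy: "(x, y) \<in> G"
        then have "(x, \<ominus>\<^bsub>Y\<^esub> y) \<in> sat (prod_mod X Y) ?N"
          using pre_mor_subset_sat[OF X Y N] by blast
        from raddI[OF this xy, of Y] show "(x, \<zero>\<^bsub>Y\<^esub>) \<in> radd Y (sat (prod_mod X Y) ?N) G"
          using GD(2)[OF xy] by simp
      qed
      then show "?H \<subseteq> qadd X Y (sat (prod_mod X Y) ?N) G"
        using radd_subset_qadd[OF qmor_sat[OF X Y N] G] by blast
    qed
  qed
qed

end

context
  fixes X :: "('a, 'x) rmodule" and Y :: "('a, 'y) rmodule" and Z :: "('a, 'z) rmodule"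
  assumes X [simp]: "rmod X" and Y [simp]: "rmod Y" and Z [simp]: "rmod Z"
begin

text \<open>The sum of the two composites lies in the composite of the sum because H is additive as
  a relation.\<close>

lemma qcomp_qadd_left:
  assumes G: "qmor X Y G" "qmor X Y G'" and H: "qmor Y Z H"
  shows "qcomp X Z (qadd X Y G G') H = qadd X Z (qcomp X Z G H) (qcomp X Z G' H)"
proof (rule qmor_eqI[OF X Z])
  note HD = rel_submoduleD[OF pre_morD[OF qmor_pre[OF H]] Y Z]
  note cG = qmor_comp[OF X Y Z G(1) H] and cG' = qmor_comp[OF X Y Z G(2) H]
  let ?P = "radd Z (G O H) (G' O H)"
  show "pre_mor X Z ?P" using assms by (intro pre_mor_radd pre_mor_comp[of X Y Z] qmor_pre X Y Z)
  have "?P \<subseteq> radd Z (qcomp X Z G H) (qcomp X Z G' H)"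
    by (intro radd_mono relcomp_subset_qcomp[OF X Y Z] assms)
  then show "?P \<subseteq> qadd X Z (qcomp X Z G H) (qcomp X Z G' H)"
    using radd_subset_qadd[OF X Z cG cG'] by blast
  have "?P \<subseteq> radd Y G G' O H" using HD(4) by (auto simp: radd_def; blast)
  also have "\<dots> \<subseteq> qadd X Y G G' O H" using radd_subset_qadd[OF X Y G] by blast
  finally show "?P \<subseteq> qcomp X Z (qadd X Y G G') H"
    using relcomp_subset_qcomp[OF X Y Z qmor_add[OF X Y G] H] by blast
  show "qmor X Z (qcomp X Z (qadd X Y G G') H)" by (rule qmor_comp[OF X Y Z qmor_add[OF X Y G] H])
  show "qmor X Z (qadd X Z (qcomp X Z G H) (qcomp X Z G' H))" by (rule qmor_add[OF X Z cG cG'])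
qed

text \<open>The common part is now the composite of the sum: there one intermediate point serves
  both summands, whereas separate composites may pass through different points.\<close>

lemma qcomp_qadd_right:
  assumes G: "qmor X Y G" and H: "qmor Y Z H" "qmor Y Z H'"
  shows "qcomp X Z G (qadd Y Z H H') = qadd X Z (qcomp X Z G H) (qcomp X Z G H')"
proof (rule qmor_eqI[OF X Z])
  note cH = qmor_comp[OF X Y Z G H(1)] and cH' = qmor_comp[OF X Y Z G H(2)]
  let ?P = "G O radd Z H H'"
  show "pre_mor X Z ?P" using assms by (intro pre_mor_radd pre_mor_comp[of X Y Z] qmor_pre X Y Z)
  have "?P \<subseteq> radd Z (G O H) (G O H')" by (auto simp: radd_def; blast)
  also have "\<dots> \<subseteq> radd Z (qcomp X Z G H) (qcomp X Z G H')"
    by (intro radd_mono relcomp_subset_qcomp[OF X Y Z] assms)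
  finally show "?P \<subseteq> qadd X Z (qcomp X Z G H) (qcomp X Z G H')"
    using radd_subset_qadd[OF X Z cH cH'] by blast
  have "?P \<subseteq> G O qadd Y Z H H'" using radd_subset_qadd[OF Y Z H] by blast
  then show "?P \<subseteq> qcomp X Z G (qadd Y Z H H')"
    using relcomp_subset_qcomp[OF X Y Z G qmor_add[OF Y Z H]] by blast
  show "qmor X Z (qcomp X Z G (qadd Y Z H H'))" by (rule qmor_comp[OF X Y Z G qmor_add[OF Y Z H]])
  show "qmor X Z (qadd X Z (qcomp X Z G H) (qcomp X Z G H'))" by (rule qmor_add[OF X Z cH cH'])
qed

end

end

subsection \<open>Adjunctions and equivalences\<close>

lemma hom_setI: "\<lbrakk>f \<in> Arr C; Dom C f = X; Cod C f = Y\<rbrakk> \<Longrightarrow> f \<in> hom_set C X Y"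
  by (simp add: hom_set_def)

lemma hom_setD: "f \<in> hom_set C X Y \<Longrightarrow> f \<in> Arr C" "f \<in> hom_set C X Y \<Longrightarrow> Dom C f = X"
  "f \<in> hom_set C X Y \<Longrightarrow> Cod C f = Y"
  by (simp_all add: hom_set_def)

lemma Arr_hom_set: "f \<in> Arr C \<Longrightarrow> f \<in> hom_set C (Dom C f) (Cod C f)"
  by (simp add: hom_set_def)

lemma (in category) hom_set_Obj: "f \<in> hom_set C X Y \<Longrightarrow> X \<in> Obj C" "f \<in> hom_set C X Y \<Longrightarrow> Y \<in> Obj C"
  using Dom_in Cod_in by (auto simp: hom_set_def)

lemma is_functorD:
  assumes "is_functor C D T"
  shows "category C" "category D"
    "X \<in> Obj C \<Longrightarrow> obj_map T X \<in> Obj D"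
    "X \<in> Obj C \<Longrightarrow> arr_map T (Ident C X) = Ident D (obj_map T X)"
    "f \<in> hom_set C X Y \<Longrightarrow> arr_map T f \<in> hom_set D (obj_map T X) (obj_map T Y)"
    "\<lbrakk>f \<in> hom_set C X Y; g \<in> hom_set C Y Z\<rbrakk>
      \<Longrightarrow> arr_map T (g \<cdot>\<^bsub>C\<^esub> f) = arr_map T g \<cdot>\<^bsub>D\<^esub> arr_map T f"
  using assms by (auto simp: is_functor_def hom_set_def)

lemma is_functorI:
  assumes "category C" "category D"
    "\<And>X. X \<in> Obj C \<Longrightarrow> obj_map T X \<in> Obj D"
    "\<And>X. X \<in> Obj C \<Longrightarrow> arr_map T (Ident C X) = Ident D (obj_map T X)"
    "\<And>f X Y. f \<in> hom_set C X Y \<Longrightarrow> arr_map T f \<in> hom_set D (obj_map T X) (obj_map T Y)"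
    "\<And>f g X Y Z. \<lbrakk>f \<in> hom_set C X Y; g \<in> hom_set C Y Z\<rbrakk>
      \<Longrightarrow> arr_map T (g \<cdot>\<^bsub>C\<^esub> f) = arr_map T g \<cdot>\<^bsub>D\<^esub> arr_map T f"
  shows "is_functor C D T"
  unfolding is_functor_def using assms(1-5) assms(6)[OF Arr_hom_set hom_setI]
  by (auto dest: Arr_hom_set)

lemma is_isoI:
  "\<lbrakk>f \<in> hom_set C X Y; g \<in> hom_set C Y X; g \<cdot>\<^bsub>C\<^esub> f = Ident C X; f \<cdot>\<^bsub>C\<^esub> g = Ident C Y\<rbrakk>
    \<Longrightarrow> is_iso C f"
  by (auto simp: is_iso_def hom_set_def)

lemma is_isoE:
  assumes "is_iso C f" "f \<in> hom_set C X Y"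
  obtains g where "g \<in> hom_set C Y X" "g \<cdot>\<^bsub>C\<^esub> f = Ident C X" "f \<cdot>\<^bsub>C\<^esub> g = Ident C Y"
  using assms by (auto simp: is_iso_def hom_set_def)

lemma nat_transI:
  assumes "is_functor C D S" "is_functor C D T"
    "\<And>X. X \<in> Obj C \<Longrightarrow> \<eta> X \<in> hom_set D (obj_map S X) (obj_map T X)"
    "\<And>f X Y. f \<in> hom_set C X Y \<Longrightarrow> \<eta> Y \<cdot>\<^bsub>D\<^esub> arr_map S f = arr_map T f \<cdot>\<^bsub>D\<^esub> \<eta> X"
  shows "nat_trans C D S T \<eta>"
  unfolding nat_trans_def using assms by (auto dest: Arr_hom_set)

lemma nat_transD:
  assumes "nat_trans C D S T \<eta>"
  shows "X \<in> Obj C \<Longrightarrow> \<eta> X \<in> hom_set D (obj_map S X) (obj_map T X)"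
    "f \<in> hom_set C X Y \<Longrightarrow> \<eta> Y \<cdot>\<^bsub>D\<^esub> arr_map S f = arr_map T f \<cdot>\<^bsub>D\<^esub> \<eta> X"
  using assms by (auto simp: nat_trans_def hom_set_def)

lemma is_functor_id: "category C \<Longrightarrow> is_functor C C id_functor"
  by (rule is_functorI) (simp_all add: id_functor_def)

lemma is_functor_comp: "\<lbrakk>is_functor C D S; is_functor D E T\<rbrakk> \<Longrightarrow> is_functor C E (comp_functor T S)"
  by (rule is_functorI)
    (auto simp: comp_functor_def is_functorD dest: is_functorD(5)
      intro!: is_functorD(1)[of C D S] is_functorD(2)[of D E T] is_functorD(5)[of D E T]
        is_functorD(6)[of D E T])

text \<open>Functoriality, naturality and the triangle identities all follow from uniqueness of
  factorizations. The object map and the counit stay prescribed in the conclusion, since later the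
  adjoint must have a chosen value at a given object.\<close>

lemma universal_arrows_adjunction:
  assumes L: "is_functor C D L"
    and R: "\<And>Y. Y \<in> Obj D \<Longrightarrow> R Y \<in> Obj C"
    and \<epsilon>: "\<And>Y. Y \<in> Obj D \<Longrightarrow> \<epsilon> Y \<in> hom_set D (obj_map L (R Y)) Y"
    and univ: "\<And>X Y g. \<lbrakk>X \<in> Obj C; Y \<in> Obj D; g \<in> hom_set D (obj_map L X) Y\<rbrakk>
      \<Longrightarrow> \<exists>!h. h \<in> hom_set C X (R Y) \<and> \<epsilon> Y \<cdot>\<^bsub>D\<^esub> arr_map L h = g"
  obtains \<omega> \<eta> where "adjunction C D L \<omega> \<eta> \<epsilon>" "obj_map \<omega> = R"
proof -
  interpret C: category C by (rule is_functorD(1)[OF L])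
  interpret D: category D by (rule is_functorD(2)[OF L])
  note L = is_functorD(3-)[OF L] and isL = L
  note Lh = L(3)
  \<comment> \<open>\<open>\<phi> X Y g\<close> is the adjoint transpose of
    \<open>g\<close>.\<close>
  define \<phi> where "\<phi> X Y g = (THE h. h \<in> hom_set C X (R Y) \<and> \<epsilon> Y \<cdot>\<^bsub>D\<^esub> arr_map L h = g)" for X Y g
  have \<phi>: "\<phi> X Y g \<in> hom_set C X (R Y)" "\<epsilon> Y \<cdot>\<^bsub>D\<^esub> arr_map L (\<phi> X Y g) = g"
    if "X \<in> Obj C" "Y \<in> Obj D" "g \<in> hom_set D (obj_map L X) Y" for X Y g
    using theI'[OF univ[OF that]] by (simp_all add: \<phi>_def)
  have uniq: "h = h'" if "Y \<in> Obj D" "h \<in> hom_set C X (R Y)" "h' \<in> hom_set C X (R Y)"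
    "\<epsilon> Y \<cdot>\<^bsub>D\<^esub> arr_map L h = \<epsilon> Y \<cdot>\<^bsub>D\<^esub> arr_map L h'" for X Y h h'
    using univ[OF C.hom_set_Obj(1)[OF that(2)] that(1) D.Comp_in[OF Lh[OF that(2)] \<epsilon>[OF that(1)]]] that
    by auto
  define \<omega> where "\<omega> = \<lparr>obj_map = R, arr_map = (\<lambda>g. \<phi> (R (Dom D g)) (Cod D g) (g \<cdot>\<^bsub>D\<^esub> \<epsilon> (Dom D g)))\<rparr>"
  define \<eta> where "\<eta> X = \<phi> X (obj_map L X) (Ident D (obj_map L X))" for X
  have \<omega>: "arr_map \<omega> g \<in> hom_set C (R Y) (R Y')" "\<epsilon> Y' \<cdot>\<^bsub>D\<^esub> arr_map L (arr_map \<omega> g) = g \<cdot>\<^bsub>D\<^esub> \<epsilon> Y"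
    if g: "g \<in> hom_set D Y Y'" for g Y Y'
    using \<phi>[OF R D.hom_set_Obj(2)[OF g] D.Comp_in[OF \<epsilon> g]] D.hom_set_Obj[OF g] hom_setD[OF g]
    by (simp_all add: \<omega>_def)
  have \<omega>o: "obj_map \<omega> = R" by (simp add: \<omega>_def)
  have \<eta>: "\<eta> X \<in> hom_set C X (R (obj_map L X))"
    "\<epsilon> (obj_map L X) \<cdot>\<^bsub>D\<^esub> arr_map L (\<eta> X) = Ident D (obj_map L X)" if "X \<in> Obj C" for X
    using \<phi>[OF that L(1)[OF that] D.Ident_in[OF L(1)[OF that]]] by (simp_all add: \<eta>_def)
  have fun\<omega>: "is_functor D C \<omega>"
  proof (rule is_functorI, goal_cases)
    case (4 Y)
    show ?case unfolding \<omega>o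
      using 4 R \<epsilon>[OF 4] \<omega>[OF D.Ident_in[OF 4]]
      by (intro uniq[OF 4 _ C.Ident_in[OF R[OF 4]]])
        (simp_all add: L(2) D.Ident_left[OF \<epsilon>] D.Ident_right[OF \<epsilon>])
  next
    case (6 f g X Y Z)
    note Z = D.hom_set_Obj(2)[OF 6(2)] and X = D.hom_set_Obj(1)[OF 6(1)] and Y = D.hom_set_Obj(2)[OF 6(1)]
    note gf = D.Comp_in[OF 6(1,2)]
    note wf = \<omega>(1)[OF 6(1)] and wg = \<omega>(1)[OF 6(2)]
    have "\<epsilon> Z \<cdot>\<^bsub>D\<^esub> arr_map L (arr_map \<omega> g \<cdot>\<^bsub>C\<^esub> arr_map \<omega> f)
        = (\<epsilon> Z \<cdot>\<^bsub>D\<^esub> arr_map L (arr_map \<omega> g)) \<cdot>\<^bsub>D\<^esub> arr_map L (arr_map \<omega> f)"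
      by (simp add: L(4)[OF wf wg] D.Comp_assoc[OF Lh[OF wf] Lh[OF wg] \<epsilon>[OF Z]])
    also have "\<dots> = g \<cdot>\<^bsub>D\<^esub> (\<epsilon> Y \<cdot>\<^bsub>D\<^esub> arr_map L (arr_map \<omega> f))"
      by (simp add: \<omega>(2)[OF 6(2)] D.Comp_assoc[OF Lh[OF wf] \<epsilon>[OF Y] 6(2)])
    also have "\<dots> = (g \<cdot>\<^bsub>D\<^esub> f) \<cdot>\<^bsub>D\<^esub> \<epsilon> X"
      by (simp add: \<omega>(2)[OF 6(1)] D.Comp_assoc[OF \<epsilon>[OF X] 6(1,2)])
    finally show ?case
      using uniq[OF Z \<omega>(1)[OF gf] C.Comp_in[OF wf wg]] \<omega>(2)[OF gf] by simp
  qed (use R \<omega> in \<open>auto simp: \<omega>o C.category_axioms D.category_axioms\<close>)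
  have "adjunction C D L \<omega> \<eta> \<epsilon>"
    unfolding adjunction_def
  proof (intro conjI ballI)
    show "nat_trans C C id_functor (comp_functor \<omega> L) \<eta>"
    proof (rule nat_transI[OF is_functor_id is_functor_comp[OF isL fun\<omega>]])
      fix f X Y assume f: "f \<in> hom_set C X Y"
      note Y = C.hom_set_Obj(2)[OF f] and X = C.hom_set_Obj(1)[OF f]
      note w = \<omega>[OF Lh[OF f]]
      have "\<epsilon> (obj_map L Y) \<cdot>\<^bsub>D\<^esub> arr_map L (\<eta> Y \<cdot>\<^bsub>C\<^esub> f) = arr_map L f"
        by (simp add: L(4)[OF f \<eta>(1)[OF Y]] D.Comp_assoc[OF Lh[OF f] Lh[OF \<eta>(1)[OF Y]] \<epsilon>[OF L(1)[OF Y]], symmetric]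
          \<eta>(2)[OF Y] D.Ident_left[OF Lh[OF f]])
      moreover have "\<epsilon> (obj_map L Y) \<cdot>\<^bsub>D\<^esub> arr_map L (arr_map \<omega> (arr_map L f) \<cdot>\<^bsub>C\<^esub> \<eta> X) = arr_map L f"
        by (simp add: L(4)[OF \<eta>(1)[OF X] w(1)] w(2) \<eta>(2)[OF X] D.Ident_right[OF Lh[OF f]]
          D.Comp_assoc[OF Lh[OF \<eta>(1)[OF X]] Lh[OF w(1)] \<epsilon>[OF L(1)[OF Y]], symmetric]
          D.Comp_assoc[OF Lh[OF \<eta>(1)[OF X]] \<epsilon>[OF L(1)[OF X]] Lh[OF f]])
      ultimately have "\<eta> Y \<cdot>\<^bsub>C\<^esub> f = arr_map \<omega> (arr_map L f) \<cdot>\<^bsub>C\<^esub> \<eta> X"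
        by (intro uniq[OF L(1)[OF Y] C.Comp_in[OF f \<eta>(1)[OF Y]] C.Comp_in[OF \<eta>(1)[OF X] w(1)]]) simp
      then show "\<eta> Y \<cdot>\<^bsub>C\<^esub> arr_map id_functor f = arr_map (comp_functor \<omega> L) f \<cdot>\<^bsub>C\<^esub> \<eta> X"
        by (simp add: id_functor_def comp_functor_def)
    qed (use \<eta> in \<open>auto simp: id_functor_def comp_functor_def \<omega>o C.category_axioms\<close>)
    show "nat_trans D D (comp_functor L \<omega>) id_functor \<epsilon>"
      by (rule nat_transI[OF is_functor_comp[OF fun\<omega> isL] is_functor_id])
        (use \<epsilon> \<omega> in \<open>auto simp: id_functor_def comp_functor_def \<omega>o D.category_axioms\<close>)
    show "\<epsilon> (obj_map L X) \<cdot>\<^bsub>D\<^esub> arr_map L (\<eta> X) = Ident D (obj_map L X)" if "X \<in> Obj C" for X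
      by (rule \<eta>(2)[OF that])
    show "arr_map \<omega> (\<epsilon> Y) \<cdot>\<^bsub>C\<^esub> \<eta> (obj_map \<omega> Y) = Ident C (obj_map \<omega> Y)" if Y: "Y \<in> Obj D" for Y
      unfolding \<omega>o
    proof (rule uniq[OF Y C.Comp_in C.Ident_in[OF R[OF Y]]])
      note e = \<eta>[OF R[OF Y]] and w = \<omega>[OF \<epsilon>[OF Y]]
      show "\<eta> (R Y) \<in> hom_set C (R Y) (R (obj_map L (R Y)))" by (rule e)
      show "arr_map \<omega> (\<epsilon> Y) \<in> hom_set C (R (obj_map L (R Y))) (R Y)" by (rule w)
      show "\<epsilon> Y \<cdot>\<^bsub>D\<^esub> arr_map L (arr_map \<omega> (\<epsilon> Y) \<cdot>\<^bsub>C\<^esub> \<eta> (R Y)) = \<epsilon> Y \<cdot>\<^bsub>D\<^esub> arr_map L (Ident C (R Y))"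
        by (simp add: L(2)[OF R[OF Y]] L(4)[OF e(1) w(1)] w(2) e(2)
          D.Comp_assoc[OF Lh[OF e(1)] Lh[OF w(1)] \<epsilon>[OF Y], symmetric]
          D.Comp_assoc[OF Lh[OF e(1)] \<epsilon>[OF L(1)[OF R[OF Y]]] \<epsilon>[OF Y]])
    qed
  qed (use isL fun\<omega> in auto)
  then show ?thesis using \<omega>o by (rule that)
qed

text \<open>For a fully faithful functor S, an isomorphism from S X to Y is a universal arrow from S
  to Y. So essential surjectivity yields a right adjoint whose counit is invertible by choice, and
  only invertibility of the unit remains.\<close>

lemma equivalent_catsI:
  assumes S: "is_functor C D S"
    and ff: "\<And>X Y g. \<lbrakk>X \<in> Obj C; Y \<in> Obj C; g \<in> hom_set D (obj_map S X) (obj_map S Y)\<rbrakk>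
      \<Longrightarrow> \<exists>!f. f \<in> hom_set C X Y \<and> arr_map S f = g"
    and es: "\<And>Y. Y \<in> Obj D \<Longrightarrow> \<exists>X\<in>Obj C. \<exists>i\<in>hom_set D (obj_map S X) Y. is_iso D i"
  shows "equivalent_cats C D"
proof -
  interpret C: category C by (rule is_functorD(1)[OF S])
  interpret D: category D by (rule is_functorD(2)[OF S])
  note SD = is_functorD(3-)[OF S]
  obtain R where R: "\<And>Y. Y \<in> Obj D \<Longrightarrow> R Y \<in> Obj C"
      "\<And>Y. Y \<in> Obj D \<Longrightarrow> \<exists>i\<in>hom_set D (obj_map S (R Y)) Y. is_iso D i"
    using es by metis
  then obtain \<epsilon> where \<epsilon>: "\<And>Y. Y \<in> Obj D \<Longrightarrow> \<epsilon> Y \<in> hom_set D (obj_map S (R Y)) Y"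
      "\<And>Y. Y \<in> Obj D \<Longrightarrow> is_iso D (\<epsilon> Y)"
    by metis
  have univ: "\<exists>!h. h \<in> hom_set C X (R Y) \<and> \<epsilon> Y \<cdot>\<^bsub>D\<^esub> arr_map S h = g"
    if X: "X \<in> Obj C" and Y: "Y \<in> Obj D" and g: "g \<in> hom_set D (obj_map S X) Y" for X Y g
  proof -
    obtain j where j: "j \<in> hom_set D Y (obj_map S (R Y))" "j \<cdot>\<^bsub>D\<^esub> \<epsilon> Y = Ident D (obj_map S (R Y))"
      "\<epsilon> Y \<cdot>\<^bsub>D\<^esub> j = Ident D Y" using is_isoE[OF \<epsilon>(2,1)[OF Y]] .
    have "\<epsilon> Y \<cdot>\<^bsub>D\<^esub> arr_map S h = g \<longleftrightarrow> arr_map S h = j \<cdot>\<^bsub>D\<^esub> g" if h: "h \<in> hom_set C X (R Y)" for h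
      using D.Comp_assoc[OF SD(3)[OF h] \<epsilon>(1)[OF Y] j(1)] D.Comp_assoc[OF g j(1) \<epsilon>(1)[OF Y]]
        D.Ident_left[OF g] D.Ident_left[OF SD(3)[OF h]] j by auto
    then show ?thesis using ff[OF X R(1)[OF Y] D.Comp_in[OF g j(1)]] by (simp cong: conj_cong)
  qed
  obtain T \<eta> where adj: "adjunction C D S T \<eta> \<epsilon>" and T: "obj_map T = R"
    using universal_arrows_adjunction[where R = R and \<epsilon> = \<epsilon>, OF S R(1) \<epsilon>(1) univ] by blast
  have \<eta>: "nat_trans C C id_functor (comp_functor T S) \<eta>"
    and tri: "\<And>X. X \<in> Obj C \<Longrightarrow> \<epsilon> (obj_map S X) \<cdot>\<^bsub>D\<^esub> arr_map S (\<eta> X) = Ident D (obj_map S X)"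
    using adj by (auto simp: adjunction_def)
  have "is_iso C (\<eta> X)" if X: "X \<in> Obj C" for X
  proof -
    let ?RX = "R (obj_map S X)"
    note SX = SD(1)[OF X]
    note RX = R(1)[OF SX]
    have e: "\<eta> X \<in> hom_set C X ?RX"
      using nat_transD(1)[OF \<eta> X] by (simp add: id_functor_def comp_functor_def T)
    \<comment> \<open>By fullness the counit at S X is S f for some f. The triangle identity and
      faithfulness make f a two-sided inverse of the unit.\<close>
    obtain f where f: "f \<in> hom_set C ?RX X" "arr_map S f = \<epsilon> (obj_map S X)"
      using ff[OF RX X \<epsilon>(1)[OF SX]] by blast
    have "arr_map S (f \<cdot>\<^bsub>C\<^esub> \<eta> X) = arr_map S (Ident C X)"
      by (simp add: SD(2)[OF X] SD(4)[OF e f(1)] f(2) tri[OF X])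
    then have fe: "f \<cdot>\<^bsub>C\<^esub> \<eta> X = Ident C X"
      using ff[OF X X SD(3)[OF C.Ident_in[OF X]]] C.Ident_in[OF X] C.Comp_in[OF e f(1)] by blast
    obtain j where j: "j \<in> hom_set D (obj_map S X) (obj_map S ?RX)"
        "j \<cdot>\<^bsub>D\<^esub> \<epsilon> (obj_map S X) = Ident D (obj_map S ?RX)"
      using is_isoE[OF \<epsilon>(2,1)[OF SX]] by blast
    have "j \<cdot>\<^bsub>D\<^esub> (\<epsilon> (obj_map S X) \<cdot>\<^bsub>D\<^esub> arr_map S (\<eta> X)) = arr_map S (\<eta> X)"
      by (simp add: D.Comp_assoc[OF SD(3)[OF e] \<epsilon>(1)[OF SX] j(1), symmetric] j(2) D.Ident_left[OF SD(3)[OF e]])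
    then have "arr_map S (\<eta> X) = j" using tri[OF X] D.Ident_right[OF j(1)] by simp
    then have "arr_map S (\<eta> X \<cdot>\<^bsub>C\<^esub> f) = arr_map S (Ident C ?RX)"
      using j(2) by (simp add: SD(2)[OF RX] SD(4)[OF f(1) e] f(2))
    then have "\<eta> X \<cdot>\<^bsub>C\<^esub> f = Ident C ?RX"
      using ff[OF RX RX SD(3)[OF C.Ident_in[OF RX]]] C.Ident_in[OF RX] C.Comp_in[OF f(1) e] by blast
    then show ?thesis using is_isoI[OF e f(1) fe] by simp
  qed
  then show ?thesis
    using adj \<epsilon>(2) unfolding equivalent_cats_def nat_iso_def adjunction_def by blast
qed

text \<open>An object with invertible unit is local: restriction along any s inverted by L is
  bijective on arrows into it. This is the only access to an adjunction that is merely assumed to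
  exist, and it turns closedness into an extension property.\<close>

lemma adjunction_extension:
  assumes adj: "adjunction C D L R \<eta> \<epsilon>" and X: "X \<in> Obj C" and iso: "is_iso C (\<eta> X)"
    and s: "s \<in> hom_set C W V" and Ls: "is_iso D (arr_map L s)"
  shows "f \<in> hom_set C W X \<Longrightarrow> \<exists>g\<in>hom_set C V X. g \<cdot>\<^bsub>C\<^esub> s = f"
    and "\<lbrakk>g \<in> hom_set C V X; g' \<in> hom_set C V X; g \<cdot>\<^bsub>C\<^esub> s = g' \<cdot>\<^bsub>C\<^esub> s\<rbrakk> \<Longrightarrow> g = g'"
proof -
  have L: "is_functor C D L" and R: "is_functor D C R"
    and \<eta>: "nat_trans C C id_functor (comp_functor R L) \<eta>"
    using adj by (auto simp: adjunction_def)
  interpret C: category C by (rule is_functorD(1)[OF L])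
  interpret D: category D by (rule is_functorD(2)[OF L])
  note LD = is_functorD(3-)[OF L] and RD = is_functorD(3-)[OF R]
  let ?o = "\<lambda>Z. obj_map R (obj_map L Z)" and ?a = "\<lambda>f. arr_map R (arr_map L f)"
  have e: "\<eta> Z \<in> hom_set C Z (?o Z)" if "Z \<in> Obj C" for Z
    using nat_transD(1)[OF \<eta> that] by (simp add: id_functor_def comp_functor_def)
  have nat: "\<eta> Z' \<cdot>\<^bsub>C\<^esub> f = ?a f \<cdot>\<^bsub>C\<^esub> \<eta> Z" if "f \<in> hom_set C Z Z'" for f Z Z'
    using nat_transD(2)[OF \<eta> that] by (simp add: id_functor_def comp_functor_def)
  have V: "V \<in> Obj C" and W: "W \<in> Obj C" using C.hom_set_Obj[OF s] by auto
  obtain j where j: "j \<in> hom_set C (?o X) X" "j \<cdot>\<^bsub>C\<^esub> \<eta> X = Ident C X"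
    using is_isoE[OF iso e[OF X]] by blast
  obtain t where t: "t \<in> hom_set D (obj_map L V) (obj_map L W)"
    "t \<cdot>\<^bsub>D\<^esub> arr_map L s = Ident D (obj_map L W)" "arr_map L s \<cdot>\<^bsub>D\<^esub> t = Ident D (obj_map L V)"
    using is_isoE[OF Ls LD(3)[OF s]] by blast
  note Rt = RD(3)[OF t(1)] and RLs = RD(3)[OF LD(3)[OF s]]
  show "\<exists>g\<in>hom_set C V X. g \<cdot>\<^bsub>C\<^esub> s = f" if f: "f \<in> hom_set C W X"
  proof
    note RLf = RD(3)[OF LD(3)[OF f]]
    \<comment> \<open>The transpose of the inverse t of L s, an arrow from V to R L W with u s equal
      to the unit at W. It extends the unit over V, and composing it with R L f and the inverse of
      the unit at X extends f.\<close>
    let ?u = "arr_map R t \<cdot>\<^bsub>C\<^esub> \<eta> V"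
    have u: "?u \<in> hom_set C V (?o W)" by (rule C.Comp_in[OF e[OF V] Rt])
    have us: "?u \<cdot>\<^bsub>C\<^esub> s = \<eta> W"
    proof -
      have "?u \<cdot>\<^bsub>C\<^esub> s = arr_map R t \<cdot>\<^bsub>C\<^esub> (?a s \<cdot>\<^bsub>C\<^esub> \<eta> W)"
        by (simp add: C.Comp_assoc[OF s e[OF V] Rt] nat[OF s])
      also have "\<dots> = (arr_map R t \<cdot>\<^bsub>C\<^esub> ?a s) \<cdot>\<^bsub>C\<^esub> \<eta> W"
        by (simp add: C.Comp_assoc[OF e[OF W] RLs Rt])
      also have "arr_map R t \<cdot>\<^bsub>C\<^esub> ?a s = Ident C (?o W)"
        by (simp add: RD(4)[OF LD(3)[OF s] t(1), symmetric] t(2) RD(2)[OF LD(1)[OF W]])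
      finally show ?thesis by (simp add: C.Ident_left[OF e[OF W]])
    qed
    let ?v = "j \<cdot>\<^bsub>C\<^esub> ?a f"
    have v: "?v \<in> hom_set C (?o W) X" by (rule C.Comp_in[OF RLf j(1)])
    show "?v \<cdot>\<^bsub>C\<^esub> ?u \<in> hom_set C V X" by (rule C.Comp_in[OF u v])
    have "(?v \<cdot>\<^bsub>C\<^esub> ?u) \<cdot>\<^bsub>C\<^esub> s = j \<cdot>\<^bsub>C\<^esub> (?a f \<cdot>\<^bsub>C\<^esub> \<eta> W)"
      by (simp add: C.Comp_assoc[OF s u v] us C.Comp_assoc[OF e[OF W] RLf j(1)])
    also have "\<dots> = (j \<cdot>\<^bsub>C\<^esub> \<eta> X) \<cdot>\<^bsub>C\<^esub> f"
      by (simp add: nat[OF f, symmetric] C.Comp_assoc[OF f e[OF X] j(1)])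
    finally show "(?v \<cdot>\<^bsub>C\<^esub> ?u) \<cdot>\<^bsub>C\<^esub> s = f" by (simp add: j(2) C.Ident_left[OF f])
  qed
  show "g = g'" if g: "g \<in> hom_set C V X" "g' \<in> hom_set C V X" and eq: "g \<cdot>\<^bsub>C\<^esub> s = g' \<cdot>\<^bsub>C\<^esub> s"
  proof -
    \<comment> \<open>L h is recovered from L (h s) by the inverse t, and h from L h by the inverse
      j of the unit.\<close>
    have *: "arr_map L h = arr_map L (h \<cdot>\<^bsub>C\<^esub> s) \<cdot>\<^bsub>D\<^esub> t" "h = j \<cdot>\<^bsub>C\<^esub> (?a h \<cdot>\<^bsub>C\<^esub> \<eta> V)"
      if h: "h \<in> hom_set C V X" for h
    proof -
      show "arr_map L h = arr_map L (h \<cdot>\<^bsub>C\<^esub> s) \<cdot>\<^bsub>D\<^esub> t"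
        by (simp add: LD(4)[OF s h] D.Comp_assoc[OF t(1) LD(3)[OF s] LD(3)[OF h]] t(3)
          D.Ident_right[OF LD(3)[OF h]])
      show "h = j \<cdot>\<^bsub>C\<^esub> (?a h \<cdot>\<^bsub>C\<^esub> \<eta> V)"
        by (simp add: nat[OF h, symmetric] C.Comp_assoc[OF h e[OF X] j(1), symmetric] j(2) C.Ident_left[OF h])
    qed
    have "arr_map L g = arr_map L g'" using *(1)[OF g(1)] *(1)[OF g(2)] eq by simp
    then show ?thesis using *(2)[OF g(1)] *(2)[OF g(2)] by simp
  qed
qed


subsection \<open>Transport of Gabriel topologies\<close>

text \<open>Images under h have poor closure properties on paper, so each axiom is checked on
  pullbacks, where it becomes the same axiom for A.\<close>

lemma gabriel_topology_ring_iso: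
  fixes A :: "'a ring" and B :: "'b ring"
  assumes A: "ring A" and B: "ring B" and h: "h \<in> ring_iso A B" and F: "gabriel_topology A F"
  shows "gabriel_topology B ((\<lambda>I. h ` I) ` F)"
proof -
  interpret gabriel A F using A F by (simp add: gabriel_def right_modules_def gabriel_axioms_def)
  interpret B: right_modules B using B by (simp add: right_modules_def)
  have hom: "h \<in> ring_hom A B" and bij: "bij_betw h (carrier A) (carrier B)"
    using h by (auto simp: ring_iso_def)
  note H = ring_hom_closed[OF hom] ring_hom_mult[OF hom] ring_hom_add[OF hom] ring_hom_zero[OF hom A B]
  have surj: "\<exists>a\<in>carrier A. b = h a" if "b \<in> carrier B" for b
    using bij that by (auto simp: bij_betw_def)
  have inj: "h a = h b \<longleftrightarrow> a = b" if "a \<in> carrier A" "b \<in> carrier A" for a b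
    using bij that by (auto simp: bij_betw_def inj_on_eq_iff)
  \<comment> \<open>Pullback of right ideals along h. By \<open>mem\<close> below, a right ideal of
    B belongs to the image topology as soon as its pullback is in F.\<close>
  let ?p = "\<lambda>J. {a \<in> carrier A. h a \<in> J}"
  have img: "right_ideal B (h ` I)" if "submodule A (regular_module A) I" for I
    unfolding right_ideal_def
  proof (rule B.submoduleI)
    note D = submoduleD[OF _ that, simplified]
    show "\<zero>\<^bsub>regular_module B\<^esub> \<in> h ` I" using D(2) H(4) by (metis B.regular_module_simps(2) imageI)
    show "h ` I \<subseteq> carrier (regular_module B)" using D(1) H(1) by auto
    show "x \<oplus>\<^bsub>regular_module B\<^esub> y \<in> h ` I" if "x \<in> h ` I" "y \<in> h ` I" for x y
      using that D(1,3) by (auto simp: H(3)[symmetric])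
    show "x \<triangleleft>\<^bsub>regular_module B\<^esub> b \<in> h ` I" if "x \<in> h ` I" "b \<in> carrier B" for x b
      using that D(1,4) surj[of b] by (auto simp: H(2)[symmetric])
  qed simp
  have pre: "submodule A (regular_module A) (?p J)" "h ` ?p J = J" if "right_ideal B J" for J
  proof -
    note D = B.submoduleD[OF B.rmod_regular that[unfolded right_ideal_def], simplified]
    show "submodule A (regular_module A) (?p J)"
      by (rule submoduleI) (use D in \<open>auto simp: H\<close>)
    show "h ` ?p J = J" using D(1) surj by blast
  qed
  have mem: "J \<in> (\<lambda>I. h ` I) ` F" if "right_ideal B J" "?p J \<in> F" for J
    using that(2) by (rule rev_image_eqI) (simp add: pre(2)[OF that(1)])
  have colon: "{a \<in> carrier A. h a \<in> ideal_colon B J (h b)} = {a \<in> carrier A. b \<otimes>\<^bsub>A\<^esub> a \<in> ?p J}"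
    if "b \<in> carrier A" for J b
    using that by (auto simp: ideal_colon_def H)
  have pimg: "?p (h ` I) = I" if "I \<in> F" for I
    using F_carrierD[OF that] inj by (auto simp: image_iff)
  have colonI: "right_ideal B (ideal_colon B J b)" if J: "right_ideal B J" and b: "b \<in> carrier B" for J b
    using B.submodule_colon[OF B.rmod_regular J[unfolded right_ideal_def], of b] b
    by (simp add: ideal_colon_def right_ideal_def)
  note FI = img[OF F_ideal]
  show ?thesis
    unfolding gabriel_topology_def
  proof (intro conjI ballI allI impI)
    show "(\<lambda>I. h ` I) ` F \<noteq> {}" using F_carrier by auto
    show "right_ideal B J" if "J \<in> (\<lambda>I. h ` I) ` F" for J using that FI by auto
    show "J \<in> (\<lambda>I. h ` I) ` F" if I: "I \<in> (\<lambda>I. h ` I) ` F" and J: "right_ideal B J \<and> I \<subseteq> J" for I J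
    proof (rule mem)
      obtain K where K: "I = h ` K" "K \<in> F" using I by blast
      then have "K \<subseteq> ?p J" using J F_carrierD by auto
      then show "?p J \<in> F" using F_upward[OF K(2)] pre(1) J by blast
    qed (use J in blast)
    show "I \<inter> J \<in> (\<lambda>I. h ` I) ` F" if IJ: "I \<in> (\<lambda>I. h ` I) ` F" "J \<in> (\<lambda>I. h ` I) ` F" for I J
    proof -
      obtain K L where K: "I = h ` K" "K \<in> F" "J = h ` L" "L \<in> F" using IJ by blast
      have "inj_on h (K \<union> L)"
        using bij F_carrierD[OF K(2)] F_carrierD[OF K(4)] by (auto simp: bij_betw_def intro: inj_on_subset)
      then have "h ` (K \<inter> L) = I \<inter> J" unfolding K by (intro inj_on_image_Int) auto
      then show ?thesis using F_Int[OF K(2,4)] by blast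
    qed
    show "ideal_colon B I b \<in> (\<lambda>I. h ` I) ` F" if I: "I \<in> (\<lambda>I. h ` I) ` F" and b: "b \<in> carrier B" for I b
    proof (rule mem)
      obtain K where K: "I = h ` K" "K \<in> F" using I by blast
      obtain a where a: "a \<in> carrier A" "b = h a" using surj[OF b] by auto
      show "right_ideal B (ideal_colon B I b)" using colonI[OF _ b] FI K by auto
      show "{a \<in> carrier A. h a \<in> ideal_colon B I b} \<in> F"
        unfolding a(2) colon[OF a(1)] K(1) pimg[OF K(2)] by (rule F_colon[OF K(2) a(1)])
    qed
    show "I \<in> (\<lambda>I. h ` I) ` F"
      if J: "J \<in> (\<lambda>I. h ` I) ` F" and I: "right_ideal B I \<and> (\<forall>b\<in>J. ideal_colon B I b \<in> (\<lambda>I. h ` I) ` F)"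
      for I J
    proof (rule mem)
      obtain K where K: "J = h ` K" "K \<in> F" using J by auto
      show "?p I \<in> F"
      proof (rule F_local[OF K(2)])
        fix a assume a: "a \<in> K"
        then have aA: "a \<in> carrier A" using F_carrierD K by auto
        obtain L where L: "ideal_colon B I (h a) = h ` L" "L \<in> F" using I a K by auto
        show "{b \<in> carrier A. a \<otimes>\<^bsub>A\<^esub> b \<in> ?p I} \<in> F"
          unfolding colon[OF aA, symmetric] L(1) pimg[OF L(2)] by (rule L(2))
      qed (use pre I in blast)
    qed (use I in blast)
  qed
qed


subsection \<open>Quotient modules\<close>

context right_modules
begin

text \<open>The quotient is built on chosen representatives instead of cosets, which keeps its
  carrier in the type \<open>'u\<close>, as an object of the module category requires.\<close>

lemma quotient_exists:
  fixes X :: "('a, 'u) rmodule"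
  assumes X [simp]: "rmod X" and N: "submodule R X N"
  obtains Q :: "('a, 'u) rmodule" and q where "rmod Q" "linear X Q q" "q ` carrier X = carrier Q"
    "\<And>x. x \<in> carrier X \<Longrightarrow> q x = \<zero>\<^bsub>Q\<^esub> \<longleftrightarrow> x \<in> N"
proof -
  note ND = submoduleD[OF X N]
  define r where "r x y \<longleftrightarrow> x \<in> carrier X \<and> y \<in> carrier X \<and> x \<oplus>\<^bsub>X\<^esub> (\<ominus>\<^bsub>X\<^esub> y) \<in> N" for x y
  have r_iff: "r x y \<longleftrightarrow> y \<in> carrier X \<and> (\<exists>n\<in>N. x = n \<oplus>\<^bsub>X\<^esub> y)" for x y
    unfolding r_def using ND(1) rmod_simps[OF X] by (metis (full_types))
  have r_refl: "r x x" if "x \<in> carrier X" for x using that ND(2) by (simp add: r_def)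
  have r_sym: "r y x" if xy: "r x y" for x y
  proof -
    obtain n where n: "n \<in> N" "x = n \<oplus>\<^bsub>X\<^esub> y" "y \<in> carrier X" using xy unfolding r_iff by blast
    then have "y = (\<ominus>\<^bsub>X\<^esub> n) \<oplus>\<^bsub>X\<^esub> x" using ND(1) by (simp add: rmod_ac(1)[OF X, symmetric])
    then show ?thesis unfolding r_iff using submodule_neg[OF X N n(1)] n ND(1) by auto
  qed
  have r_trans: "r x z" if xy: "r x y" "r y z" for x y z
  proof -
    obtain n m where "n \<in> N" "x = n \<oplus>\<^bsub>X\<^esub> y" "m \<in> N" "y = m \<oplus>\<^bsub>X\<^esub> z" "z \<in> carrier X"
      using xy unfolding r_iff by blast
    then have "x = (n \<oplus>\<^bsub>X\<^esub> m) \<oplus>\<^bsub>X\<^esub> z" "n \<oplus>\<^bsub>X\<^esub> m \<in> N" using ND(1,3) by (simp_all add: rmod_ac(1)[OF X])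
    then show ?thesis unfolding r_iff using \<open>z \<in> carrier X\<close> by auto
  qed
  have r_add: "r (x \<oplus>\<^bsub>X\<^esub> x') (y \<oplus>\<^bsub>X\<^esub> y')" if xy: "r x y" "r x' y'" for x y x' y'
  proof -
    obtain n m where *: "n \<in> N" "x = n \<oplus>\<^bsub>X\<^esub> y" "m \<in> N" "x' = m \<oplus>\<^bsub>X\<^esub> y'" "y \<in> carrier X" "y' \<in> carrier X"
      using xy unfolding r_iff by blast
    then have "x \<oplus>\<^bsub>X\<^esub> x' = (n \<oplus>\<^bsub>X\<^esub> m) \<oplus>\<^bsub>X\<^esub> (y \<oplus>\<^bsub>X\<^esub> y')" using ND(1) by (simp add: rmod_ac[OF X])
    then show ?thesis unfolding r_iff using * ND(3) by auto
  qed
  have r_act: "r (x \<triangleleft>\<^bsub>X\<^esub> a) (y \<triangleleft>\<^bsub>X\<^esub> a)" if "r x y" "a \<in> carrier R" for x y a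
    using that ND(1,4) unfolding r_iff by (force simp: rmod_act)
  \<comment> \<open>Equivalent elements have the same predicate \<open>r x\<close>, so the choice
    operator picks the same representative for the whole class.\<close>
  define q where "q x = (SOME y. r x y)" for x
  have q: "r x (q x)" if "x \<in> carrier X" for x
    unfolding q_def using someI[of "r x", OF r_refl[OF that]] .
  have q_eq: "q x = q y \<longleftrightarrow> r x y" if "x \<in> carrier X" "y \<in> carrier X" for x y
  proof
    assume "q x = q y"
    then show "r x y" using q[OF that(1)] r_sym[OF q[OF that(2)]] r_trans by simp
  next
    assume "r x y"
    then have "r x = r y" using r_trans r_sym by blast
    then show "q x = q y" by (simp add: q_def)
  qed
  have qX: "q x \<in> carrier X" if "x \<in> carrier X" for x using q[OF that] by (simp add: r_def)
  define Q :: "('a, 'u) rmodule" where "Q = \<lparr>carrier = q ` carrier X, mult = undefined, one = undefined,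
     zero = q \<zero>\<^bsub>X\<^esub>, add = (\<lambda>x y. q (x \<oplus>\<^bsub>X\<^esub> y)), act = (\<lambda>x a. q (x \<triangleleft>\<^bsub>X\<^esub> a))\<rparr>"
  have Qs: "carrier Q = q ` carrier X" "zero Q = q \<zero>\<^bsub>X\<^esub>"
    by (simp_all add: Q_def)
  have Qs': "\<And>x y. \<lbrakk>x \<in> carrier X; y \<in> carrier X\<rbrakk> \<Longrightarrow> q x \<oplus>\<^bsub>Q\<^esub> q y = q (x \<oplus>\<^bsub>X\<^esub> y)"
    "\<And>x a. \<lbrakk>x \<in> carrier X; a \<in> carrier R\<rbrakk> \<Longrightarrow> q x \<triangleleft>\<^bsub>Q\<^esub> a = q (x \<triangleleft>\<^bsub>X\<^esub> a)"
    using qX by (simp_all add: Q_def q_eq r_add[OF r_sym[OF q] r_sym[OF q]] r_act[OF r_sym[OF q]])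
  show ?thesis
  proof
    show "rmod Q"
    proof (rule rmodI, goal_cases)
      case (6 x)
      then obtain x' where x: "x' \<in> carrier X" "x = q x'" by (auto simp: Qs)
      then show ?case by (intro bexI[of _ "q (\<ominus>\<^bsub>X\<^esub> x')"]) (simp_all add: Qs Qs')
    qed (auto simp: Qs Qs' rmod_act rmod_ac[OF X])
    show "linear X Q q" by (auto simp: linear_def Qs Qs')
    show "q x = \<zero>\<^bsub>Q\<^esub> \<longleftrightarrow> x \<in> N" if "x \<in> carrier X" for x
    proof -
      have "\<ominus>\<^bsub>X\<^esub> \<zero>\<^bsub>X\<^esub> = \<zero>\<^bsub>X\<^esub>" by (metis X rmod_simps(2,3,7,8))
      then show ?thesis using that by (simp add: Qs q_eq r_def)
    qed
  qed (simp add: Qs)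
qed

text \<open>Scalars act on a coset by a union over its elements; all cosets in that union coincide.
  A coset is zero exactly when its representative lies in N, so annihilation of cosets becomes
  membership in N.\<close>

lemma torsion_quot_module_iff:
  assumes X: "rmod X" and N: "submodule R X N" and F: "\<And>I. I \<in> F \<Longrightarrow> I \<subseteq> carrier R"
  shows "torsion_module F (quot_module X N) \<longleftrightarrow> (\<forall>x\<in>carrier X. \<exists>I\<in>F. \<forall>a\<in>I. x \<triangleleft>\<^bsub>X\<^esub> a \<in> N)"
proof -
  note ND = submoduleD[OF X N]
  have coset: "N +>\<^bsub>X\<^esub> x = {n \<oplus>\<^bsub>X\<^esub> x | n. n \<in> N}" for x by (auto simp: a_r_coset_def')
  have coset_N: "N +>\<^bsub>X\<^esub> x = N \<longleftrightarrow> x \<in> N" if x: "x \<in> carrier X" for x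
  proof
    assume "N +>\<^bsub>X\<^esub> x = N"
    then have "\<zero>\<^bsub>X\<^esub> \<oplus>\<^bsub>X\<^esub> x \<in> N" using ND(2) unfolding coset by blast
    then show "x \<in> N" using x by (simp add: X)
  next
    assume xN: "x \<in> N"
    have "y = (y \<oplus>\<^bsub>X\<^esub> (\<ominus>\<^bsub>X\<^esub> x)) \<oplus>\<^bsub>X\<^esub> x" if "y \<in> N" for y
      using that ND(1) x by (simp add: X)
    then show "N +>\<^bsub>X\<^esub> x = N" unfolding coset using ND(3) xN submodule_diff[OF X N _ xN] by blast
  qed
  have eq: "N +>\<^bsub>X\<^esub> (n \<oplus>\<^bsub>X\<^esub> x) = N +>\<^bsub>X\<^esub> x" if n: "n \<in> N" and x: "x \<in> carrier X" for n x
  proof -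
    have "m \<oplus>\<^bsub>X\<^esub> (n \<oplus>\<^bsub>X\<^esub> x) = (m \<oplus>\<^bsub>X\<^esub> n) \<oplus>\<^bsub>X\<^esub> x"
      "m \<oplus>\<^bsub>X\<^esub> x = (m \<oplus>\<^bsub>X\<^esub> (\<ominus>\<^bsub>X\<^esub> n)) \<oplus>\<^bsub>X\<^esub> (n \<oplus>\<^bsub>X\<^esub> x)" if "m \<in> N" for m
      using ND(1)[OF that] ND(1)[OF n] x by (simp_all add: X rmod_ac(1)[OF X, symmetric])
    then show ?thesis unfolding coset using ND(3) n submodule_diff[OF X N _ n] by blast
  qed
  have act: "(N +>\<^bsub>X\<^esub> x) \<triangleleft>\<^bsub>quot_module X N\<^esub> a = N +>\<^bsub>X\<^esub> (x \<triangleleft>\<^bsub>X\<^esub> a)"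
    if x: "x \<in> carrier X" and a: "a \<in> carrier R" for x a
  proof -
    have "N +>\<^bsub>X\<^esub> ((n \<oplus>\<^bsub>X\<^esub> x) \<triangleleft>\<^bsub>X\<^esub> a) = N +>\<^bsub>X\<^esub> (x \<triangleleft>\<^bsub>X\<^esub> a)" if n: "n \<in> N" for n
      using eq[OF ND(4)[OF n a]] x a ND(1)[OF n] by (simp add: X rmod_act[OF X])
    then have "(\<Union>y\<in>N +>\<^bsub>X\<^esub> x. N +>\<^bsub>X\<^esub> (y \<triangleleft>\<^bsub>X\<^esub> a)) = (\<Union>n\<in>N. N +>\<^bsub>X\<^esub> (x \<triangleleft>\<^bsub>X\<^esub> a))"
      unfolding coset[of x] by blast
    then show ?thesis using ND(2) by (auto simp: quot_module_def)
  qed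
  have car: "carrier (quot_module X N) = (\<lambda>x. N +>\<^bsub>X\<^esub> x) ` carrier X"
    by (auto simp: quot_module_def A_RCOSETS_def' image_iff)
  have z: "\<zero>\<^bsub>quot_module X N\<^esub> = N" by (simp add: quot_module_def)
  have "(N +>\<^bsub>X\<^esub> x) \<triangleleft>\<^bsub>quot_module X N\<^esub> a = N \<longleftrightarrow> x \<triangleleft>\<^bsub>X\<^esub> a \<in> N"
    if "x \<in> carrier X" "a \<in> carrier R" for x a
    using that by (simp add: act coset_N X)
  then show ?thesis using F unfolding torsion_module_def car z by (simp add: subset_iff)
qed

end

subsection \<open>Concrete description of the quotient category\<close>

lemma infinite_pairing:
  assumes "infinite (UNIV :: 'u set)"
  obtains e :: "'u \<times> 'u \<Rightarrow> 'u" where "inj e"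
  using card_of_Times_same_infinite[OF assms] card_of_ordLeq[of "UNIV \<times> UNIV :: ('u \<times> 'u) set" "UNIV :: 'u set"]
  by (auto simp: ordIso_iff_ordLeq)

text \<open>The class \<open>K\<close> allows treating all modules and finitely generated modules at once.\<close>

locale gabriel_universe = gabriel A F for A :: "'a ring" (structure) and F +
  fixes K :: "('a, 'u) rmodule set"
  assumes infinite_universe: "infinite (UNIV :: 'u set)"
    and K_mono: "\<lbrakk>X \<in> K; Y \<in> K; rmod X; rmod Y; rmod Z; linear Z X p; linear Z Y q;
      \<And>z. \<lbrakk>z \<in> carrier Z; p z = \<zero>\<^bsub>X\<^esub>; q z = \<zero>\<^bsub>Y\<^esub>\<rbrakk> \<Longrightarrow> z = \<zero>\<^bsub>Z\<^esub>\<rbrakk> \<Longrightarrow> Z \<in> K"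
    and K_epi: "\<lbrakk>X \<in> K; rmod X; rmod Y; linear X Y p; p ` carrier X = carrier Y\<rbrakk> \<Longrightarrow> Y \<in> K"
begin

abbreviation ob :: "('a, 'u) rmodule \<Rightarrow> bool" where
  "ob X \<equiv> rmod X \<and> X \<in> K"

definition mods :: "('a, 'u) rmod_cat" where
  "mods = full_subcat (Mod_cat A) K"

definition tors_mods :: "('a, 'u) rmodule set" where
  "tors_mods = {X \<in> Obj mods. torsion_module F X}"

definition quot :: "('a, 'u) rmod_quot_cat" where
  "quot = serre_quotient mods tors_mods"

text \<open>Normal form of an arrow: \<open>restrict\<close> makes the map extensional, so only its
  values on the carrier matter and equality of arrows is pointwise.\<close>

definition mor :: "('a, 'u) rmodule \<Rightarrow> ('a, 'u) rmodule \<Rightarrow> ('u \<Rightarrow> 'u) \<Rightarrow> ('a, 'u) rmod_arr" where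
  "mor X Y h = (X, Y, restrict h (carrier X))"

lemma mods_simps:
  "Obj mods = {X. ob X}" "Dom mods = (\<lambda>(X, Y, h). X)" "Cod mods = (\<lambda>(X, Y, h). Y)"
  "Ident mods = (\<lambda>X. mor X X (\<lambda>x. x))"
  "Zero mods = (\<lambda>X Y. mor X Y (\<lambda>x. \<zero>\<^bsub>Y\<^esub>))"
  "Arr mods = {(X, Y, h). ob X \<and> ob Y \<and> h \<in> linear_maps A X Y}"
  by (auto simp: mods_def full_subcat_def Mod_cat_def mor_def)

lemma Dom_Cod_mor [simp]: "Dom mods (mor X Y h) = X" "Cod mods (mor X Y h) = Y"
  by (simp_all add: mods_simps mor_def)

lemma mor_in: "\<lbrakk>ob X; ob Y; linear X Y h\<rbrakk> \<Longrightarrow> mor X Y h \<in> hom_set mods X Y"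
  by (simp add: hom_set_def mods_simps mor_def linear_maps_iff)

lemma mor_Arr: "\<lbrakk>ob X; ob Y; linear X Y h\<rbrakk> \<Longrightarrow> mor X Y h \<in> Arr mods"
  by (simp add: mods_simps mor_def linear_maps_iff)

lemma ArrE:
  assumes "f \<in> Arr mods"
  obtains X Y h where "ob X" "ob Y" "linear X Y h" "f = mor X Y h"
  using assms by (auto simp: mods_simps mor_def linear_maps_iff extensional_restrict)

lemma homE:
  assumes "f \<in> hom_set mods X Y"
  obtains h where "ob X" "ob Y" "linear X Y h" "f = mor X Y h"
  using assms by (auto simp: hom_set_def elim!: ArrE)

lemma mor_eq_iff: "mor X Y h = mor X' Y' h' \<longleftrightarrow> X = X' \<and> Y = Y' \<and> (\<forall>x\<in>carrier X. h x = h' x)"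
  by (auto simp: mor_def fun_eq_iff restrict_def)

lemma Comp_mor: "linear X Y h \<Longrightarrow> mor Y' Z g \<cdot>\<^bsub>mods\<^esub> mor X Y h = mor X Z (\<lambda>x. restrict g (carrier Y') (h x))"
  by (auto simp: mods_def full_subcat_def Mod_cat_def mor_def fun_eq_iff restrict_def)

lemma Comp_mor' [simp]: "linear X Y h \<Longrightarrow> mor Y Z g \<cdot>\<^bsub>mods\<^esub> mor X Y h = mor X Z (\<lambda>x. g (h x))"
  by (auto simp: Comp_mor mor_eq_iff linearD)

lemma Add_mor: "Add mods (mor X Y g) (mor X Y h) = mor X Y (\<lambda>x. g x \<oplus>\<^bsub>Y\<^esub> h x)"
  by (auto simp: mods_def full_subcat_def Mod_cat_def mor_def fun_eq_iff restrict_def)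

lemma linear_add: "\<lbrakk>linear X Y g; linear X Y h; rmod Y\<rbrakk> \<Longrightarrow> linear X Y (\<lambda>x. g x \<oplus>\<^bsub>Y\<^esub> h x)"
  by (auto simp: linear_def rmod_ac rmod_act)

lemma category_mods: "category mods"
proof (unfold_locales, goal_cases)
  case (3 X) then show ?case by (simp add: mods_simps mor_in[unfolded mods_simps] linear_id)
next
  case (4 f X Y g Z) then show ?case by (elim homE) (simp add: mor_in linear_comp[of X Y _ Z])
next
  case (5 f X Y) then show ?case by (elim homE) (simp add: mods_simps mor_eq_iff)
next
  case (6 f X Y) then show ?case by (elim homE) (simp add: mods_simps(4) linear_id)
next
  case (7 f W X g Y h Z)
  then show ?case by (elim homE) (simp add: linear_comp[of W X _ Y] linear_comp[of X Y _ Z])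
qed (auto simp: mods_simps(1) elim!: ArrE)

text \<open>The arrows to be inverted, in terms of elements: torsion kernel and torsion
  cokernel.\<close>

definition qiso :: "('a, 'u) rmodule \<Rightarrow> ('a, 'u) rmodule \<Rightarrow> ('u \<Rightarrow> 'u) \<Rightarrow> bool" where
  "qiso X Y s \<longleftrightarrow> linear X Y s \<and> (\<forall>x\<in>carrier X. s x = \<zero>\<^bsub>Y\<^esub> \<longrightarrow> x \<in> tors X) \<and> dense Y (s ` carrier X)"

lemma kernel_mor:
  assumes X: "ob X" and Y: "ob Y" and h: "linear X Y h"
  obtains W i where "ob W" "linear W X i" "inj_on i (carrier W)"
    "i ` carrier W = {x \<in> carrier X. h x = \<zero>\<^bsub>Y\<^esub>}" "is_kernel mods (mor X Y h) (mor W X i)"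
proof -
  have rX: "rmod X" and rY: "rmod Y" using X Y by auto
  have sub: "submodule A X {x \<in> carrier X. h x = \<zero>\<^bsub>Y\<^esub>}"
    using submodule_vimage[OF h rX rY submodule_zero[OF rY]] by simp
  obtain W i where W: "rmod W" "linear W X i" "bij_betw i (carrier W) {x \<in> carrier X. h x = \<zero>\<^bsub>Y\<^esub>}"
    "carrier W = (\<lambda>x. x) ` {x \<in> carrier X. h x = \<zero>\<^bsub>Y\<^esub>}"
    using subset_transport[OF rX sub inj_on_id2] .
  have inj: "inj_on i (carrier W)" and img: "i ` carrier W = {x \<in> carrier X. h x = \<zero>\<^bsub>Y\<^esub>}"
    using W(3) by (auto simp: bij_betw_def)
  have K: "W \<in> K"
    \<comment> \<open>Taking both maps equal to the inclusion turns \<open>K_mono\<close> into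
      closure under submodules.\<close>
    by (rule K_mono[of X X W i i]) (use X W inj linear_inj_iff[OF W(2,1)] in auto)
  have "is_kernel mods (mor X Y h) (mor W X i)"
    unfolding is_kernel_def
  proof (intro conjI ballI impI)
    show "mor X Y h \<cdot>\<^bsub>mods\<^esub> mor W X i = Zero mods (Dom mods (mor W X i)) (Cod mods (mor X Y h))"
      using W img by (auto simp: mods_simps(5) mor_eq_iff)
    fix g assume "g \<in> Arr mods" and g: "Cod mods g = Dom mods (mor X Y h) \<and>
      mor X Y h \<cdot>\<^bsub>mods\<^esub> g = Zero mods (Dom mods g) (Cod mods (mor X Y h))"
    then obtain Z g' where Z: "ob Z" "linear Z X g'" "g = mor Z X g'"
      by (auto elim!: ArrE)
    then have hg: "h (g' z) = \<zero>\<^bsub>Y\<^esub>" if "z \<in> carrier Z" for z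
      using g that by (simp add: mods_simps(5) mor_eq_iff)
    define k where "k z = inv_into (carrier W) i (g' z)" for z
    have gi: "g' z \<in> i ` carrier W" if "z \<in> carrier Z" for z
      using hg[OF that] linearD(1)[OF Z(2) that] img by auto
    have k: "k z \<in> carrier W" "i (k z) = g' z" if "z \<in> carrier Z" for z
      using inv_into_into[OF gi[OF that]] f_inv_into_f[OF gi[OF that]] by (auto simp: k_def)
    have "linear Z W k"
      unfolding linear_def
    proof (intro conjI ballI)
      fix x y assume x: "x \<in> carrier Z" "y \<in> carrier Z"
      show "k (x \<oplus>\<^bsub>Z\<^esub> y) = k x \<oplus>\<^bsub>W\<^esub> k y"
        by (rule inj_onD[OF inj]) (use x k Z W(1) linearD(2)[OF W(2)] linearD(2)[OF Z(2)] in auto)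
    next
      fix x a assume x: "x \<in> carrier Z" "a \<in> carrier A"
      show "k (x \<triangleleft>\<^bsub>Z\<^esub> a) = k x \<triangleleft>\<^bsub>W\<^esub> a"
        by (rule inj_onD[OF inj]) (use x k Z W(1) linearD(3)[OF W(2)] linearD(3)[OF Z(2)] in auto)
    qed (use k in auto)
    then show "\<exists>!u. u \<in> hom_set mods (Dom mods g) (Dom mods (mor W X i)) \<and> mor W X i \<cdot>\<^bsub>mods\<^esub> u = g"
    proof (intro ex1I conjI)
      show "mor Z W k \<in> hom_set mods (Dom mods g) (Dom mods (mor W X i))" if "linear Z W k"
        using that W K Z by (simp add: mor_in)
      show "mor W X i \<cdot>\<^bsub>mods\<^esub> mor Z W k = g" if "linear Z W k"
        using that Z k by (simp add: mor_eq_iff)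
      fix u assume "u \<in> hom_set mods (Dom mods g) (Dom mods (mor W X i)) \<and> mor W X i \<cdot>\<^bsub>mods\<^esub> u = g"
      then obtain u' where u: "linear Z W u'" "u = mor Z W u'" "mor W X i \<cdot>\<^bsub>mods\<^esub> mor Z W u' = g"
        using Z by (auto elim!: homE)
      then show "u = mor Z W k"
        using Z k linearD(1)[OF u(1)] inj by (auto simp: mor_eq_iff inj_on_def)
    qed
  qed (use X Y W K h in \<open>auto simp: mor_Arr\<close>)
  then show ?thesis using that[of W i] W K inj img by auto
qed

lemma cokernel_mor:
  assumes X: "ob X" and Y: "ob Y" and h: "linear X Y h"
  obtains Q q where "ob Q" "linear Y Q q" "q ` carrier Y = carrier Q"
    "\<forall>y\<in>carrier Y. q y = \<zero>\<^bsub>Q\<^esub> \<longleftrightarrow> y \<in> h ` carrier X"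
    "is_cokernel mods (mor X Y h) (mor Y Q q)"
proof -
  have rX: "rmod X" and rY: "rmod Y" using X Y by auto
  obtain Q :: "('a, 'u) rmodule" and q where Q: "rmod Q" "linear Y Q q" "q ` carrier Y = carrier Q"
    "\<forall>y\<in>carrier Y. q y = \<zero>\<^bsub>Q\<^esub> \<longleftrightarrow> y \<in> h ` carrier X"
    using quotient_exists[OF rY submodule_image[OF h rX rY submodule_carrier[OF rX]]] by metis
  have K: "Q \<in> K" using K_epi[of Y Q q] Y Q by auto
  have "is_cokernel mods (mor X Y h) (mor Y Q q)"
    unfolding is_cokernel_def
  proof (intro conjI ballI impI)
    show "mor Y Q q \<cdot>\<^bsub>mods\<^esub> mor X Y h = Zero mods (Dom mods (mor X Y h)) (Cod mods (mor Y Q q))"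
      using h linearD(1)[OF h] Q(4) by (simp add: mods_simps(5) mor_eq_iff)
    fix g assume "g \<in> Arr mods" and g: "Dom mods g = Cod mods (mor X Y h) \<and>
      g \<cdot>\<^bsub>mods\<^esub> mor X Y h = Zero mods (Dom mods (mor X Y h)) (Cod mods g)"
    then obtain Z g' where Z: "ob Z" "linear Y Z g'" "g = mor Y Z g'"
      by (auto elim!: ArrE)
    then have gh: "g' (h x) = \<zero>\<^bsub>Z\<^esub>" if "x \<in> carrier X" for x
      using g that h by (simp add: mods_simps(5) mor_eq_iff)
    define k where "k z = g' (inv_into (carrier Y) q z)" for z
    \<comment> \<open>The chosen preimage of q y differs from y by an element of the image of h,
      which g' kills.\<close>
    have k: "k (q y) = g' y" if y: "y \<in> carrier Y" for y
    proof -
      define y' where "y' = inv_into (carrier Y) q (q y)"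
      have y': "y' \<in> carrier Y" "q y' = q y"
        unfolding y'_def using y by (auto intro: inv_into_into f_inv_into_f)
      have "q (y' \<oplus>\<^bsub>Y\<^esub> (\<ominus>\<^bsub>Y\<^esub> y)) = \<zero>\<^bsub>Q\<^esub>"
        using y y' linearD[OF Q(2)] Q(1) rY by (simp add: linear_neg[OF Q(2)])
      then obtain x where "x \<in> carrier X" "y' \<oplus>\<^bsub>Y\<^esub> (\<ominus>\<^bsub>Y\<^esub> y) = h x"
        using Q(4)[rule_format, of "y' \<oplus>\<^bsub>Y\<^esub> (\<ominus>\<^bsub>Y\<^esub> y)"] y y' rY by auto
      then have "g' (y' \<oplus>\<^bsub>Y\<^esub> (\<ominus>\<^bsub>Y\<^esub> y)) = \<zero>\<^bsub>Z\<^esub>" using gh by simp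
      then have "g' y' \<oplus>\<^bsub>Z\<^esub> (\<ominus>\<^bsub>Z\<^esub> g' y) = \<zero>\<^bsub>Z\<^esub>"
        using y y' Z rY by (simp add: linear_neg[OF Z(2)] linearD[OF Z(2)])
      then have "g' y' = g' y"
        using rmod_diff_zero[of Z "g' y'" "g' y"] y y' Z linearD(1)[OF Z(2)] by simp
      then show ?thesis by (simp add: k_def y'_def)
    qed
    have lin: "linear Q Z k"
      unfolding linear_def Q(3)[symmetric]
      using rY Z linearD[OF Z(2)]
      by (auto simp: k linearD(2,3)[OF Q(2), symmetric])
    show "\<exists>!u. u \<in> hom_set mods (Cod mods (mor Y Q q)) (Cod mods g) \<and> u \<cdot>\<^bsub>mods\<^esub> mor Y Q q = g"
    proof (intro ex1I conjI)
      show "mor Q Z k \<in> hom_set mods (Cod mods (mor Y Q q)) (Cod mods g)"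
        using lin Q K Z by (simp add: mor_in)
      show "mor Q Z k \<cdot>\<^bsub>mods\<^esub> mor Y Q q = g"
        using Q(2) Z k by (simp add: mor_eq_iff)
      fix u assume "u \<in> hom_set mods (Cod mods (mor Y Q q)) (Cod mods g) \<and> u \<cdot>\<^bsub>mods\<^esub> mor Y Q q = g"
      then obtain u' where u: "linear Q Z u'" "u = mor Q Z u'" "mor Q Z u' \<cdot>\<^bsub>mods\<^esub> mor Y Q q = g"
        using Z by (auto elim!: homE)
      then have "u' (q y) = g' y" if "y \<in> carrier Y" for y
        using that Z Q(2) by (simp add: mor_eq_iff)
      then show "u = mor Q Z k"
        unfolding u(2) mor_eq_iff Q(3)[symmetric] using k by auto
    qed
  qed (use X Y Q K h in \<open>auto simp: mor_Arr\<close>)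
  then show ?thesis using that[of Q q] Q K by auto
qed

lemma tors_mods_iff: "X \<in> tors_mods \<longleftrightarrow> ob X \<and> carrier X \<subseteq> tors X"
  by (auto simp: tors_mods_def mods_simps torsion_module_iff)

text \<open>\<open>S_iso\<close> mentions an arbitrary kernel and cokernel. Their universal
  properties compare them with the concrete ones, and linear maps send torsion to torsion.\<close>

lemma S_iso_iff:
  assumes X: "ob X" and Y: "ob Y" and s: "linear X Y s"
  shows "S_iso mods tors_mods (mor X Y s) \<longleftrightarrow> qiso X Y s"
proof -
  have rX: "rmod X" and rY: "rmod Y" using X Y by auto
  obtain W i where W: "ob W" "linear W X i" "inj_on i (carrier W)"
    "i ` carrier W = {x \<in> carrier X. s x = \<zero>\<^bsub>Y\<^esub>}" "is_kernel mods (mor X Y s) (mor W X i)"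
    using kernel_mor[OF assms] .
  obtain Q q where Q: "ob Q" "linear Y Q q" "q ` carrier Y = carrier Q"
    "\<forall>y\<in>carrier Y. q y = \<zero>\<^bsub>Q\<^esub> \<longleftrightarrow> y \<in> s ` carrier X"
    "is_cokernel mods (mor X Y s) (mor Y Q q)"
    using cokernel_mor[OF assms] .
  show ?thesis
  proof
    assume "S_iso mods tors_mods (mor X Y s)"
    then obtain k c where k: "is_kernel mods (mor X Y s) k" "Dom mods k \<in> tors_mods"
      and c: "is_cokernel mods (mor X Y s) c" "Cod mods c \<in> tors_mods"
      by (auto simp: S_iso_def)
    have "k \<in> Arr mods" "Cod mods k = X" using k(1) by (auto simp: is_kernel_def)
    then obtain V k' where V: "ob V" "linear V X k'" "k = mor V X k'"
      by (auto elim!: ArrE)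
    have "\<exists>u. u \<in> hom_set mods W V \<and> mor V X k' \<cdot>\<^bsub>mods\<^esub> u = mor W X i"
      using k(1) W(5) unfolding is_kernel_def V(3) by (metis Dom_Cod_mor)
    then obtain u where u: "linear W V u" "\<And>w. w \<in> carrier W \<Longrightarrow> k' (u w) = i w"
      by (auto elim!: homE simp: mor_eq_iff)
    have ker: "x \<in> tors X" if x: "x \<in> carrier X" "s x = \<zero>\<^bsub>Y\<^esub>" for x
    proof -
      obtain w where w: "w \<in> carrier W" "x = i w" using W(4) x by blast
      then have "u w \<in> tors V" using linearD(1)[OF u(1)] k(2) V by (auto simp: tors_mods_iff)
      then have "k' (u w) \<in> tors X"
        by (rule linear_sat[OF V(2), rotated]) (use linear_zero[OF V(2)] V rX in auto)
      then show ?thesis using u(2) w by simp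
    qed
    have "c \<in> Arr mods" "Dom mods c = Y" using c(1) by (auto simp: is_cokernel_def)
    then obtain V c' where V: "ob V" "linear Y V c'" "c = mor Y V c'"
      by (auto elim!: ArrE)
    have "\<exists>u. u \<in> hom_set mods V Q \<and> u \<cdot>\<^bsub>mods\<^esub> mor Y V c' = mor Y Q q"
      using c(1) Q(5) unfolding is_cokernel_def V(3) by (metis Dom_Cod_mor)
    then obtain v where v: "linear V Q v" "\<And>y. y \<in> carrier Y \<Longrightarrow> v (c' y) = q y"
      using V by (auto elim!: homE simp: mor_eq_iff)
    have "y \<in> sat Y (s ` carrier X)" if y: "y \<in> carrier Y" for y
    proof -
      have "c' y \<in> tors V" using linearD(1)[OF V(2) y] c(2) V by (auto simp: tors_mods_iff)
      then have "v (c' y) \<in> tors Q"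
        by (rule linear_sat[OF v(1), rotated]) (use linear_zero[OF v(1)] V Q in auto)
      then obtain I where I: "I \<in> F" "\<And>a. a \<in> I \<Longrightarrow> a \<in> carrier A" "\<And>a. a \<in> I \<Longrightarrow> q y \<triangleleft>\<^bsub>Q\<^esub> a = \<zero>\<^bsub>Q\<^esub>"
        using v(2)[OF y] by (auto elim!: satE)
      show ?thesis
      proof (rule satI[OF y I(1)])
        fix a assume a: "a \<in> I"
        then have "q (y \<triangleleft>\<^bsub>Y\<^esub> a) = \<zero>\<^bsub>Q\<^esub>" using I y linearD(3)[OF Q(2)] by simp
        then show "y \<triangleleft>\<^bsub>Y\<^esub> a \<in> s ` carrier X" using Q(4)[rule_format, of "y \<triangleleft>\<^bsub>Y\<^esub> a"] I(2)[OF a] y rY by simp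
      qed
    qed
    then show "qiso X Y s" using ker s by (auto simp: qiso_def dense_def)
  next
    assume q: "qiso X Y s"
    have "W \<in> tors_mods"
      unfolding tors_mods_iff
    proof (intro conjI subsetI)
      fix w assume w: "w \<in> carrier W"
      then have "i w \<in> tors X" using q W(4) by (auto simp: qiso_def)
      then obtain I where I: "I \<in> F" "\<And>a. a \<in> I \<Longrightarrow> a \<in> carrier A" "\<And>a. a \<in> I \<Longrightarrow> i w \<triangleleft>\<^bsub>X\<^esub> a = \<zero>\<^bsub>X\<^esub>"
        by (auto elim!: satE)
      show "w \<in> tors W"
      proof (rule satI[OF w I(1)])
        fix a assume a: "a \<in> I"
        then have "i (w \<triangleleft>\<^bsub>W\<^esub> a) = \<zero>\<^bsub>X\<^esub>" using I w linearD(3)[OF W(2)] by simp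
        moreover have "w \<triangleleft>\<^bsub>W\<^esub> a \<in> carrier W" using w I(2)[OF a] W(1) by simp
        ultimately show "w \<triangleleft>\<^bsub>W\<^esub> a \<in> {\<zero>\<^bsub>W\<^esub>}"
          using W(1,3) linear_inj_iff[OF W(2)] rX by simp
      qed
    qed (use W in auto)
    moreover have "Q \<in> tors_mods"
      unfolding tors_mods_iff
    proof (intro conjI subsetI)
      fix z assume "z \<in> carrier Q"
      then obtain y where y: "y \<in> carrier Y" "z = q y" using Q(3) by auto
      then have "y \<in> sat Y (s ` carrier X)" using q by (auto simp: qiso_def dense_def)
      then show "z \<in> tors Q"
        unfolding y(2)
        by (rule linear_sat[OF Q(2), rotated]) (use Q(4) linearD(1)[OF s] in auto)
    qed (use Q in auto)
    ultimately show "S_iso mods tors_mods (mor X Y s)"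
      unfolding S_iso_def using W(5) Q(5)
      by (intro exI[of _ "mor W X i"] exI[of _ "mor Y Q q"]) simp
  qed
qed

definition span :: "('a, 'u) rmodule \<Rightarrow> ('u \<Rightarrow> 'u) \<Rightarrow> ('u \<Rightarrow> 'u) \<Rightarrow> ('u \<times> 'u) set" where
  "span W s f = {(s w, f w) | w. w \<in> carrier W}"

text \<open>A value at 0 is f of an element of the kernel of s, and that kernel is torsion.\<close>

lemma pre_mor_span:
  assumes W: "rmod W" and X: "rmod X" and Y: "rmod Y" and s: "qiso W X s" and f: "linear W Y f"
  shows "pre_mor X Y (span W s f)"
proof -
  have ls: "linear W X s" using s by (simp add: qiso_def)
  have "linear W (prod_mod X Y) (\<lambda>w. (s w, f w))"
    using ls f by (auto simp: linear_def)
  then have "submodule A (prod_mod X Y) ((\<lambda>w. (s w, f w)) ` carrier W)"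
    by (rule submodule_image) (use W X Y in \<open>auto intro: submodule_carrier\<close>)
  moreover have "(\<lambda>w. (s w, f w)) ` carrier W = span W s f" by (auto simp: span_def)
  moreover have "Domain (span W s f) = s ` carrier W" by (auto simp: span_def)
  moreover have "y \<in> tors Y" if y: "(\<zero>\<^bsub>X\<^esub>, y) \<in> span W s f" for y
  proof -
    obtain w where w: "w \<in> carrier W" "s w = \<zero>\<^bsub>X\<^esub>" "y = f w" using y by (auto simp: span_def)
    then have "w \<in> tors W" using s by (simp add: qiso_def)
    then show ?thesis
      unfolding w(3) by (rule linear_sat[OF f, rotated]) (use linear_zero[OF f W Y] in auto)
  qed
  ultimately show ?thesis using s by (simp add: pre_mor_def qiso_def)
qed

text \<open>The relation G itself, coded into the universe by pairing, is the apex of the roof, with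
  the two coordinates as legs. The legs are jointly injective, which keeps the apex in K.\<close>

lemma realize_relation:
  assumes X: "ob X" and Y: "ob Y" and G: "submodule A (prod_mod X Y) G"
  obtains W p q where "ob W" "linear W X p" "linear W Y q" "span W p q = G"
    "\<forall>w\<in>carrier W. p w = \<zero>\<^bsub>X\<^esub> \<longrightarrow> q w = \<zero>\<^bsub>Y\<^esub> \<longrightarrow> w = \<zero>\<^bsub>W\<^esub>"
proof -
  have rX: "rmod X" and rY: "rmod Y" using X Y by auto
  obtain e :: "'u \<times> 'u \<Rightarrow> 'u" where e: "inj e" using infinite_pairing[OF infinite_universe] by auto
  obtain W d where W: "rmod W" "linear W (prod_mod X Y) d" "bij_betw d (carrier W) G"
    "carrier W = e ` G"
    using subset_transport[OF rmod_prod[OF rX rY] G inj_on_subset[OF e subset_UNIV]] .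
  let ?p = "\<lambda>w. fst (d w)" and ?q = "\<lambda>w. snd (d w)"
  have "linear (prod_mod X Y) X fst" "linear (prod_mod X Y) Y snd" by (auto simp: linear_def)
  then have lin: "linear W X ?p" "linear W Y ?q" using linear_comp[OF W(2)] by auto
  have inj: "w = \<zero>\<^bsub>W\<^esub>" if w: "w \<in> carrier W" "?p w = \<zero>\<^bsub>X\<^esub>" "?q w = \<zero>\<^bsub>Y\<^esub>" for w
  proof -
    have "d w = \<zero>\<^bsub>prod_mod X Y\<^esub>" using w by (simp add: prod_eq_iff)
    then show ?thesis
      using W(3) linear_inj_iff[OF W(2,1)] rX rY w(1) by (auto simp: bij_betw_def)
  qed
  have "span W ?p ?q = d ` carrier W" by (auto simp: span_def)
  then have "span W ?p ?q = G" using W(3) by (simp add: bij_betw_def)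
  moreover have "W \<in> K" by (rule K_mono[of X Y W ?p ?q]) (use X Y W lin inj in auto)
  ultimately show ?thesis using that[of W ?p ?q] lin inj W by auto
qed

text \<open>Where the first leg vanishes the second takes a torsion value. An ideal killing that
  value kills both coordinates, hence the element of the apex; so the first leg has torsion
  kernel.\<close>

lemma realize_qmor:
  assumes X: "ob X" and Y: "ob Y" and G: "pre_mor X Y G"
  obtains W s f where "ob W" "qiso W X s" "linear W Y f" "span W s f = G"
proof -
  obtain W p q where W: "ob W" "linear W X p" "linear W Y q" "span W p q = G"
    "\<forall>w\<in>carrier W. p w = \<zero>\<^bsub>X\<^esub> \<longrightarrow> q w = \<zero>\<^bsub>Y\<^esub> \<longrightarrow> w = \<zero>\<^bsub>W\<^esub>"
    using realize_relation[OF X Y pre_morD[OF G]] .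
  have "w \<in> tors W" if w: "w \<in> carrier W" "p w = \<zero>\<^bsub>X\<^esub>" for w
  proof -
    have "(\<zero>\<^bsub>X\<^esub>, q w) \<in> G" unfolding W(4)[symmetric] span_def using w by (metis (mono_tags, lifting) mem_Collect_eq)
    then have "q w \<in> tors Y" using G by (simp add: pre_mor_def)
    then obtain I where I: "I \<in> F" "\<And>a. a \<in> I \<Longrightarrow> a \<in> carrier A" "\<And>a. a \<in> I \<Longrightarrow> q w \<triangleleft>\<^bsub>Y\<^esub> a = \<zero>\<^bsub>Y\<^esub>"
      by (auto elim!: satE)
    show ?thesis
    proof (rule satI[OF w(1) I(1)])
      fix a assume a: "a \<in> I"
      have "w \<triangleleft>\<^bsub>W\<^esub> a = \<zero>\<^bsub>W\<^esub>"
        by (rule W(5)[rule_format]) (use w W(1) X I(2,3)[OF a] linearD(3)[OF W(2)] linearD(3)[OF W(3)] in auto)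
      then show "w \<triangleleft>\<^bsub>W\<^esub> a \<in> {\<zero>\<^bsub>W\<^esub>}" by simp
    qed
  qed
  moreover have "Domain G = p ` carrier W" unfolding W(4)[symmetric] span_def by auto
  ultimately have "qiso W X p" using G W(2) by (simp add: qiso_def pre_mor_def)
  then show ?thesis using that W by blast
qed

text \<open>Shown below to be exactly the equivalence classes of \<open>roof_rel\<close>, so that a
  relation G names an arrow of the quotient category.\<close>

definition qarr :: "('a, 'u) rmodule \<Rightarrow> ('a, 'u) rmodule \<Rightarrow> ('u \<times> 'u) set
    \<Rightarrow> (('a, 'u) rmod_arr \<times> ('a, 'u) rmod_arr) set" where
  "qarr X Y G = {(mor W X s, mor W Y f) | W s f. ob W \<and> qiso W X s \<and> linear W Y f \<and>
     sat (prod_mod X Y) (span W s f) = G}"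

lemma qarrI: "\<lbrakk>ob W; qiso W X s; linear W Y f; sat (prod_mod X Y) (span W s f) = G\<rbrakk>
    \<Longrightarrow> (mor W X s, mor W Y f) \<in> qarr X Y G"
  by (auto simp: qarr_def)

lemma span_cong: "(\<And>w. w \<in> carrier W \<Longrightarrow> s w = s' w \<and> f w = f' w) \<Longrightarrow> span W s f = span W s' f'"
  by (force simp: span_def)

lemma qiso_cong: "(\<And>w. w \<in> carrier W \<Longrightarrow> s w = s' w) \<Longrightarrow> rmod W \<Longrightarrow> qiso W X s \<longleftrightarrow> qiso W X s'"
  using linear_cong[of W s s' X] image_cong[of "carrier W" "carrier W" s s'] by (simp add: qiso_def)

lemma qarr_memD:
  assumes "(mor W X' s, mor W' Y' f) \<in> qarr X Y G"
  shows "W' = W" "X' = X" "Y' = Y" "ob W" "qiso W X s" "linear W Y f"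
    "sat (prod_mod X Y) (span W s f) = G"
proof -
  obtain V t g where V: "mor W X' s = mor V X t" "mor W' Y' f = mor V Y g" "ob V" "qiso V X t"
    "linear V Y g" "sat (prod_mod X Y) (span V t g) = G"
    using assms by (auto simp: qarr_def)
  then have *: "V = W" "W' = W" "X' = X" "Y' = Y" "\<And>w. w \<in> carrier W \<Longrightarrow> t w = s w \<and> g w = f w"
    by (auto simp: mor_eq_iff)
  then show "W' = W" "X' = X" "Y' = Y" "ob W" using V by auto
  show "qiso W X s" "linear W Y f" "sat (prod_mod X Y) (span W s f) = G"
    using V * qiso_cong[of W t s X] linear_cong[of W g f Y] span_cong[of W t s g f] by auto
qed

lemma roofsE:
  assumes "r \<in> roofs mods tors_mods"
  obtains W X Y s f where "ob W" "ob X" "ob Y" "qiso W X s" "linear W Y f" "r = (mor W X s, mor W Y f)"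
  using assms S_iso_iff by (auto simp: roofs_def elim!: ArrE)

lemma roofsI:
  "\<lbrakk>ob W; ob X; ob Y; qiso W X s; linear W Y f\<rbrakk> \<Longrightarrow> (mor W X s, mor W Y f) \<in> roofs mods tors_mods"
  using S_iso_iff[of W X s] by (auto simp: roofs_def mor_Arr qiso_def)

text \<open>The span of a common refinement lies inside both spans, which forces equal saturations.
  Conversely, if the saturations agree, an ideal in F moves each point of one span into the other,
  so the pullback of the two apexes is a common refinement with dense image in X.\<close>

lemma roof_rel_iff:
  assumes W: "ob W" "ob X" "ob Y" "qiso W X s" "linear W Y f"
    and W': "ob W'" "ob X'" "ob Y'" "qiso W' X' s'" "linear W' Y' f'"
  shows "((mor W X s, mor W Y f), (mor W' X' s', mor W' Y' f')) \<in> roof_rel mods tors_mods \<longleftrightarrow>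
    X = X' \<and> Y = Y' \<and> sat (prod_mod X Y) (span W s f) = sat (prod_mod X Y) (span W' s' f')" (is "?L \<longleftrightarrow> ?R")
proof
  have ls: "linear W X s" and ls': "linear W' X' s'" using W W' by (auto simp: qiso_def)
  {
    assume ?L
    then obtain u v where XY: "X' = X" "Y' = Y" and uv: "u \<in> Arr mods" "v \<in> Arr mods"
      "Dom mods u = Dom mods v" "Cod mods u = W" "Cod mods v = W'"
      "mor W X s \<cdot>\<^bsub>mods\<^esub> u = mor W' X' s' \<cdot>\<^bsub>mods\<^esub> v" "mor W Y f \<cdot>\<^bsub>mods\<^esub> u = mor W' Y' f' \<cdot>\<^bsub>mods\<^esub> v"
      "S_iso mods tors_mods (mor W X s \<cdot>\<^bsub>mods\<^esub> u)"
      unfolding roof_rel_def by auto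
    then obtain V u' v' where V: "ob V" "linear V W u'" "linear V W' v'" "u = mor V W u'" "v = mor V W' v'"
      by (auto elim!: ArrE)
    note eqs = uv(6-8)[unfolded V XY Comp_mor'[OF V(2)] Comp_mor'[OF V(3)] mor_eq_iff]
    have q: "qiso V X (\<lambda>z. s (u' z))"
      using eqs(3) S_iso_iff[OF V(1) W(2) linear_comp[OF V(2) ls]] by simp
    have "pre_mor X Y (span V (\<lambda>z. s (u' z)) (\<lambda>z. f (u' z)))"
      using pre_mor_span[OF _ _ _ q linear_comp[OF V(2) W(5)]] V W by auto
    moreover have "qmor X Y (sat (prod_mod X Y) (span W s f))"
      using W by (intro qmor_sat pre_mor_span) auto
    moreover have "qmor X Y (sat (prod_mod X Y) (span W' s' f'))"
      using W' XY by (intro qmor_sat pre_mor_span) auto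
    moreover have "span V (\<lambda>z. s (u' z)) (\<lambda>z. f (u' z)) \<subseteq> sat (prod_mod X Y) (span W s f)"
    proof -
      have "span V (\<lambda>z. s (u' z)) (\<lambda>z. f (u' z)) \<subseteq> span W s f"
        using linearD(1)[OF V(2)] by (auto simp: span_def)
      also have "\<dots> \<subseteq> sat (prod_mod X Y) (span W s f)"
        using W by (intro pre_mor_subset_sat pre_mor_span) auto
      finally show ?thesis .
    qed
    moreover have "span V (\<lambda>z. s (u' z)) (\<lambda>z. f (u' z)) \<subseteq> sat (prod_mod X Y) (span W' s' f')"
    proof -
      have "span V (\<lambda>z. s (u' z)) (\<lambda>z. f (u' z)) \<subseteq> span W' s' f'"
        using linearD(1)[OF V(3)] eqs by (auto simp: span_def)
      also have "\<dots> \<subseteq> sat (prod_mod X Y) (span W' s' f')"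
        using W' XY by (intro pre_mor_subset_sat pre_mor_span) auto
      finally show ?thesis .
    qed
    ultimately show ?R using XY qmor_eqI[of X Y] W by blast
  }
  assume R: ?R
  then have XY: "X' = X" "Y' = Y" by auto
  have r: "rmod W" "rmod X" "rmod Y" "rmod W'" using W W' by auto
  \<comment> \<open>The pullback of the two apexes over the product of X and Y.\<close>
  let ?G = "{(w, w'). w \<in> carrier W \<and> w' \<in> carrier W' \<and> s w = s' w' \<and> f w = f' w'}"
  have "submodule A (prod_mod W W') ?G"
    using r linearD[OF ls] linearD[OF W(5)] linearD[OF ls'] linearD[OF W'(5)] XY
      linear_zero[OF ls] linear_zero[OF W(5)] linear_zero[OF ls'] linear_zero[OF W'(5)]
    by (auto simp: rel_submodule_iff)
  from realize_relation[OF W(1) W'(1) this]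
  obtain V u v where V: "ob V" "linear V W u" "linear V W' v" "span V u v = ?G"
    "\<forall>z\<in>carrier V. u z = \<zero>\<^bsub>W\<^esub> \<longrightarrow> v z = \<zero>\<^bsub>W'\<^esub> \<longrightarrow> z = \<zero>\<^bsub>V\<^esub>"
    .
  have "(u z, v z) \<in> ?G" if "z \<in> carrier V" for z
    unfolding V(4)[symmetric] using that by (auto simp: span_def)
  then have eqs: "s (u z) = s' (v z)" "f (u z) = f' (v z)" if "z \<in> carrier V" for z
    using that by auto
  have "z \<in> tors V" if z: "z \<in> carrier V" "s (u z) = \<zero>\<^bsub>X\<^esub>" for z
  proof -
    have "u z \<in> tors W" using W(4) z linearD(1)[OF V(2)] by (simp add: qiso_def)
    moreover have "v z \<in> tors W'" using W'(4) z linearD(1)[OF V(3)] eqs XY by (simp add: qiso_def)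
    ultimately obtain I J where I: "I \<in> F" "\<And>a. a \<in> I \<Longrightarrow> a \<in> carrier A" "\<And>a. a \<in> I \<Longrightarrow> u z \<triangleleft>\<^bsub>W\<^esub> a = \<zero>\<^bsub>W\<^esub>"
      and J: "J \<in> F" "\<And>a. a \<in> J \<Longrightarrow> v z \<triangleleft>\<^bsub>W'\<^esub> a = \<zero>\<^bsub>W'\<^esub>"
      by (metis satE singletonD)
    show ?thesis
    proof (rule satI[OF z(1) F_Int[OF I(1) J(1)]])
      fix a assume a: "a \<in> I \<inter> J"
      have "z \<triangleleft>\<^bsub>V\<^esub> a = \<zero>\<^bsub>V\<^esub>"
        by (rule V(5)[rule_format]) (use a z V(1) I J linearD(3)[OF V(2)] linearD(3)[OF V(3)] in auto)
      then show "z \<triangleleft>\<^bsub>V\<^esub> a \<in> {\<zero>\<^bsub>V\<^esub>}" by simp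
    qed
  qed
  moreover have "dense X ((\<lambda>z. s (u z)) ` carrier V)"
  proof (rule dense_sat[of X "s ` carrier W"])
    show "submodule A X ((\<lambda>z. s (u z)) ` carrier V)"
      using V r by (intro submodule_image[OF linear_comp[OF V(2) ls]] submodule_carrier) auto
    show "s ` carrier W \<subseteq> sat X ((\<lambda>z. s (u z)) ` carrier V)"
    proof clarify
      fix w assume w: "w \<in> carrier W"
      have "(s w, f w) \<in> span W s f" using w by (auto simp: span_def)
      then have "(s w, f w) \<in> sat (prod_mod X Y) (span W' s' f')"
        using R pre_mor_subset_sat[OF r(2,3) pre_mor_span[OF r(1-3) W(4,5)]] by blast
      then obtain I where I: "I \<in> F" "\<forall>a\<in>I. (s w \<triangleleft>\<^bsub>X\<^esub> a, f w \<triangleleft>\<^bsub>Y\<^esub> a) \<in> span W' s' f'"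
        unfolding sat_prod_iff by blast
      show "s w \<in> sat X ((\<lambda>z. s (u z)) ` carrier V)"
      proof (rule satI[OF linearD(1)[OF ls w] I(1)])
        fix a assume a: "a \<in> I"
        have aA: "a \<in> carrier A" by (rule F_carrierD[OF I(1) a])
        obtain w' where "w' \<in> carrier W'" "s w \<triangleleft>\<^bsub>X\<^esub> a = s' w'" "f w \<triangleleft>\<^bsub>Y\<^esub> a = f' w'"
          using I(2) a by (auto simp: span_def)
        then have "(w \<triangleleft>\<^bsub>W\<^esub> a, w') \<in> ?G"
          using w aA r linearD(3)[OF ls w aA] linearD(3)[OF W(5) w aA] by simp
        then obtain z where "z \<in> carrier V" "u z = w \<triangleleft>\<^bsub>W\<^esub> a" unfolding V(4)[symmetric] by (auto simp: span_def)
        then show "s w \<triangleleft>\<^bsub>X\<^esub> a \<in> (\<lambda>z. s (u z)) ` carrier V"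
          using linearD(3)[OF ls w aA] by force
      qed
    qed
  qed (use W in \<open>auto simp: qiso_def\<close>)
  ultimately have q: "qiso V X (\<lambda>z. s (u z))" using linear_comp[OF V(2) ls] by (simp add: qiso_def)
  have "\<exists>u\<in>Arr mods. \<exists>v\<in>Arr mods. Dom mods u = Dom mods v \<and> Cod mods u = W \<and> Cod mods v = W' \<and>
      mor W X s \<cdot>\<^bsub>mods\<^esub> u = mor W' X s' \<cdot>\<^bsub>mods\<^esub> v \<and> mor W Y f \<cdot>\<^bsub>mods\<^esub> u = mor W' Y f' \<cdot>\<^bsub>mods\<^esub> v \<and>
      S_iso mods tors_mods (mor W X s \<cdot>\<^bsub>mods\<^esub> u)"
    by (rule bexI[of _ "mor V W u"], rule bexI[of _ "mor V W' v"])
      (use V W W' eqs S_iso_iff[OF V(1) W(2) linear_comp[OF V(2) ls]] q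
        in \<open>auto simp: mor_eq_iff mor_Arr\<close>)
  then show ?L
    unfolding roof_rel_def XY using roofsI[OF W] roofsI[OF W'[unfolded XY]] by simp
qed

lemma roof_class_eq:
  assumes W: "ob W" "ob X" "ob Y" "qiso W X s" "linear W Y f"
  shows "roof_class mods tors_mods (mor W X s) (mor W Y f) = qarr X Y (sat (prod_mod X Y) (span W s f))"
proof (intro equalityI subsetI)
  fix r assume "r \<in> roof_class mods tors_mods (mor W X s) (mor W Y f)"
  then have r: "((mor W X s, mor W Y f), r) \<in> roof_rel mods tors_mods" by simp
  then have "r \<in> roofs mods tors_mods" by (auto simp: roof_rel_def)
  then obtain W' X' Y' s' f' where W': "ob W'" "ob X'" "ob Y'" "qiso W' X' s'" "linear W' Y' f'"
    "r = (mor W' X' s', mor W' Y' f')" by (rule roofsE)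
  then show "r \<in> qarr X Y (sat (prod_mod X Y) (span W s f))"
    using r roof_rel_iff[OF W W'(1-5)] by (auto intro!: qarrI)
next
  fix r assume "r \<in> qarr X Y (sat (prod_mod X Y) (span W s f))"
  then obtain W' s' f' where "ob W'" "qiso W' X s'" "linear W' Y f'" "r = (mor W' X s', mor W' Y f')"
    "sat (prod_mod X Y) (span W' s' f') = sat (prod_mod X Y) (span W s f)" by (auto simp: qarr_def)
  then show "r \<in> roof_class mods tors_mods (mor W X s) (mor W Y f)"
    using roof_rel_iff[OF W, of W' X Y s' f'] W by simp
qed

end

section \<open>Composition, sums and identities of the quotient category in terms of
  relations\<close>

context gabriel_universe
begin

lemma span_id: "span X (\<lambda>x. x) f = graph X f"
  by (auto simp: span_def graph_def)

lemma qiso_id: "rmod X \<Longrightarrow> qiso X X (\<lambda>x. x)"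
  using subset_sat[of X "{\<zero>\<^bsub>X\<^esub>}"] subset_sat[of X "carrier X"]
  by (auto simp: qiso_def linear_id dense_def submodule_zero submodule_carrier)

lemma qiso_comp:
  assumes W: "rmod W" and X: "rmod X" and V: "rmod V" and u: "qiso V W u" and s: "qiso W X s"
  shows "qiso V X (\<lambda>z. s (u z))"
proof -
  have lu: "linear V W u" and ls: "linear W X s" using u s by (auto simp: qiso_def)
  have "z \<in> tors V" if z: "z \<in> carrier V" "s (u z) = \<zero>\<^bsub>X\<^esub>" for z
  proof -
    have "u z \<in> tors W" using s z linearD(1)[OF lu] by (simp add: qiso_def)
    then obtain I where I: "I \<in> F" "\<And>a. a \<in> I \<Longrightarrow> a \<in> carrier A" "\<And>a. a \<in> I \<Longrightarrow> u z \<triangleleft>\<^bsub>W\<^esub> a = \<zero>\<^bsub>W\<^esub>"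
      by (auto elim!: satE)
    show ?thesis
    proof (rule satI_local[OF V submodule_zero[OF V] z(1) I(1)])
      fix a assume a: "a \<in> I"
      then have "u (z \<triangleleft>\<^bsub>V\<^esub> a) = \<zero>\<^bsub>W\<^esub>" using z I linearD(3)[OF lu] by simp
      then show "z \<triangleleft>\<^bsub>V\<^esub> a \<in> tors V" using u z I(2)[OF a] V by (simp add: qiso_def)
    qed
  qed
  moreover have "dense X ((\<lambda>z. s (u z)) ` carrier V)"
  proof (rule dense_sat[of X "s ` carrier W"])
    show "s ` carrier W \<subseteq> sat X ((\<lambda>z. s (u z)) ` carrier V)"
    proof clarify
      fix w assume "w \<in> carrier W"
      then have "w \<in> sat W (u ` carrier V)" using u by (auto simp: qiso_def dense_def)
      then show "s w \<in> sat X ((\<lambda>z. s (u z)) ` carrier V)"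
        by (rule linear_sat[OF ls, rotated]) auto
    qed
    show "submodule A X ((\<lambda>z. s (u z)) ` carrier V)"
      by (rule submodule_image[OF linear_comp[OF lu ls] V X submodule_carrier[OF V]])
  qed (use s X in \<open>auto simp: qiso_def\<close>)
  ultimately show ?thesis using linear_comp[OF lu ls] by (simp add: qiso_def)
qed

text \<open>The pullback of f and t works: the kernel of u embeds into the torsion kernel of t, and
  an ideal moving f w into the image of t moves w into the image of u.\<close>

lemma ore_square:
  assumes W: "ob W" and W': "ob W'" and Y: "rmod Y" and f: "linear W Y f" and t: "qiso W' Y t"
  obtains V u v where "ob V" "qiso V W u" "linear V W' v" "\<forall>z\<in>carrier V. f (u z) = t (v z)"
proof -
  have lt: "linear W' Y t" using t by (auto simp: qiso_def)
  have r: "rmod W" "rmod W'" using W W' by auto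
  let ?G = "{(w, w'). w \<in> carrier W \<and> w' \<in> carrier W' \<and> f w = t w'}"
  have "submodule A (prod_mod W W') ?G"
    using r Y linearD[OF f] linearD[OF lt] linear_zero[OF f] linear_zero[OF lt]
    by (auto simp: rel_submodule_iff)
  from realize_relation[OF W W' this]
  obtain V u v where V: "ob V" "linear V W u" "linear V W' v" "span V u v = ?G"
    "\<forall>z\<in>carrier V. u z = \<zero>\<^bsub>W\<^esub> \<longrightarrow> v z = \<zero>\<^bsub>W'\<^esub> \<longrightarrow> z = \<zero>\<^bsub>V\<^esub>"
    .
  have "(u z, v z) \<in> ?G" if "z \<in> carrier V" for z
    unfolding V(4)[symmetric] using that by (auto simp: span_def)
  then have eqs: "f (u z) = t (v z)" if "z \<in> carrier V" for z
    using that by auto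
  have "z \<in> tors V" if z: "z \<in> carrier V" "u z = \<zero>\<^bsub>W\<^esub>" for z
  proof -
    have "t (v z) = \<zero>\<^bsub>Y\<^esub>" using eqs[OF z(1)] z(2) linear_zero[OF f r(1) Y] by simp
    then have "v z \<in> tors W'" using t z linearD(1)[OF V(3)] by (simp add: qiso_def)
    then obtain I where I: "I \<in> F" "\<And>a. a \<in> I \<Longrightarrow> a \<in> carrier A" "\<And>a. a \<in> I \<Longrightarrow> v z \<triangleleft>\<^bsub>W'\<^esub> a = \<zero>\<^bsub>W'\<^esub>"
      by (auto elim!: satE)
    show ?thesis
    proof (rule satI[OF z(1) I(1)])
      fix a assume a: "a \<in> I"
      have "z \<triangleleft>\<^bsub>V\<^esub> a = \<zero>\<^bsub>V\<^esub>"
        by (rule V(5)[rule_format]) (use a z V(1) I r linearD(3)[OF V(2)] linearD(3)[OF V(3)] in auto)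
      then show "z \<triangleleft>\<^bsub>V\<^esub> a \<in> {\<zero>\<^bsub>V\<^esub>}" by simp
    qed
  qed
  moreover have "dense W (u ` carrier V)"
    unfolding dense_def
  proof
    fix w assume w: "w \<in> carrier W"
    obtain I where I: "I \<in> F" "\<And>a. a \<in> I \<Longrightarrow> a \<in> carrier A" "\<And>a. a \<in> I \<Longrightarrow> f w \<triangleleft>\<^bsub>Y\<^esub> a \<in> t ` carrier W'"
      using denseE[of Y "t ` carrier W'" "f w"] t linearD(1)[OF f w] by (auto simp: qiso_def)
    show "w \<in> sat W (u ` carrier V)"
    proof (rule satI[OF w I(1)])
      fix a assume a: "a \<in> I"
      obtain w' where "w' \<in> carrier W'" "f w \<triangleleft>\<^bsub>Y\<^esub> a = t w'" using I(3)[OF a] by auto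
      then have "(w \<triangleleft>\<^bsub>W\<^esub> a, w') \<in> ?G" using w I(2)[OF a] r linearD(3)[OF f w] by simp
      then show "w \<triangleleft>\<^bsub>W\<^esub> a \<in> u ` carrier V" unfolding V(4)[symmetric] by (auto simp: span_def)
    qed
  qed
  ultimately have "qiso V W u" using V(2) by (simp add: qiso_def)
  then show ?thesis using that V(1,3) eqs by blast
qed

lemma qarrI_subset:
  assumes "ob W" "ob X" "ob Y" "qiso W X s" "linear W Y f" "qmor X Y G" "span W s f \<subseteq> G"
  shows "sat (prod_mod X Y) (span W s f) = G" "(mor W X s, mor W Y f) \<in> qarr X Y G"
proof -
  show "sat (prod_mod X Y) (span W s f) = G"
    using qmor_eq_sat[OF _ _ pre_mor_span] assms by auto
  then show "(mor W X s, mor W Y f) \<in> qarr X Y G" using assms by (intro qarrI) auto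
qed

lemma qarrE:
  assumes "r \<in> qarr X Y G" "qmor X Y G" "ob X" "ob Y"
  obtains W s f where "r = (mor W X s, mor W Y f)" "ob W" "qiso W X s" "linear W Y f" "span W s f \<subseteq> G"
proof -
  obtain W s f where W: "r = (mor W X s, mor W Y f)" "ob W" "qiso W X s" "linear W Y f"
    "sat (prod_mod X Y) (span W s f) = G" using assms by (auto simp: qarr_def)
  then show ?thesis
    using that[of W s f] pre_mor_subset_sat[OF _ _ pre_mor_span[OF _ _ _ W(3,4)]] assms by auto
qed

lemma qarr_nonempty:
  assumes X: "ob X" and Y: "ob Y" and G: "qmor X Y G"
  obtains W s f where "ob W" "qiso W X s" "linear W Y f" "span W s f = G"
    "(mor W X s, mor W Y f) \<in> qarr X Y G" "roof_class mods tors_mods (mor W X s) (mor W Y f) = qarr X Y G"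
proof -
  obtain W s f where W: "ob W" "qiso W X s" "linear W Y f" "span W s f = G"
    using realize_qmor[OF X Y qmor_pre[OF G]] .
  moreover have "sat (prod_mod X Y) G = G" using sat_qmor G X Y by blast
  ultimately show ?thesis
    using that[OF W] qarrI_subset(2)[OF W(1) X Y W(2,3) G] roof_class_eq[OF W(1) X Y W(2,3)] by simp
qed

lemma qarr_inject:
  assumes "ob X" "ob Y" "qmor X Y G" "qarr X Y G = qarr X Y H"
  shows "G = H"
  using qarr_nonempty[OF assms(1-3)] qarr_memD(7) assms(4) by metis

lemma Obj_quot: "Obj quot = {X. ob X}"
  by (simp add: quot_def serre_quotient_def mods_simps)

lemma Arr_quot: "Arr quot = {qarr X Y G | X Y G. ob X \<and> ob Y \<and> qmor X Y G}"
proof (intro equalityI subsetI)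
  fix \<Phi> assume "\<Phi> \<in> Arr quot"
  then obtain r where r: "r \<in> roofs mods tors_mods" "\<Phi> = roof_rel mods tors_mods `` {r}"
    by (auto simp: quot_def serre_quotient_def quotient_def)
  obtain W X Y s f where W: "ob W" "ob X" "ob Y" "qiso W X s" "linear W Y f" "r = (mor W X s, mor W Y f)"
    using roofsE[OF r(1)] .
  have "qmor X Y (sat (prod_mod X Y) (span W s f))"
    using W by (intro qmor_sat pre_mor_span) auto
  then show "\<Phi> \<in> {qarr X Y G | X Y G. ob X \<and> ob Y \<and> qmor X Y G}"
    using r(2) roof_class_eq[OF W(1-5)] W by blast
next
  fix \<Phi> assume "\<Phi> \<in> {qarr X Y G | X Y G. ob X \<and> ob Y \<and> qmor X Y G}"
  then obtain X Y G where X: "ob X" "ob Y" "qmor X Y G" "\<Phi> = qarr X Y G" by blast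
  obtain W s f where W: "ob W" "qiso W X s" "linear W Y f" "span W s f = G"
    "(mor W X s, mor W Y f) \<in> qarr X Y G" "roof_class mods tors_mods (mor W X s) (mor W Y f) = qarr X Y G"
    using qarr_nonempty[OF X(1-3)] .
  then show "\<Phi> \<in> Arr quot"
    using X roofsI[OF W(1) X(1,2) W(2,3)]
    by (auto simp: quot_def serre_quotient_def quotient_def)
qed

lemma
  assumes X: "ob X" "ob Y" "qmor X Y G"
  shows Dom_qarr [simp]: "Dom quot (qarr X Y G) = X" and Cod_qarr [simp]: "Cod quot (qarr X Y G) = Y"
proof -
  have "(SOME r. r \<in> qarr X Y G) \<in> qarr X Y G"
    using qarr_nonempty[OF X] someI_ex[of "\<lambda>r. r \<in> qarr X Y G"] by metis
  then obtain W s f where "(SOME r. r \<in> qarr X Y G) = (mor W X s, mor W Y f)"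
    by (rule qarrE[OF _ X(3,1,2)])
  then show "Dom quot (qarr X Y G) = X" "Cod quot (qarr X Y G) = Y"
    by (simp_all add: quot_def serre_quotient_def)
qed

lemma hom_quotI: "\<lbrakk>ob X; ob Y; qmor X Y G\<rbrakk> \<Longrightarrow> qarr X Y G \<in> hom_set quot X Y"
  by (auto simp: hom_set_def Arr_quot)

lemma hom_quotE:
  assumes "f \<in> hom_set quot X Y"
  obtains G where "ob X" "ob Y" "qmor X Y G" "f = qarr X Y G"
  using assms by (auto simp: hom_set_def Arr_quot)

lemma Union_eq_singleton: "\<lbrakk>x \<in> S; \<And>y. y \<in> S \<Longrightarrow> y = x\<rbrakk> \<Longrightarrow> \<Union>S = x"
  by blast

text \<open>The union defining the composite ranges over all ways to complete two roofs to a square.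
  Each of them gives a span inside G O H, hence the same class, and \<open>ore_square\<close> shows
  that there is at least one.\<close>

lemma Comp_quot:
  assumes X: "ob X" and Y: "ob Y" and Z: "ob Z" and G: "qmor X Y G" and H: "qmor Y Z H"
  shows "qarr Y Z H \<cdot>\<^bsub>quot\<^esub> qarr X Y G = qarr X Z (qcomp X Z G H)"
proof -
  have r: "rmod X" "rmod Y" "rmod Z" using X Y Z by auto
  note GH = qmor_comp[OF r G H]
  let ?P = "\<lambda>s f t g u v. (s, f) \<in> qarr X Y G \<and> (t, g) \<in> qarr Y Z H \<and> u \<in> Arr mods \<and> v \<in> Arr mods \<and>
    Dom mods u = Dom mods v \<and> Cod mods u = Dom mods f \<and> Cod mods v = Dom mods t \<and>
    f \<cdot>\<^bsub>mods\<^esub> u = t \<cdot>\<^bsub>mods\<^esub> v \<and> S_iso mods tors_mods u"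
  let ?S = "{roof_class mods tors_mods (s \<cdot>\<^bsub>mods\<^esub> u) (g \<cdot>\<^bsub>mods\<^esub> v) | s f t g u v. ?P s f t g u v}"
  have eq: "roof_class mods tors_mods (s \<cdot>\<^bsub>mods\<^esub> u) (g \<cdot>\<^bsub>mods\<^esub> v) = qarr X Z (qcomp X Z G H)"
    if P: "?P s f t g u v" for s f t g u v
  proof -
    obtain W s' f' where W: "s = mor W X s'" "f = mor W Y f'" "ob W" "qiso W X s'" "linear W Y f'"
      "span W s' f' \<subseteq> G" using P qarrE[OF _ G X Y, of "(s, f)"] by blast
    obtain W' t' g' where W': "t = mor W' Y t'" "g = mor W' Z g'" "ob W'" "qiso W' Y t'" "linear W' Z g'"
      "span W' t' g' \<subseteq> H" using P qarrE[OF _ H Y Z, of "(t, g)"] by blast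
    obtain V u' v' where V: "ob V" "linear V W u'" "linear V W' v'" "u = mor V W u'" "v = mor V W' v'"
      using P W(2) W'(1) by (auto elim!: ArrE)
    have ls: "linear W X s'" using W by (simp add: qiso_def)
    have e: "f' (u' z) = t' (v' z)" if "z \<in> carrier V" for z
      using P that unfolding W(2) W'(1) V(4,5) Comp_mor'[OF V(2)] Comp_mor'[OF V(3)] mor_eq_iff by simp
    have q: "qiso V X (\<lambda>z. s' (u' z))"
      using P V W r S_iso_iff[OF V(1) W(3) V(2)] by (intro qiso_comp[of W X V u' s']) auto
    note lg = linear_comp[OF V(3) W'(5)]
    have "span V (\<lambda>z. s' (u' z)) (\<lambda>z. g' (v' z)) \<subseteq> qcomp X Z G H"
    proof -
      have "span V (\<lambda>z. s' (u' z)) (\<lambda>z. g' (v' z)) \<subseteq> G O H"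
      proof (clarsimp simp: span_def)
        fix z assume z: "z \<in> carrier V"
        then have "(s' (u' z), f' (u' z)) \<in> G" "(t' (v' z), g' (v' z)) \<in> H"
          using W(6) W'(6) linearD(1)[OF V(2) z] linearD(1)[OF V(3) z] by (auto simp: span_def)
        then show "(s' (u' z), g' (v' z)) \<in> G O H" using e[OF z] by auto
      qed
      then show ?thesis using relcomp_subset_qcomp[OF r G H] by blast
    qed
    from qarrI_subset(1)[OF V(1) X Z q lg GH this] roof_class_eq[OF V(1) X Z q lg]
    show ?thesis using V W(1) W'(2) by simp
  qed
  have "\<exists>s f t g u v. ?P s f t g u v"
  proof -
    obtain W s f where W: "ob W" "qiso W X s" "linear W Y f" "span W s f = G"
      "(mor W X s, mor W Y f) \<in> qarr X Y G" "roof_class mods tors_mods (mor W X s) (mor W Y f) = qarr X Y G"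
      using qarr_nonempty[OF X Y G] .
    obtain W' t g where W': "ob W'" "qiso W' Y t" "linear W' Z g" "span W' t g = H"
      "(mor W' Y t, mor W' Z g) \<in> qarr Y Z H" "roof_class mods tors_mods (mor W' Y t) (mor W' Z g) = qarr Y Z H"
      using qarr_nonempty[OF Y Z H] .
    obtain V u v where V: "ob V" "qiso V W u" "linear V W' v" "\<forall>z\<in>carrier V. f (u z) = t (v z)"
      using ore_square[OF W(1) W'(1) r(2) W(3) W'(2)] .
    have lu: "linear V W u" using V by (simp add: qiso_def)
    have "?P (mor W X s) (mor W Y f) (mor W' Y t) (mor W' Z g) (mor V W u) (mor V W' v)"
      using V W W' lu S_iso_iff[OF V(1) W(1) lu] by (auto simp: mor_Arr mor_eq_iff)
    then show ?thesis by blast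
  qed
  then have "\<Union>?S = qarr X Z (qcomp X Z G H)"
    using eq by (intro Union_eq_singleton) blast+
  then show ?thesis by (simp add: quot_def serre_quotient_def)
qed

text \<open>Again all choices give the same class, since their spans lie inside
  \<open>radd Y G H\<close>. A common denominator exists: pull one denominator back along the
  other.\<close>

lemma Add_quot:
  assumes X: "ob X" and Y: "ob Y" and G: "qmor X Y G" and H: "qmor X Y H"
  shows "Add quot (qarr X Y G) (qarr X Y H) = qarr X Y (qadd X Y G H)"
proof -
  have r: "rmod X" "rmod Y" using X Y by auto
  note GH = qmor_add[OF r G H]
  let ?S = "{roof_class mods tors_mods s (Add mods f g) | s f g. (s, f) \<in> qarr X Y G \<and> (s, g) \<in> qarr X Y H}"
  have eq: "roof_class mods tors_mods s (Add mods f g) = qarr X Y (qadd X Y G H)"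
    if P: "(s, f) \<in> qarr X Y G" "(s, g) \<in> qarr X Y H" for s f g
  proof -
    obtain W s' f' where W: "s = mor W X s'" "f = mor W Y f'" "ob W" "qiso W X s'" "linear W Y f'"
      "span W s' f' \<subseteq> G" using P qarrE[OF _ G X Y, of "(s, f)"] by blast
    obtain W' t' g' where W': "s = mor W' X t'" "g = mor W' Y g'" "ob W'" "qiso W' X t'" "linear W' Y g'"
      "span W' t' g' \<subseteq> H" using P qarrE[OF _ H X Y, of "(s, g)"] by blast
    have WW: "W' = W" and st: "\<And>w. w \<in> carrier W \<Longrightarrow> t' w = s' w" using W(1) W'(1) by (auto simp: mor_eq_iff)
    have lin: "linear W Y (\<lambda>w. f' w \<oplus>\<^bsub>Y\<^esub> g' w)" using linear_add[OF W(5) _ r(2)] W'(5) WW by simp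
    have "span W s' (\<lambda>w. f' w \<oplus>\<^bsub>Y\<^esub> g' w) \<subseteq> radd Y G H"
    proof (clarsimp simp: span_def)
      fix w assume "w \<in> carrier W"
      then have "(s' w, f' w) \<in> G" "(s' w, g' w) \<in> H"
        using W(6) W'(6) WW st by (force simp: span_def)+
      then show "(s' w, f' w \<oplus>\<^bsub>Y\<^esub> g' w) \<in> radd Y G H" by (rule raddI)
    qed
    then have "span W s' (\<lambda>w. f' w \<oplus>\<^bsub>Y\<^esub> g' w) \<subseteq> qadd X Y G H"
      using radd_subset_qadd[OF r G H] by blast
    from qarrI_subset(1)[OF W(3) X Y W(4) lin GH this] roof_class_eq[OF W(3) X Y W(4) lin]
    show ?thesis using W(1,2) W'(2) WW by (simp add: Add_mor)
  qed
  have "\<exists>s f g. (s, f) \<in> qarr X Y G \<and> (s, g) \<in> qarr X Y H"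
  proof -
    obtain W s f where W: "ob W" "qiso W X s" "linear W Y f" "span W s f = G"
      "(mor W X s, mor W Y f) \<in> qarr X Y G" "roof_class mods tors_mods (mor W X s) (mor W Y f) = qarr X Y G"
      using qarr_nonempty[OF X Y G] .
    obtain W' t g where W': "ob W'" "qiso W' X t" "linear W' Y g" "span W' t g = H"
      "(mor W' X t, mor W' Y g) \<in> qarr X Y H" "roof_class mods tors_mods (mor W' X t) (mor W' Y g) = qarr X Y H"
      using qarr_nonempty[OF X Y H] .
    have ls: "linear W X s" using W by (simp add: qiso_def)
    obtain V u v where V: "ob V" "qiso V W u" "linear V W' v" "\<forall>z\<in>carrier V. s (u z) = t (v z)"
      using ore_square[OF W(1) W'(1) r(1) ls W'(2)] .
    have lu: "linear V W u" using V by (simp add: qiso_def)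
    have q: "qiso V X (\<lambda>z. s (u z))" using V W r by (intro qiso_comp[of W X V u s]) auto
    have "span V (\<lambda>z. s (u z)) (\<lambda>z. f (u z)) \<subseteq> G"
      using linearD(1)[OF lu] unfolding W(4)[symmetric] by (auto simp: span_def)
    then have "(mor V X (\<lambda>z. s (u z)), mor V Y (\<lambda>z. f (u z))) \<in> qarr X Y G"
      by (intro qarrI_subset(2) V X Y q G linear_comp[OF lu W(3)])
    moreover have "span V (\<lambda>z. s (u z)) (\<lambda>z. g (v z)) \<subseteq> H"
      using linearD(1)[OF V(3)] V(4) unfolding W'(4)[symmetric] by (auto simp: span_def)
    then have "(mor V X (\<lambda>z. s (u z)), mor V Y (\<lambda>z. g (v z))) \<in> qarr X Y H"
      by (intro qarrI_subset(2) V X Y q H linear_comp[OF V(3) W'(3)])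
    ultimately show ?thesis by blast
  qed
  then have "\<Union>?S = qarr X Y (qadd X Y G H)"
    using eq by (intro Union_eq_singleton) blast+
  then show ?thesis by (simp add: quot_def serre_quotient_def)
qed

lemma roof_class_id:
  assumes X: "ob X" and Y: "ob Y" and h: "linear X Y h"
  shows "roof_class mods tors_mods (Ident mods X) (mor X Y h) = qarr X Y (qgraph X Y h)"
  using roof_class_eq[OF X X Y qiso_id h] X by (simp add: mods_simps(4) span_id)

lemma Ident_quot: "ob X \<Longrightarrow> Ident quot X = qarr X X (qgraph X X (\<lambda>x. x))"
  using roof_class_id[of X X "\<lambda>x. x"] by (simp add: quot_def serre_quotient_def mods_simps(4) linear_id)

lemma Zero_quot: "\<lbrakk>ob X; ob Y\<rbrakk> \<Longrightarrow> Zero quot X Y = qarr X Y (qgraph X Y (\<lambda>x. \<zero>\<^bsub>Y\<^esub>))"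
  using roof_class_id[of X Y "\<lambda>x. \<zero>\<^bsub>Y\<^esub>"]
  by (simp add: quot_def serre_quotient_def mods_simps(5) linear_const_zero)

definition pi_functor where "pi_functor = quotient_functor mods tors_mods"

lemma pi_obj [simp]: "obj_map pi_functor = id"
  by (simp add: pi_functor_def quotient_functor_def)

lemma pi_arr: "\<lbrakk>ob X; ob Y; linear X Y h\<rbrakk> \<Longrightarrow> arr_map pi_functor (mor X Y h) = qarr X Y (qgraph X Y h)"
  by (simp add: pi_functor_def quotient_functor_def roof_class_id)

lemma category_quot: "category quot"
proof (unfold_locales, goal_cases)
  case (3 X) then show ?case by (simp add: Obj_quot Ident_quot hom_quotI qmor_graph linear_id)
next
  case (4 f X Y g Z) then show ?case
    by (elim hom_quotE) (simp add: Comp_quot hom_quotI qmor_comp[of X Y Z])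
next
  case (5 f X Y) then show ?case
    by (elim hom_quotE) (simp add: Ident_quot Comp_quot qmor_graph linear_id qcomp_id_right)
next
  case (6 f X Y) then show ?case
    by (elim hom_quotE) (simp add: Ident_quot Comp_quot qmor_graph linear_id qcomp_id_left)
next
  case (7 f W X g Y h Z)
  then show ?case
    by (elim hom_quotE)
      (simp add: Comp_quot qmor_comp[of W X Y] qmor_comp[of X Y Z] qcomp_assoc[of W X Y Z])
qed (auto simp: Obj_quot Arr_quot)

lemma preadditive_quot: "preadditive_category quot"
proof (intro preadditive_category.intro category_quot preadditive_category_axioms.intro)
  fix X Y assume "X \<in> Obj quot" "Y \<in> Obj quot"
  then have X: "ob X" and Y: "ob Y" by (auto simp: Obj_quot)
  interpret H: abelian_group "hom_q X Y" using hom_q_group X Y by auto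
  have H: "carrier (hom_q X Y) = {G. qmor X Y G}" "add (hom_q X Y) = qadd X Y"
    "zero (hom_q X Y) = qgraph X Y (\<lambda>_. \<zero>\<^bsub>Y\<^esub>)" by (simp_all add: hom_q_def)
  note Hs = H.a_assoc H.a_comm H.l_zero H.a_closed H.zero_closed
  show "abelian_group (hom_module quot X Y)"
  proof (rule abelian_groupI, goal_cases)
    case (6 f)
    then obtain G where G: "qmor X Y G" "f = qarr X Y G" by (auto simp: hom_module_def elim: hom_quotE)
    then obtain G' where "qmor X Y G'" "qadd X Y G' G = qgraph X Y (\<lambda>_. \<zero>\<^bsub>Y\<^esub>)"
      using H.l_neg[of G] H.a_inv_closed[of G] unfolding H by auto
    then show ?case
      using G X Y by (auto simp: hom_module_def Zero_quot Add_quot hom_quotI intro!: bexI[of _ "qarr X Y G'"])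
  qed (use Hs[unfolded H mem_Collect_eq] X Y in
      \<open>auto simp: hom_module_def Zero_quot Add_quot hom_quotI elim!: hom_quotE\<close>)
next
  fix f X Y f' g Z assume "f \<in> hom_set quot X Y" "f' \<in> hom_set quot X Y" "g \<in> hom_set quot Y Z"
  then show "g \<cdot>\<^bsub>quot\<^esub> Add quot f f' = Add quot (g \<cdot>\<^bsub>quot\<^esub> f) (g \<cdot>\<^bsub>quot\<^esub> f')"
    by (elim hom_quotE) (simp add: Add_quot Comp_quot qmor_add qmor_comp[of X Y Z] qcomp_qadd_left[of X Y Z])
next
  fix f X Y g Z g' assume "f \<in> hom_set quot X Y" "g \<in> hom_set quot Y Z" "g' \<in> hom_set quot Y Z"
  then show "Add quot g g' \<cdot>\<^bsub>quot\<^esub> f = Add quot (g \<cdot>\<^bsub>quot\<^esub> f) (g' \<cdot>\<^bsub>quot\<^esub> f)"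
    by (elim hom_quotE) (simp add: Add_quot Comp_quot qmor_add qmor_comp[of X Y Z] qcomp_qadd_right[of X Y Z])
qed

lemma pi_is_functor: "is_functor mods quot pi_functor"
proof (rule is_functorI[OF category_mods category_quot], goal_cases)
  case (2 X) then show ?case by (simp add: mods_simps pi_arr linear_id Ident_quot)
next
  case (3 f X Y) then show ?case by (elim homE) (simp add: pi_arr hom_quotI qmor_graph)
next
  case (4 f g X Y Z) then show ?case
    by (elim homE) (simp add: pi_arr Comp_quot qmor_graph linear_comp[of X Y _ Z] qcomp_qgraph_qgraph[of X Y Z])
qed (auto simp: mods_simps Obj_quot)

lemma is_iso_qarr:
  assumes X: "ob X" and Y: "ob Y" and G: "pre_mor X Y G" "pre_mor Y X (G\<inverse>)"
  shows "is_iso quot (qarr X Y (sat (prod_mod X Y) G))"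
proof (rule is_isoI)
  have r: "rmod X" "rmod Y" using X Y by auto
  show "qarr X Y (sat (prod_mod X Y) G) \<in> hom_set quot X Y"
    "qarr Y X (sat (prod_mod Y X) (G\<inverse>)) \<in> hom_set quot Y X"
    using X Y r G by (auto intro!: hom_quotI qmor_sat)
  show "qarr Y X (sat (prod_mod Y X) (G\<inverse>)) \<cdot>\<^bsub>quot\<^esub> qarr X Y (sat (prod_mod X Y) G) = Ident quot X"
    using X Y r G by (simp add: Comp_quot qmor_sat Ident_quot qmor_converse)
  show "qarr X Y (sat (prod_mod X Y) G) \<cdot>\<^bsub>quot\<^esub> qarr Y X (sat (prod_mod Y X) (G\<inverse>)) = Ident quot Y"
    using X Y r qmor_converse[of Y X "G\<inverse>"] G by (simp add: Comp_quot qmor_sat Ident_quot)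
qed

end

subsection \<open>Finitely generated modules over a right noetherian ring\<close>

context right_modules
begin

definition gen :: "('a, 'x) rmodule \<Rightarrow> 'x set \<Rightarrow> 'x set" where
  "gen X S = \<Inter>{N. submodule R X N \<and> S \<subseteq> N}"

lemma gen_least: "\<lbrakk>submodule R X N; S \<subseteq> N\<rbrakk> \<Longrightarrow> gen X S \<subseteq> N"
  by (auto simp: gen_def)

lemma gen_superset: "S \<subseteq> gen X S"
  by (auto simp: gen_def)

lemma submodule_gen:
  assumes X: "rmod X" and S: "S \<subseteq> carrier X"
  shows "submodule R X (gen X S)"
proof (rule submoduleI[OF X])
  show "gen X S \<subseteq> carrier X" by (rule gen_least[OF submodule_carrier[OF X] S])
qed (auto simp: gen_def dest: submoduleD[OF X])

lemma fin_gen_iff: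
  assumes X: "rmod X"
  shows "fin_gen R X \<longleftrightarrow> (\<exists>S. finite S \<and> S \<subseteq> carrier X \<and> gen X S = carrier X)"
proof -
  have "(\<forall>N. submodule R X N \<and> S \<subseteq> N \<longrightarrow> N = carrier X) \<longleftrightarrow> gen X S = carrier X"
    if S: "S \<subseteq> carrier X" for S
  proof
    assume "\<forall>N. submodule R X N \<and> S \<subseteq> N \<longrightarrow> N = carrier X"
    then show "gen X S = carrier X" using submodule_gen[OF X S] gen_superset[of S X] by blast
  next
    assume g: "gen X S = carrier X"
    show "\<forall>N. submodule R X N \<and> S \<subseteq> N \<longrightarrow> N = carrier X"
    proof (intro allI impI)
      fix N assume N: "submodule R X N \<and> S \<subseteq> N"
      then have "carrier X \<subseteq> N" using gen_least[of X N S] g by simp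
      moreover have "N \<subseteq> carrier X" using N by (simp add: submodule_iff[OF X])
      ultimately show "N = carrier X" by simp
    qed
  qed
  then show ?thesis by (simp only: fin_gen_def cong: conj_cong)
qed

lemma gen_linear_image:
  assumes h: "linear X Y h" and X: "rmod X" and Y: "rmod Y" and S: "S \<subseteq> carrier X"
  shows "h ` gen X S = gen Y (h ` S)"
proof
  have hS: "h ` S \<subseteq> carrier Y" using linearD(1)[OF h] S by auto
  have "gen X S \<subseteq> {x \<in> carrier X. h x \<in> gen Y (h ` S)}"
    by (rule gen_least[OF submodule_vimage[OF h X Y submodule_gen[OF Y hS]]])
      (use S gen_superset[of "h ` S" Y] in auto)
  then show "h ` gen X S \<subseteq> gen Y (h ` S)" by auto
  show "gen Y (h ` S) \<subseteq> h ` gen X S"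
    by (rule gen_least[OF submodule_image[OF h X Y submodule_gen[OF X S]]])
      (use gen_superset[of S X] in auto)
qed

lemma gen_empty: "rmod X \<Longrightarrow> gen X {} = {\<zero>\<^bsub>X\<^esub>}"
  using submodule_gen[of X "{}"] gen_least[OF submodule_zero, of X "{}"] submoduleD(2)[of X "gen X {}"] by auto

lemma gen_insert:
  assumes X: "rmod X" and S: "S \<subseteq> carrier X" and s: "s \<in> carrier X"
  shows "gen X (insert s S) = {(s \<triangleleft>\<^bsub>X\<^esub> a) \<oplus>\<^bsub>X\<^esub> m | a m. a \<in> carrier R \<and> m \<in> gen X S}" (is "_ = ?N")
proof
  note G = submodule_gen[OF X S]
  note GD = submoduleD[OF X G]
  have "submodule R X ?N"
  proof (rule submoduleI[OF X])
    show "?N \<subseteq> carrier X" using GD(1) s X by auto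
    have "\<zero>\<^bsub>X\<^esub> = (s \<triangleleft>\<^bsub>X\<^esub> \<zero>) \<oplus>\<^bsub>X\<^esub> \<zero>\<^bsub>X\<^esub>" using X s by simp
    then show "\<zero>\<^bsub>X\<^esub> \<in> ?N" using GD(2) by blast
  next
    fix x y assume "x \<in> ?N" "y \<in> ?N"
    then obtain a m b n where *: "x = (s \<triangleleft>\<^bsub>X\<^esub> a) \<oplus>\<^bsub>X\<^esub> m" "a \<in> carrier R" "m \<in> gen X S"
      "y = (s \<triangleleft>\<^bsub>X\<^esub> b) \<oplus>\<^bsub>X\<^esub> n" "b \<in> carrier R" "n \<in> gen X S" by blast
    have "x \<oplus>\<^bsub>X\<^esub> y = (s \<triangleleft>\<^bsub>X\<^esub> (a \<oplus> b)) \<oplus>\<^bsub>X\<^esub> (m \<oplus>\<^bsub>X\<^esub> n)"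
      using * s GD(1)[OF *(3)] GD(1)[OF *(6)] by (simp add: X rmod_act[OF X] rmod_ac[OF X])
    then show "x \<oplus>\<^bsub>X\<^esub> y \<in> ?N" using * GD(3) by blast
  next
    fix x b assume "x \<in> ?N" and b: "b \<in> carrier R"
    then obtain a m where *: "x = (s \<triangleleft>\<^bsub>X\<^esub> a) \<oplus>\<^bsub>X\<^esub> m" "a \<in> carrier R" "m \<in> gen X S" by blast
    have "x \<triangleleft>\<^bsub>X\<^esub> b = (s \<triangleleft>\<^bsub>X\<^esub> (a \<otimes> b)) \<oplus>\<^bsub>X\<^esub> (m \<triangleleft>\<^bsub>X\<^esub> b)"
      using * s b GD(1)[OF *(3)] by (simp add: X rmod_act[OF X])
    then show "x \<triangleleft>\<^bsub>X\<^esub> b \<in> ?N" using * b GD(4) by blast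
  qed
  moreover have "insert s S \<subseteq> ?N"
  proof
    fix x assume "x \<in> insert s S"
    then consider "x = s" | "x \<in> S" by auto
    then show "x \<in> ?N"
    proof cases
      case 1
      then have "x = (s \<triangleleft>\<^bsub>X\<^esub> \<one>) \<oplus>\<^bsub>X\<^esub> \<zero>\<^bsub>X\<^esub>" using X s by simp
      then show ?thesis using GD(2) by blast
    next
      case 2
      then have "x = (s \<triangleleft>\<^bsub>X\<^esub> \<zero>) \<oplus>\<^bsub>X\<^esub> x" using X s S by auto
      moreover have "x \<in> gen X S" using 2 gen_superset[of S X] by auto
      ultimately show ?thesis by (intro CollectI exI[of _ \<zero>] exI[of _ x]) auto
    qed
  qed
  ultimately show "gen X (insert s S) \<subseteq> ?N" by (rule gen_least)
  have i: "submodule R X (gen X (insert s S))" by (rule submodule_gen[OF X]) (use S s in auto)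
  have "gen X S \<subseteq> gen X (insert s S)"
    by (rule gen_least[OF i order_trans[OF subset_insertI gen_superset]])
  moreover have "s \<in> gen X (insert s S)" using gen_superset[of "insert s S" X] by simp
  ultimately show "?N \<subseteq> gen X (insert s S)" using submoduleD(3,4)[OF X i] by (auto simp: subset_iff)
qed

lemma noetherian_ideal:
  assumes R: "right_noetherian R" and I: "submodule R (regular_module R) I"
  obtains T where "finite T" "T \<subseteq> I" "I = gen (regular_module R) T"
proof -
  have "fin_gen R ((regular_module R)\<lparr>carrier := I\<rparr>)"
    using R I by (simp add: right_noetherian_def right_ideal_def)
  then obtain T where T: "finite T" "T \<subseteq> I"
    "\<And>N. submodule R ((regular_module R)\<lparr>carrier := I\<rparr>) N \<Longrightarrow> T \<subseteq> N \<Longrightarrow> N = I"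
    by (auto simp: fin_gen_def)
  have TR: "T \<subseteq> carrier (regular_module R)" using T(2) submoduleD(1)[OF rmod_regular I] by auto
  have "submodule R ((regular_module R)\<lparr>carrier := I\<rparr>) (gen (regular_module R) T)"
    by (subst submodule_restrict_iff[OF rmod_regular I])
      (use submodule_gen[OF rmod_regular TR] gen_least[OF I T(2)] in simp)
  from T(3)[OF this gen_superset] show ?thesis using that[OF T(1,2)] by simp
qed

text \<open>Induction on the number of generators. The possible coefficients of s in elements of N
  form a right ideal, which is finitely generated; lifts of its generators to N, together with
  generators of the intersection of N with \<open>gen X S\<close>, generate N.\<close>

lemma noetherian_submodule:
  assumes R: "right_noetherian R" and X: "rmod X" and S: "finite S" "S \<subseteq> carrier X"
    and N: "submodule R X N" "N \<subseteq> gen X S"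
  shows "\<exists>T. finite T \<and> T \<subseteq> N \<and> N = gen X T"
  using S N
proof (induction S arbitrary: N rule: finite_induct)
  case empty
  then have "N = {\<zero>\<^bsub>X\<^esub>}" using submoduleD(2)[OF X empty(2)] gen_empty[OF X] by auto
  then show ?case using gen_empty[OF X] by (intro exI[of _ "{}"]) auto
next
  case (insert s S)
  have sX: "s \<in> carrier X" and SX: "S \<subseteq> carrier X" using insert by auto
  note G = submodule_gen[OF X SX]
  note ND = submoduleD[OF X insert.prems(2)] and GD = submoduleD[OF X G]
  obtain T where T: "finite T" "T \<subseteq> N \<inter> gen X S" "N \<inter> gen X S = gen X T"
    using insert.IH[OF SX submodule_Int[OF X insert.prems(2) G]] by auto
  \<comment> \<open>The coefficient ideal is defined for any submodule because it is compared for
    two of them: N and the candidate \<open>gen X ?T\<close>.\<close>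
  define J where "J N' = {a \<in> carrier R. \<exists>n\<in>N'. \<exists>m\<in>gen X S. n = (s \<triangleleft>\<^bsub>X\<^esub> a) \<oplus>\<^bsub>X\<^esub> m}" for N'
  have J: "submodule R (regular_module R) (J N')" if N': "submodule R X N'" for N'
  proof (rule submoduleI[OF rmod_regular])
    note N'D = submoduleD[OF X N']
    show "J N' \<subseteq> carrier (regular_module R)" by (auto simp: J_def)
    have "\<zero>\<^bsub>X\<^esub> = (s \<triangleleft>\<^bsub>X\<^esub> \<zero>) \<oplus>\<^bsub>X\<^esub> \<zero>\<^bsub>X\<^esub>" using X sX by simp
    then show "\<zero>\<^bsub>regular_module R\<^esub> \<in> J N'" using N'D(2) GD(2) by (auto simp: J_def)
  next
    fix a b assume "a \<in> J N'" "b \<in> J N'"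
    then obtain m n where *: "a \<in> carrier R" "b \<in> carrier R" "m \<in> gen X S" "n \<in> gen X S"
      "(s \<triangleleft>\<^bsub>X\<^esub> a) \<oplus>\<^bsub>X\<^esub> m \<in> N'" "(s \<triangleleft>\<^bsub>X\<^esub> b) \<oplus>\<^bsub>X\<^esub> n \<in> N'" by (auto simp: J_def)
    have "((s \<triangleleft>\<^bsub>X\<^esub> a) \<oplus>\<^bsub>X\<^esub> m) \<oplus>\<^bsub>X\<^esub> ((s \<triangleleft>\<^bsub>X\<^esub> b) \<oplus>\<^bsub>X\<^esub> n) = (s \<triangleleft>\<^bsub>X\<^esub> (a \<oplus> b)) \<oplus>\<^bsub>X\<^esub> (m \<oplus>\<^bsub>X\<^esub> n)"
      using * sX GD(1)[OF *(3)] GD(1)[OF *(4)] by (simp add: X rmod_act[OF X] rmod_ac[OF X])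
    then have "(s \<triangleleft>\<^bsub>X\<^esub> (a \<oplus> b)) \<oplus>\<^bsub>X\<^esub> (m \<oplus>\<^bsub>X\<^esub> n) \<in> N'"
      using submoduleD(3)[OF X N' *(5,6)] by simp
    then show "a \<oplus>\<^bsub>regular_module R\<^esub> b \<in> J N'" using *(1,2) GD(3)[OF *(3,4)] by (auto simp: J_def)
  next
    fix a b assume "a \<in> J N'" and b: "b \<in> carrier R"
    then obtain m where *: "a \<in> carrier R" "m \<in> gen X S" "(s \<triangleleft>\<^bsub>X\<^esub> a) \<oplus>\<^bsub>X\<^esub> m \<in> N'" by (auto simp: J_def)
    have "((s \<triangleleft>\<^bsub>X\<^esub> a) \<oplus>\<^bsub>X\<^esub> m) \<triangleleft>\<^bsub>X\<^esub> b = (s \<triangleleft>\<^bsub>X\<^esub> (a \<otimes> b)) \<oplus>\<^bsub>X\<^esub> (m \<triangleleft>\<^bsub>X\<^esub> b)"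
      using * sX b GD(1)[OF *(2)] by (simp add: X rmod_act[OF X])
    then have "(s \<triangleleft>\<^bsub>X\<^esub> (a \<otimes> b)) \<oplus>\<^bsub>X\<^esub> (m \<triangleleft>\<^bsub>X\<^esub> b) \<in> N'"
      using submoduleD(4)[OF X N' *(3) b] by simp
    then show "a \<triangleleft>\<^bsub>regular_module R\<^esub> b \<in> J N'" using *(1) b GD(4)[OF *(2) b] by (auto simp: J_def)
  qed
  obtain I where I: "finite I" "I \<subseteq> J N" "J N = gen (regular_module R) I"
    using noetherian_ideal[OF R J[OF insert.prems(2)]] .
  have "\<forall>a\<in>I. \<exists>n\<in>N. \<exists>m\<in>gen X S. n = (s \<triangleleft>\<^bsub>X\<^esub> a) \<oplus>\<^bsub>X\<^esub> m" using I(2) by (auto simp: J_def)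
  then obtain \<nu> where \<nu>: "\<And>a. a \<in> I \<Longrightarrow> \<nu> a \<in> N \<and> (\<exists>m\<in>gen X S. \<nu> a = (s \<triangleleft>\<^bsub>X\<^esub> a) \<oplus>\<^bsub>X\<^esub> m)"
    by metis
  let ?T = "T \<union> \<nu> ` I"
  have TN: "?T \<subseteq> N" using T(2) \<nu> by auto
  then have TX: "?T \<subseteq> carrier X" using ND(1) by auto
  note gT = submodule_gen[OF X TX]
  have "N \<subseteq> gen X ?T"
  proof
    fix n assume n: "n \<in> N"
    then obtain a m where am: "n = (s \<triangleleft>\<^bsub>X\<^esub> a) \<oplus>\<^bsub>X\<^esub> m" "a \<in> carrier R" "m \<in> gen X S"
      using insert.prems(3) gen_insert[OF X SX sX] by auto
    have "I \<subseteq> J (gen X ?T)"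
    proof
      fix b assume b: "b \<in> I"
      then have "\<nu> b \<in> gen X ?T" "b \<in> carrier R" using gen_superset[of ?T X] I(2) by (auto simp: J_def)
      then show "b \<in> J (gen X ?T)" using \<nu>[OF b] unfolding J_def by blast
    qed
    then have "J N \<subseteq> J (gen X ?T)" unfolding I(3) by (rule gen_least[OF J[OF gT]])
    moreover have "a \<in> J N" using am n by (auto simp: J_def)
    ultimately have "a \<in> J (gen X ?T)" by blast
    then obtain n' m' where n': "n' \<in> gen X ?T" "m' \<in> gen X S" "n' = (s \<triangleleft>\<^bsub>X\<^esub> a) \<oplus>\<^bsub>X\<^esub> m'"
      by (auto simp: J_def)
    have c: "m \<in> carrier X" "m' \<in> carrier X" "n' \<in> carrier X" "n \<in> carrier X"
      using GD(1) am n' submoduleD(1)[OF X gT n'(1)] ND(1)[OF n] by auto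
    \<comment> \<open>n and n' have the same coefficient at s, so their difference lies in
      \<open>gen X S\<close> and in N, where T generates.\<close>
    let ?d = "m \<oplus>\<^bsub>X\<^esub> (\<ominus>\<^bsub>X\<^esub> m')"
    have "m' \<oplus>\<^bsub>X\<^esub> ?d = m" using c rmod_ac(2)[OF X, of m' ?d] by (simp add: X)
    then have e: "n = n' \<oplus>\<^bsub>X\<^esub> ?d"
      using am(1,2) n'(3) c sX by (simp add: X rmod_ac(1)[OF X])
    have "n' \<in> N" using gen_least[OF insert.prems(2) TN] n'(1) by auto
    then have "(\<ominus>\<^bsub>X\<^esub> n') \<oplus>\<^bsub>X\<^esub> n \<in> N" by (intro ND(3) submodule_neg[OF X insert.prems(2)] n)
    moreover have "(\<ominus>\<^bsub>X\<^esub> n') \<oplus>\<^bsub>X\<^esub> n = ?d" unfolding e using c by (simp add: X rmod_ac(1)[OF X, symmetric])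
    moreover have "?d \<in> gen X S" by (intro submodule_diff[OF X G] am n')
    ultimately have "?d \<in> gen X T" using T(3) by auto
    moreover have "gen X T \<subseteq> gen X ?T" by (rule gen_least[OF gT order_trans[OF Un_upper1 gen_superset]])
    ultimately show "n \<in> gen X ?T" unfolding e using submoduleD(3)[OF X gT n'(1)] by auto
  qed
  moreover have "gen X ?T \<subseteq> N" by (rule gen_least[OF insert.prems(2) TN])
  ultimately show ?case using T(1) I(1) TN by (intro exI[of _ ?T]) auto
qed

lemma fin_gen_epi:
  assumes X: "rmod X" and Y: "rmod Y" and h: "linear X Y h" "h ` carrier X = carrier Y" and fg: "fin_gen R X"
  shows "fin_gen R Y"
proof -
  obtain S where S: "finite S" "S \<subseteq> carrier X" "gen X S = carrier X" using fg fin_gen_iff[OF X] by auto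
  then have "h ` S \<subseteq> carrier Y" using linearD(1)[OF h(1)] by auto
  with S show ?thesis
    unfolding fin_gen_iff[OF Y] using gen_linear_image[OF h(1) X Y, of S] h
    by (intro exI[of _ "h ` S"]) auto
qed

lemma fin_gen_mono:
  assumes R: "right_noetherian R" and X: "rmod X" and Y: "rmod Y" and h: "linear X Y h" "inj_on h (carrier X)"
    and fg: "fin_gen R Y"
  shows "fin_gen R X"
proof -
  obtain S where S: "finite S" "S \<subseteq> carrier Y" "gen Y S = carrier Y" using fg fin_gen_iff[OF Y] by auto
  have sub: "submodule R Y (h ` carrier X)" by (rule submodule_image[OF h(1) X Y submodule_carrier[OF X]])
  then obtain T where T: "finite T" "T \<subseteq> h ` carrier X" "h ` carrier X = gen Y T"
    using noetherian_submodule[OF R Y S(1,2) sub] S(3) submoduleD(1)[OF Y sub] by blast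
  then obtain T' where T': "T' \<subseteq> carrier X" "finite T'" "T = h ` T'" by (meson finite_subset_image)
  have "gen X T' \<subseteq> carrier X" by (rule gen_least[OF submodule_carrier[OF X] T'(1)])
  moreover have "h ` gen X T' = h ` carrier X" using T(3) T' gen_linear_image[OF h(1) X Y T'(1)] by simp
  ultimately have "gen X T' = carrier X" using h(2) by (simp add: inj_on_image_eq_iff)
  then show ?thesis using T' fin_gen_iff[OF X] by auto
qed

lemma fin_gen_prod:
  assumes X: "rmod X" and Y: "rmod Y" and fg: "fin_gen R X" "fin_gen R Y"
  shows "fin_gen R (prod_mod X Y)"
proof -
  obtain S where S: "finite S" "S \<subseteq> carrier X" "gen X S = carrier X" using fg fin_gen_iff[OF X] by auto
  obtain T where T: "finite T" "T \<subseteq> carrier Y" "gen Y T = carrier Y" using fg fin_gen_iff[OF Y] by auto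
  note P = rmod_prod[OF X Y]
  let ?U = "(\<lambda>x. (x, \<zero>\<^bsub>Y\<^esub>)) ` S \<union> (\<lambda>y. (\<zero>\<^bsub>X\<^esub>, y)) ` T"
  have U: "?U \<subseteq> carrier (prod_mod X Y)" using S T X Y by auto
  note g = submodule_gen[OF P U]
  have lin: "linear X (prod_mod X Y) (\<lambda>x. (x, \<zero>\<^bsub>Y\<^esub>))" "linear Y (prod_mod X Y) (\<lambda>y. (\<zero>\<^bsub>X\<^esub>, y))"
    using X Y by (auto simp: linear_def)
  have "(\<lambda>x. (x, \<zero>\<^bsub>Y\<^esub>)) ` carrier X \<subseteq> gen (prod_mod X Y) ?U"
    unfolding S(3)[symmetric] gen_linear_image[OF lin(1) X P S(2)]
    by (rule gen_least[OF g order_trans[OF Un_upper1 gen_superset]])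
  moreover have "(\<lambda>y. (\<zero>\<^bsub>X\<^esub>, y)) ` carrier Y \<subseteq> gen (prod_mod X Y) ?U"
    unfolding T(3)[symmetric] gen_linear_image[OF lin(2) Y P T(2)]
    by (rule gen_least[OF g order_trans[OF Un_upper2 gen_superset]])
  ultimately have "(x, y) \<in> gen (prod_mod X Y) ?U" if "x \<in> carrier X" "y \<in> carrier Y" for x y
    using submoduleD(3)[OF P g, of "(x, \<zero>\<^bsub>Y\<^esub>)" "(\<zero>\<^bsub>X\<^esub>, y)"] that X Y by (auto simp: image_subset_iff)
  then have "gen (prod_mod X Y) ?U = carrier (prod_mod X Y)"
    using submoduleD(1)[OF P g] by auto
  then show ?thesis using S T U fin_gen_iff[OF P] by (intro iffD2[OF fin_gen_iff[OF P]] exI[of _ ?U]) auto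
qed

end


subsection \<open>Embeddings into the universe\<close>

text \<open>Lists are coded by iterated pairing. The length is stored as well, since the base value
  \<open>undefined\<close> might itself be a pair and codes of different lengths could
  coincide.\<close>

lemma infinite_list_embedding:
  assumes "infinite (UNIV :: 'u set)"
  obtains e :: "'u list \<Rightarrow> 'u" where "inj e"
proof -
  obtain p :: "'u \<times> 'u \<Rightarrow> 'u" where p: "inj p" using infinite_pairing[OF assms] by auto
  obtain \<nu> :: "nat \<Rightarrow> 'u" where \<nu>: "inj \<nu>" using assms by (meson infinite_countable_subset)
  define c where "c = (\<lambda>xs :: 'u list. foldr (\<lambda>x y. p (x, y)) xs undefined)"
  have c: "xs = ys" if "length xs = length ys" "c xs = c ys" for xs ys
    using that by (induction xs ys rule: list_induct2) (auto simp: c_def dest: injD[OF p])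
  have "inj (\<lambda>xs. p (\<nu> (length xs), c xs))"
    by (rule injI) (auto dest!: injD[OF p] injD[OF \<nu>] intro: c)
  then show ?thesis by (rule that)
qed

text \<open>Each element is coded by a coefficient at the new generator and the code of the
  remainder. The decomposition is a choice among several, but it determines the element, which is
  all that injectivity asks.\<close>

lemma (in right_modules) gen_embedding:
  fixes X :: "('a, 'x) rmodule" and e :: "'a \<Rightarrow> 'u"
  assumes X: "rmod X" and S: "finite S" "S \<subseteq> carrier X"
    and e: "inj_on e (carrier R)" and inf: "infinite (UNIV :: 'u set)"
  shows "\<exists>\<phi> :: 'x \<Rightarrow> 'u. inj_on \<phi> (gen X S)"
  using S
proof (induction S rule: finite_induct)
  case empty
  then show ?case using gen_empty[OF X] by auto
next
  case (insert s S)
  then obtain \<phi> :: "'x \<Rightarrow> 'u" where \<phi>: "inj_on \<phi> (gen X S)" by auto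
  obtain p :: "'u \<times> 'u \<Rightarrow> 'u" where p: "inj p" using infinite_pairing[OF inf] by auto
  have "\<forall>x\<in>gen X (insert s S). \<exists>a m. a \<in> carrier R \<and> m \<in> gen X S \<and> x = (s \<triangleleft>\<^bsub>X\<^esub> a) \<oplus>\<^bsub>X\<^esub> m"
    using gen_insert[OF X, of S s] insert by auto
  then obtain a m where am: "\<And>x. x \<in> gen X (insert s S) \<Longrightarrow>
      a x \<in> carrier R \<and> m x \<in> gen X S \<and> x = (s \<triangleleft>\<^bsub>X\<^esub> (a x)) \<oplus>\<^bsub>X\<^esub> (m x)"
    by metis
  have "inj_on (\<lambda>x. p (e (a x), \<phi> (m x))) (gen X (insert s S))"
  proof (rule inj_onI)
    fix x y assume xy: "x \<in> gen X (insert s S)" "y \<in> gen X (insert s S)"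
      "p (e (a x), \<phi> (m x)) = p (e (a y), \<phi> (m y))"
    then have "e (a x) = e (a y)" "\<phi> (m x) = \<phi> (m y)" by (auto dest: injD[OF p])
    then have "a x = a y" "m x = m y" using am[OF xy(1)] am[OF xy(2)] e \<phi> by (auto dest: inj_onD)
    then show "x = y" using am[OF xy(1)] am[OF xy(2)] by simp
  qed
  then show ?case by blast
qed

text \<open>A jointly injective pair embeds Z into the finitely generated product of X and Y, and
  over a right noetherian ring submodules of such a module are finitely generated.\<close>

lemma gabriel_universe_fin_gen:
  assumes A: "right_noetherian A" and F: "gabriel_topology A F" and inf: "infinite (UNIV :: 'u set)"
  shows "gabriel_universe A F {X :: ('a, 'u) rmodule. fin_gen A X}"
proof -
  have "ring A" using A by (simp add: right_noetherian_def)
  then interpret gabriel A F using F by (simp add: gabriel_def right_modules_def gabriel_axioms_def)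
  show ?thesis
  proof (intro gabriel_universe.intro gabriel_axioms gabriel_universe_axioms.intro inf)
    fix X Y Z :: "('a, 'u) rmodule" and p q
    assume *: "X \<in> {X. fin_gen A X}" "Y \<in> {X. fin_gen A X}" "rmod X" "rmod Y" "rmod Z"
      "linear Z X p" "linear Z Y q" "\<And>z. \<lbrakk>z \<in> carrier Z; p z = \<zero>\<^bsub>X\<^esub>; q z = \<zero>\<^bsub>Y\<^esub>\<rbrakk> \<Longrightarrow> z = \<zero>\<^bsub>Z\<^esub>"
    have lin: "linear Z (prod_mod X Y) (\<lambda>z. (p z, q z))" using *(6,7) by (auto simp: linear_def)
    have "inj_on (\<lambda>z. (p z, q z)) (carrier Z)"
      using linear_inj_iff[OF lin *(5) rmod_prod[OF *(3,4)]] *(8) by auto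
    then show "Z \<in> {X. fin_gen A X}"
      using fin_gen_mono[OF A *(5) rmod_prod[OF *(3,4)] lin] fin_gen_prod[OF *(3,4)] *(1,2) by auto
  qed (use fin_gen_epi in auto)
qed

lemma gabriel_universe_UNIV:
  assumes "ring A" "gabriel_topology A F" "infinite (UNIV :: 'u set)"
  shows "gabriel_universe A F (UNIV :: ('a, 'u) rmodule set)"
  using assms by (simp add: gabriel_universe_def gabriel_universe_axioms_def gabriel_def
    right_modules_def gabriel_axioms_def)

subsection \<open>The right adjoint and closed modules\<close>

context gabriel
begin

abbreviation AA :: "('a, 'a) rmodule" where
  "AA \<equiv> regular_module A"

lemma linear_act: "\<lbrakk>rmod X; x \<in> carrier X\<rbrakk> \<Longrightarrow> linear AA X (\<lambda>a. x \<triangleleft>\<^bsub>X\<^esub> a)"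
  by (simp add: linear_def rmod_act)

lemma linear_mult: "b \<in> carrier A \<Longrightarrow> linear AA AA (\<lambda>a. b \<otimes> a)"
  using linear_act[OF rmod_regular, of b] by simp

lemma qgraph_add:
  assumes X: "rmod X" and Y: "rmod Y" and g: "linear X Y g" and h: "linear X Y h"
  shows "qgraph X Y (\<lambda>x. g x \<oplus>\<^bsub>Y\<^esub> h x) = qadd X Y (qgraph X Y g) (qgraph X Y h)"
proof (rule sym, rule qmor_eq_qgraph[OF X Y])
  show "linear X Y (\<lambda>x. g x \<oplus>\<^bsub>Y\<^esub> h x)"
    using g h by (auto simp: linear_def rmod_ac[OF Y] rmod_act[OF Y] Y)
  show "qmor X Y (qadd X Y (qgraph X Y g) (qgraph X Y h))"
    by (intro qmor_add qmor_graph X Y g h)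
  have "graph X (\<lambda>x. g x \<oplus>\<^bsub>Y\<^esub> h x) \<subseteq> radd Y (qgraph X Y g) (qgraph X Y h)"
    using subsetD[OF graph_subset_qgraph[OF X Y g]] subsetD[OF graph_subset_qgraph[OF X Y h]]
    by (auto simp: graph_iff intro!: raddI)
  then show "graph X (\<lambda>x. g x \<oplus>\<^bsub>Y\<^esub> h x) \<subseteq> qadd X Y (qgraph X Y g) (qgraph X Y h)"
    using radd_subset_qadd[OF X Y qmor_graph[OF X Y g] qmor_graph[OF X Y h]] by blast
qed

lemma qmor_act_comp: "\<lbrakk>rmod X; rmod Y; qmor X Y G; x \<in> carrier X\<rbrakk> \<Longrightarrow> qmor AA Y (graph AA (\<lambda>a. x \<triangleleft>\<^bsub>X\<^esub> a) O G)"
  by (rule qmor_graph_comp[of AA X Y]) (simp_all add: linear_act)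

text \<open>Composing G with the map sending a to x a gives the value of G at x, as a morphism from
  A. Additivity in x is distributivity of composition over sums.\<close>

lemma act_comp_add:
  assumes X: "rmod X" and Y: "rmod Y" and G: "qmor X Y G" and x: "x \<in> carrier X" "x' \<in> carrier X"
  shows "graph AA (\<lambda>a. (x \<oplus>\<^bsub>X\<^esub> x') \<triangleleft>\<^bsub>X\<^esub> a) O G
    = qadd AA Y (graph AA (\<lambda>a. x \<triangleleft>\<^bsub>X\<^esub> a) O G) (graph AA (\<lambda>a. x' \<triangleleft>\<^bsub>X\<^esub> a) O G)"
proof -
  have *: "graph AA (\<lambda>a. z \<triangleleft>\<^bsub>X\<^esub> a) O G = qcomp AA Y (qgraph AA X (\<lambda>a. z \<triangleleft>\<^bsub>X\<^esub> a)) G" if "z \<in> carrier X" for z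
    using qcomp_qgraph_left[OF rmod_regular X Y linear_act[OF X that] G] by simp
  have "graph AA (\<lambda>a. (x \<oplus>\<^bsub>X\<^esub> x') \<triangleleft>\<^bsub>X\<^esub> a) = graph AA (\<lambda>a. (x \<triangleleft>\<^bsub>X\<^esub> a) \<oplus>\<^bsub>X\<^esub> (x' \<triangleleft>\<^bsub>X\<^esub> a))"
    using x by (auto simp: graph_def rmod_act[OF X])
  then have "qgraph AA X (\<lambda>a. (x \<oplus>\<^bsub>X\<^esub> x') \<triangleleft>\<^bsub>X\<^esub> a)
      = qadd AA X (qgraph AA X (\<lambda>a. x \<triangleleft>\<^bsub>X\<^esub> a)) (qgraph AA X (\<lambda>a. x' \<triangleleft>\<^bsub>X\<^esub> a))"
    using qgraph_add[OF rmod_regular X linear_act[OF X x(1)] linear_act[OF X x(2)]] by simp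
  then show ?thesis
    using x X qcomp_qadd_left[OF rmod_regular X Y _ _ G] qmor_graph[OF rmod_regular X linear_act[OF X]]
    by (simp add: *)
qed

lemma act_comp_act:
  assumes X: "rmod X" and x: "x \<in> carrier X" and b: "b \<in> carrier A"
  shows "graph AA (\<lambda>a. (x \<triangleleft>\<^bsub>X\<^esub> b) \<triangleleft>\<^bsub>X\<^esub> a) O G = graph AA (\<lambda>a. b \<otimes> a) O (graph AA (\<lambda>a. x \<triangleleft>\<^bsub>X\<^esub> a) O G)"
  using assms by (auto simp: graph_iff relcomp_unfold rmod_act)

text \<open>Morphisms from A to Y in the quotient, that is, \<open>\<omega>\<close> applied to
  \<open>\<pi>\<close> of Y; scalars act by precomposition with left multiplications. The elements
  are sets of pairs, so a transport is still required to place the module in the universe.\<close>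

definition hom_mod :: "('a, 'x) rmodule \<Rightarrow> ('a, ('a \<times> 'x) set) rmodule" where
  "hom_mod Y = \<lparr>carrier = {G. qmor AA Y G}, mult = undefined, one = undefined,
     zero = qgraph AA Y (\<lambda>_. \<zero>\<^bsub>Y\<^esub>), add = qadd AA Y, act = (\<lambda>G b. graph AA (\<lambda>a. b \<otimes> a) O G)\<rparr>"

context
  fixes Y :: "('a, 'x) rmodule"
  assumes Y [simp]: "rmod Y"
begin

lemma rmod_hom_mod: "rmod (hom_mod Y)"
proof -
  interpret H: abelian_group "hom_q AA Y" by (rule hom_q_group[OF rmod_regular Y])
  have Hs: "carrier (hom_q AA Y) = {G. qmor AA Y G}" "add (hom_q AA Y) = qadd AA Y"
    "zero (hom_q AA Y) = qgraph AA Y (\<lambda>_. \<zero>\<^bsub>Y\<^esub>)" by (simp_all add: hom_q_def)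
  note g = H.a_assoc[unfolded Hs mem_Collect_eq] H.a_comm[unfolded Hs mem_Collect_eq]
    H.l_zero[unfolded Hs mem_Collect_eq] H.a_closed[unfolded Hs mem_Collect_eq] H.zero_closed[unfolded Hs mem_Collect_eq]
  have c: "qcomp AA Y (qgraph AA AA (\<lambda>a. b \<otimes> a)) G = graph AA (\<lambda>a. b \<otimes> a) O G"
    if "b \<in> carrier A" "qmor AA Y G" for b G
    using qcomp_qgraph_left[OF rmod_regular rmod_regular Y linear_mult that(2)] that(1) by simp
  have c': "qmor AA Y (graph AA (\<lambda>a. b \<otimes> a) O G)" if "b \<in> carrier A" "qmor AA Y G" for b G
    using qmor_graph_comp[OF rmod_regular rmod_regular Y linear_mult that(2)] that(1) by simp
  show ?thesis
  proof ((rule rmodI; unfold hom_mod_def partial_object.simps ring.simps rmodule.simps mem_Collect_eq), goal_cases)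
    case (6 G)
    then show ?case
      using H.l_neg[of G] H.a_inv_closed[of G] unfolding Hs by blast
  next
    case (8 G H b)
    then show ?case
      using qcomp_qadd_right[OF rmod_regular rmod_regular Y qmor_graph[OF rmod_regular rmod_regular linear_mult[OF 8(3)]], of G H]
      by (simp add: c g)
  next
    case (9 G b b')
    then show ?case using act_comp_add[OF rmod_regular Y 9(1), of b b'] by simp
  next
    case (10 G b b')
    then show ?case using act_comp_act[OF rmod_regular, of b b' G] by simp
  next
    case (11 G)
    then show ?case
      using rel_submoduleD(1)[OF pre_morD[OF qmor_pre[OF 11]] rmod_regular Y]
      by (auto simp: graph_iff relcomp_unfold)
  qed (rule g c'; assumption)+
qed

text \<open>The counit: evaluation at the unit. It is a relation because the unit may lie outside
  the domain of a morphism.\<close>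

definition hom_eval :: "(('a \<times> 'x) set \<times> 'x) set" where
  "hom_eval = {(G, y). qmor AA Y G \<and> (\<one>, y) \<in> G}"

lemma hom_mod_simps:
  "carrier (hom_mod Y) = {G. qmor AA Y G}" "add (hom_mod Y) = qadd AA Y"
  "zero (hom_mod Y) = qgraph AA Y (\<lambda>_. \<zero>\<^bsub>Y\<^esub>)" "act (hom_mod Y) G b = graph AA (\<lambda>a. b \<otimes> a) O G"
  by (simp_all add: hom_mod_def)

lemma one_act_hom_mod:
  "b \<in> carrier A \<Longrightarrow> (\<one>, y) \<in> G \<triangleleft>\<^bsub>hom_mod Y\<^esub> b \<longleftrightarrow> (b, y) \<in> G"
  by (simp add: hom_mod_simps relcomp_unfold graph_iff)

text \<open>The morphism G b has value y at the unit exactly when (b, y) is in G. Density of the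
  domain of G and saturation of G thus become the corresponding properties of evaluation at
  G.\<close>

lemma qmor_hom_eval: "qmor (hom_mod Y) Y hom_eval"
proof -
  note H = rmod_hom_mod
  have sub: "submodule A (prod_mod (hom_mod Y) Y) hom_eval"
    unfolding rel_submodule_iff[OF H Y]
  proof (intro conjI allI impI)
    show "(\<zero>\<^bsub>hom_mod Y\<^esub>, \<zero>\<^bsub>Y\<^esub>) \<in> hom_eval"
      using graph_subset_qgraph[OF rmod_regular Y linear_const_zero[OF rmod_regular Y]]
        qmor_graph[OF rmod_regular Y linear_const_zero[OF rmod_regular Y]]
      by (auto simp: hom_eval_def hom_mod_simps graph_iff)
  next
    fix G y G' y' assume "(G, y) \<in> hom_eval" "(G', y') \<in> hom_eval"
    then have G: "qmor AA Y G" "(\<one>, y) \<in> G" "qmor AA Y G'" "(\<one>, y') \<in> G'" by (auto simp: hom_eval_def)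
    then have "(\<one>, y \<oplus>\<^bsub>Y\<^esub> y') \<in> qadd AA Y G G'"
      using subsetD[OF radd_subset_qadd[OF rmod_regular Y G(1,3)] raddI[OF G(2,4)]] by simp
    then show "(G \<oplus>\<^bsub>hom_mod Y\<^esub> G', y \<oplus>\<^bsub>Y\<^esub> y') \<in> hom_eval"
      using qmor_add[OF rmod_regular Y G(1,3)] by (simp add: hom_eval_def hom_mod_simps)
  next
    fix G y a assume "(G, y) \<in> hom_eval" and a: "a \<in> carrier A"
    then have G: "qmor AA Y G" "(\<one>, y) \<in> G" by (auto simp: hom_eval_def)
    have "(a, y \<triangleleft>\<^bsub>Y\<^esub> a) \<in> G"
      using rel_submoduleD(5)[OF pre_morD[OF qmor_pre[OF G(1)]] rmod_regular Y G(2) a] a by simp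
    moreover have "G \<triangleleft>\<^bsub>hom_mod Y\<^esub> a \<in> carrier (hom_mod Y)"
      using rmod_simps(4)[OF H] G(1) a by (simp add: hom_mod_simps(1))
    ultimately show "(G \<triangleleft>\<^bsub>hom_mod Y\<^esub> a, y \<triangleleft>\<^bsub>Y\<^esub> a) \<in> hom_eval"
      using one_act_hom_mod[OF a, of "y \<triangleleft>\<^bsub>Y\<^esub> a" G] by (simp add: hom_eval_def hom_mod_simps(1))
  qed (auto simp: hom_eval_def hom_mod_simps dest!: qmor_pre pre_morD
      intro: rel_submoduleD(2)[OF _ rmod_regular Y])
  moreover have "dense (hom_mod Y) (Domain hom_eval)"
    unfolding dense_def
  proof
    fix G assume G: "G \<in> carrier (hom_mod Y)"
    then have q: "qmor AA Y G" by (simp add: hom_mod_simps)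
    then have "dense AA (Domain G)" by (simp add: qmor_def pre_mor_def)
    then obtain I where I: "I \<in> F" "\<And>a. a \<in> I \<Longrightarrow> a \<in> carrier A" "\<And>a. a \<in> I \<Longrightarrow> \<one> \<triangleleft>\<^bsub>AA\<^esub> a \<in> Domain G"
      by (rule denseE) auto
    show "G \<in> sat (hom_mod Y) (Domain hom_eval)"
    proof (rule satI[OF G I(1)])
      fix a assume a: "a \<in> I"
      obtain y where y: "(a, y) \<in> G" using I(2,3)[OF a] by auto
      have "G \<triangleleft>\<^bsub>hom_mod Y\<^esub> a \<in> carrier (hom_mod Y)"
        using rmod_simps(4)[OF H G I(2)[OF a]] .
      then have "(G \<triangleleft>\<^bsub>hom_mod Y\<^esub> a, y) \<in> hom_eval"
        using one_act_hom_mod[OF I(2)[OF a], of y G] y by (simp add: hom_eval_def hom_mod_simps(1))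
      then show "G \<triangleleft>\<^bsub>hom_mod Y\<^esub> a \<in> Domain hom_eval" by blast
    qed
  qed
  moreover have "y \<in> tors Y" if "(\<zero>\<^bsub>hom_mod Y\<^esub>, y) \<in> hom_eval" for y
  proof -
    have "(\<one>, y) \<in> qgraph AA Y (\<lambda>_. \<zero>\<^bsub>Y\<^esub>)" using that by (simp add: hom_eval_def hom_mod_simps)
    then show ?thesis unfolding sat_prod_iff by (auto simp: graph_iff sat_def)
  qed
  moreover have "sat (prod_mod (hom_mod Y) Y) hom_eval \<subseteq> hom_eval"
  proof clarify
    fix G y assume "(G, y) \<in> sat (prod_mod (hom_mod Y) Y) hom_eval"
    note * = this[unfolded sat_prod_iff]
    have G: "qmor AA Y G" and y: "y \<in> carrier Y" using * by (simp_all only: hom_mod_simps(1) mem_Collect_eq)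
    obtain I where I: "I \<in> F" "\<forall>a\<in>I. (G \<triangleleft>\<^bsub>hom_mod Y\<^esub> a, y \<triangleleft>\<^bsub>Y\<^esub> a) \<in> hom_eval"
      by (rule bexE[OF *[THEN conjunct2, THEN conjunct2]])
    have "(\<one> \<triangleleft>\<^bsub>AA\<^esub> a, y \<triangleleft>\<^bsub>Y\<^esub> a) \<in> G" if "a \<in> I" for a
      using I(2) that one_act_hom_mod[OF F_carrierD[OF I(1) that]] F_carrierD[OF I(1) that]
      by (auto simp: hom_eval_def)
    from qmor_closedI[OF G I(1) this _ y] have "(\<one>, y) \<in> G" by simp
    then show "(G, y) \<in> hom_eval" using G by (simp add: hom_eval_def)
  qed
  ultimately show ?thesis by (simp add: qmor_def pre_mor_def)
qed

lemma hom_eval_act: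
  assumes G: "qmor AA Y G"
  shows "graph AA (\<lambda>a. G \<triangleleft>\<^bsub>hom_mod Y\<^esub> a) O hom_eval = G"
proof -
  have "(a, y) \<in> graph AA (\<lambda>a. G \<triangleleft>\<^bsub>hom_mod Y\<^esub> a) O hom_eval \<longleftrightarrow> (a, y) \<in> G" for a y
  proof (cases "a \<in> carrier A")
    case True
    then have "G \<triangleleft>\<^bsub>hom_mod Y\<^esub> a \<in> carrier (hom_mod Y)"
      using rmod_simps(4)[OF rmod_hom_mod] G by (simp add: hom_mod_simps(1))
    then show ?thesis
      using True one_act_hom_mod[OF True, of y G]
      by (simp add: graph_iff relcomp_unfold hom_eval_def hom_mod_simps(1))
  next
    case False
    then show ?thesis
      using rel_submoduleD(1)[OF pre_morD[OF qmor_pre[OF G]] rmod_regular Y] by (auto simp: graph_iff)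
  qed
  then show ?thesis by auto
qed

end

text \<open>A universal arrow to \<open>Y\<close> can be tested on the generator \<open>A\<close>.\<close>

definition universal :: "('a, 'r) rmodule \<Rightarrow> ('a, 'y) rmodule \<Rightarrow> ('r \<times> 'y) set \<Rightarrow> bool" where
  "universal R Y E \<longleftrightarrow> rmod R \<and> rmod Y \<and> qmor R Y E \<and>
     bij_betw (\<lambda>r. graph AA (\<lambda>a. r \<triangleleft>\<^bsub>R\<^esub> a) O E) (carrier R) {G. qmor AA Y G}"

text \<open>The map is forced: h w has to be the element of R that represents the value of G at w.
  Linearity of this choice follows from injectivity of the representation.\<close>

lemma universal_arrow:
  assumes u: "universal R Y E" and W: "rmod W"
  shows "qmor W Y G \<Longrightarrow> \<exists>h. linear W R h \<and> graph W h O E = G"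
    and "\<lbrakk>linear W R h; linear W R h'; graph W h O E = graph W h' O E; w \<in> carrier W\<rbrakk> \<Longrightarrow> h w = h' w"
proof -
  have R: "rmod R" and Y: "rmod Y" and E: "qmor R Y E"
    and bij: "bij_betw (\<lambda>r. graph AA (\<lambda>a. r \<triangleleft>\<^bsub>R\<^esub> a) O E) (carrier R) {G. qmor AA Y G}"
    using u by (auto simp: universal_def)
  let ?e = "\<lambda>r. graph AA (\<lambda>a. r \<triangleleft>\<^bsub>R\<^esub> a) O E"
  have inj: "r = r'" if "?e r = ?e r'" "r \<in> carrier R" "r' \<in> carrier R" for r r'
    using bij that by (auto simp: bij_betw_def inj_on_def)
  have comp: "?e (h w) = graph AA (\<lambda>a. w \<triangleleft>\<^bsub>W\<^esub> a) O (graph W h O E)"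
    if "linear W R h" "w \<in> carrier W" for h w
    using that W linearD(3)[OF that(1,2)] by (auto simp: graph_iff relcomp_unfold)
  show "h w = h' w" if "linear W R h" "linear W R h'" "graph W h O E = graph W h' O E" "w \<in> carrier W"
    using comp[OF that(1,4)] comp[OF that(2,4)] that linearD(1)[OF that(1,4)] linearD(1)[OF that(2,4)]
    by (intro inj) simp_all
  show "\<exists>h. linear W R h \<and> graph W h O E = G" if G: "qmor W Y G"
  proof -
    let ?g = "\<lambda>w. graph AA (\<lambda>a. w \<triangleleft>\<^bsub>W\<^esub> a) O G"
    define h where "h w = inv_into (carrier R) ?e (?g w)" for w
    have mem: "?g w \<in> ?e ` carrier R" if "w \<in> carrier W" for w
      using bij qmor_act_comp[OF W Y G that] by (auto simp: bij_betw_def)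
    have h: "h w \<in> carrier R" "?e (h w) = ?g w" if "w \<in> carrier W" for w
      using inv_into_into[OF mem[OF that]] f_inv_into_f[OF mem[OF that]] by (simp_all add: h_def)
    have lin: "linear W R h"
      unfolding linear_def
    proof (intro conjI ballI)
      fix x y assume x: "x \<in> carrier W" "y \<in> carrier W"
      have "?e (h x \<oplus>\<^bsub>R\<^esub> h y) = ?e (h (x \<oplus>\<^bsub>W\<^esub> y))"
        using x W h act_comp_add[OF R Y E h(1)[OF x(1)] h(1)[OF x(2)]] act_comp_add[OF W Y G x]
        by simp
      then show "h (x \<oplus>\<^bsub>W\<^esub> y) = h x \<oplus>\<^bsub>R\<^esub> h y"
        by (intro inj[symmetric]) (use x h W R in auto)
    next
      fix x b assume x: "x \<in> carrier W" "b \<in> carrier A"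
      have "?e (h x \<triangleleft>\<^bsub>R\<^esub> b) = ?e (h (x \<triangleleft>\<^bsub>W\<^esub> b))"
        using x W h act_comp_act[OF R h(1)[OF x(1)] x(2), of E] act_comp_act[OF W x, of G]
        by simp
      then show "h (x \<triangleleft>\<^bsub>W\<^esub> b) = h x \<triangleleft>\<^bsub>R\<^esub> b"
        by (intro inj[symmetric]) (use x h W R in auto)
    qed (use h in auto)
    have "graph W h O E = G"
    proof (rule qmor_subset_eq[OF W Y qmor_graph_comp[OF W R Y lin E] G])
      show "graph W h O E \<subseteq> G"
      proof clarify
        fix w r y assume wr: "(w, r) \<in> graph W h" "(r, y) \<in> E"
        then have w: "w \<in> carrier W" "(h w, y) \<in> E" by (auto simp: graph_iff)
        then have "(\<one>, y) \<in> ?e (h w)" using h(1) R by (auto simp: graph_iff relcomp_unfold)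
        then have "(\<one>, y) \<in> ?g w" using h(2) w by simp
        then show "(w, y) \<in> G" using w W by (auto simp: graph_iff relcomp_unfold)
      qed
    qed
    then show ?thesis using lin by blast
  qed
qed

text \<open>Closedness without mention of an adjoint. It makes sense for modules in any type, in
  particular for Hom(M, X), whose elements are arrows of C.\<close>

definition eclosed :: "('a, 'x) rmodule \<Rightarrow> bool" where
  "eclosed Y \<longleftrightarrow> rmod Y \<and> tors Y \<subseteq> {\<zero>\<^bsub>Y\<^esub>} \<and>
     (\<forall>G. qmor AA Y G \<longrightarrow> (\<exists>z\<in>carrier Y. graph AA (\<lambda>a. z \<triangleleft>\<^bsub>Y\<^esub> a) \<subseteq> G))"

text \<open>Any further value at x in the saturation differs from h x by an element killed by an
  ideal in F.\<close>

lemma qgraph_torsion_free: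
  assumes X: "rmod X" and Y: "rmod Y" and h: "linear X Y h" and t: "tors Y \<subseteq> {\<zero>\<^bsub>Y\<^esub>}"
  shows "qgraph X Y h = graph X h"
proof
  show "graph X h \<subseteq> qgraph X Y h" by (rule graph_subset_qgraph[OF X Y h])
  show "qgraph X Y h \<subseteq> graph X h"
  proof clarify
    fix x y assume "(x, y) \<in> qgraph X Y h"
    then obtain I where I: "x \<in> carrier X" "y \<in> carrier Y" "I \<in> F"
      "\<forall>a\<in>I. (x \<triangleleft>\<^bsub>X\<^esub> a, y \<triangleleft>\<^bsub>Y\<^esub> a) \<in> graph X h" unfolding sat_prod_iff by blast
    have hx: "h x \<in> carrier Y" by (rule linearD(1)[OF h I(1)])
    have "(y \<oplus>\<^bsub>Y\<^esub> (\<ominus>\<^bsub>Y\<^esub> h x)) \<in> tors Y"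
    proof (rule satI[OF _ I(3)])
      fix a assume a: "a \<in> I"
      have "y \<triangleleft>\<^bsub>Y\<^esub> a = h x \<triangleleft>\<^bsub>Y\<^esub> a"
        using I(4) a linearD(3)[OF h I(1) F_carrierD[OF I(3) a]] by (auto simp: graph_iff)
      then show "(y \<oplus>\<^bsub>Y\<^esub> (\<ominus>\<^bsub>Y\<^esub> h x)) \<triangleleft>\<^bsub>Y\<^esub> a \<in> {\<zero>\<^bsub>Y\<^esub>}"
        using I(2) hx F_carrierD[OF I(3) a] by (simp add: rmod_act[OF Y] Y)
    qed (use I(2) hx Y in auto)
    then have "y = h x" using t I(2) hx rmod_diff_zero[OF Y] by blast
    then show "(x, y) \<in> graph X h" using I(1) by (simp add: graph_iff)
  qed
qed

text \<open>Allows the adjoint to take the value Y at a closed module Y, with the identity as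
  counit.\<close>

lemma universal_eclosed:
  assumes "eclosed Y"
  shows "universal Y Y (qgraph Y Y (\<lambda>x. x))"
proof -
  have Y: "rmod Y" and t: "tors Y \<subseteq> {\<zero>\<^bsub>Y\<^esub>}"
    and e: "\<And>G. qmor AA Y G \<Longrightarrow> \<exists>z\<in>carrier Y. graph AA (\<lambda>a. z \<triangleleft>\<^bsub>Y\<^esub> a) \<subseteq> G"
    using assms by (auto simp: eclosed_def)
  have id: "qgraph Y Y (\<lambda>x. x) = graph Y (\<lambda>x. x)" by (rule qgraph_torsion_free[OF Y Y linear_id t])
  have eq: "graph AA (\<lambda>a. z \<triangleleft>\<^bsub>Y\<^esub> a) O qgraph Y Y (\<lambda>x. x) = graph AA (\<lambda>a. z \<triangleleft>\<^bsub>Y\<^esub> a)" if "z \<in> carrier Y" for z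
    unfolding id using that Y by (auto simp: graph_iff relcomp_unfold)
  have "bij_betw (\<lambda>z. graph AA (\<lambda>a. z \<triangleleft>\<^bsub>Y\<^esub> a)) (carrier Y) {G. qmor AA Y G}"
    unfolding bij_betw_def
  proof (intro conjI equalityI subsetI inj_onI)
    fix z z' assume z: "z \<in> carrier Y" "z' \<in> carrier Y"
      "graph AA (\<lambda>a. z \<triangleleft>\<^bsub>Y\<^esub> a) = graph AA (\<lambda>a. z' \<triangleleft>\<^bsub>Y\<^esub> a)"
    have "(\<one>, z) \<in> graph AA (\<lambda>a. z \<triangleleft>\<^bsub>Y\<^esub> a)" using z(1) Y by (simp add: graph_iff)
    then show "z = z'" unfolding z(3) using z(2) Y by (simp add: graph_iff)
  next
    fix G assume "G \<in> (\<lambda>z. graph AA (\<lambda>a. z \<triangleleft>\<^bsub>Y\<^esub> a)) ` carrier Y"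
    then show "G \<in> {G. qmor AA Y G}"
      using qmor_graph[OF rmod_regular Y linear_act[OF Y]] qgraph_torsion_free[OF rmod_regular Y linear_act[OF Y] t]
      by auto
  next
    fix G assume "G \<in> {G. qmor AA Y G}"
    then have G: "qmor AA Y G" by simp
    obtain z where z: "z \<in> carrier Y" "graph AA (\<lambda>a. z \<triangleleft>\<^bsub>Y\<^esub> a) \<subseteq> G" using e[OF G] by auto
    have "G = qgraph AA Y (\<lambda>a. z \<triangleleft>\<^bsub>Y\<^esub> a)"
      using qmor_eq_qgraph[OF rmod_regular Y linear_act[OF Y z(1)] G z(2)] .
    then show "G \<in> (\<lambda>z. graph AA (\<lambda>a. z \<triangleleft>\<^bsub>Y\<^esub> a)) ` carrier Y"
      using qgraph_torsion_free[OF rmod_regular Y linear_act[OF Y z(1)] t] z(1) by auto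
  qed
  then have "bij_betw (\<lambda>z. graph AA (\<lambda>a. z \<triangleleft>\<^bsub>Y\<^esub> a) O qgraph Y Y (\<lambda>x. x)) (carrier Y) {G. qmor AA Y G}"
    by (rule iffD1[OF bij_betw_cong, rotated]) (simp add: eq)
  then show ?thesis using Y qmor_graph[OF Y Y linear_id] by (simp add: universal_def)
qed

text \<open>The general value of the adjoint: a copy of \<open>hom_mod Y\<close> in whatever type
  can hold it, with evaluation at the unit as counit.\<close>

lemma universal_transport:
  assumes Y: "rmod Y" and \<phi>: "inj_on \<phi> {G. qmor AA Y G}"
  shows "\<exists>E. universal (transport_module \<phi> (hom_mod Y)) Y E"
proof -
  let ?R = "transport_module \<phi> (hom_mod Y)" and ?d = "inv_into (carrier (hom_mod Y)) \<phi>"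
  note H = rmod_hom_mod[OF Y]
  have \<phi>: "inj_on \<phi> (carrier (hom_mod Y))" using \<phi> by (simp add: hom_mod_simps[OF Y])
  note R = rmod_transport[OF \<phi> H] and d = linear_transport(2)[OF \<phi> H]
  have bij: "bij_betw ?d (carrier ?R) {G. qmor AA Y G}"
    using \<phi> by (simp add: transport_module_simps bij_betw_inv_into inj_on_imp_bij_betw hom_mod_simps[OF Y, symmetric])
  let ?E = "graph ?R ?d O hom_eval Y"
  have "graph AA (\<lambda>a. r \<triangleleft>\<^bsub>?R\<^esub> a) O ?E = ?d r" if r: "r \<in> carrier ?R" for r
  proof -
    have "graph AA (\<lambda>a. r \<triangleleft>\<^bsub>?R\<^esub> a) O graph ?R ?d = graph AA (\<lambda>a. ?d r \<triangleleft>\<^bsub>hom_mod Y\<^esub> a)"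
      using r R linearD(3)[OF d r] by (auto simp: graph_iff relcomp_unfold)
    then have "graph AA (\<lambda>a. r \<triangleleft>\<^bsub>?R\<^esub> a) O ?E = graph AA (\<lambda>a. ?d r \<triangleleft>\<^bsub>hom_mod Y\<^esub> a) O hom_eval Y"
      by (simp add: O_assoc[symmetric])
    also have "\<dots> = ?d r" using hom_eval_act[OF Y] linearD(1)[OF d r] by (simp add: hom_mod_simps[OF Y])
    finally show ?thesis .
  qed
  then have "bij_betw (\<lambda>r. graph AA (\<lambda>a. r \<triangleleft>\<^bsub>?R\<^esub> a) O ?E) (carrier ?R) {G. qmor AA Y G}"
    using bij by (simp cong: bij_betw_cong)
  then show ?thesis
    using R Y qmor_graph_comp[OF R H Y d qmor_hom_eval[OF Y]] unfolding universal_def by blast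
qed

text \<open>Over a right noetherian ring a morphism out of \<open>A\<close> is determined by its values on
  finitely many generators of an ideal in \<open>F\<close>, which bounds the size of the right adjoint.\<close>

lemma hom_mod_embedding:
  fixes Y :: "('a, 'u) rmodule" and e :: "'a \<Rightarrow> 'u"
  assumes A: "right_noetherian A" and Y: "rmod Y" and e: "inj_on e (carrier A)" and inf: "infinite (UNIV :: 'u set)"
  shows "\<exists>\<phi> :: ('a \<times> 'u) set \<Rightarrow> 'u. inj_on \<phi> {G. qmor AA Y G}"
proof -
  note P = rmod_prod[OF rmod_regular Y]
  obtain p :: "'u \<times> 'u \<Rightarrow> 'u" where p: "inj p" using infinite_pairing[OF inf] by auto
  obtain l :: "'u list \<Rightarrow> 'u" where l: "inj l" using infinite_list_embedding[OF inf] by auto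
  \<comment> \<open>A morphism is coded by a finite list of its pairs, lists being embeddable in
    \<open>'u\<close>. The list determines the morphism: it generates a subrelation with the full
    domain of G, whose saturation is G.\<close>
  have "\<exists>ts. set ts \<subseteq> carrier A \<times> carrier Y \<and> G = sat (prod_mod AA Y) (gen (prod_mod AA Y) (set ts))"
    if G: "qmor AA Y G" for G
  proof -
    note G' = pre_morD[OF qmor_pre[OF G]]
    note dom = submodule_Domain[OF G' rmod_regular Y]
    obtain T where T: "finite T" "T \<subseteq> Domain G" "Domain G = gen AA T" using noetherian_ideal[OF A dom] .
    obtain y where y: "\<forall>a\<in>T. (a, y a) \<in> G"
      using bchoice[of T "\<lambda>a y. (a, y) \<in> G"] T(2) by blast
    let ?U = "(\<lambda>a. (a, y a)) ` T"
    have UG: "?U \<subseteq> G" using y by auto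
    then have Uc: "?U \<subseteq> carrier (prod_mod AA Y)" using submoduleD(1)[OF P G'] by auto
    have sub: "submodule A (prod_mod AA Y) (gen (prod_mod AA Y) ?U)" by (rule submodule_gen[OF P Uc])
    have le: "gen (prod_mod AA Y) ?U \<subseteq> G" by (rule gen_least[OF G' UG])
    have "fst ` gen (prod_mod AA Y) ?U = gen AA (fst ` ?U)"
      by (rule gen_linear_image[OF _ P rmod_regular Uc]) (auto simp: linear_def)
    also have "fst ` ?U = T" by force
    finally have "Domain (gen (prod_mod AA Y) ?U) = Domain G" using T(3) by (simp add: Domain_fst)
    then have "pre_mor AA Y (gen (prod_mod AA Y) ?U)"
      using qmor_pre[OF G] sub le by (auto simp: pre_mor_def)
    then have "G = sat (prod_mod AA Y) (gen (prod_mod AA Y) ?U)"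
      using qmor_eq_sat[OF rmod_regular Y _ G le] by simp
    moreover obtain ts where "set ts = ?U" using finite_list[of ?U] T(1) by auto
    ultimately show ?thesis using Uc by (intro exI[of _ ts]) auto
  qed
  then obtain ts where ts: "\<And>G. qmor AA Y G \<Longrightarrow> set (ts G) \<subseteq> carrier A \<times> carrier Y \<and>
      G = sat (prod_mod AA Y) (gen (prod_mod AA Y) (set (ts G)))"
    by metis
  let ?c = "\<lambda>(a, y). p (e a, y)"
  have c: "inj_on ?c (carrier A \<times> carrier Y)"
    using e by (auto simp: inj_on_def dest!: injD[OF p])
  have "inj_on (\<lambda>G. l (map ?c (ts G))) {G. qmor AA Y G}"
  proof (rule inj_onI)
    fix G H assume GH: "G \<in> {G. qmor AA Y G}" "H \<in> {G. qmor AA Y G}" "l (map ?c (ts G)) = l (map ?c (ts H))"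
    then have "map ?c (ts G) = map ?c (ts H)" by (auto dest: injD[OF l])
    then have "ts G = ts H"
      by (rule map_inj_on) (use ts GH inj_on_subset[OF c] in auto)
    then show "G = H" using ts GH by (metis mem_Collect_eq)
  qed
  then show ?thesis by blast
qed

end

lemma full_subcat_UNIV: "full_subcat C UNIV = C"
  by (simp add: full_subcat_def)

context right_modules
begin

lemma
  assumes e: "inj_on e (carrier R)"
  shows rmod_reg: "rmod (reg e R)"
    and linear_reg: "linear (regular_module R) (reg e R) e"
    and linear_reg_inv: "linear (reg e R) (regular_module R) (inv_into (carrier R) e)"
    and carrier_reg: "carrier (reg e R) = e ` carrier R"
  unfolding reg_def using e rmod_transport[of e "regular_module R"] linear_transport[of e "regular_module R"]
  by (simp_all add: transport_module_simps(1))

end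

section \<open>Closedness by elements and closedness by an adjunction\<close>

context gabriel_universe
begin

lemma quotient_data_fin_gen:
  assumes "K = {X. fin_gen A X}"
  shows "fgmod_cat A = mods" "fgmod_quot A F = quot" "fgmod_pi A F = pi_functor"
  unfolding fgmod_cat_def mods_def fgmod_quot_def quot_def tors_mods_def fgmod_pi_def pi_functor_def
  by (simp_all only: assms)

lemma quotient_data_UNIV:
  assumes "K = UNIV"
  shows "Mod_cat A = mods" "Mod_quot A F = quot" "Mod_pi A F = pi_functor"
  unfolding mods_def Mod_quot_def quot_def tors_mods_def Mod_pi_def pi_functor_def
  by (simp_all only: assms full_subcat_UNIV)

lemma qiso_is_iso:
  assumes W: "ob W" and X: "ob X" and s: "qiso W X s"
  shows "is_iso quot (arr_map pi_functor (mor W X s))"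
proof -
  have r: "rmod W" "rmod X" and ls: "linear W X s" using assms by (auto simp: qiso_def)
  note p = pre_mor_graph[OF r ls]
  have "Domain ((graph W s)\<inverse>) = s ` carrier W" by (auto simp: graph_def)
  then have "pre_mor X W ((graph W s)\<inverse>)"
    using s submodule_converse[OF pre_morD[OF p] r] by (auto simp: pre_mor_def qiso_def graph_iff)
  from is_iso_qarr[OF W X p this] show ?thesis by (simp add: pi_arr W X ls)
qed

text \<open>Arrows into X extend uniquely along every map that \<open>\<pi>\<close> inverts.
  Uniqueness, for the inclusion into A of an ideal in F, gives torsion-freeness; existence, for the
  denominator of a roof from A to X, gives the representing element.\<close>

lemma eclosed_if_adjoint:
  assumes adj: "adjunction mods quot pi_functor \<omega> \<eta> \<epsilon>" and X: "ob X" and iso: "is_iso mods (\<eta> X)"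
    and e: "inj_on e (carrier A)" and R: "reg e A \<in> K"
  shows "eclosed X"
proof -
  let ?R = "reg e A" and ?d = "inv_into (carrier A) e"
  have rR: "rmod ?R" and le: "linear AA ?R e" and ld: "linear ?R AA ?d" and cR: "carrier ?R = e ` carrier A"
    using rmod_reg[OF e] linear_reg[OF e] linear_reg_inv[OF e] carrier_reg[OF e] by auto
  have obR: "ob ?R" and rX: "rmod X" using rR R X by auto
  have XO: "X \<in> Obj mods" using X by (simp add: mods_simps)
  have d: "?d (e a) = a" if "a \<in> carrier A" for a using e that by simp
  note ext = adjunction_extension[OF adj XO iso mor_in[OF _ obR] qiso_is_iso[OF _ obR]]
  have "tors X \<subseteq> {\<zero>\<^bsub>X\<^esub>}"
  proof
    fix x assume x: "x \<in> tors X"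
    then have xX: "x \<in> carrier X" by (rule sat_carrier)
    \<comment> \<open>Multiplication by x and the zero map, both from the copy of A, agree on this
      ideal. Its inclusion is inverted by \<open>\<pi>\<close>, so they coincide and x is 0.\<close>
    let ?I = "{a \<in> carrier A. x \<triangleleft>\<^bsub>X\<^esub> a \<in> {\<zero>\<^bsub>X\<^esub>}}"
    have I: "?I \<in> F" using x by (simp only: sat_iff[OF rX submodule_zero[OF rX]])
    have sub: "submodule A ?R (e ` ?I)"
      by (rule submodule_image[OF le rmod_regular rR F_ideal[OF I]])
    obtain W i where W: "rmod W" "linear W ?R i" "bij_betw i (carrier W) (e ` ?I)" "carrier W = (\<lambda>x. x) ` (e ` ?I)"
      using subset_transport[OF rR sub inj_on_id2] .
    have inj: "inj_on i (carrier W)" and img: "i ` carrier W = e ` ?I" using W(3) by (auto simp: bij_betw_def)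
    have obW: "ob W"
      using W(1) K_mono[OF R R rR rR W(1,2,2)] linear_inj_iff[OF W(2,1) rR] inj by blast
    have "qiso W ?R i"
    proof -
      have "w \<in> tors W" if "w \<in> carrier W" "i w = \<zero>\<^bsub>?R\<^esub>" for w
        using that inj linear_inj_iff[OF W(2,1) rR] subset_sat[OF W(1) submodule_zero[OF W(1)]] by auto
      moreover have "dense ?R (e ` ?I)"
        unfolding dense_def
      proof
        fix r assume "r \<in> carrier ?R"
        then obtain a where a: "a \<in> carrier A" "r = e a" using cR by auto
        then have "a \<in> sat AA ?I" using I dense_regular_iff[OF F_ideal[OF I]] by (auto simp: dense_def)
        then show "r \<in> sat ?R (e ` ?I)" unfolding a(2) by (rule linear_sat[OF le, rotated]) auto
      qed
      ultimately show ?thesis using W(2) img by (simp add: qiso_def)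
    qed
    note u = ext(2)[OF obW W(2) obW this]
    have lx: "linear ?R X (\<lambda>r. x \<triangleleft>\<^bsub>X\<^esub> ?d r)" using linear_comp[OF ld linear_act[OF rX xX]] .
    have l0: "linear ?R X (\<lambda>r. \<zero>\<^bsub>X\<^esub>)" by (rule linear_const_zero[OF rR rX])
    have "x \<triangleleft>\<^bsub>X\<^esub> ?d (i w) = \<zero>\<^bsub>X\<^esub>" if "w \<in> carrier W" for w
    proof -
      have "i w \<in> e ` ?I" using img that by blast
      then show ?thesis using d by auto
    qed
    then have "mor ?R X (\<lambda>r. x \<triangleleft>\<^bsub>X\<^esub> ?d r) \<cdot>\<^bsub>mods\<^esub> mor W ?R i = mor ?R X (\<lambda>r. \<zero>\<^bsub>X\<^esub>) \<cdot>\<^bsub>mods\<^esub> mor W ?R i"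
      using W(2) by (simp add: mor_eq_iff)
    from u[OF mor_in[OF obR X lx] mor_in[OF obR X l0] this]
    have "x \<triangleleft>\<^bsub>X\<^esub> ?d (e \<one>) = \<zero>\<^bsub>X\<^esub>" using cR by (auto simp: mor_eq_iff)
    then show "x \<in> {\<zero>\<^bsub>X\<^esub>}" using d[of \<one>] xX rX by simp
  qed
  moreover have "\<exists>z\<in>carrier X. graph AA (\<lambda>a. z \<triangleleft>\<^bsub>X\<^esub> a) \<subseteq> G" if G: "qmor AA X G" for G
  proof -
    \<comment> \<open>G is moved to the copy of A in the universe, where it is given by a roof.
      Extending the numerator over the denominator gives a map g, and z is the value of g at the
      unit.\<close>
    let ?G = "graph ?R ?d O G"
    have q: "qmor ?R X ?G" by (rule qmor_graph_comp[OF rR rmod_regular rX ld G])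
    obtain W s f where W: "ob W" "qiso W ?R s" "linear W X f" "span W s f = ?G"
      using realize_qmor[OF obR X qmor_pre[OF q]] .
    have ls: "linear W ?R s" using W by (simp add: qiso_def)
    obtain g where g: "linear ?R X g" "mor ?R X g \<cdot>\<^bsub>mods\<^esub> mor W ?R s = mor W X f"
      using ext(1)[OF W(1) ls W(1,2) mor_in[OF W(1) X W(3)]] by (auto elim!: homE)
    have gs: "g (s w) = f w" if "w \<in> carrier W" for w
      using g(2) that ls by (simp add: mor_eq_iff)
    have "?G \<subseteq> qgraph ?R X g"
    proof -
      have "?G \<subseteq> graph ?R g" unfolding W(4)[symmetric] using gs linearD(1)[OF ls] by (auto simp: span_def graph_iff)
      then show ?thesis using graph_subset_qgraph[OF rR rX g(1)] by blast
    qed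
    then have eq: "?G = qgraph ?R X g" by (rule qmor_subset_eq[OF rR rX q qmor_graph[OF rR rX g(1)]])
    define z where "z = g (e \<one>)"
    have z: "z \<in> carrier X" using linearD(1)[OF g(1), of "e \<one>"] cR by (auto simp: z_def)
    have "(a, z \<triangleleft>\<^bsub>X\<^esub> a) \<in> G" if a: "a \<in> carrier A" for a
    proof -
      have ea: "e \<one> \<in> carrier ?R" "e a \<in> carrier ?R" using cR a by auto
      have "e a = e \<one> \<triangleleft>\<^bsub>?R\<^esub> a" using linearD(3)[OF le, of \<one> a] a by simp
      then have "g (e a) = z \<triangleleft>\<^bsub>X\<^esub> a" using linearD(3)[OF g(1) ea(1) a] by (simp add: z_def)
      then have "(e a, z \<triangleleft>\<^bsub>X\<^esub> a) \<in> qgraph ?R X g"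
        using graph_subset_qgraph[OF rR rX g(1)] ea by (auto simp: graph_iff)
      then show ?thesis using d[OF a] unfolding eq[symmetric] by (auto simp: graph_iff)
    qed
    then show ?thesis using z by (intro bexI[of _ z]) (auto simp: graph_iff)
  qed
  ultimately show ?thesis using rX by (simp add: eclosed_def)
qed

text \<open>Universal arrows are chosen with value X and identity counit at X, and arbitrarily
  elsewhere. By uniqueness of factorizations the unit at X is then the identity.\<close>

lemma adjoint_exists:
  assumes K: "K = UNIV" and \<phi>: "\<And>Y :: ('a, 'u) rmodule. rmod Y \<Longrightarrow> \<exists>\<phi> :: ('a \<times> 'u) set \<Rightarrow> 'u. inj_on \<phi> {G. qmor AA Y G}"
    and X: "eclosed X"
  shows "\<exists>\<omega> \<eta> \<epsilon>. adjunction mods quot pi_functor \<omega> \<eta> \<epsilon> \<and> is_iso mods (\<eta> X)"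
proof -
  interpret T: category mods by (rule category_mods)
  have KU: "X \<in> K" for X using K by simp
  have rX: "rmod X" using X by (simp add: eclosed_def)
  have "\<exists>R E. universal (R :: ('a, 'u) rmodule) Y E \<and> (Y = X \<longrightarrow> R = X \<and> E = qgraph X X (\<lambda>x. x))"
    if Y: "rmod Y" for Y :: "('a, 'u) rmodule"
  proof (cases "Y = X")
    case True
    then show ?thesis using universal_eclosed[OF X] by blast
  next
    case False
    then show ?thesis using universal_transport[OF Y] \<phi>[OF Y] by blast
  qed
  then obtain R E where RE: "\<And>Y. rmod Y \<Longrightarrow> universal (R Y :: ('a, 'u) rmodule) Y (E Y)"
    and REX: "R X = X" "E X = qgraph X X (\<lambda>x. x)"
    using rX by metis
  have R: "rmod (R Y)" and E: "qmor (R Y) Y (E Y)" if "rmod Y" for Y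
    using RE[OF that] by (auto simp: universal_def)
  let ?\<epsilon> = "\<lambda>Y. qarr (R Y) Y (E Y)"
  have comp: "?\<epsilon> Y \<cdot>\<^bsub>quot\<^esub> arr_map pi_functor (mor W (R Y) h) = qarr W Y (graph W h O E Y)"
    if "rmod W" "rmod Y" "linear W (R Y) h" for W Y h
    using that R[OF that(2)] E[OF that(2)] KU
    by (simp add: pi_arr Comp_quot qmor_graph qcomp_qgraph_left[of W "R Y" Y])
  have univ: "\<exists>!h. h \<in> hom_set mods W (R Y) \<and> ?\<epsilon> Y \<cdot>\<^bsub>quot\<^esub> arr_map pi_functor h = g"
    if W: "W \<in> Obj mods" and Y: "Y \<in> Obj quot" and g: "g \<in> hom_set quot (obj_map pi_functor W) Y" for W Y g
  proof -
    have r: "rmod W" "rmod Y" using W Y by (auto simp: mods_simps Obj_quot)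
    obtain G where G: "qmor W Y G" "g = qarr W Y G" using g by (auto elim: hom_quotE)
    obtain h where h: "linear W (R Y) h" "graph W h O E Y = G"
      using universal_arrow(1)[OF RE[OF r(2)] r(1) G(1)] by blast
    show ?thesis
    proof (intro ex1I conjI)
      show "mor W (R Y) h \<in> hom_set mods W (R Y)" using h r R KU by (simp add: mor_in)
      show "?\<epsilon> Y \<cdot>\<^bsub>quot\<^esub> arr_map pi_functor (mor W (R Y) h) = g" using comp[OF r h(1)] h(2) G by simp
      fix k assume k: "k \<in> hom_set mods W (R Y) \<and> ?\<epsilon> Y \<cdot>\<^bsub>quot\<^esub> arr_map pi_functor k = g"
      then obtain h' where h': "linear W (R Y) h'" "k = mor W (R Y) h'" by (auto elim: homE)
      have "qarr W Y G = qarr W Y (graph W h' O E Y)" using k h' comp[OF r h'(1)] G by simp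
      then have "graph W h' O E Y = graph W h O E Y" using qarr_inject[of W Y G] r KU G h(2) by simp
      then show "k = mor W (R Y) h"
        using universal_arrow(2)[OF RE[OF r(2)] r(1) h'(1) h(1)] h'(2) by (simp add: mor_eq_iff)
    qed
  qed
  obtain \<omega> \<eta> where adj: "adjunction mods quot pi_functor \<omega> \<eta> ?\<epsilon>" and o: "obj_map \<omega> = R"
    by (rule universal_arrows_adjunction[of mods quot pi_functor R ?\<epsilon>, OF pi_is_functor _ _ univ])
      (use R E KU in \<open>auto simp: mods_simps Obj_quot intro: hom_quotI\<close>)
  have XO: "X \<in> Obj mods" "X \<in> Obj quot" using rX KU by (auto simp: mods_simps Obj_quot)
  have obX: "ob X" using rX KU by simp
  have "nat_trans mods mods id_functor (comp_functor \<omega> pi_functor) \<eta>" using adj by (simp add: adjunction_def)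
  from nat_transD(1)[OF this XO(1)] have \<eta>: "\<eta> X \<in> hom_set mods X (R X)"
    by (simp add: id_functor_def comp_functor_def o)
  have tri: "?\<epsilon> X \<cdot>\<^bsub>quot\<^esub> arr_map pi_functor (\<eta> X) = Ident quot X"
    using adj XO by (simp add: adjunction_def)
  have "?\<epsilon> X \<cdot>\<^bsub>quot\<^esub> arr_map pi_functor (mor X X (\<lambda>x. x)) = Ident quot X"
    using obX by (simp add: REX pi_arr linear_id Comp_quot qmor_graph qcomp_qgraph_qgraph[of X X X] Ident_quot)
  moreover have "mor X X (\<lambda>x. x) \<in> hom_set mods X (R X)" using obX by (simp add: REX mor_in linear_id)
  moreover have "Ident quot X \<in> hom_set quot (obj_map pi_functor X) X"
    using category.Ident_in[OF category_quot XO(2)] by simp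
  ultimately have "\<eta> X = mor X X (\<lambda>x. x)"
    using univ[OF XO] \<eta> tri by blast
  then have "\<eta> X = Ident mods X" by (simp add: mods_simps)
  then have "is_iso mods (\<eta> X)"
    using is_isoI[OF T.Ident_in[OF XO(1)] T.Ident_in[OF XO(1)]] T.Ident_left[OF T.Ident_in[OF XO(1)]] by simp
  then show ?thesis using adj by blast
qed

end

context gabriel
begin

lemma F_closedI:
  fixes X :: "('a, 'u) rmodule" and e :: "'a \<Rightarrow> 'u"
  assumes A: "right_noetherian A" and e: "universe_embedding A e" and X: "eclosed X"
  shows "F_closed A F X"
proof -
  have inf: "infinite (UNIV :: 'u set)" and inj: "inj_on e (carrier A)"
    using e by (auto simp: universe_embedding_def)
  interpret U: gabriel_universe A F "UNIV :: ('a, 'u) rmodule set"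
    by (rule gabriel_universe_UNIV[OF ring_axioms gabriel inf])
  show ?thesis
    unfolding F_closed_def U.quotient_data_UNIV[OF refl]
    using U.adjoint_exists[OF refl hom_mod_embedding[OF A _ inj inf] X] X
    by (simp add: U.mods_simps eclosed_def)
qed

lemma F_closedD:
  fixes X :: "('a, 'u) rmodule" and e :: "'a \<Rightarrow> 'u"
  assumes X: "F_closed A F X" and e: "universe_embedding A e"
  shows "eclosed X"
proof -
  have inf: "infinite (UNIV :: 'u set)" and inj: "inj_on e (carrier A)"
    using e by (auto simp: universe_embedding_def)
  interpret U: gabriel_universe A F "UNIV :: ('a, 'u) rmodule set"
    by (rule gabriel_universe_UNIV[OF ring_axioms gabriel inf])
  show ?thesis
    using X U.eclosed_if_adjoint[OF _ _ _ inj]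
    unfolding F_closed_def U.quotient_data_UNIV[OF refl] by (auto simp: U.mods_simps)
qed

end

subsection \<open>Preadditive categories\<close>

context preadditive_category
begin

lemma hom_module_simps [simp]:
  "carrier (hom_module C X Y) = hom_set C X Y" "zero (hom_module C X Y) = Zero C X Y"
  "add (hom_module C X Y) = Add C" "act (hom_module C X Y) = Comp C"
  by (simp_all add: hom_module_def)

lemma End_ring_simps [simp]:
  "carrier (End_ring C M) = hom_set C M M" "zero (End_ring C M) = Zero C M M"
  "add (End_ring C M) = Add C" "mult (End_ring C M) = Comp C" "one (End_ring C M) = Ident C M"
  by (simp_all add: End_ring_def)

lemma
  assumes "X \<in> Obj C" "Y \<in> Obj C"
  shows Add_in: "\<lbrakk>f \<in> hom_set C X Y; g \<in> hom_set C X Y\<rbrakk> \<Longrightarrow> Add C f g \<in> hom_set C X Y"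
    and Zero_in: "Zero C X Y \<in> hom_set C X Y"
    and Add_assoc: "\<lbrakk>f \<in> hom_set C X Y; g \<in> hom_set C X Y; h \<in> hom_set C X Y\<rbrakk>
      \<Longrightarrow> Add C (Add C f g) h = Add C f (Add C g h)"
    and Add_comm: "\<lbrakk>f \<in> hom_set C X Y; g \<in> hom_set C X Y\<rbrakk> \<Longrightarrow> Add C f g = Add C g f"
    and Add_Zero_left: "f \<in> hom_set C X Y \<Longrightarrow> Add C (Zero C X Y) f = f"
    and Add_Zero_right: "f \<in> hom_set C X Y \<Longrightarrow> Add C f (Zero C X Y) = f"
    and Add_neg: "f \<in> hom_set C X Y \<Longrightarrow> \<exists>g\<in>hom_set C X Y. Add C g f = Zero C X Y"
proof -
  interpret H: abelian_group "hom_module C X Y" by (rule hom_abelian_group[OF assms])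
  show "\<lbrakk>f \<in> hom_set C X Y; g \<in> hom_set C X Y\<rbrakk> \<Longrightarrow> Add C f g \<in> hom_set C X Y"
    using H.a_closed by simp
  show "Zero C X Y \<in> hom_set C X Y" using H.zero_closed by simp
  show "\<lbrakk>f \<in> hom_set C X Y; g \<in> hom_set C X Y; h \<in> hom_set C X Y\<rbrakk>
      \<Longrightarrow> Add C (Add C f g) h = Add C f (Add C g h)" using H.a_assoc by simp
  show "\<lbrakk>f \<in> hom_set C X Y; g \<in> hom_set C X Y\<rbrakk> \<Longrightarrow> Add C f g = Add C g f" using H.a_comm[of f g] by simp
  show "f \<in> hom_set C X Y \<Longrightarrow> Add C (Zero C X Y) f = f" using H.l_zero by simp
  show "f \<in> hom_set C X Y \<Longrightarrow> Add C f (Zero C X Y) = f" using H.r_zero by simp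
  show "f \<in> hom_set C X Y \<Longrightarrow> \<exists>g\<in>hom_set C X Y. Add C g f = Zero C X Y"
    using H.l_neg[of f] H.a_inv_closed[of f] by auto
qed

lemma Add_idem_Zero:
  assumes "f \<in> hom_set C X Y" "Add C f f = f"
  shows "f = Zero C X Y"
proof -
  note XY = hom_set_Obj[OF assms(1)]
  obtain g where g: "g \<in> hom_set C X Y" "Add C g f = Zero C X Y" using Add_neg[OF XY assms(1)] by auto
  have "Add C g (Add C f f) = f"
    by (simp add: Add_assoc[OF XY g(1) assms(1,1), symmetric] g Add_Zero_left[OF XY assms(1)])
  then show ?thesis using assms(2) g(2) by simp
qed

lemma Comp_Zero_right:
  assumes "g \<in> hom_set C Y Z" "X \<in> Obj C"
  shows "g \<cdot> Zero C X Y = Zero C X Z"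
proof -
  note YZ = hom_set_Obj[OF assms(1)]
  note z = Zero_in[OF assms(2) YZ(1)]
  show ?thesis
    by (rule Add_idem_Zero[OF Comp_in[OF z assms(1)]])
      (simp add: Comp_Add_right[OF z z assms(1), symmetric] Add_Zero_left[OF assms(2) YZ(1) z])
qed

lemma Comp_Zero_left:
  assumes "f \<in> hom_set C X Y" "Z \<in> Obj C"
  shows "Zero C Y Z \<cdot> f = Zero C X Z"
proof -
  note XY = hom_set_Obj[OF assms(1)]
  note z = Zero_in[OF XY(2) assms(2)]
  show ?thesis
    by (rule Add_idem_Zero[OF Comp_in[OF assms(1) z]])
      (simp add: Comp_Add_left[OF assms(1) z z, symmetric] Add_Zero_left[OF XY(2) assms(2) z])
qed

lemma ring_End:
  assumes M: "M \<in> Obj C"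
  shows "ring (End_ring C M)"
proof (rule ringI)
  show "abelian_group (End_ring C M)"
    by (rule abelian_groupI)
      (use Add_in[OF M M] Zero_in[OF M M] Add_assoc[OF M M] Add_Zero_left[OF M M] Add_neg[OF M M]
        in \<open>auto intro: Add_comm[OF M M]\<close>)
  show "monoid (End_ring C M)"
    by (rule monoidI) (auto simp: Ident_left Ident_right Ident_in[OF M] Comp_in
      intro!: Comp_assoc Comp_in)
qed (auto intro!: Comp_Add_left Comp_Add_right)

lemma right_module_hom:
  assumes M: "M \<in> Obj C" and X: "X \<in> Obj C"
  shows "right_module (End_ring C M) (hom_module C M X)"
  by (intro right_module.intro right_module_axioms.intro ring_End hom_abelian_group M X)
    (auto intro: Comp_in Comp_Add_left Comp_Add_right Comp_assoc[symmetric] Ident_right)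

lemma linear_postcomp:
  assumes M: "M \<in> Obj C" and f: "f \<in> hom_set C X Y"
  shows "right_modules.linear (End_ring C M) (hom_module C M X) (hom_module C M Y) (\<lambda>g. f \<cdot> g)"
proof -
  interpret right_modules "End_ring C M" using ring_End[OF M] by (simp add: right_modules_def)
  show ?thesis using f by (auto simp: linear_def intro: Comp_in Comp_Add_right Comp_assoc[symmetric])
qed

lemma G_projective_iff:
  assumes M: "M \<in> Obj C" and G: "\<And>I. I \<in> G \<Longrightarrow> I \<subseteq> hom_set C M M"
  shows "G_projective C M G \<longleftrightarrow> (\<forall>X\<in>Obj C. \<forall>Y\<in>Obj C. \<forall>p\<in>hom_set C X Y. is_epi C p \<longrightarrow>
    (\<forall>g\<in>hom_set C M Y. \<exists>I\<in>G. \<forall>a\<in>I. \<exists>h\<in>hom_set C M X. g \<cdot> a = p \<cdot> h))"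
proof -
  interpret right_modules "End_ring C M" using ring_End[OF M] by (simp add: right_modules_def)
  have "torsion_module G (quot_module (hom_module C M Y) ((\<lambda>g. p \<cdot> g) ` hom_set C M X)) \<longleftrightarrow>
      (\<forall>g\<in>hom_set C M Y. \<exists>I\<in>G. \<forall>a\<in>I. \<exists>h\<in>hom_set C M X. g \<cdot> a = p \<cdot> h)"
    if X: "X \<in> Obj C" and Y: "Y \<in> Obj C" and p: "p \<in> hom_set C X Y" for X Y p
  proof -
    note r = right_module_hom[OF M X] right_module_hom[OF M Y]
    have sub: "submodule (End_ring C M) (hom_module C M Y) ((\<lambda>g. p \<cdot> g) ` hom_set C M X)"
      using submodule_image[OF linear_postcomp[OF M p] r submodule_carrier[OF r(1)]] by simp
    show ?thesis
      by (subst torsion_quot_module_iff[OF r(2) sub]) (use G in \<open>auto simp: image_iff\<close>)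
  qed
  then show ?thesis unfolding G_projective_def by (simp cong: ball_cong)
qed

text \<open>A biproduct of P and Q extends the coproduct by one summand. The hypotheses are
  equations between arrows, so for the quotient category they can be verified on module maps and
  carried over by \<open>\<pi>\<close>.\<close>

lemma coproduct_Suc:
  assumes P: "is_coproduct C r X P j" and Q: "X r = Q"
    and i: "i1 \<in> hom_set C P W" "i2 \<in> hom_set C Q W" "p1 \<in> hom_set C W P" "p2 \<in> hom_set C W Q"
    and id: "p1 \<cdot> i1 = Ident C P" "p2 \<cdot> i2 = Ident C Q" "p1 \<cdot> i2 = Zero C Q P" "p2 \<cdot> i1 = Zero C P Q"
      "Add C (i1 \<cdot> p1) (i2 \<cdot> p2) = Ident C W"
  shows "is_coproduct C (Suc r) X W (\<lambda>k. if k < r then i1 \<cdot> j k else i2)"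
  unfolding is_coproduct_def
proof (intro conjI allI ballI impI)
  have PO: "P \<in> Obj C" and j: "\<And>k. k < r \<Longrightarrow> j k \<in> hom_set C (X k) P" using P by (auto simp: is_coproduct_def)
  have QO: "Q \<in> Obj C" using hom_set_Obj[OF i(2)] by auto
  show W: "W \<in> Obj C" using hom_set_Obj[OF i(1)] by auto
  show "(if k < r then i1 \<cdot> j k else i2) \<in> hom_set C (X k) W" if "k < Suc r" for k
    using that j[of k] i Q by (auto intro: Comp_in simp: less_Suc_eq)
  fix Y f assume Y: "Y \<in> Obj C" and f: "\<forall>k<Suc r. f k \<in> hom_set C (X k) Y"
  have "\<exists>!h. h \<in> hom_set C P Y \<and> (\<forall>k<r. h \<cdot> j k = f k)"
    using P Y f by (simp add: is_coproduct_def)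
  then obtain h where h: "h \<in> hom_set C P Y" "\<And>k. k < r \<Longrightarrow> h \<cdot> j k = f k"
    and uniq: "\<And>h'. h' \<in> hom_set C P Y \<Longrightarrow> (\<And>k. k < r \<Longrightarrow> h' \<cdot> j k = f k) \<Longrightarrow> h' = h"
    by blast
  have fr: "f r \<in> hom_set C Q Y" using f Q by auto
  note hp = Comp_in[OF i(3) h(1)] and fp = Comp_in[OF i(4) fr]
  let ?u = "Add C (h \<cdot> p1) (f r \<cdot> p2)"
  have u: "?u \<in> hom_set C W Y" by (rule Add_in[OF W Y hp fp])
  have u1: "?u \<cdot> i1 = h"
    by (simp add: Comp_Add_left[OF i(1) hp fp] Comp_assoc[OF i(1,3) h(1)] Comp_assoc[OF i(1,4) fr] id
      Ident_right[OF h(1)] Comp_Zero_right[OF fr PO] Add_Zero_right[OF PO Y h(1)])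
  have u2: "?u \<cdot> i2 = f r"
    by (simp add: Comp_Add_left[OF i(2) hp fp] Comp_assoc[OF i(2,3) h(1)] Comp_assoc[OF i(2,4) fr] id
      Ident_right[OF fr] Comp_Zero_right[OF h(1) QO] Add_Zero_left[OF QO Y fr])
  show "\<exists>!h. h \<in> hom_set C W Y \<and> (\<forall>k<Suc r. h \<cdot> (if k < r then i1 \<cdot> j k else i2) = f k)"
  proof (intro ex1I conjI allI impI)
    show "?u \<cdot> (if k < r then i1 \<cdot> j k else i2) = f k" if "k < Suc r" for k
      using that u1 u2 h(2)[of k] Comp_assoc[OF j[of k] i(1) u] by (auto simp: less_Suc_eq)
    fix h' assume h': "h' \<in> hom_set C W Y \<and> (\<forall>k<Suc r. h' \<cdot> (if k < r then i1 \<cdot> j k else i2) = f k)"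
    then have h'W: "h' \<in> hom_set C W Y" by simp
    have "h' \<cdot> i1 = h"
    proof (rule uniq[OF Comp_in[OF i(1) h'W]])
      fix k assume k: "k < r"
      then have "h' \<cdot> (i1 \<cdot> j k) = f k" using h' by (metis less_Suc_eq)
      then show "(h' \<cdot> i1) \<cdot> j k = f k" by (simp add: Comp_assoc[OF j[OF k] i(1) h'W])
    qed
    moreover have "h' \<cdot> i2 = f r" using h' by (metis less_irrefl lessI)
    moreover have "h' = Add C ((h' \<cdot> i1) \<cdot> p1) ((h' \<cdot> i2) \<cdot> p2)"
      by (simp add: Comp_assoc[OF i(3,1) h'W] Comp_assoc[OF i(4,2) h'W] id(5) Ident_right[OF h'W]
        Comp_Add_right[OF Comp_in[OF i(3,1)] Comp_in[OF i(4,2)] h'W, symmetric])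
    ultimately show "h' = ?u" by simp
  qed (rule u)
qed

end

lemma is_epiI:
  assumes "category C" "p \<in> hom_set C X Y"
    "\<And>Z g h. \<lbrakk>g \<in> hom_set C Y Z; h \<in> hom_set C Y Z; g \<cdot>\<^bsub>C\<^esub> p = h \<cdot>\<^bsub>C\<^esub> p\<rbrakk> \<Longrightarrow> g = h"
  shows "is_epi C p"
  unfolding is_epi_def using assms by (auto simp: hom_set_def)

lemma is_epiD:
  assumes "is_epi C p" "p \<in> hom_set C X Y" "g \<in> hom_set C Y Z" "h \<in> hom_set C Y Z" "g \<cdot>\<^bsub>C\<^esub> p = h \<cdot>\<^bsub>C\<^esub> p"
  shows "g = h"
  using assms by (auto simp: is_epi_def hom_set_def)


subsection \<open>Ampleness of the image of a closed ring\<close>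

context gabriel
begin

text \<open>At each x in S the common values of G and H are defined on an ideal in F, so x is
  saturated over the domain of the intersection of G and H. This domain is then dense, and the
  intersection is a pre-morphism inside both.\<close>

lemma qmor_eq_if_generators:
  assumes X: "rmod X" and Y: "rmod Y" and G: "qmor X Y G" and H: "qmor X Y H"
    and S: "S \<subseteq> carrier X" and d: "dense X (gen X S)"
    and eq: "\<And>x. x \<in> S \<Longrightarrow> graph AA (\<lambda>a. x \<triangleleft>\<^bsub>X\<^esub> a) O G = graph AA (\<lambda>a. x \<triangleleft>\<^bsub>X\<^esub> a) O H"
  shows "G = H"
proof -
  note P = rmod_prod[OF X Y]
  have sub: "submodule A (prod_mod X Y) (G \<inter> H)"
    using submodule_Int[OF P pre_morD pre_morD] qmor_pre G H by blast
  note E = submodule_Domain[OF sub X Y]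
  have "S \<subseteq> sat X (Domain (G \<inter> H))"
  proof
    fix x assume x: "x \<in> S"
    then have xX: "x \<in> carrier X" using S by auto
    let ?D = "graph AA (\<lambda>a. x \<triangleleft>\<^bsub>X\<^esub> a) O G"
    have "dense AA (Domain ?D)" using qmor_act_comp[OF X Y G xX] by (simp add: qmor_def pre_mor_def)
    then obtain I where I: "I \<in> F" "\<And>a. a \<in> I \<Longrightarrow> a \<in> carrier A" "\<And>a. a \<in> I \<Longrightarrow> \<one> \<triangleleft>\<^bsub>AA\<^esub> a \<in> Domain ?D"
      by (rule denseE) auto
    show "x \<in> sat X (Domain (G \<inter> H))"
    proof (rule satI[OF xX I(1)])
      fix a assume a: "a \<in> I"
      then obtain y where y: "(a, y) \<in> ?D" using I(2,3)[OF a] by auto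
      then have "(x \<triangleleft>\<^bsub>X\<^esub> a, y) \<in> G" by (auto simp: graph_iff)
      moreover have "(x \<triangleleft>\<^bsub>X\<^esub> a, y) \<in> H" using y unfolding eq[OF x] by (auto simp: graph_iff)
      ultimately show "x \<triangleleft>\<^bsub>X\<^esub> a \<in> Domain (G \<inter> H)" by blast
    qed
  qed
  then have "gen X S \<subseteq> sat X (Domain (G \<inter> H))" by (rule gen_least[OF submodule_sat[OF X E]])
  then have "dense X (Domain (G \<inter> H))" by (rule dense_sat[OF d E X])
  then have "pre_mor X Y (G \<inter> H)" using sub G by (auto simp: pre_mor_def qmor_def)
  then show ?thesis using qmor_eqI[OF X Y _ G H] by blast
qed

lemma qcomp_qgraph_right:
  assumes X: "rmod X" and Y: "rmod Y" and Z: "rmod Z" and G: "qmor X Y G" and h: "linear Y Z h"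
  shows "qcomp X Z G (qgraph Y Z h) = sat (prod_mod X Z) (G O graph Y h)"
proof (rule qmor_eq_sat[OF X Z pre_mor_comp[OF X Y Z qmor_pre[OF G] pre_mor_graph[OF Y Z h]]
      qmor_comp[OF X Y Z G qmor_graph[OF Y Z h]]])
  have "G O graph Y h \<subseteq> G O qgraph Y Z h" using graph_subset_qgraph[OF Y Z h] by blast
  then show "G O graph Y h \<subseteq> qcomp X Z G (qgraph Y Z h)"
    using relcomp_subset_qcomp[OF X Y Z G qmor_graph[OF Y Z h]] by blast
qed

end

context gabriel_universe
begin

text \<open>The projection of Y modulo the range of G and the zero map agree after G. As G
  represents an epimorphism they are equal in the quotient category, which says that the class of
  every y is torsion.\<close>

lemma dense_Range_if_epi:
  assumes X: "ob X" and Y: "ob Y" and G: "qmor X Y G" and epi: "is_epi quot (qarr X Y G)"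
  shows "dense Y (Range G)"
proof -
  have r: "rmod X" "rmod Y" using X Y by auto
  have "submodule A Y (Range G)"
    using submodule_Domain[OF submodule_converse[OF pre_morD[OF qmor_pre[OF G]] r] r(2,1)] by simp
  from quotient_exists[OF r(2) this]
  obtain Q :: "('a, 'u) rmodule" and q where Q: "rmod Q" "linear Y Q q" "q ` carrier Y = carrier Q"
    "\<forall>y\<in>carrier Y. q y = \<zero>\<^bsub>Q\<^esub> \<longleftrightarrow> y \<in> Range G" by metis
  have obQ: "ob Q" using Q K_epi[of Y Q q] Y by auto
  note z = linear_const_zero[OF r(2) Q(1)]
  have q0: "q y = \<zero>\<^bsub>Q\<^esub>" if "(x, y) \<in> G" for x y
    using Q(4) that rel_submoduleD(2)[OF pre_morD[OF qmor_pre[OF G]] r that] by blast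
  have "G O graph Y q = G O graph Y (\<lambda>_. \<zero>\<^bsub>Q\<^esub>)"
  proof (intro equalityI subrelI)
    fix x z assume "(x, z) \<in> G O graph Y q"
    then obtain y where "(x, y) \<in> G" "(y, z) \<in> graph Y q" by (rule relcompEpair)
    then show "(x, z) \<in> G O graph Y (\<lambda>_. \<zero>\<^bsub>Q\<^esub>)"
      using q0[of x y] by (intro relcompI[of x y]) (simp_all add: graph_iff)
  next
    fix x z assume "(x, z) \<in> G O graph Y (\<lambda>_. \<zero>\<^bsub>Q\<^esub>)"
    then obtain y where "(x, y) \<in> G" "(y, z) \<in> graph Y (\<lambda>_. \<zero>\<^bsub>Q\<^esub>)" by (rule relcompEpair)
    then show "(x, z) \<in> G O graph Y q"
      using q0[of x y] by (intro relcompI[of x y]) (simp_all add: graph_iff)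
  qed
  then have "qcomp X Q G (qgraph Y Q q) = qcomp X Q G (qgraph Y Q (\<lambda>_. \<zero>\<^bsub>Q\<^esub>))"
    by (simp add: qcomp_qgraph_right[OF r Q(1) G Q(2)] qcomp_qgraph_right[OF r Q(1) G z])
  then have "qarr Y Q (qgraph Y Q q) = qarr Y Q (qgraph Y Q (\<lambda>_. \<zero>\<^bsub>Q\<^esub>))"
    using qmor_graph[OF r(2) Q(1) Q(2)] qmor_graph[OF r(2) Q(1) z]
    by (intro is_epiD[OF epi hom_quotI[OF X Y G] hom_quotI[OF Y obQ] hom_quotI[OF Y obQ]])
      (simp_all only: Comp_quot[OF X Y obQ G])
  then have eq: "qgraph Y Q q = qgraph Y Q (\<lambda>_. \<zero>\<^bsub>Q\<^esub>)"
    using qarr_inject[OF Y obQ qmor_graph[OF r(2) Q(1) Q(2)]] by simp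
  show ?thesis
    unfolding dense_def
  proof
    fix y assume y: "y \<in> carrier Y"
    then have "(y, q y) \<in> qgraph Y Q (\<lambda>_. \<zero>\<^bsub>Q\<^esub>)"
      using graph_subset_qgraph[OF r(2) Q(1,2)] eq by (auto simp: graph_iff)
    then obtain I where I: "I \<in> F" "\<forall>a\<in>I. (y \<triangleleft>\<^bsub>Y\<^esub> a, q y \<triangleleft>\<^bsub>Q\<^esub> a) \<in> graph Y (\<lambda>_. \<zero>\<^bsub>Q\<^esub>)"
      unfolding sat_prod_iff by blast
    show "y \<in> sat Y (Range G)"
    proof (rule satI[OF y I(1)])
      fix a assume a: "a \<in> I"
      have aA: "a \<in> carrier A" by (rule F_carrierD[OF I(1) a])
      have "q (y \<triangleleft>\<^bsub>Y\<^esub> a) = \<zero>\<^bsub>Q\<^esub>" using I(2) a linearD(3)[OF Q(2) y aA] by (auto simp: graph_iff)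
      then show "y \<triangleleft>\<^bsub>Y\<^esub> a \<in> Range G" using Q(4) y aA r by simp
    qed
  qed
qed

text \<open>X modulo itself is a zero module, and it stays in K as an epimorphic image.\<close>

lemma zero_object:
  assumes X: "ob X"
  obtains Z where "ob Z" "carrier Z = {\<zero>\<^bsub>Z\<^esub>}"
proof -
  have r: "rmod X" using X by auto
  obtain Q :: "('a, 'u) rmodule" and q where Q: "rmod Q" "linear X Q q" "q ` carrier X = carrier Q"
    "\<forall>y\<in>carrier X. q y = \<zero>\<^bsub>Q\<^esub> \<longleftrightarrow> y \<in> carrier X"
    using quotient_exists[OF r submodule_carrier[OF r]] by metis
  then have "carrier Q = {\<zero>\<^bsub>Q\<^esub>}" using rmod_simps(2)[OF r] rmod_simps(2)[OF Q(1)] by force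
  moreover have "ob Q" using Q K_epi[of X Q q] X by auto
  ultimately show ?thesis using that by blast
qed

lemma coproduct_quot:
  assumes X: "ob X"
  shows "\<exists>P j. is_coproduct quot r (\<lambda>_. X) P j"
proof (induction r)
  case 0
  obtain Z where Z: "ob Z" "carrier Z = {\<zero>\<^bsub>Z\<^esub>}" using zero_object[OF X] .
  have "\<exists>!h. h \<in> hom_set quot Z Y" if Y: "ob Y" for Y
  proof (rule ex1I)
    have r: "rmod Z" "rmod Y" using Z Y by auto
    let ?z = "qarr Z Y (qgraph Z Y (\<lambda>_. \<zero>\<^bsub>Y\<^esub>))"
    note q = qmor_graph[OF r linear_const_zero[OF r]]
    show "?z \<in> hom_set quot Z Y" using Z(1) Y q by (rule hom_quotI)
    fix h assume "h \<in> hom_set quot Z Y"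
    then obtain G where G: "qmor Z Y G" "h = qarr Z Y G" by (rule hom_quotE)
    have "graph Z (\<lambda>_. \<zero>\<^bsub>Y\<^esub>) \<subseteq> G"
      using rel_submoduleD(3)[OF pre_morD[OF qmor_pre[OF G(1)]] r] Z(2) by (auto simp: graph_def)
    then show "h = ?z" using qmor_eq_qgraph[OF r linear_const_zero[OF r] G(1)] G(2) by simp
  qed
  then have "is_coproduct quot 0 (\<lambda>_. X) Z undefined" using Z by (simp add: is_coproduct_def Obj_quot)
  then show ?case by blast
next
  case (Suc r)
  interpret Q: preadditive_category quot by (rule preadditive_quot)
  obtain P j where P: "is_coproduct quot r (\<lambda>_. X) P j" using Suc by blast
  then have obP: "ob P" by (simp add: is_coproduct_def Obj_quot)
  have rX: "rmod X" and rP: "rmod P" using X obP by auto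
  note rW = rmod_prod[OF rP rX]
  obtain \<phi> :: "'u \<times> 'u \<Rightarrow> 'u" where "inj \<phi>" using infinite_pairing[OF infinite_universe] by auto
  then have \<phi>: "inj_on \<phi> (carrier (prod_mod P X))" by (rule inj_on_subset) simp
  let ?W = "transport_module \<phi> (prod_mod P X)" and ?d = "inv_into (carrier (prod_mod P X)) \<phi>"
  note rW' = rmod_transport[OF \<phi> rW] and l = linear_transport[OF \<phi> rW]
  have d: "?d (\<phi> p) = p" if "p \<in> carrier (prod_mod P X)" for p using \<phi> that by (rule inv_into_f_f)
  have cW: "carrier ?W = \<phi> ` (carrier P \<times> carrier X)" by (simp add: transport_module_simps)
  have l1: "linear P ?W (\<lambda>x. \<phi> (x, \<zero>\<^bsub>X\<^esub>))"
    by (rule linear_comp[OF _ l(1)]) (use rX in \<open>auto simp: linear_def\<close>)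
  have l2: "linear X ?W (\<lambda>y. \<phi> (\<zero>\<^bsub>P\<^esub>, y))"
    by (rule linear_comp[OF _ l(1)]) (use rP in \<open>auto simp: linear_def\<close>)
  have k1: "linear ?W P (\<lambda>w. fst (?d w))" by (rule linear_comp[OF l(2)]) (auto simp: linear_def)
  have k2: "linear ?W X (\<lambda>w. snd (?d w))" by (rule linear_comp[OF l(2)]) (auto simp: linear_def)
  have "?W \<in> K"
  proof (rule K_mono[OF _ _ rP rX rW' k1 k2])
    fix w assume w: "w \<in> carrier ?W" "fst (?d w) = \<zero>\<^bsub>P\<^esub>" "snd (?d w) = \<zero>\<^bsub>X\<^esub>"
    then obtain p where "p \<in> carrier P \<times> carrier X" "w = \<phi> p" using cW by auto
    then show "w = \<zero>\<^bsub>?W\<^esub>" using w d[of p] by (cases p) (auto simp: transport_module_simps)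
  qed (use X obP in auto)
  then have obW: "ob ?W" using rW' by simp
  \<comment> \<open>As \<open>\<pi>\<close> is an additive functor, the biproduct equations in the
    quotient reduce to pointwise identities between module maps.\<close>
  let ?pi = "arr_map pi_functor"
  have pi_comp: "?pi (mor Y Z g) \<cdot>\<^bsub>quot\<^esub> ?pi (mor V Y f) = ?pi (mor V Z (\<lambda>x. g (f x)))"
    if "ob V" "ob Y" "ob Z" "linear V Y f" "linear Y Z g" for V Y Z f g
    using is_functorD(6)[OF pi_is_functor mor_in mor_in, of V Y f Z g] that by simp
  have pi_cong: "?pi (mor Y Z g) = ?pi (mor Y Z g')" if "\<And>y. y \<in> carrier Y \<Longrightarrow> g y = g' y" for Y Z g g'
    using that by (intro arg_cong[where f = "arr_map pi_functor"]) (simp add: mor_eq_iff)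
  have pi_id: "?pi (mor Y Y (\<lambda>x. x)) = Ident quot Y" if "ob Y" for Y
    using that by (simp add: pi_arr linear_id Ident_quot)
  have pi_zero: "?pi (mor Y Z (\<lambda>x. \<zero>\<^bsub>Z\<^esub>)) = Zero quot Y Z" if "ob Y" "ob Z" for Y Z
    using that by (simp add: pi_arr linear_const_zero Zero_quot)
  have pi_add: "Add quot (?pi (mor Y Z g)) (?pi (mor Y Z g')) = ?pi (mor Y Z (\<lambda>x. g x \<oplus>\<^bsub>Z\<^esub> g' x))"
    if "ob Y" "ob Z" "linear Y Z g" "linear Y Z g'" for Y Z g g'
    using that by (simp add: pi_arr linear_add Add_quot qmor_graph qgraph_add)
  have "is_coproduct quot (Suc r) (\<lambda>_. X) ?W
      (\<lambda>k. if k < r then ?pi (mor P ?W (\<lambda>x. \<phi> (x, \<zero>\<^bsub>X\<^esub>))) \<cdot>\<^bsub>quot\<^esub> j k else ?pi (mor X ?W (\<lambda>y. \<phi> (\<zero>\<^bsub>P\<^esub>, y))))"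
  proof (rule Q.coproduct_Suc[OF P refl])
    show "?pi (mor P ?W (\<lambda>x. \<phi> (x, \<zero>\<^bsub>X\<^esub>))) \<in> hom_set quot P ?W"
      "?pi (mor X ?W (\<lambda>y. \<phi> (\<zero>\<^bsub>P\<^esub>, y))) \<in> hom_set quot X ?W"
      "?pi (mor ?W P (\<lambda>w. fst (?d w))) \<in> hom_set quot ?W P"
      "?pi (mor ?W X (\<lambda>w. snd (?d w))) \<in> hom_set quot ?W X"
      using is_functorD(5)[OF pi_is_functor mor_in] obP obW X l1 l2 k1 k2 by simp_all
    show "?pi (mor ?W P (\<lambda>w. fst (?d w))) \<cdot>\<^bsub>quot\<^esub> ?pi (mor P ?W (\<lambda>x. \<phi> (x, \<zero>\<^bsub>X\<^esub>))) = Ident quot P"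
      unfolding pi_comp[OF obP obW obP l1 k1] pi_id[OF obP, symmetric]
      by (rule pi_cong) (use d rX in simp)
    show "?pi (mor ?W X (\<lambda>w. snd (?d w))) \<cdot>\<^bsub>quot\<^esub> ?pi (mor X ?W (\<lambda>y. \<phi> (\<zero>\<^bsub>P\<^esub>, y))) = Ident quot X"
      unfolding pi_comp[OF X obW X l2 k2] pi_id[OF X, symmetric]
      by (rule pi_cong) (use d rP in simp)
    show "?pi (mor ?W P (\<lambda>w. fst (?d w))) \<cdot>\<^bsub>quot\<^esub> ?pi (mor X ?W (\<lambda>y. \<phi> (\<zero>\<^bsub>P\<^esub>, y))) = Zero quot X P"
      unfolding pi_comp[OF X obW obP l2 k1] pi_zero[OF X obP, symmetric]
      by (rule pi_cong) (use d rP in simp)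
    show "?pi (mor ?W X (\<lambda>w. snd (?d w))) \<cdot>\<^bsub>quot\<^esub> ?pi (mor P ?W (\<lambda>x. \<phi> (x, \<zero>\<^bsub>X\<^esub>))) = Zero quot P X"
      unfolding pi_comp[OF obP obW X l1 k2] pi_zero[OF obP X, symmetric]
      by (rule pi_cong) (use d rX in simp)
    show "Add quot (?pi (mor P ?W (\<lambda>x. \<phi> (x, \<zero>\<^bsub>X\<^esub>))) \<cdot>\<^bsub>quot\<^esub> ?pi (mor ?W P (\<lambda>w. fst (?d w))))
       (?pi (mor X ?W (\<lambda>y. \<phi> (\<zero>\<^bsub>P\<^esub>, y))) \<cdot>\<^bsub>quot\<^esub> ?pi (mor ?W X (\<lambda>w. snd (?d w)))) = Ident quot ?W"
      unfolding pi_comp[OF obW obP obW k1 l1] pi_comp[OF obW X obW k2 l2] pi_id[OF obW, symmetric]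
        pi_add[OF obW obW linear_comp[OF k1 l1] linear_comp[OF k2 l2]]
    proof (rule pi_cong)
      fix w assume "w \<in> carrier ?W"
      then obtain x y where "x \<in> carrier P" "y \<in> carrier X" "w = \<phi> (x, y)" using cW by auto
      then show "\<phi> (fst (?d w), \<zero>\<^bsub>X\<^esub>) \<oplus>\<^bsub>?W\<^esub> \<phi> (\<zero>\<^bsub>P\<^esub>, snd (?d w)) = w"
        using d rX rP by (simp add: transport_module_simps(3)[OF \<phi>])
    qed
  qed
  then show ?case by blast
qed

end

section \<open>The canonical ring isomorphism and the three conditions of ampleness\<close>

locale closed_ring = gabriel_universe A F K
  for A :: "'a ring" (structure) and F and K :: "('a, 'u) rmodule set" +
  fixes e :: "'a \<Rightarrow> 'u"
  assumes noetherian: "right_noetherian A" and K_fin_gen: "K = {X. fin_gen A X}"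
    and inj_e: "inj_on e (carrier A)" and closed: "eclosed (reg e A)"
begin

abbreviation R where "R \<equiv> reg e A"
abbreviation d where "d \<equiv> inv_into (carrier A) e"

lemmas rR = rmod_reg[OF inj_e] and le = linear_reg[OF inj_e] and ld = linear_reg_inv[OF inj_e]
  and cR = carrier_reg[OF inj_e]

lemma d_e [simp]: "a \<in> carrier A \<Longrightarrow> d (e a) = a"
  using inj_e by simp

lemma obR: "ob R"
proof -
  have one: "{\<one>} \<subseteq> carrier AA" by simp
  have "carrier AA \<subseteq> gen AA {\<one>}"
    using submoduleD(4)[OF rmod_regular submodule_gen[OF rmod_regular one], of \<one>] gen_superset[of "{\<one>}" AA]
    by auto
  moreover have "gen AA {\<one>} \<subseteq> carrier AA" by (rule gen_least[OF submodule_carrier[OF rmod_regular] one])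
  ultimately have "fin_gen A AA" using fin_gen_iff[OF rmod_regular] one by blast
  then have "fin_gen A R" by (rule fin_gen_epi[OF rmod_regular rR le, rotated]) (simp add: cR)
  then show ?thesis using rR K_fin_gen by simp
qed

text \<open>The linear map from the copy R of A that sends the unit to x.\<close>

definition elt :: "('a, 'u) rmodule \<Rightarrow> 'u \<Rightarrow> 'u \<Rightarrow> 'u" where
  "elt X x = (\<lambda>r. x \<triangleleft>\<^bsub>X\<^esub> d r)"

lemma linear_elt: "\<lbrakk>rmod X; x \<in> carrier X\<rbrakk> \<Longrightarrow> linear R X (elt X x)"
  unfolding elt_def by (rule linear_comp[OF ld linear_act])

lemma e_act: "\<lbrakk>a \<in> carrier A; b \<in> carrier A\<rbrakk> \<Longrightarrow> e a \<triangleleft>\<^bsub>R\<^esub> b = e (a \<otimes> b)"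
  using linearD(3)[OF le, of a b] by simp

lemma canonical_map_eq:
  assumes a: "a \<in> carrier A"
  shows "canonical_map e A F a = arr_map pi_functor (mor R R (elt R (e a)))"
proof -
  have "left_mult e A a = mor R R (elt R (e a))"
    using a by (auto simp: left_mult_def mor_def elt_def cR e_act fun_eq_iff restrict_def)
  then show ?thesis by (simp add: canonical_map_def quotient_data_fin_gen[OF K_fin_gen])
qed

lemma tors_R: "tors R \<subseteq> {\<zero>\<^bsub>R\<^esub>}"
  using closed by (simp add: eclosed_def)

lemma canonical_map_qarr:
  assumes a: "a \<in> carrier A"
  shows "canonical_map e A F a = qarr R R (graph R (elt R (e a)))"
proof -
  have "linear R R (elt R (e a))" by (rule linear_elt[OF rR]) (use a cR in auto)
  then show ?thesis
    using obR by (simp add: canonical_map_eq[OF a] pi_arr qgraph_torsion_free[OF rR rR _ tors_R])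
qed

lemma canonical_map_mult:
  assumes "a \<in> carrier A" "b \<in> carrier A"
  shows "canonical_map e A F (a \<otimes> b) = canonical_map e A F a \<cdot>\<^bsub>quot\<^esub> canonical_map e A F b"
proof -
  have l: "linear R R (elt R (e a))" "linear R R (elt R (e b))"
    using assms cR by (auto intro!: linear_elt rR)
  have "mor R R (elt R (e (a \<otimes> b))) = mor R R (elt R (e a)) \<cdot>\<^bsub>mods\<^esub> mor R R (elt R (e b))"
    using assms l by (auto simp: mor_eq_iff elt_def cR e_act m_assoc)
  then show ?thesis
    using is_functorD(6)[OF pi_is_functor mor_in mor_in, OF obR obR l(2) obR obR l(1)] assms
    by (simp add: canonical_map_eq)
qed

text \<open>Injectivity: R is torsion-free, so the relation of a left multiplication is its bare
  graph and shows its value at the unit. Surjectivity: closedness represents every endomorphism of R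
  in the quotient by an element of A.\<close>

lemma canonical_map_iso: "canonical_map e A F \<in> ring_iso A (End_ring quot R)"
proof -
  have l: "linear R R (elt R (e a))" if "a \<in> carrier A" for a
    using that cR by (intro linear_elt rR) auto
  interpret Q: preadditive_category quot by (rule preadditive_quot)
  have "canonical_map e A F \<in> ring_hom A (End_ring quot R)"
  proof (rule ring_hom_memI)
    fix a assume a: "a \<in> carrier A"
    show "canonical_map e A F a \<in> carrier (End_ring quot R)"
      using is_functorD(5)[OF pi_is_functor mor_in[OF obR obR l[OF a]]] by (simp add: canonical_map_eq[OF a])
    fix b assume b: "b \<in> carrier A"
    show "canonical_map e A F (a \<otimes> b) = canonical_map e A F a \<otimes>\<^bsub>End_ring quot R\<^esub> canonical_map e A F b"
      using canonical_map_mult[OF a b] by simp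
    have "mor R R (elt R (e (a \<oplus> b))) = mor R R (\<lambda>r. elt R (e a) r \<oplus>\<^bsub>R\<^esub> elt R (e b) r)"
      using a b linearD(2)[OF le, of a b] cR by (auto simp: mor_eq_iff elt_def rmod_act[OF rR])
    then show "canonical_map e A F (a \<oplus> b) = canonical_map e A F a \<oplus>\<^bsub>End_ring quot R\<^esub> canonical_map e A F b"
      using a b l obR linear_add[OF l[OF a] l[OF b] rR]
      by (simp add: canonical_map_eq pi_arr Add_quot qmor_graph qgraph_add)
  next
    have "mor R R (elt R (e \<one>)) = mor R R (\<lambda>x. x)" by (auto simp: mor_eq_iff elt_def cR e_act)
    then show "canonical_map e A F \<one> = \<one>\<^bsub>End_ring quot R\<^esub>"
      using obR by (simp add: canonical_map_eq pi_arr linear_id Ident_quot)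
  qed
  moreover have "bij_betw (canonical_map e A F) (carrier A) (carrier (End_ring quot R))"
    unfolding bij_betw_def
  proof (intro conjI inj_onI equalityI subsetI)
    fix a b assume ab: "a \<in> carrier A" "b \<in> carrier A" "canonical_map e A F a = canonical_map e A F b"
    have "qmor R R (graph R (elt R (e a)))"
      using qmor_graph[OF rR rR l[OF ab(1)]] qgraph_torsion_free[OF rR rR l[OF ab(1)] tors_R] by simp
    from qarr_inject[OF obR obR this] ab
    have "graph R (elt R (e a)) = graph R (elt R (e b))" by (simp add: canonical_map_qarr)
    moreover have "(e \<one>, elt R (e a) (e \<one>)) \<in> graph R (elt R (e a))" using cR by (auto simp: graph_iff)
    ultimately have "elt R (e a) (e \<one>) = elt R (e b) (e \<one>)" by (simp add: graph_iff)
    then have "e a = e b" using ab by (simp add: elt_def e_act)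
    then show "a = b" using inj_onD[OF inj_e] ab by blast
  next
    fix g assume "g \<in> canonical_map e A F ` carrier A"
    then show "g \<in> carrier (End_ring quot R)" using calculation by (auto dest: ring_hom_closed)
  next
    fix g assume "g \<in> carrier (End_ring quot R)"
    then obtain G where G: "qmor R R G" "g = qarr R R G" by (auto elim: hom_quotE)
    have "qmor AA R (graph AA e O G)" by (rule qmor_graph_comp[OF rmod_regular rR rR le G(1)])
    then obtain z where z: "z \<in> carrier R" "graph AA (\<lambda>a. z \<triangleleft>\<^bsub>R\<^esub> a) \<subseteq> graph AA e O G"
      using closed by (auto simp: eclosed_def)
    then obtain a where a: "a \<in> carrier A" "z = e a" using cR by auto
    have "graph R (elt R (e a)) \<subseteq> G"
    proof clarify
      fix r y assume "(r, y) \<in> graph R (elt R (e a))"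
      then obtain x where x: "x \<in> carrier A" "r = e x" "y = z \<triangleleft>\<^bsub>R\<^esub> x" using cR a by (auto simp: graph_iff elt_def)
      then have "(x, y) \<in> graph AA e O G" using z(2) by (auto simp: graph_iff subset_iff)
      then show "(r, y) \<in> G" using x by (auto simp: graph_iff)
    qed
    then have "G = qgraph R R (elt R (e a))" by (rule qmor_eq_qgraph[OF rR rR l[OF a(1)] G(1)])
    then have "g = canonical_map e A F a"
      using G(2) canonical_map_qarr[OF a(1)] qgraph_torsion_free[OF rR rR l[OF a(1)] tors_R] by simp
    then show "g \<in> canonical_map e A F ` carrier A" using a(1) by blast
  qed
  ultimately show ?thesis by (simp add: ring_iso_def)
qed

lemma Comp_elt:
  assumes X: "ob X" and Y: "ob Y" and G: "qmor X Y G" and x: "x \<in> carrier X"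
  shows "qarr X Y G \<cdot>\<^bsub>quot\<^esub> arr_map pi_functor (mor R X (elt X x)) = qarr R Y (graph R (elt X x) O G)"
    and "qmor R Y (graph R (elt X x) O G)"
proof -
  have r: "rmod X" "rmod Y" using X Y by auto
  note l = linear_elt[OF r(1) x]
  show "qarr X Y G \<cdot>\<^bsub>quot\<^esub> arr_map pi_functor (mor R X (elt X x)) = qarr R Y (graph R (elt X x) O G)"
    using X Y l G obR by (simp add: pi_arr Comp_quot qmor_graph qcomp_qgraph_left[OF rR r l G])
  show "qmor R Y (graph R (elt X x) O G)" by (rule qmor_graph_comp[OF rR r l G])
qed

text \<open>Morphisms that agree on all components of p agree at the elements of xs, hence
  everywhere by density. Both generation conditions of ampleness are instances.\<close>

lemma epi_from_generators:
  assumes X: "ob X" and S: "set xs \<subseteq> carrier X" and dense: "dense X (gen X (set xs))"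
  shows "\<exists>P j p. is_coproduct quot (length xs) (\<lambda>_. R) P j \<and> p \<in> hom_set quot P X \<and>
    (\<forall>i<length xs. p \<cdot>\<^bsub>quot\<^esub> j i = arr_map pi_functor (mor R X (elt X (xs ! i)))) \<and> is_epi quot p"
proof -
  interpret Q: category quot by (rule category_quot)
  let ?f = "\<lambda>i. arr_map pi_functor (mor R X (elt X (xs ! i)))"
  obtain P j where P: "is_coproduct quot (length xs) (\<lambda>_. R) P j" using coproduct_quot[OF obR] by blast
  have f: "?f i \<in> hom_set quot R X" if "i < length xs" for i
    using is_functorD(5)[OF pi_is_functor mor_in[OF obR X linear_elt]] X S nth_mem[OF that] by auto
  have j: "j i \<in> hom_set quot R P" if "i < length xs" for i using P that by (simp add: is_coproduct_def)
  obtain p where p: "p \<in> hom_set quot P X" "\<forall>i<length xs. p \<cdot>\<^bsub>quot\<^esub> j i = ?f i"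
  proof -
    have "\<exists>!p. p \<in> hom_set quot P X \<and> (\<forall>i<length xs. p \<cdot>\<^bsub>quot\<^esub> j i = ?f i)"
      using P f X by (simp add: is_coproduct_def Obj_quot)
    then show ?thesis using that by blast
  qed
  have "is_epi quot p"
  proof (rule is_epiI[OF category_quot p(1)])
    fix Y g h assume g: "g \<in> hom_set quot X Y" and h: "h \<in> hom_set quot X Y" and eq: "g \<cdot>\<^bsub>quot\<^esub> p = h \<cdot>\<^bsub>quot\<^esub> p"
    obtain G where Y: "ob Y" and G: "qmor X Y G" "g = qarr X Y G" using hom_quotE[OF g] .
    obtain H where H: "qmor X Y H" "h = qarr X Y H" using hom_quotE[OF h] .
    have "G = H"
    proof (rule qmor_eq_if_generators[OF _ _ G(1) H(1) S dense])
      fix x assume "x \<in> set xs"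
      then obtain i where i: "i < length xs" "x = xs ! i" by (auto simp: in_set_conv_nth)
      have x: "x \<in> carrier X" using S \<open>x \<in> set xs\<close> by auto
      have "g \<cdot>\<^bsub>quot\<^esub> ?f i = h \<cdot>\<^bsub>quot\<^esub> ?f i"
        using eq p(2) i Q.Comp_assoc[OF j[OF i(1)] p(1) g] Q.Comp_assoc[OF j[OF i(1)] p(1) h] by simp
      then have "qarr R Y (graph R (elt X x) O G) = qarr R Y (graph R (elt X x) O H)"
        using Comp_elt(1)[OF X Y G(1) x] Comp_elt(1)[OF X Y H(1) x] G(2) H(2) i by simp
      then have eq: "graph R (elt X x) O G = graph R (elt X x) O H"
        by (rule qarr_inject[OF obR Y Comp_elt(2)[OF X Y G(1) x]])
      have "graph AA (\<lambda>a. x \<triangleleft>\<^bsub>X\<^esub> a) = graph AA e O graph R (elt X x)"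
        by (auto simp: graph_iff relcomp_unfold elt_def cR dest: inj_onD[OF inj_e])
      then show "graph AA (\<lambda>a. x \<triangleleft>\<^bsub>X\<^esub> a) O G = graph AA (\<lambda>a. x \<triangleleft>\<^bsub>X\<^esub> a) O H"
        using eq by (simp add: O_assoc)
    qed (use X Y in auto)
    then show "g = h" using G H by simp
  qed
  then show ?thesis using P p by blast
qed

lemma finite_generator_R: "finite_generator quot R"
  unfolding finite_generator_def
proof
  fix X assume "X \<in> Obj quot"
  then have X: "ob X" by (simp add: Obj_quot)
  then have rX: "rmod X" by simp
  have "fin_gen A X" using X K_fin_gen by simp
  then obtain S where S: "finite S" "S \<subseteq> carrier X" "gen X S = carrier X" using fin_gen_iff[OF rX] by auto
  obtain xs where xs: "set xs = S" using finite_list[OF S(1)] by auto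
  have "dense X (gen X (set xs))"
    using subset_sat[OF rX submodule_carrier[OF rX]] S xs by (simp add: dense_def)
  then show "\<exists>r P j p. is_coproduct quot r (\<lambda>_. R) P j \<and> p \<in> hom_set quot P X \<and> is_epi quot p"
    using epi_from_generators[OF X, of xs] S xs by blast
qed

abbreviation G where "G \<equiv> (\<lambda>I. canonical_map e A F ` I) ` F"

text \<open>An ideal I in F has finitely many generators by the noetherian hypothesis, and it is
  dense in A.\<close>

lemma finitely_self_generated_R: "finitely_self_generated quot R G"
  unfolding finitely_self_generated_def
proof
  fix J assume "J \<in> G"
  then obtain I where I: "I \<in> F" "J = canonical_map e A F ` I" by auto
  obtain T where T: "finite T" "T \<subseteq> I" "I = gen AA T" using noetherian_ideal[OF noetherian F_ideal[OF I(1)]] .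
  obtain ts where ts: "set ts = T" using finite_list[OF T(1)] by auto
  have TA: "T \<subseteq> carrier A" using T(2) F_carrierD[OF I(1)] by auto
  let ?xs = "map e ts"
  have "gen R (set ?xs) = e ` I"
    using gen_linear_image[OF le rmod_regular rR, of T] TA T(3) ts by simp
  moreover have "dense R (e ` I)"
    unfolding dense_def
  proof
    fix r assume "r \<in> carrier R"
    then obtain a where a: "a \<in> carrier A" "r = e a" using cR by auto
    then have "a \<in> sat AA I" using I dense_regular_iff[OF F_ideal[OF I(1)]] by (auto simp: dense_def)
    then show "r \<in> sat R (e ` I)" unfolding a(2) by (rule linear_sat[OF le, rotated]) auto
  qed
  moreover have "set ?xs \<subseteq> carrier R" using TA ts cR by auto
  ultimately obtain P j p where p: "is_coproduct quot (length ?xs) (\<lambda>_. R) P j" "p \<in> hom_set quot P R"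
    "\<forall>i<length ?xs. p \<cdot>\<^bsub>quot\<^esub> j i = arr_map pi_functor (mor R R (elt R (?xs ! i)))" "is_epi quot p"
    using epi_from_generators[OF obR, of ?xs] by metis
  have t: "ts ! i \<in> I" "ts ! i \<in> carrier A" if "i < length ts" for i
    using nth_mem[OF that] ts TA T(2) by auto
  show "\<exists>r f P j p. (\<forall>i<r. f i \<in> J) \<and> is_coproduct quot r (\<lambda>_. R) P j \<and> p \<in> hom_set quot P R \<and>
      (\<forall>i<r. p \<cdot>\<^bsub>quot\<^esub> j i = f i) \<and> is_epi quot p"
    by (rule exI[of _ "length ts"], rule exI[of _ "\<lambda>i. canonical_map e A F (ts ! i)"])
      (use p t T(2) I(2) in \<open>auto simp: canonical_map_eq[symmetric]\<close>)
qed

text \<open>Represent g by D and the epimorphism p by P. If (a, y) is in D and (x, y b) is in P,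
  then g after multiplication by a b lifts along p, by means of x. The admissible a form an ideal in
  F and, for each of them, the b contain an ideal in F because the range of P is dense; locality
  combines the two.\<close>

lemma G_projective_R: "G_projective quot R G"
proof -
  interpret Q: preadditive_category quot by (rule preadditive_quot)
  have RO: "R \<in> Obj quot" using obR by (simp add: Obj_quot)
  have hom: "canonical_map e A F \<in> ring_hom A (End_ring quot R)"
    using canonical_map_iso by (simp add: ring_iso_def)
  have can: "canonical_map e A F a \<in> hom_set quot R R" if "a \<in> carrier A" for a
    using ring_hom_closed[OF hom that] by simp
  have G: "J \<subseteq> hom_set quot R R" if "J \<in> G" for J using that can F_carrierD by auto
  show ?thesis
  proof (rule iffD2[OF Q.G_projective_iff[OF RO]], erule G, intro ballI impI)
    fix X Y p g assume p: "p \<in> hom_set quot X Y" and epi: "is_epi quot p" and g: "g \<in> hom_set quot R Y"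
    obtain P where X: "ob X" and Y: "ob Y" and P: "qmor X Y P" "p = qarr X Y P" using hom_quotE[OF p] .
    obtain D where D: "qmor R Y D" "g = qarr R Y D" using hom_quotE[OF g] .
    have rX: "rmod X" and rY: "rmod Y" using X Y by auto
    have XO: "X \<in> Obj quot" using X by (simp add: Obj_quot)
    have dP: "dense Y (Range P)" using dense_Range_if_epi[OF X Y P(1)] epi P(2) by simp
    note DD = rel_submoduleD[OF pre_morD[OF qmor_pre[OF D(1)]] rR rY]
    note PD = rel_submoduleD[OF pre_morD[OF qmor_pre[OF P(1)]] rX rY]
    \<comment> \<open>The elements of A after which g lifts along p; the task is to show that they
      form an ideal in F.\<close>
    let ?I = "{a \<in> carrier A. \<exists>h\<in>hom_set quot R X. g \<cdot>\<^bsub>quot\<^esub> canonical_map e A F a = p \<cdot>\<^bsub>quot\<^esub> h}"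
    have sub: "submodule A AA ?I"
    proof (rule submoduleI[OF rmod_regular])
      have "canonical_map e A F \<zero> = Zero quot R R"
        using ring_hom_zero[OF hom ring_axioms Q.ring_End[OF RO]] by simp
      then have "g \<cdot>\<^bsub>quot\<^esub> canonical_map e A F \<zero> = p \<cdot>\<^bsub>quot\<^esub> Zero quot R X"
        by (simp add: Q.Comp_Zero_right[OF g RO] Q.Comp_Zero_right[OF p RO])
      then show "\<zero>\<^bsub>AA\<^esub> \<in> ?I" using Q.Zero_in[OF RO XO] by auto
    next
      fix a b assume "a \<in> ?I" "b \<in> ?I"
      then obtain h h' where h: "a \<in> carrier A" "b \<in> carrier A" "h \<in> hom_set quot R X" "h' \<in> hom_set quot R X"
        "g \<cdot>\<^bsub>quot\<^esub> canonical_map e A F a = p \<cdot>\<^bsub>quot\<^esub> h" "g \<cdot>\<^bsub>quot\<^esub> canonical_map e A F b = p \<cdot>\<^bsub>quot\<^esub> h'" by auto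
      then have "g \<cdot>\<^bsub>quot\<^esub> canonical_map e A F (a \<oplus> b) = p \<cdot>\<^bsub>quot\<^esub> Add quot h h'"
        using ring_hom_add[OF hom h(1,2)]
        by (simp add: Q.Comp_Add_right[OF can[OF h(1)] can[OF h(2)] g] Q.Comp_Add_right[OF h(3,4) p])
      then show "a \<oplus>\<^bsub>AA\<^esub> b \<in> ?I" using h Q.Add_in[OF RO XO h(3,4)] by auto
    next
      fix a b assume "a \<in> ?I" and b: "b \<in> carrier A"
      then obtain h where h: "a \<in> carrier A" "h \<in> hom_set quot R X"
        "g \<cdot>\<^bsub>quot\<^esub> canonical_map e A F a = p \<cdot>\<^bsub>quot\<^esub> h" by auto
      have "g \<cdot>\<^bsub>quot\<^esub> canonical_map e A F (a \<otimes> b) = p \<cdot>\<^bsub>quot\<^esub> (h \<cdot>\<^bsub>quot\<^esub> canonical_map e A F b)"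
        by (simp add: canonical_map_mult[OF h(1) b] Q.Comp_assoc[OF can[OF b] can[OF h(1)] g, symmetric] h(3)
          Q.Comp_assoc[OF can[OF b] h(2) p])
      then show "a \<triangleleft>\<^bsub>AA\<^esub> b \<in> ?I" using h(1) b Q.Comp_in[OF can[OF b] h(2)] by auto
    qed auto
    \<comment> \<open>Both composites are the morphism from R to Y that takes the unit to y
      b.\<close>
    have key: "a \<otimes> b \<in> ?I"
      if ab: "a \<in> carrier A" "b \<in> carrier A" and y: "(e a, y) \<in> D" and x: "(x, y \<triangleleft>\<^bsub>Y\<^esub> b) \<in> P" for a b x y
    proof -
      have yY: "y \<in> carrier Y" using DD(2)[OF y] .
      have xX: "x \<in> carrier X" using PD(1)[OF x] .
      have eab: "e (a \<otimes> b) \<in> carrier R" using ab cR by auto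
      have yb: "y \<triangleleft>\<^bsub>Y\<^esub> b \<in> carrier Y" using yY ab rY by simp
      note l = linear_elt[OF rY yb]
      have "graph R (elt R (e (a \<otimes> b))) O D = qgraph R Y (elt Y (y \<triangleleft>\<^bsub>Y\<^esub> b))"
      proof (rule qmor_eq_qgraph[OF rR rY l Comp_elt(2)[OF obR Y D(1) eab]], clarify)
        fix r z assume "(r, z) \<in> graph R (elt Y (y \<triangleleft>\<^bsub>Y\<^esub> b))"
        then obtain c where c: "c \<in> carrier A" "r = e c" "z = (y \<triangleleft>\<^bsub>Y\<^esub> b) \<triangleleft>\<^bsub>Y\<^esub> c"
          using cR by (auto simp: graph_iff elt_def)
        have "(e a \<triangleleft>\<^bsub>R\<^esub> (b \<otimes> c), y \<triangleleft>\<^bsub>Y\<^esub> (b \<otimes> c)) \<in> D" using DD(5)[OF y] ab c by simp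
        then have "(e (a \<otimes> b) \<triangleleft>\<^bsub>R\<^esub> c, z) \<in> D" using ab c yY by (simp add: e_act m_assoc rmod_act[OF rY])
        then show "(r, z) \<in> graph R (elt R (e (a \<otimes> b))) O D"
          using c cR by (auto simp: graph_iff relcomp_unfold elt_def)
      qed
      moreover have "graph R (elt X x) O P = qgraph R Y (elt Y (y \<triangleleft>\<^bsub>Y\<^esub> b))"
      proof (rule qmor_eq_qgraph[OF rR rY l Comp_elt(2)[OF X Y P(1) xX]], clarify)
        fix r z assume "(r, z) \<in> graph R (elt Y (y \<triangleleft>\<^bsub>Y\<^esub> b))"
        then obtain c where c: "c \<in> carrier A" "r = e c" "z = (y \<triangleleft>\<^bsub>Y\<^esub> b) \<triangleleft>\<^bsub>Y\<^esub> c"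
          using cR by (auto simp: graph_iff elt_def)
        have "(x \<triangleleft>\<^bsub>X\<^esub> c, z) \<in> P" using PD(5)[OF x c(1)] c by simp
        then show "(r, z) \<in> graph R (elt X x) O P"
          using c cR by (auto simp: graph_iff relcomp_unfold elt_def)
      qed
      ultimately have "g \<cdot>\<^bsub>quot\<^esub> canonical_map e A F (a \<otimes> b) = p \<cdot>\<^bsub>quot\<^esub> arr_map pi_functor (mor R X (elt X x))"
        using ab canonical_map_eq[of "a \<otimes> b"] Comp_elt(1)[OF obR Y D(1) eab] Comp_elt(1)[OF X Y P(1) xX] D(2) P(2)
        by simp
      moreover have "arr_map pi_functor (mor R X (elt X x)) \<in> hom_set quot R X"
        using is_functorD(5)[OF pi_is_functor mor_in[OF obR X linear_elt[OF rX xX]]] by simp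
      ultimately show ?thesis using ab by auto
    qed
    have "qmor AA Y (graph AA e O D)" by (rule qmor_graph_comp[OF rmod_regular rR rY le D(1)])
    then have pre: "pre_mor AA Y (graph AA e O D)" by (rule qmor_pre)
    then have dD: "dense AA (Domain (graph AA e O D))" by (simp add: pre_mor_def)
    have "Domain (graph AA e O D) \<in> F"
      using dD dense_regular_iff[OF submodule_Domain[OF pre_morD[OF pre] rmod_regular rY]] by simp
    then have "?I \<in> F"
    proof (rule F_local[OF _ sub])
      fix a assume "a \<in> Domain (graph AA e O D)"
      then obtain y where y: "a \<in> carrier A" "(e a, y) \<in> D" by (auto simp: graph_iff)
      obtain L where L: "L \<in> F" "\<And>b. b \<in> L \<Longrightarrow> b \<in> carrier A" "\<And>b. b \<in> L \<Longrightarrow> y \<triangleleft>\<^bsub>Y\<^esub> b \<in> Range P"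
        by (rule denseE[OF dP DD(2)[OF y(2)]]) auto
      have "L \<subseteq> {b \<in> carrier A. a \<otimes> b \<in> ?I}"
      proof
        fix b assume b: "b \<in> L"
        then obtain x where "(x, y \<triangleleft>\<^bsub>Y\<^esub> b) \<in> P" using L(3)[OF b] by auto
        then have "a \<otimes> b \<in> ?I" by (rule key[OF y(1) L(2)[OF b] y(2)])
        then show "b \<in> {b \<in> carrier A. a \<otimes> b \<in> ?I}" using L(2)[OF b] by blast
      qed
      then show "{b \<in> carrier A. a \<otimes> b \<in> ?I} \<in> F"
        using F_upward[OF L(1)] submodule_colon[OF rmod_regular sub, of a] y(1) by simp
    qed
    then show "\<exists>J\<in>G. \<forall>a\<in>J. \<exists>h\<in>hom_set quot R X. g \<cdot>\<^bsub>quot\<^esub> a = p \<cdot>\<^bsub>quot\<^esub> h"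
      by (intro bexI[of _ "canonical_map e A F ` ?I"]) auto
  qed
qed

lemma ample_R: "ample quot R G"
  by (simp add: ample_def finite_generator_R finitely_self_generated_R G_projective_R)

end

subsection \<open>Abelian categories\<close>

lemma is_kernelE:
  assumes k: "is_kernel C f k" and f: "f \<in> hom_set C X Y"
  obtains K where "k \<in> hom_set C K X" "f \<cdot>\<^bsub>C\<^esub> k = Zero C K Y"
    "\<forall>W. \<forall>g\<in>hom_set C W X. f \<cdot>\<^bsub>C\<^esub> g = Zero C W Y \<longrightarrow> (\<exists>!h. h \<in> hom_set C W K \<and> k \<cdot>\<^bsub>C\<^esub> h = g)"
  using k f by (auto simp: is_kernel_def hom_set_def)

lemma is_cokernelE:
  assumes q: "is_cokernel C f q" and f: "f \<in> hom_set C X Y"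
  obtains Q where "q \<in> hom_set C Y Q" "q \<cdot>\<^bsub>C\<^esub> f = Zero C X Q"
    "\<forall>W. \<forall>g\<in>hom_set C Y W. g \<cdot>\<^bsub>C\<^esub> f = Zero C X W \<longrightarrow> (\<exists>!h. h \<in> hom_set C Q W \<and> h \<cdot>\<^bsub>C\<^esub> q = g)"
  using q f by (auto simp: is_cokernel_def hom_set_def)

context preadditive_category
begin

lemma kernel_cancel:
  assumes k: "is_kernel C f k" "k \<in> hom_set C K X" and h: "h \<in> hom_set C W K" "h' \<in> hom_set C W K" "k \<cdot> h = k \<cdot> h'"
  shows "h = h'"
proof -
  have f: "f \<in> hom_set C X (Cod C f)" using k by (auto simp: is_kernel_def hom_set_def)
  obtain K' where K: "k \<in> hom_set C K' X" "f \<cdot> k = Zero C K' (Cod C f)"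
    "\<forall>W. \<forall>g\<in>hom_set C W X. f \<cdot> g = Zero C W (Cod C f) \<longrightarrow> (\<exists>!h. h \<in> hom_set C W K' \<and> k \<cdot> h = g)"
    using is_kernelE[OF k(1) f] .
  have "K' = K" using K(1) k(2) by (auto simp: hom_set_def)
  have "f \<cdot> (k \<cdot> h) = Zero C W (Cod C f)"
    using Comp_assoc[OF h(1) k(2) f] K(2) Comp_Zero_left[OF h(1)] hom_set_Obj(2)[OF f] \<open>K' = K\<close> by simp
  then show ?thesis using K(3) Comp_in[OF h(1) k(2)] h \<open>K' = K\<close> by metis
qed

lemma cokernel_epi:
  assumes q: "is_cokernel C f q"
  shows "is_epi C q"
proof -
  have f: "f \<in> hom_set C (Dom C f) (Cod C f)" using q by (auto simp: is_cokernel_def hom_set_def)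
  obtain Q where Q: "q \<in> hom_set C (Cod C f) Q" "q \<cdot> f = Zero C (Dom C f) Q"
    "\<forall>W. \<forall>g\<in>hom_set C (Cod C f) W. g \<cdot> f = Zero C (Dom C f) W \<longrightarrow> (\<exists>!h. h \<in> hom_set C Q W \<and> h \<cdot> q = g)"
    using is_cokernelE[OF q f] .
  show ?thesis
  proof (rule is_epiI[OF category_axioms Q(1)])
    fix Z g h assume g: "g \<in> hom_set C Q Z" and h: "h \<in> hom_set C Q Z" and eq: "g \<cdot> q = h \<cdot> q"
    have "(g \<cdot> q) \<cdot> f = Zero C (Dom C f) Z"
      using Comp_assoc[OF f Q(1) g] Q(2) Comp_Zero_right[OF g] hom_set_Obj(1)[OF f] by simp
    then show "g = h" using Q(3) Comp_in[OF Q(1) g] g h eq by metis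
  qed
qed

lemma epi_if_zero_cancel:
  assumes p: "p \<in> hom_set C X Y"
    and z: "\<And>Z d. \<lbrakk>d \<in> hom_set C Y Z; d \<cdot> p = Zero C X Z\<rbrakk> \<Longrightarrow> d = Zero C Y Z"
  shows "is_epi C p"
proof (rule is_epiI[OF category_axioms p])
  fix Z g h assume g: "g \<in> hom_set C Y Z" and h: "h \<in> hom_set C Y Z" and eq: "g \<cdot> p = h \<cdot> p"
  note XY = hom_set_Obj[OF p] and Z = hom_set_Obj(2)[OF g]
  obtain h' where h': "h' \<in> hom_set C Y Z" "Add C h' h = Zero C Y Z" using Add_neg[OF XY(2) Z h] by auto
  have "Add C h' g \<cdot> p = Add C h' h \<cdot> p" by (simp add: Comp_Add_left[OF p h'(1)] g h eq)
  then have "Add C h' g = Zero C Y Z"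
    using z[OF Add_in[OF XY(2) Z h'(1) g]] h'(2) Comp_Zero_left[OF p Z] by simp
  then have "Add C h (Add C h' g) = Add C h (Add C h' h)" using h'(2) by simp
  then have "Add C (Add C h h') g = Add C (Add C h h') h"
    by (simp add: Add_assoc[OF XY(2) Z h h'(1)] g h)
  then show "g = h" using h' Add_comm[OF XY(2) Z h h'(1)] Add_Zero_left[OF XY(2) Z] g h by simp
qed

end

context abelian_category
begin

text \<open>K is the image of \<open>\<rho>\<close>, the kernel of its cokernel. If d kills
  \<open>\<rho>'\<close>, then \<open>\<rho>\<close> factors through k l, where l is the kernel of
  d. This mono is the kernel of some t; t kills \<open>\<rho>\<close>, so it factors through q and
  kills k. Hence k factors through k l, l has a right inverse, and d is 0.\<close>

lemma image_factor_epi: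
  assumes \<rho>: "\<rho> \<in> hom_set C P' P" and q: "is_cokernel C \<rho> q" and k: "is_kernel C q k" "k \<in> hom_set C K P"
    and \<rho>': "\<rho>' \<in> hom_set C P' K" "k \<cdot> \<rho>' = \<rho>"
  shows "is_epi C \<rho>'"
proof (rule epi_if_zero_cancel[OF \<rho>'(1)])
  fix Z d assume d: "d \<in> hom_set C K Z" "d \<cdot> \<rho>' = Zero C P' Z"
  note Z = hom_set_Obj(2)[OF d(1)]
  obtain Q where Q: "q \<in> hom_set C P Q" "q \<cdot> \<rho> = Zero C P' Q"
    "\<forall>W. \<forall>g\<in>hom_set C P W. g \<cdot> \<rho> = Zero C P' W \<longrightarrow> (\<exists>!h. h \<in> hom_set C Q W \<and> h \<cdot> q = g)"
    using is_cokernelE[OF q \<rho>] .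
  obtain l where l: "is_kernel C d l" using kernels d(1) by (auto simp: hom_set_def)
  obtain L where L: "l \<in> hom_set C L K" "d \<cdot> l = Zero C L Z"
    "\<forall>W. \<forall>g\<in>hom_set C W K. d \<cdot> g = Zero C W Z \<longrightarrow> (\<exists>!h. h \<in> hom_set C W L \<and> l \<cdot> h = g)"
    using is_kernelE[OF l d(1)] .
  obtain \<rho>'' where \<rho>'': "\<rho>'' \<in> hom_set C P' L" "l \<cdot> \<rho>'' = \<rho>'" using L(3) \<rho>'(1) d(2) by blast
  note kl = Comp_in[OF L(1) k(2)]
  have "is_mono C (k \<cdot> l)"
    unfolding is_mono_def
  proof (intro conjI ballI impI)
    show "k \<cdot> l \<in> Arr C" using kl by (simp add: hom_set_def)
    fix g h assume gh: "g \<in> Arr C" "h \<in> Arr C" "Dom C g = Dom C h \<and> Cod C g = Dom C (k \<cdot> l) \<and>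
      Cod C h = Dom C (k \<cdot> l) \<and> (k \<cdot> l) \<cdot> g = (k \<cdot> l) \<cdot> h"
    then have *: "g \<in> hom_set C (Dom C g) L" "h \<in> hom_set C (Dom C g) L" using kl by (auto simp: hom_set_def)
    have "k \<cdot> (l \<cdot> g) = k \<cdot> (l \<cdot> h)" using gh Comp_assoc[OF *(1) L(1) k(2)] Comp_assoc[OF *(2) L(1) k(2)] by simp
    then have "l \<cdot> g = l \<cdot> h" by (rule kernel_cancel[OF k Comp_in[OF *(1) L(1)] Comp_in[OF *(2) L(1)]])
    then show "g = h" by (rule kernel_cancel[OF l L(1) *])
  qed
  then obtain t where t: "is_kernel C t (k \<cdot> l)" using mono_normal by blast
  then have t': "t \<in> hom_set C P (Cod C t)" using kl by (auto simp: is_kernel_def hom_set_def)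
  let ?T = "Cod C t"
  obtain L' where L': "k \<cdot> l \<in> hom_set C L' P" "t \<cdot> (k \<cdot> l) = Zero C L' ?T"
    "\<forall>W. \<forall>g\<in>hom_set C W P. t \<cdot> g = Zero C W ?T \<longrightarrow> (\<exists>!h. h \<in> hom_set C W L' \<and> (k \<cdot> l) \<cdot> h = g)"
    using is_kernelE[OF t t'] .
  have LL: "L' = L" using L'(1) kl by (auto simp: hom_set_def)
  have T: "?T \<in> Obj C" using hom_set_Obj(2)[OF t'] .
  have "t \<cdot> \<rho> = (t \<cdot> (k \<cdot> l)) \<cdot> \<rho>''"
    using Comp_assoc[OF \<rho>''(1) kl t'] Comp_assoc[OF \<rho>''(1) L(1) k(2)] \<rho>''(2) \<rho>'(2) by simp
  then have "t \<cdot> \<rho> = Zero C P' ?T" using L'(2) LL Comp_Zero_left[OF \<rho>''(1) T] by simp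
  then obtain t'' where t'': "t'' \<in> hom_set C Q ?T" "t'' \<cdot> q = t" using Q(3) t' by blast
  have qk: "q \<cdot> k = Zero C K Q"
    using is_kernelE[OF k(1) Q(1)] k(2) by (metis hom_setD(2))
  have KO: "K \<in> Obj C" using hom_set_Obj(1)[OF k(2)] .
  have "t \<cdot> k = Zero C K ?T"
    using Comp_assoc[OF k(2) Q(1) t''(1)] t''(2) qk Comp_Zero_right[OF t''(1) KO] by simp
  then obtain m where m: "m \<in> hom_set C K L" "(k \<cdot> l) \<cdot> m = k" using L'(3) k(2) LL by blast
  have "k \<cdot> (l \<cdot> m) = k \<cdot> Ident C K" using Comp_assoc[OF m(1) L(1) k(2)] m(2) Ident_right[OF k(2)] by simp
  then have lm: "l \<cdot> m = Ident C K" by (rule kernel_cancel[OF k Comp_in[OF m(1) L(1)] Ident_in[OF KO]])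
  have "d = (d \<cdot> l) \<cdot> m" using Comp_assoc[OF m(1) L(1) d(1)] lm Ident_right[OF d(1)] by simp
  then show "d = Zero C K Z" using L(2) Comp_Zero_left[OF m(1) Z] by simp
qed

lemma coproduct_family:
  assumes M: "M \<in> Obj C" and X: "X \<in> Obj C" and xs: "set xs \<subseteq> hom_set C M X"
  obtains P j p where "is_coproduct C (length xs) (\<lambda>_. M) P j" "p \<in> hom_set C P X" "\<forall>i<length xs. p \<cdot> j i = xs ! i"
proof -
  obtain P j where P: "is_coproduct C (length xs) (\<lambda>_. M) P j"
    using finite_coproducts[of "length xs" "\<lambda>_. M"] M by blast
  have "\<forall>i<length xs. xs ! i \<in> hom_set C M X" using xs nth_mem by blast
  then have "\<exists>!h. h \<in> hom_set C P X \<and> (\<forall>i<length xs. h \<cdot> j i = xs ! i)"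
    using P X by (simp add: is_coproduct_def)
  then show ?thesis using that[OF P] by blast
qed

end

lemma coproductD:
  assumes "is_coproduct C r (\<lambda>_. M) P j"
  shows "P \<in> Obj C" "i < r \<Longrightarrow> j i \<in> hom_set C M P"
    "\<lbrakk>Y \<in> Obj C; \<And>i. i < r \<Longrightarrow> f i \<in> hom_set C M Y\<rbrakk> \<Longrightarrow> \<exists>!h. h \<in> hom_set C P Y \<and> (\<forall>i<r. h \<cdot>\<^bsub>C\<^esub> j i = f i)"
  using assms by (auto simp: is_coproduct_def)

lemma coproduct_ext:
  assumes "category C" and P: "is_coproduct C r (\<lambda>_. M) P j" and g: "g \<in> hom_set C P Y" "h \<in> hom_set C P Y"
    and eq: "\<And>i. i < r \<Longrightarrow> g \<cdot>\<^bsub>C\<^esub> j i = h \<cdot>\<^bsub>C\<^esub> j i"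
  shows "g = h"
proof -
  interpret category C by fact
  have "\<exists>!u. u \<in> hom_set C P Y \<and> (\<forall>i<r. u \<cdot>\<^bsub>C\<^esub> j i = h \<cdot>\<^bsub>C\<^esub> j i)"
    using coproductD(3)[OF P, of Y "\<lambda>i. h \<cdot>\<^bsub>C\<^esub> j i"] hom_set_Obj(2)[OF g(1)] Comp_in[OF coproductD(2)[OF P] g(2)] by blast
  then show ?thesis using g eq by blast
qed


subsection \<open>The equivalence defined by an ample object\<close>

locale ample_object = abelian_category C for C :: "('o, 'm) addcat" (structure) +
  fixes M :: 'o and F :: "'m set set"
  assumes M: "M \<in> Obj C" and noetherian: "right_noetherian (End_ring C M)"
    and gabriel_F: "gabriel_topology (End_ring C M) F" and ample_M: "ample C M F"
begin

abbreviation EM where "EM \<equiv> End_ring C M"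
abbreviation H where "H \<equiv> hom_module C M"

sublocale gabriel EM F
  using ring_End[OF M] gabriel_F by (simp add: gabriel_def right_modules_def gabriel_axioms_def)

lemma rH: "X \<in> Obj C \<Longrightarrow> rmod (H X)"
  by (rule right_module_hom[OF M])

lemma F_hom: "\<lbrakk>I \<in> F; a \<in> I\<rbrakk> \<Longrightarrow> a \<in> hom_set C M M"
  using F_carrierD by simp

text \<open>Speaks of epimorphisms from powers of M through their components, that is, through
  subsets of Hom(M, X), which can be compared with submodules.\<close>

definition jointly_epi :: "'o \<Rightarrow> 'm set \<Rightarrow> bool" where
  "jointly_epi X S \<longleftrightarrow> (\<forall>Y. \<forall>g\<in>hom_set C X Y. \<forall>h\<in>hom_set C X Y. (\<forall>x\<in>S. g \<cdot> x = h \<cdot> x) \<longrightarrow> g = h)"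

lemma jointly_epiD:
  "\<lbrakk>jointly_epi X S; g \<in> hom_set C X Y; h \<in> hom_set C X Y; \<And>x. x \<in> S \<Longrightarrow> g \<cdot> x = h \<cdot> x\<rbrakk> \<Longrightarrow> g = h"
  by (auto simp: jointly_epi_def)

lemma jointly_epi_components:
  assumes P: "is_coproduct C r (\<lambda>_. M) P j" and p: "p \<in> hom_set C P X" "is_epi C p"
  shows "jointly_epi X ((\<lambda>i. p \<cdot> j i) ` {..<r})"
  unfolding jointly_epi_def
proof (intro allI ballI impI)
  fix Y g h assume g: "g \<in> hom_set C X Y" and h: "h \<in> hom_set C X Y"
    and eq: "\<forall>x\<in>(\<lambda>i. p \<cdot> j i) ` {..<r}. g \<cdot> x = h \<cdot> x"
  have "g \<cdot> p = h \<cdot> p"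
  proof (rule coproduct_ext[OF category_axioms P Comp_in[OF p(1) g] Comp_in[OF p(1) h]])
    fix i assume i: "i < r"
    show "(g \<cdot> p) \<cdot> j i = (h \<cdot> p) \<cdot> j i"
      using eq i Comp_assoc[OF coproductD(2)[OF P i] p(1) g] Comp_assoc[OF coproductD(2)[OF P i] p(1) h] by simp
  qed
  then show "g = h" by (rule is_epiD[OF p(2,1) g h])
qed

lemma jointly_epi_family:
  assumes X: "X \<in> Obj C"
  obtains xs where "set xs \<subseteq> hom_set C M X" "jointly_epi X (set xs)"
proof -
  obtain r P j p where P: "is_coproduct C r (\<lambda>_. M) P j" "p \<in> hom_set C P X" "is_epi C p"
    using ample_M X by (auto simp: ample_def finite_generator_def)
  have "set (map (\<lambda>i. p \<cdot> j i) [0..<r]) \<subseteq> hom_set C M X"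
    using Comp_in[OF coproductD(2)[OF P(1)] P(2)] by auto
  moreover have "set (map (\<lambda>i. p \<cdot> j i) [0..<r]) = (\<lambda>i. p \<cdot> j i) ` {..<r}" by (auto simp: atLeast0LessThan)
  ultimately show ?thesis using that jointly_epi_components[OF P] by metis
qed

lemma epi_of_jointly_epi:
  assumes e: "jointly_epi X (set xs)" and p: "p \<in> hom_set C P X" "\<forall>i<length xs. p \<cdot> j i = xs ! i"
    and P: "is_coproduct C (length xs) (\<lambda>_. M) P j"
  shows "is_epi C p"
proof (rule is_epiI[OF category_axioms p(1)])
  fix Z g h assume g: "g \<in> hom_set C X Z" and h: "h \<in> hom_set C X Z" and eq: "g \<cdot> p = h \<cdot> p"
  show "g = h"
  proof (rule jointly_epiD[OF e g h])
    fix x assume "x \<in> set xs"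
    then obtain i where i: "i < length xs" "x = p \<cdot> j i" using p(2) by (metis in_set_conv_nth)
    show "g \<cdot> x = h \<cdot> x"
      using eq Comp_assoc[OF coproductD(2)[OF P i(1)] p(1) g] Comp_assoc[OF coproductD(2)[OF P i(1)] p(1) h] i(2) by simp
  qed
qed

text \<open>By self-generation, finitely many elements of I are already jointly epimorphic.\<close>

lemma jointly_epi_F:
  assumes I: "I \<in> F"
  shows "jointly_epi M I"
proof -
  obtain r f P j p where *: "\<forall>i<r. f i \<in> I" "is_coproduct C r (\<lambda>_. M) P j" "p \<in> hom_set C P M"
    "\<forall>i<r. p \<cdot> j i = f i" "is_epi C p"
    using ample_M I unfolding ample_def finitely_self_generated_def by meson
  have sub: "(\<lambda>i. p \<cdot> j i) ` {..<r} \<subseteq> I" using * by auto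
  show ?thesis
    unfolding jointly_epi_def
  proof (intro allI ballI impI)
    fix Y g h assume "g \<in> hom_set C M Y" "h \<in> hom_set C M Y" "\<forall>x\<in>I. g \<cdot> x = h \<cdot> x"
    then show "g = h"
      by (intro jointly_epiD[OF jointly_epi_components[OF *(2,3,5)], of g Y h]) (use sub in blast)+
  qed
qed

lemma eq_if_eq_on_F:
  assumes I: "I \<in> F" and x: "x \<in> hom_set C M X" "y \<in> hom_set C M X" and eq: "\<And>a. a \<in> I \<Longrightarrow> x \<cdot> a = y \<cdot> a"
  shows "x = y"
  by (rule jointly_epiD[OF jointly_epi_F[OF I] x eq])

lemma tors_H:
  assumes X: "X \<in> Obj C" and x: "x \<in> tors (H X)"
  shows "x = Zero C M X"
proof -
  obtain I where I: "x \<in> hom_set C M X" "I \<in> F" "\<And>a. a \<in> I \<Longrightarrow> x \<cdot> a = Zero C M X"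
    using x by (auto elim!: satE)
  show ?thesis
    by (rule eq_if_eq_on_F[OF I(2,1) Zero_in[OF M X]]) (simp add: I(3) Comp_Zero_left[OF F_hom[OF I(2)] X])
qed

lemma submodule_equalizer:
  assumes g: "g \<in> hom_set C X Y" and h: "h \<in> hom_set C X Y"
  shows "submodule EM (H X) {x \<in> hom_set C M X. g \<cdot> x = h \<cdot> x}"
proof -
  have X: "X \<in> Obj C" and Y: "Y \<in> Obj C" using hom_set_Obj[OF g] by auto
  show ?thesis
    by (rule submoduleI[OF rH[OF X]])
      (use Zero_in[OF M X] Add_in[OF M X] Comp_in[of _ M M _ X]
        in \<open>auto simp: Comp_Zero_right[OF g M] Comp_Zero_right[OF h M] Comp_Add_right[OF _ _ g]
          Comp_Add_right[OF _ _ h] Comp_assoc[OF _ _ g, symmetric] Comp_assoc[OF _ _ h, symmetric]\<close>)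
qed

text \<open>Arrows that agree on S agree on the submodule it generates, and then on every element
  that an ideal in F carries into this submodule, because ideals in F are jointly
  epimorphic.\<close>

lemma jointly_epi_dense:
  assumes X: "X \<in> Obj C" and d: "dense (H X) (gen (H X) S)" and S: "S \<subseteq> hom_set C M X"
  shows "jointly_epi X S"
  unfolding jointly_epi_def
proof (intro allI ballI impI)
  fix Y g h assume g: "g \<in> hom_set C X Y" and h: "h \<in> hom_set C X Y" and eq: "\<forall>x\<in>S. g \<cdot> x = h \<cdot> x"
  have D: "gen (H X) S \<subseteq> {x \<in> hom_set C M X. g \<cdot> x = h \<cdot> x}"
    by (rule gen_least[OF submodule_equalizer[OF g h]]) (use eq S in auto)
  obtain xs where xs: "set xs \<subseteq> hom_set C M X" "jointly_epi X (set xs)" using jointly_epi_family[OF X] .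
  show "g = h"
  proof (rule jointly_epiD[OF xs(2) g h])
    fix x assume "x \<in> set xs"
    then have x: "x \<in> hom_set C M X" using xs by auto
    then have "x \<in> carrier (H X)" by simp
    from d this obtain I where I: "I \<in> F" "\<And>a. a \<in> I \<Longrightarrow> x \<cdot> a \<in> gen (H X) S"
      by (rule denseE) auto
    show "g \<cdot> x = h \<cdot> x"
    proof (rule eq_if_eq_on_F[OF I(1) Comp_in[OF x g] Comp_in[OF x h]])
      fix a assume a: "a \<in> I"
      have "g \<cdot> (x \<cdot> a) = h \<cdot> (x \<cdot> a)" using D I(2)[OF a] by auto
      then show "(g \<cdot> x) \<cdot> a = (h \<cdot> x) \<cdot> a"
        by (simp add: Comp_assoc[OF F_hom[OF I(1) a] x g] Comp_assoc[OF F_hom[OF I(1) a] x h])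
    qed
  qed
qed

lemma coproduct_projections:
  assumes P: "is_coproduct C r (\<lambda>_. M) P j" and k: "k < r"
  obtains \<pi> where "\<pi> \<in> hom_set C P M" "\<pi> \<cdot> j k = Ident C M" "\<forall>i<r. i \<noteq> k \<longrightarrow> \<pi> \<cdot> j i = Zero C M M"
proof -
  have "\<exists>!h. h \<in> hom_set C P M \<and> (\<forall>i<r. h \<cdot> j i = (if i = k then Ident C M else Zero C M M))"
    by (rule coproductD(3)[OF P M]) (use Ident_in[OF M] Zero_in[OF M M] in auto)
  then show ?thesis using that k by (metis (no_types, lifting))
qed

text \<open>The identity of P is the sum of the composites of projections and injections. It is
  assembled one summand at a time as an endomorphism s that is the identity on the first n
  injections and zero on the others, with all s v in N.\<close>

lemma coproduct_generated:
  assumes P: "is_coproduct C r (\<lambda>_. M) P j" and N: "submodule EM (H P) N" and j: "\<And>i. i < r \<Longrightarrow> j i \<in> N"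
  shows "hom_set C M P \<subseteq> N"
proof -
  note PO = coproductD(1)[OF P]
  note ND = submoduleD[OF rH[OF PO] N, simplified]
  have "n \<le> r \<Longrightarrow> \<exists>s\<in>hom_set C P P. (\<forall>i<n. s \<cdot> j i = j i) \<and> (\<forall>i. n \<le> i \<and> i < r \<longrightarrow> s \<cdot> j i = Zero C M P) \<and>
      (\<forall>v\<in>hom_set C M P. s \<cdot> v \<in> N)" for n
  proof (induction n)
    case 0
    show ?case
      by (rule bexI[OF _ Zero_in[OF PO PO]])
        (use ND(2) in \<open>auto simp: Comp_Zero_left[OF coproductD(2)[OF P] PO] Comp_Zero_left[OF _ PO]\<close>)
  next
    case (Suc n)
    then obtain s where s: "s \<in> hom_set C P P" "\<And>i. i < n \<Longrightarrow> s \<cdot> j i = j i"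
      "\<And>i. n \<le> i \<Longrightarrow> i < r \<Longrightarrow> s \<cdot> j i = Zero C M P" "\<And>v. v \<in> hom_set C M P \<Longrightarrow> s \<cdot> v \<in> N"
      using Suc_leD by blast
    have n: "n < r" using Suc by simp
    obtain \<pi> where \<pi>: "\<pi> \<in> hom_set C P M" "\<pi> \<cdot> j n = Ident C M" "\<forall>i<r. i \<noteq> n \<longrightarrow> \<pi> \<cdot> j i = Zero C M M"
      using coproduct_projections[OF P n] .
    note jn = coproductD(2)[OF P n] and j' = coproductD(2)[OF P]
    note jp = Comp_in[OF \<pi>(1) jn]
    let ?s = "Add C s (j n \<cdot> \<pi>)"
    have c: "?s \<cdot> v = Add C (s \<cdot> v) (j n \<cdot> (\<pi> \<cdot> v))" if "v \<in> hom_set C M P" for v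
      by (simp add: Comp_Add_left[OF that s(1) jp] Comp_assoc[OF that \<pi>(1) jn])
    show ?case
    proof (intro bexI conjI allI impI ballI)
      fix i assume i: "i < Suc n"
      show "?s \<cdot> j i = j i"
      proof (cases "i = n")
        case True
        then show ?thesis using n s(3)[of n] \<pi>(2)
          by (simp add: c[OF jn] Ident_right[OF jn] Add_Zero_left[OF M PO jn])
      next
        case False
        then have "i < n" "i < r" using i n by auto
        then show ?thesis using s(2) \<pi>(3) False
          by (simp add: c[OF j'] Comp_Zero_right[OF jn M] Add_Zero_right[OF M PO j'])
      qed
    next
      fix i assume i: "Suc n \<le> i \<and> i < r"
      then show "?s \<cdot> j i = Zero C M P" using s(3) \<pi>(3)
        by (simp add: c[OF j'] Comp_Zero_right[OF jn M] Add_Zero_right[OF M PO Zero_in[OF M PO]])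
    next
      fix v assume v: "v \<in> hom_set C M P"
      show "?s \<cdot> v \<in> N"
        unfolding c[OF v] by (intro ND(3) s(4) v ND(4) j n Comp_in[OF v \<pi>(1)])
    next
      show "?s \<in> hom_set C P P" by (rule Add_in[OF PO PO s(1) jp])
    qed
  qed
  from this[of r] obtain s where s: "s \<in> hom_set C P P" "\<And>i. i < r \<Longrightarrow> s \<cdot> j i = j i"
    "\<And>v. v \<in> hom_set C M P \<Longrightarrow> s \<cdot> v \<in> N" by auto
  have "s = Ident C P"
    by (rule coproduct_ext[OF category_axioms P s(1) Ident_in[OF PO]])
      (simp add: s(2) Ident_left[OF coproductD(2)[OF P]])
  then show ?thesis using s(3) Ident_left by (metis subsetI)
qed

text \<open>Hom(M, P) is free on the injections; the map is built by adding one coordinate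
  projection at a time.\<close>

lemma coproduct_free:
  assumes P: "is_coproduct C r (\<lambda>_. M) P j" and Y: "rmod Y" and y: "\<And>i. i < r \<Longrightarrow> y i \<in> carrier Y"
  obtains \<psi> where "linear (H P) Y \<psi>" "\<forall>i<r. \<psi> (j i) = y i"
proof -
  note PO = coproductD(1)[OF P] and j = coproductD(2)[OF P]
  have "n \<le> r \<Longrightarrow> \<exists>\<psi>. linear (H P) Y \<psi> \<and> (\<forall>i<n. \<psi> (j i) = y i) \<and> (\<forall>i. n \<le> i \<and> i < r \<longrightarrow> \<psi> (j i) = \<zero>\<^bsub>Y\<^esub>)" for n
  proof (induction n)
    case 0
    show ?case
      by (rule exI[of _ "\<lambda>_. \<zero>\<^bsub>Y\<^esub>"]) (use Y in \<open>simp add: linear_def\<close>)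
  next
    case (Suc n)
    then obtain \<psi> where \<psi>: "linear (H P) Y \<psi>" "\<And>i. i < n \<Longrightarrow> \<psi> (j i) = y i"
      "\<And>i. n \<le> i \<Longrightarrow> i < r \<Longrightarrow> \<psi> (j i) = \<zero>\<^bsub>Y\<^esub>" using Suc_leD by blast
    have n: "n < r" using Suc by simp
    obtain \<pi> where \<pi>: "\<pi> \<in> hom_set C P M" "\<pi> \<cdot> j n = Ident C M" "\<forall>i<r. i \<noteq> n \<longrightarrow> \<pi> \<cdot> j i = Zero C M M"
      using coproduct_projections[OF P n] .
    let ?\<psi> = "\<lambda>v. \<psi> v \<oplus>\<^bsub>Y\<^esub> (y n \<triangleleft>\<^bsub>Y\<^esub> (\<pi> \<cdot> v))"
    have "linear (H P) Y (\<lambda>v. y n \<triangleleft>\<^bsub>Y\<^esub> (\<pi> \<cdot> v))"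
      using linear_postcomp[OF M \<pi>(1)] Y y[OF n]
      by (auto simp: linear_def rmod_act[OF Y, simplified] dest: rmod_simps(4)[OF Y, simplified])
    then have "linear (H P) Y ?\<psi>"
      using \<psi>(1) Y by (auto simp: linear_def rmod_ac[OF Y] rmod_act[OF Y, simplified])
    moreover have "?\<psi> (j i) = y i" if "i < Suc n" for i
    proof (cases "i = n")
      case True
      then show ?thesis using \<psi>(3)[of n] n \<pi>(2) y[OF n] rmod_simps(5)[OF Y] Y by simp
    next
      case False
      then have "i < n" "i < r" using that n by auto
      then show ?thesis
        using \<psi>(2) \<pi>(3) False y[OF n] y[of i] rmod_act_zero[OF Y y[OF n]] Y by simp
    qed
    moreover have "?\<psi> (j i) = \<zero>\<^bsub>Y\<^esub>" if "Suc n \<le> i \<and> i < r" for i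
      using that \<psi>(3)[of i] \<pi>(3) rmod_act_zero[OF Y y[OF n]] Y by simp
    ultimately show ?case by blast
  qed
  from this[of r] show ?thesis using that by auto
qed

lemma projective:
  assumes p: "p \<in> hom_set C X Y" "is_epi C p" and y: "y \<in> hom_set C M Y"
  obtains I where "I \<in> F" "\<forall>a\<in>I. \<exists>x\<in>hom_set C M X. y \<cdot> a = p \<cdot> x"
proof -
  have iff: "G_projective C M F \<longleftrightarrow> (\<forall>X\<in>Obj C. \<forall>Y\<in>Obj C. \<forall>p\<in>hom_set C X Y. is_epi C p \<longrightarrow>
      (\<forall>g\<in>hom_set C M Y. \<exists>I\<in>F. \<forall>a\<in>I. \<exists>h\<in>hom_set C M X. g \<cdot> a = p \<cdot> h))"
    by (rule G_projective_iff[OF M]) (use F_hom in blast)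
  have "\<exists>I\<in>F. \<forall>a\<in>I. \<exists>x\<in>hom_set C M X. y \<cdot> a = p \<cdot> x"
    using iff ample_M p y hom_set_Obj[OF p(1)] unfolding ample_def by blast
  then show ?thesis using that by blast
qed

text \<open>F-projectivity enters here: after multiplication by an ideal in F, an element of Hom(M,
  X) lifts along the epimorphism from a power of M with components xs, and whatever comes from that
  power is generated by xs.\<close>

lemma dense_jointly_epi:
  assumes X: "X \<in> Obj C" and xs: "set xs \<subseteq> hom_set C M X" and e: "jointly_epi X (set xs)"
  shows "dense (H X) (gen (H X) (set xs))"
  unfolding dense_def
proof
  fix y assume y: "y \<in> carrier (H X)"
  obtain P j p where P: "is_coproduct C (length xs) (\<lambda>_. M) P j" "p \<in> hom_set C P X" "\<forall>i<length xs. p \<cdot> j i = xs ! i"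
    using coproduct_family[OF M X xs] .
  note PO = coproductD(1)[OF P(1)]
  have xs': "set xs \<subseteq> carrier (H X)" using xs by simp
  have N: "submodule EM (H P) {v \<in> hom_set C M P. p \<cdot> v \<in> gen (H X) (set xs)}"
    using submodule_vimage[OF linear_postcomp[OF M P(2)] rH[OF PO] rH[OF X] submodule_gen[OF rH[OF X] xs']] by simp
  have "hom_set C M P \<subseteq> {v \<in> hom_set C M P. p \<cdot> v \<in> gen (H X) (set xs)}"
    by (rule coproduct_generated[OF P(1) N])
      (use P(3) coproductD(2)[OF P(1)] gen_superset[of "set xs" "H X"] in auto)
  moreover obtain I where I: "I \<in> F" "\<forall>a\<in>I. \<exists>x\<in>hom_set C M P. y \<cdot> a = p \<cdot> x"
    using projective[OF P(2) epi_of_jointly_epi[OF e P(2,3,1)], of y] y by auto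
  ultimately show "y \<in> sat (H X) (gen (H X) (set xs))"
    by (intro satI[OF y I(1)]) (auto; fastforce)
qed

text \<open>\<open>\<Gamma>\<close> is the graph of a linear map on a submodule of \<open>Hom(M, X)\<close>. The map is induced by a
  morphism because an epimorphism from a power of \<open>M\<close> to \<open>X\<close> is a cokernel.\<close>

lemma extend_relation:
  assumes X: "X \<in> Obj C" and Y: "Y \<in> Obj C" and \<Gamma>: "submodule EM (prod_mod (H X) (H Y)) \<Gamma>"
    and inj: "\<And>y. (Zero C M X, y) \<in> \<Gamma> \<Longrightarrow> y = Zero C M Y"
    and xs: "set xs \<subseteq> Domain \<Gamma>" and e: "jointly_epi X (set xs)"
  obtains f where "f \<in> hom_set C X Y" "\<forall>x\<in>set xs. (x, f \<cdot> x) \<in> \<Gamma>"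
proof -
  note rX = rH[OF X] and rY = rH[OF Y]
  note GD = rel_submoduleD[OF \<Gamma> rX rY, simplified]
  have xsX: "set xs \<subseteq> hom_set C M X" using xs GD(1) by auto
  have "\<forall>i<length xs. \<exists>y. (xs ! i, y) \<in> \<Gamma>" using xs nth_mem by blast
  then obtain y where y: "\<And>i. i < length xs \<Longrightarrow> (xs ! i, y i) \<in> \<Gamma>" by metis
  obtain P j p where P: "is_coproduct C (length xs) (\<lambda>_. M) P j" "p \<in> hom_set C P X" "\<forall>i<length xs. p \<cdot> j i = xs ! i"
    using coproduct_family[OF M X xsX] .
  note PO = coproductD(1)[OF P(1)] and j = coproductD(2)[OF P(1)]
  have "\<exists>!h. h \<in> hom_set C P Y \<and> (\<forall>i<length xs. h \<cdot> j i = y i)"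
    by (rule coproductD(3)[OF P(1) Y GD(2)[OF y]])
  \<comment> \<open>A candidate for f on the power P of M, with the values prescribed by the
    relation on the components of p. It descends along p once it kills an arrow g whose cokernel is
    p.\<close>
  then obtain \<phi> where \<phi>: "\<phi> \<in> hom_set C P Y" "\<And>i. i < length xs \<Longrightarrow> \<phi> \<cdot> j i = y i" by blast
  have lin: "linear (H P) (prod_mod (H X) (H Y)) (\<lambda>v. (p \<cdot> v, \<phi> \<cdot> v))"
    using linear_postcomp[OF M P(2)] linear_postcomp[OF M \<phi>(1)] by (auto simp: linear_def)
  have N: "submodule EM (H P) {v \<in> hom_set C M P. (p \<cdot> v, \<phi> \<cdot> v) \<in> \<Gamma>}"
    using submodule_vimage[OF lin rH[OF PO] rmod_prod[OF rX rY] \<Gamma>] by simp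
  have "hom_set C M P \<subseteq> {v \<in> hom_set C M P. (p \<cdot> v, \<phi> \<cdot> v) \<in> \<Gamma>}"
    by (rule coproduct_generated[OF P(1) N]) (use P(3) \<phi>(2) y j in auto)
  then have all: "(p \<cdot> v, \<phi> \<cdot> v) \<in> \<Gamma>" if "v \<in> hom_set C M P" for v using that by auto
  have "is_epi C p" by (rule epi_of_jointly_epi[OF e P(2,3,1)])
  then obtain g where g: "is_cokernel C g p" using epi_normal by blast
  then have g': "g \<in> hom_set C (Dom C g) P" using P(2) by (auto simp: is_cokernel_def hom_set_def)
  let ?G = "Dom C g"
  note GO = hom_set_Obj(1)[OF g']
  obtain X' where X': "p \<in> hom_set C P X'" "p \<cdot> g = Zero C ?G X'"
    "\<forall>W. \<forall>u\<in>hom_set C P W. u \<cdot> g = Zero C ?G W \<longrightarrow> (\<exists>!h. h \<in> hom_set C X' W \<and> h \<cdot> p = u)"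
    using is_cokernelE[OF g g'] .
  have XX: "X' = X" using X'(1) P(2) by (auto simp: hom_set_def)
  obtain ks where ks: "set ks \<subseteq> hom_set C M ?G" "jointly_epi ?G (set ks)" using jointly_epi_family[OF GO] .
  \<comment> \<open>Tested on arrows k from M: p g k is 0, so the relation contains 0 paired with
    the composite of \<open>\<phi>\<close> and g k, and \<open>inj\<close> makes the latter
    0.\<close>
  have "\<phi> \<cdot> g = Zero C ?G Y"
  proof (rule jointly_epiD[OF ks(2) Comp_in[OF g' \<phi>(1)] Zero_in[OF GO Y]])
    fix k assume "k \<in> set ks"
    then have k: "k \<in> hom_set C M ?G" using ks by auto
    have "p \<cdot> (g \<cdot> k) = Zero C M X"
      using Comp_assoc[OF k g' P(2)] X'(2) XX Comp_Zero_left[OF k X] by simp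
    then have "\<phi> \<cdot> (g \<cdot> k) = Zero C M Y" using all[OF Comp_in[OF k g']] inj by simp
    then show "(\<phi> \<cdot> g) \<cdot> k = Zero C ?G Y \<cdot> k"
      using Comp_assoc[OF k g' \<phi>(1)] Comp_Zero_left[OF k Y] by simp
  qed
  then obtain f where f: "f \<in> hom_set C X Y" "f \<cdot> p = \<phi>" using X'(3) \<phi>(1) XX by blast
  have "(x, f \<cdot> x) \<in> \<Gamma>" if x: "x \<in> set xs" for x
  proof -
    obtain i where i: "i < length xs" "x = xs ! i" using x by (metis in_set_conv_nth)
    have "f \<cdot> x = y i" using Comp_assoc[OF j[OF i(1)] P(2) f(1)] f(2) P(3) \<phi>(2) i by simp
    then show ?thesis using y i by simp
  qed
  then show ?thesis using that f(1) by blast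
qed

text \<open>The regular module and Hom(M, M) are different records, as they disagree in the
  meaningless fields \<open>mult\<close> and \<open>one\<close>; products forget these
  fields.\<close>

lemma prod_mod_EM: "prod_mod AA Y = prod_mod (H M) Y"
  by (simp add: prod_mod_def)

text \<open>A morphism from A to Hom(M, Y) is defined on an ideal in F. Finitely many generators of
  this ideal are jointly epimorphic, so \<open>extend_relation\<close> for X = M yields an arrow
  from M to Y, which is the representing element.\<close>

lemma eclosed_H:
  assumes Y: "Y \<in> Obj C"
  shows "eclosed (H Y)"
  unfolding eclosed_def
proof (intro conjI allI impI)
  note rY = rH[OF Y] and rM = rH[OF M]
  show "rmod (H Y)" by (rule rY)
  show "tors (H Y) \<subseteq> {\<zero>\<^bsub>H Y\<^esub>}" using tors_H[OF Y] by auto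
  fix G assume G: "qmor AA (H Y) G"
  then have pre: "pre_mor AA (H Y) G" by (rule qmor_pre)
  have sub: "submodule EM (prod_mod (H M) (H Y)) G" using pre_morD[OF pre] by (simp add: prod_mod_EM)
  note dom = submodule_Domain[OF pre_morD[OF pre] rmod_regular rY]
  have "dense AA (Domain G)" using pre by (simp add: pre_mor_def)
  then have I: "Domain G \<in> F" using dense_regular_iff[OF dom] by simp
  obtain T where T: "finite T" "T \<subseteq> Domain G" "Domain G = gen AA T" using noetherian_ideal[OF noetherian dom] .
  obtain xs where xs: "set xs = T" using finite_list[OF T(1)] by auto
  have "jointly_epi M (set xs)"
    unfolding jointly_epi_def
  proof (intro allI ballI impI)
    fix Z g h assume g: "g \<in> hom_set C M Z" and h: "h \<in> hom_set C M Z" and eq: "\<forall>x\<in>set xs. g \<cdot> x = h \<cdot> x"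
    have "submodule EM AA {x \<in> hom_set C M M. g \<cdot> x = h \<cdot> x}"
      using submodule_equalizer[OF g h] unfolding submodule_iff[OF rM] submodule_iff[OF rmod_regular] by simp
    then have "Domain G \<subseteq> {x \<in> hom_set C M M. g \<cdot> x = h \<cdot> x}"
      unfolding T(3) by (rule gen_least) (use eq xs T(2) F_hom[OF I] in auto)
    then show "g = h" by (intro jointly_epiD[OF jointly_epi_F[OF I] g h]) auto
  qed
  then obtain f where f: "f \<in> hom_set C M Y" "\<forall>x\<in>set xs. (x, f \<cdot> x) \<in> G"
    using extend_relation[OF M Y sub _ _, of xs] tors_H[OF Y] pre T(2) xs
    by (auto simp: pre_mor_def)
  have lin: "linear AA (prod_mod AA (H Y)) (\<lambda>v. (v, f \<cdot> v))"
    using linear_postcomp[OF M f(1)] by (auto simp: linear_def)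
  have "submodule EM AA {v \<in> hom_set C M M. (v, f \<cdot> v) \<in> G}"
    using submodule_vimage[OF lin rmod_regular rmod_prod[OF rmod_regular rY] pre_morD[OF pre]] by simp
  then have "Domain G \<subseteq> {v \<in> hom_set C M M. (v, f \<cdot> v) \<in> G}"
    unfolding T(3) by (rule gen_least) (use f(2) xs T(2) F_hom[OF I] in auto)
  \<comment> \<open>G contains (a, f a) for all a in an ideal of F, so saturation gives the pair of
    the unit and f.\<close>
  then have "(\<one>\<^bsub>EM\<^esub> \<triangleleft>\<^bsub>AA\<^esub> a, f \<triangleleft>\<^bsub>H Y\<^esub> a) \<in> G" if "a \<in> Domain G" for a
    using that F_hom[OF I that] by (auto simp: Ident_left)
  from qmor_closedI[OF G I this] have one: "(Ident C M, f) \<in> G" using f(1) Ident_in[OF M] by simp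
  have "(a, f \<cdot> a) \<in> G" if "a \<in> hom_set C M M" for a
    using rel_submoduleD(5)[OF pre_morD[OF pre] rmod_regular rY one, of a] that by (simp add: Ident_left)
  then show "\<exists>z\<in>carrier (H Y). graph AA (\<lambda>a. z \<triangleleft>\<^bsub>H Y\<^esub> a) \<subseteq> G"
    using f(1) by (intro bexI[of _ f]) (auto simp: graph_iff)
qed

end

context gabriel
begin

text \<open>Carries closedness from Hom(M, M) to the copy of A in the universe, across a change of
  the type of carriers.\<close>

lemma eclosed_iso:
  assumes Y: "eclosed Y" and Z: "rmod Z" and h: "linear Y Z h" "bij_betw h (carrier Y) (carrier Z)"
  shows "eclosed Z"
proof -
  have rY: "rmod Y" using Y by (simp add: eclosed_def)
  have inj: "\<And>y y'. y \<in> carrier Y \<Longrightarrow> y' \<in> carrier Y \<Longrightarrow> h y = h y' \<longleftrightarrow> y = y'"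
    using h(2) by (auto simp: bij_betw_def inj_on_eq_iff)
  let ?k = "inv_into (carrier Y) h"
  have k: "?k z \<in> carrier Y" "h (?k z) = z" if "z \<in> carrier Z" for z
    using h(2) that by (auto simp: bij_betw_def inv_into_into f_inv_into_f)
  have lk: "linear Z Y ?k"
    unfolding linear_def
  proof (intro conjI ballI)
    fix x y assume "x \<in> carrier Z" "y \<in> carrier Z"
    then show "?k (x \<oplus>\<^bsub>Z\<^esub> y) = ?k x \<oplus>\<^bsub>Y\<^esub> ?k y"
      using k rY Z linearD(2)[OF h(1)] by (subst inj[symmetric]) simp_all
  next
    fix x a assume "x \<in> carrier Z" "a \<in> carrier A"
    then show "?k (x \<triangleleft>\<^bsub>Z\<^esub> a) = ?k x \<triangleleft>\<^bsub>Y\<^esub> a"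
      using k rY Z linearD(3)[OF h(1)] by (subst inj[symmetric]) simp_all
  qed (use k in auto)
  show ?thesis
    unfolding eclosed_def
  proof (intro conjI allI impI Z)
    show "tors Z \<subseteq> {\<zero>\<^bsub>Z\<^esub>}"
    proof
      fix z assume z: "z \<in> tors Z"
      then have "?k z \<in> tors Y" by (rule linear_sat[OF lk, rotated]) (use linear_zero[OF lk Z rY] in auto)
      then have "?k z = \<zero>\<^bsub>Y\<^esub>" using Y by (auto simp: eclosed_def)
      then show "z \<in> {\<zero>\<^bsub>Z\<^esub>}" using k(2)[OF sat_carrier[OF z]] linear_zero[OF h(1) rY Z] by simp
    qed
    fix G assume G: "qmor AA Z G"
    let ?G = "sat (prod_mod AA Y) (G O graph Z ?k)"
    have pre: "pre_mor AA Y (G O graph Z ?k)"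
      by (rule pre_mor_comp[OF rmod_regular Z rY qmor_pre[OF G] pre_mor_graph[OF Z rY lk]])
    obtain y where y: "y \<in> carrier Y" "graph AA (\<lambda>a. y \<triangleleft>\<^bsub>Y\<^esub> a) \<subseteq> ?G"
      using Y qmor_sat[OF rmod_regular rY pre] unfolding eclosed_def by blast
    have "(a, h y \<triangleleft>\<^bsub>Z\<^esub> a) \<in> G" if a: "a \<in> carrier A" for a
    proof -
      have "(a, y \<triangleleft>\<^bsub>Y\<^esub> a) \<in> ?G" using y(2) a by (auto simp: graph_iff)
      then obtain I where I: "I \<in> F" "\<forall>b\<in>I. (a \<triangleleft>\<^bsub>AA\<^esub> b, (y \<triangleleft>\<^bsub>Y\<^esub> a) \<triangleleft>\<^bsub>Y\<^esub> b) \<in> G O graph Z ?k"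
        unfolding sat_prod_iff by blast
      show ?thesis
      proof (rule qmor_closedI[OF G I(1)])
        fix b assume b: "b \<in> I"
        then obtain z where z: "(a \<triangleleft>\<^bsub>AA\<^esub> b, z) \<in> G" "z \<in> carrier Z" "(y \<triangleleft>\<^bsub>Y\<^esub> a) \<triangleleft>\<^bsub>Y\<^esub> b = ?k z"
          using I(2) by (auto simp: graph_iff)
        have "(h y \<triangleleft>\<^bsub>Z\<^esub> a) \<triangleleft>\<^bsub>Z\<^esub> b = z"
          using z(2) k(2)[OF z(2)] y(1) a F_carrierD[OF I(1) b] rY by (simp add: linearD(3)[OF h(1), symmetric] z(3))
        then show "(a \<triangleleft>\<^bsub>AA\<^esub> b, (h y \<triangleleft>\<^bsub>Z\<^esub> a) \<triangleleft>\<^bsub>Z\<^esub> b) \<in> G" using z(1) by simp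
      qed (use a y(1) linearD(1)[OF h(1)] Z in auto)
    qed
    then show "\<exists>z\<in>carrier Z. graph AA (\<lambda>a. z \<triangleleft>\<^bsub>Z\<^esub> a) \<subseteq> G"
      using linearD(1)[OF h(1) y(1)] by (intro bexI[of _ "h y"]) (auto simp: graph_iff)
  qed
qed

end

section \<open>The functor Hom(M, -) into the quotient category and the equivalence\<close>

locale ample_universe = ample_object C M F for C :: "('o, 'm) addcat" (structure) and M F +
  fixes e :: "'m \<Rightarrow> 'u"
  assumes e: "universe_embedding (End_ring C M) e"
begin

lemma infinite_u: "infinite (UNIV :: 'u set)" and inj_e: "inj_on e (carrier EM)"
  using e by (auto simp: universe_embedding_def)

sublocale gabriel_universe EM F "{X :: ('m, 'u) rmodule. fin_gen EM X}"
  by (rule gabriel_universe_fin_gen[OF noetherian gabriel_F infinite_u])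

text \<open>\<open>Hom(M, X)\<close> need not be finitely generated, so the functor sends \<open>X\<close> to a finitely
  generated dense submodule of it, placed in the universe.\<close>

definition embeds :: "'o \<Rightarrow> ('m, 'u) rmodule \<Rightarrow> ('u \<Rightarrow> 'm) \<Rightarrow> bool" where
  "embeds X U i \<longleftrightarrow> ob U \<and> linear U (H X) i \<and> inj_on i (carrier U) \<and> dense (H X) (i ` carrier U)"

text \<open>A finite jointly epimorphic family generates a dense submodule, and a finitely generated
  module is small enough for the universe.\<close>

lemma embeds_exists:
  assumes X: "X \<in> Obj C"
  shows "\<exists>U i. embeds X U i"
proof -
  note rX = rH[OF X]
  obtain xs where xs: "set xs \<subseteq> hom_set C M X" "jointly_epi X (set xs)" using jointly_epi_family[OF X] .
  have xs': "set xs \<subseteq> carrier (H X)" using xs by simp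
  let ?N = "gen (H X) (set xs)"
  note N = submodule_gen[OF rX xs']
  have d: "dense (H X) ?N" by (rule dense_jointly_epi[OF X xs])
  obtain \<phi> :: "'m \<Rightarrow> 'u" where \<phi>: "inj_on \<phi> ?N"
    using gen_embedding[OF rX _ xs' inj_e infinite_u] by auto
  obtain U i where U: "rmod U" "linear U (H X) i" "bij_betw i (carrier U) ?N" "carrier U = \<phi> ` ?N"
    using subset_transport[OF rX N \<phi>] .
  have inj: "inj_on i (carrier U)" and img: "i ` carrier U = ?N" using U(3) by (auto simp: bij_betw_def)
  have "set xs \<subseteq> i ` carrier U" using gen_superset[of "set xs" "H X"] img by simp
  then obtain T where T: "T \<subseteq> carrier U" "finite T" "set xs = i ` T" by (meson finite_set finite_subset_image)
  have "i ` gen U T = i ` carrier U" using gen_linear_image[OF U(2,1) rX T(1)] T(3) img by simp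
  moreover have "gen U T \<subseteq> carrier U" by (rule gen_least[OF submodule_carrier[OF U(1)] T(1)])
  ultimately have "gen U T = carrier U" using inj by (simp add: inj_on_image_eq_iff)
  then have "fin_gen EM U" using T fin_gen_iff[OF U(1)] by auto
  then have "embeds X U i" using U inj img d by (simp add: embeds_def)
  then show ?thesis by blast
qed

definition rep_pair :: "'o \<Rightarrow> ('m, 'u) rmodule \<times> ('u \<Rightarrow> 'm)" where
  "rep_pair X = (SOME p. embeds X (fst p) (snd p))"

definition rep :: "'o \<Rightarrow> ('m, 'u) rmodule" where "rep X = fst (rep_pair X)"
definition incl :: "'o \<Rightarrow> 'u \<Rightarrow> 'm" where "incl X = snd (rep_pair X)"

lemma rep:
  assumes "X \<in> Obj C"
  shows "ob (rep X)" "linear (rep X) (H X) (incl X)" "inj_on (incl X) (carrier (rep X))"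
    "dense (H X) (incl X ` carrier (rep X))"
proof -
  have "\<exists>p. embeds X (fst p) (snd p)" using embeds_exists[OF assms] by auto
  then have "embeds X (rep X) (incl X)" unfolding rep_def incl_def rep_pair_def by (rule someI_ex)
  then show "ob (rep X)" "linear (rep X) (H X) (incl X)" "inj_on (incl X) (carrier (rep X))"
    "dense (H X) (incl X ` carrier (rep X))" by (auto simp: embeds_def)
qed

lemma rep_rmod: "X \<in> Obj C \<Longrightarrow> rmod (rep X)"
  using rep(1) by simp

lemma incl_in: "\<lbrakk>X \<in> Obj C; u \<in> carrier (rep X)\<rbrakk> \<Longrightarrow> incl X u \<in> hom_set C M X"
  using linearD(1)[OF rep(2)] by simp

lemma incl_zero_iff: "\<lbrakk>X \<in> Obj C; u \<in> carrier (rep X)\<rbrakk> \<Longrightarrow> incl X u = Zero C M X \<longleftrightarrow> u = \<zero>\<^bsub>rep X\<^esub>"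
  using linear_inj_iff[OF rep(2) rep_rmod rH] rep(3) linear_zero[OF rep(2) rep_rmod rH] by auto

text \<open>Postcomposition with f. It is a relation because f may move an element of
  \<open>rep X\<close> outside \<open>rep Y\<close>, which is only dense in Hom(M, Y).\<close>

definition rel :: "'o \<Rightarrow> 'o \<Rightarrow> 'm \<Rightarrow> ('u \<times> 'u) set" where
  "rel X Y f = {(u, w). u \<in> carrier (rep X) \<and> w \<in> carrier (rep Y) \<and> f \<cdot> incl X u = incl Y w}"

text \<open>The domain is dense because \<open>rep Y\<close> is dense in Hom(M, Y). The relation is
  saturated because arrows from M that agree on an ideal in F are equal.\<close>

lemma qmor_rel:
  assumes f: "f \<in> hom_set C X Y"
  shows "qmor (rep X) (rep Y) (rel X Y f)"
proof -
  have X: "X \<in> Obj C" and Y: "Y \<in> Obj C" using hom_set_Obj[OF f] by auto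
  note r = rep_rmod[OF X] rep_rmod[OF Y]
  have lf: "linear (rep X) (H Y) (\<lambda>u. f \<cdot> incl X u)" by (rule linear_comp[OF rep(2)[OF X] linear_postcomp[OF M f]])
  note lD = linearD[OF lf] and iD = linearD[OF rep(2)[OF Y]]
  have sub: "submodule EM (prod_mod (rep X) (rep Y)) (rel X Y f)"
    unfolding rel_submodule_iff[OF r]
    using lD iD linear_zero[OF lf r(1) rH[OF Y]] linear_zero[OF rep(2)[OF Y] r(2) rH[OF Y]] r
    by (auto simp: rel_def)
  moreover have "dense (rep X) (Domain (rel X Y f))"
    unfolding dense_def
  proof
    fix u assume u: "u \<in> carrier (rep X)"
    obtain I where I: "I \<in> F" "\<And>a. a \<in> I \<Longrightarrow> a \<in> carrier EM"
      "\<And>a. a \<in> I \<Longrightarrow> (f \<cdot> incl X u) \<triangleleft>\<^bsub>H Y\<^esub> a \<in> incl Y ` carrier (rep Y)"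
      by (rule denseE[OF rep(4)[OF Y] lD(1)[OF u]]) blast
    show "u \<in> sat (rep X) (Domain (rel X Y f))"
    proof (rule satI[OF u I(1)])
      fix a assume a: "a \<in> I"
      obtain w where "w \<in> carrier (rep Y)" "(f \<cdot> incl X u) \<triangleleft>\<^bsub>H Y\<^esub> a = incl Y w" using I(3)[OF a] by auto
      then have "(u \<triangleleft>\<^bsub>rep X\<^esub> a, w) \<in> rel X Y f"
        using u I(2)[OF a] r lD(3)[OF u I(2)[OF a]] by (simp add: rel_def)
      then show "u \<triangleleft>\<^bsub>rep X\<^esub> a \<in> Domain (rel X Y f)" by blast
    qed
  qed
  moreover have "w \<in> tors (rep Y)" if "(\<zero>\<^bsub>rep X\<^esub>, w) \<in> rel X Y f" for w
  proof -
    have "w \<in> carrier (rep Y)" "incl Y w = Zero C M Y"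
      using that linear_zero[OF lf r(1) rH[OF Y]] by (auto simp: rel_def)
    then have "w = \<zero>\<^bsub>rep Y\<^esub>" using incl_zero_iff[OF Y] by simp
    then show ?thesis using subset_sat[OF r(2) submodule_zero[OF r(2)]] by simp
  qed
  moreover have "(u, w) \<in> rel X Y f" if uw: "(u, w) \<in> sat (prod_mod (rep X) (rep Y)) (rel X Y f)" for u w
  proof -
    obtain I where I: "u \<in> carrier (rep X)" "w \<in> carrier (rep Y)" "I \<in> F"
      "\<forall>a\<in>I. (u \<triangleleft>\<^bsub>rep X\<^esub> a, w \<triangleleft>\<^bsub>rep Y\<^esub> a) \<in> rel X Y f" using uw unfolding sat_prod_iff by blast
    have "f \<cdot> incl X u = incl Y w"
    proof (rule eq_if_eq_on_F[OF I(3)])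
      fix a assume a: "a \<in> I"
      then show "(f \<cdot> incl X u) \<cdot> a = incl Y w \<cdot> a"
        using I(4) lD(3)[OF I(1) F_carrierD[OF I(3) a]] iD(3)[OF I(2) F_carrierD[OF I(3) a]]
        by (auto simp: rel_def)
    qed (use lD(1)[OF I(1)] iD(1)[OF I(2)] in auto)
    then show ?thesis using I by (simp add: rel_def)
  qed
  ultimately show ?thesis by (auto simp: qmor_def pre_mor_def)
qed

definition hom_functor where
  "hom_functor = \<lparr>obj_map = rep, arr_map = (\<lambda>f. qarr (rep (Dom C f)) (rep (Cod C f)) (rel (Dom C f) (Cod C f) f))\<rparr>"

lemma hom_functor_arr: "f \<in> hom_set C X Y \<Longrightarrow> arr_map hom_functor f = qarr (rep X) (rep Y) (rel X Y f)"
  by (auto simp: hom_functor_def hom_set_def)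

lemma hom_functor_obj: "obj_map hom_functor = rep"
  by (simp add: hom_functor_def)

lemma is_functor_hom: "is_functor C quot hom_functor"
proof (rule is_functorI[OF category_axioms category_quot])
  fix X assume X: "X \<in> Obj C"
  then show "obj_map hom_functor X \<in> Obj quot" using rep(1)[OF X] by (simp add: hom_functor_obj Obj_quot)
  have "graph (rep X) (\<lambda>x. x) \<subseteq> rel X X (Ident C X)"
    using Ident_left[OF incl_in[OF X]] by (auto simp: graph_iff rel_def)
  then have "rel X X (Ident C X) = qgraph (rep X) (rep X) (\<lambda>x. x)"
    by (intro qmor_eq_qgraph rep_rmod X linear_id qmor_rel Ident_in)
  then show "arr_map hom_functor (Ident C X) = Ident quot (obj_map hom_functor X)"
    using Ident_quot[OF rep(1)[OF X]] by (simp add: hom_functor_arr[OF Ident_in[OF X]] hom_functor_obj)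
next
  fix f X Y assume f: "f \<in> hom_set C X Y"
  then show "arr_map hom_functor f \<in> hom_set quot (obj_map hom_functor X) (obj_map hom_functor Y)"
    unfolding hom_functor_arr[OF f] hom_functor_obj
    using hom_set_Obj[OF f] by (intro hom_quotI qmor_rel rep(1))
next
  fix f g X Y Z assume f: "f \<in> hom_set C X Y" and g: "g \<in> hom_set C Y Z"
  have X: "X \<in> Obj C" and Y: "Y \<in> Obj C" and Z: "Z \<in> Obj C" using hom_set_Obj[OF f] hom_set_Obj[OF g] by auto
  note r = rep_rmod[OF X] rep_rmod[OF Y] rep_rmod[OF Z]
  note gf = Comp_in[OF f g]
  have "rel X Y f O rel Y Z g \<subseteq> rel X Z (g \<cdot> f)"
    using Comp_assoc[OF incl_in[OF X] f g] by (auto simp: rel_def)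
  then have "rel X Z (g \<cdot> f) = qcomp (rep X) (rep Z) (rel X Y f) (rel Y Z g)"
    using pre_mor_comp[OF r qmor_pre[OF qmor_rel[OF f]] qmor_pre[OF qmor_rel[OF g]]]
    by (intro qmor_eq_sat r qmor_rel gf)
  then show "arr_map hom_functor (g \<cdot> f) = arr_map hom_functor g \<cdot>\<^bsub>quot\<^esub> arr_map hom_functor f"
    using Comp_quot[OF rep(1)[OF X] rep(1)[OF Y] rep(1)[OF Z] qmor_rel[OF f] qmor_rel[OF g]]
    by (simp add: hom_functor_arr[OF f] hom_functor_arr[OF g] hom_functor_arr[OF gf])
qed

lemma dense_incl_image:
  assumes X: "X \<in> Obj C" and d: "dense (rep X) D" and D: "submodule EM (rep X) D"
  shows "dense (H X) (incl X ` D)"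
proof (rule dense_sat[OF rep(4)[OF X] submodule_image[OF rep(2)[OF X] rep_rmod[OF X] rH[OF X] D] rH[OF X]])
  show "incl X ` carrier (rep X) \<subseteq> sat (H X) (incl X ` D)"
  proof clarify
    fix u assume "u \<in> carrier (rep X)"
    then have "u \<in> sat (rep X) D" using d by (auto simp: dense_def)
    then show "incl X u \<in> sat (H X) (incl X ` D)" by (rule linear_sat[OF rep(2)[OF X], rotated]) auto
  qed
qed

lemma noetherian_ob:
  assumes U: "ob U" and D: "submodule EM U D"
  obtains T where "finite T" "T \<subseteq> D" "D = gen U T"
proof -
  have r: "rmod U" and "fin_gen EM U" using U by auto
  then obtain S where S: "finite S" "S \<subseteq> carrier U" "gen U S = carrier U" using fin_gen_iff by blast
  have "D \<subseteq> gen U S" using D S(3) by (simp add: submodule_iff[OF r])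
  from noetherian_submodule[OF noetherian r S(1,2) D this] show ?thesis using that by blast
qed

text \<open>Inside Hom(M, X) and Hom(M, Y) the relation G is single-valued, the latter module being
  torsion-free. Generators of its domain are jointly epimorphic by density, so
  \<open>extend_relation\<close> supplies f; then G and the relation of f share a part with the
  whole domain of G.\<close>

lemma hom_functor_full:
  assumes X: "X \<in> Obj C" and Y: "Y \<in> Obj C" and G: "qmor (rep X) (rep Y) G"
  obtains f where "f \<in> hom_set C X Y" "rel X Y f = G"
proof -
  note r = rep_rmod[OF X] rep_rmod[OF Y] and rX = rH[OF X] and rY = rH[OF Y]
  note pre = qmor_pre[OF G]
  note GD = rel_submoduleD[OF pre_morD[OF pre] r]
  let ?i = "\<lambda>p. (incl X (fst p), incl Y (snd p))"
  let ?\<Gamma> = "?i ` G"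
  have lin: "linear (prod_mod (rep X) (rep Y)) (prod_mod (H X) (H Y)) ?i"
    using linearD[OF rep(2)[OF X]] linearD[OF rep(2)[OF Y]] by (auto simp: linear_def)
  have \<Gamma>: "submodule EM (prod_mod (H X) (H Y)) ?\<Gamma>"
    by (rule submodule_image[OF lin rmod_prod[OF r] rmod_prod[OF rX rY] pre_morD[OF pre]])
  have sv: "y = Zero C M Y" if y: "(Zero C M X, y) \<in> ?\<Gamma>" for y
  proof -
    obtain u w where uw: "(u, w) \<in> G" "incl X u = Zero C M X" "y = incl Y w" using y by auto
    then have "u = \<zero>\<^bsub>rep X\<^esub>" using incl_zero_iff[OF X GD(1)[OF uw(1)]] by simp
    then have "w \<in> tors (rep Y)" using uw(1) pre by (simp add: pre_mor_def)
    then have "incl Y w \<in> tors (H Y)"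
      by (rule linear_sat[OF rep(2)[OF Y], rotated]) (use linear_zero[OF rep(2)[OF Y] r(2) rY] in auto)
    then show ?thesis using tors_H[OF Y] uw(3) by simp
  qed
  note dom = submodule_Domain[OF pre_morD[OF pre] r]
  obtain T where T: "finite T" "T \<subseteq> Domain G" "Domain G = gen (rep X) T" using noetherian_ob[OF rep(1)[OF X] dom] .
  have TX: "T \<subseteq> carrier (rep X)" using T(2) GD(1) by auto
  obtain ts where ts: "set ts = T" using finite_list[OF T(1)] by auto
  let ?xs = "map (incl X) ts"
  have "dense (H X) (incl X ` Domain G)"
    using dense_incl_image[OF X _ dom] pre by (simp add: pre_mor_def)
  then have "dense (H X) (gen (H X) (set ?xs))"
    using gen_linear_image[OF rep(2)[OF X] r(1) rX TX] T(3) ts by simp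
  then have je: "jointly_epi X (set ?xs)"
    by (rule jointly_epi_dense[OF X]) (use TX ts incl_in[OF X] in auto)
  have xs: "set ?xs \<subseteq> Domain ?\<Gamma>" using ts T(2) by force
  obtain f where f: "f \<in> hom_set C X Y" "\<forall>x\<in>set ?xs. (x, f \<cdot> x) \<in> ?\<Gamma>"
    using extend_relation[OF X Y \<Gamma> sv xs je] by blast
  note qf = qmor_rel[OF f(1)]
  have sub: "submodule EM (prod_mod (rep X) (rep Y)) (G \<inter> rel X Y f)"
    by (rule submodule_Int[OF rmod_prod[OF r] pre_morD[OF pre] pre_morD[OF qmor_pre[OF qf]]])
  have "T \<subseteq> Domain (G \<inter> rel X Y f)"
  proof
    fix t assume t: "t \<in> T"
    then have "(incl X t, f \<cdot> incl X t) \<in> ?\<Gamma>" using f(2) ts by auto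
    then obtain u w where uw: "(u, w) \<in> G" "incl X u = incl X t" "incl Y w = f \<cdot> incl X t" by auto
    then have "u = t" using rep(3)[OF X] GD(1)[OF uw(1)] TX t by (auto dest: inj_onD)
    then show "t \<in> Domain (G \<inter> rel X Y f)" using uw GD(1,2)[OF uw(1)] by (auto simp: rel_def)
  qed
  then have "Domain G \<subseteq> Domain (G \<inter> rel X Y f)"
    unfolding T(3) by (rule gen_least[OF submodule_Domain[OF sub r]])
  then have "pre_mor (rep X) (rep Y) (G \<inter> rel X Y f)"
    using sub pre dense_mono[of "rep X" "Domain G"] by (auto simp: pre_mor_def)
  then have "rel X Y f = G" using qmor_eqI[OF r _ qf G] by blast
  then show ?thesis using that f(1) by blast
qed

text \<open>Arrows with the same relation agree on a dense subset of Hom(M, X), and such a subset is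
  jointly epimorphic.\<close>

lemma hom_functor_faithful:
  assumes f: "f \<in> hom_set C X Y" and g: "g \<in> hom_set C X Y" and eq: "rel X Y f = rel X Y g"
  shows "f = g"
proof -
  have X: "X \<in> Obj C" and Y: "Y \<in> Obj C" using hom_set_Obj[OF f] by auto
  note r = rep_rmod[OF X] rep_rmod[OF Y]
  note pre = qmor_pre[OF qmor_rel[OF f]]
  note dom = submodule_Domain[OF pre_morD[OF pre] r]
  let ?D = "incl X ` Domain (rel X Y f)"
  have D: "?D \<subseteq> hom_set C M X" using incl_in[OF X] by (auto simp: rel_def)
  have "dense (H X) ?D" using dense_incl_image[OF X _ dom] pre by (simp add: pre_mor_def)
  then have "dense (H X) (gen (H X) ?D)" by (rule dense_mono) (rule gen_superset)
  then have "jointly_epi X ?D" by (rule jointly_epi_dense[OF X _ D])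
  then show ?thesis
  proof (rule jointly_epiD[OF _ f g])
    fix x assume "x \<in> ?D"
    then obtain u w where u: "(u, w) \<in> rel X Y f" "x = incl X u" by auto
    moreover have "(u, w) \<in> rel X Y g" using u(1) eq by simp
    ultimately show "f \<cdot> x = g \<cdot> x" by (simp add: rel_def)
  qed
qed

text \<open>A finite presentation of \<open>Q\<close> defines a morphism between powers of \<open>M\<close>, whose cokernel is
  the required object.\<close>

lemma hom_functor_surjective:
  assumes Q: "ob Q"
  shows "\<exists>X\<in>Obj C. \<exists>i\<in>hom_set quot (rep X) Q. is_iso quot i"
proof -
  have rQ: "rmod Q" and fg: "fin_gen EM Q" using Q by auto
  obtain S where S: "finite S" "S \<subseteq> carrier Q" "gen Q S = carrier Q" using fg fin_gen_iff[OF rQ] by auto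
  obtain ys where ys: "set ys = S" using finite_list[OF S(1)] by auto
  obtain P j where P: "is_coproduct C (length ys) (\<lambda>_. M) P j"
    using finite_coproducts[of "length ys" "\<lambda>_. M"] M by blast
  note PO = coproductD(1)[OF P] and j = coproductD(2)[OF P]
  note rP = rH[OF PO]
  obtain \<psi> where \<psi>: "linear (H P) Q \<psi>" "\<forall>i<length ys. \<psi> (j i) = ys ! i"
    using coproduct_free[OF P rQ, of "\<lambda>i. ys ! i"] S(2) ys nth_mem by blast
  have surj: "\<psi> ` hom_set C M P = carrier Q"
  proof
    have img: "submodule EM Q (\<psi> ` carrier (H P))" by (rule submodule_image[OF \<psi>(1) rP rQ submodule_carrier[OF rP]])
    have "S \<subseteq> \<psi> ` carrier (H P)"
    proof
      fix y assume "y \<in> S"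
      then obtain i where "i < length ys" "y = ys ! i" using ys by (metis in_set_conv_nth)
      then show "y \<in> \<psi> ` carrier (H P)" using \<psi>(2) j[of i] by (intro image_eqI[of _ _ "j i"]) auto
    qed
    then have "carrier Q \<subseteq> \<psi> ` carrier (H P)" unfolding S(3)[symmetric] by (rule gen_least[OF img])
    then show "carrier Q \<subseteq> \<psi> ` hom_set C M P" by simp
    show "\<psi> ` hom_set C M P \<subseteq> carrier Q" using linearD(1)[OF \<psi>(1)] by auto
  qed
  \<comment> \<open>The relations of the presentation. As Hom(M, P) is finitely generated, so is
    this submodule, and its generators are the components of an arrow \<open>\<rho>\<close> between
    powers of M.\<close>
  let ?Z = "{v \<in> hom_set C M P. \<psi> v = \<zero>\<^bsub>Q\<^esub>}"
  have Z: "submodule EM (H P) ?Z"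
    using submodule_vimage[OF \<psi>(1) rP rQ submodule_zero[OF rQ]] by simp
  let ?J = "j ` {..<length ys}"
  have J: "?J \<subseteq> carrier (H P)" using j by auto
  have "?Z \<subseteq> gen (H P) ?J"
    using coproduct_generated[OF P submodule_gen[OF rP J]] gen_superset[of ?J "H P"] by blast
  then obtain T where T: "finite T" "T \<subseteq> ?Z" "?Z = gen (H P) T"
    using noetherian_submodule[OF noetherian rP _ J Z] by auto
  obtain rs where rs: "set rs = T" using finite_list[OF T(1)] by auto
  have rsP: "set rs \<subseteq> hom_set C M P" using rs T(2) by auto
  obtain P' j' \<rho> where P': "is_coproduct C (length rs) (\<lambda>_. M) P' j'" "\<rho> \<in> hom_set C P' P"
    "\<forall>i<length rs. \<rho> \<cdot> j' i = rs ! i"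
    using coproduct_family[OF M PO rsP] .
  note P'O = coproductD(1)[OF P'(1)] and j' = coproductD(2)[OF P'(1)]
  note rP' = rH[OF P'O]
  obtain q where q: "is_cokernel C \<rho> q" using cokernels hom_setD(1)[OF P'(2)] by blast
  obtain X where X: "q \<in> hom_set C P X" "q \<cdot> \<rho> = Zero C P' X"
    "\<forall>W. \<forall>g\<in>hom_set C P W. g \<cdot> \<rho> = Zero C P' W \<longrightarrow> (\<exists>!h. h \<in> hom_set C X W \<and> h \<cdot> q = g)"
    using is_cokernelE[OF q P'(2)] .
  have XO: "X \<in> Obj C" using hom_set_Obj(2)[OF X(1)] .
  note r = rep_rmod[OF XO]
  have kill: "q \<cdot> v = Zero C M X" if v: "v \<in> hom_set C M P" "\<psi> v = \<zero>\<^bsub>Q\<^esub>" for v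
  proof -
    have "submodule EM (H P) {v \<in> hom_set C M P. q \<cdot> v \<in> {Zero C M X}}"
      using submodule_vimage[OF linear_postcomp[OF M X(1)] rP rH[OF XO] submodule_zero[OF rH[OF XO]]] by simp
    then have "?Z \<subseteq> {v \<in> hom_set C M P. q \<cdot> v \<in> {Zero C M X}}"
      unfolding T(3)
    proof (rule gen_least, intro subsetI)
      fix t assume t: "t \<in> T"
      then obtain i where i: "i < length rs" "t = \<rho> \<cdot> j' i" using rs P'(3) by (metis in_set_conv_nth)
      then have "q \<cdot> t = Zero C M X"
        using Comp_assoc[OF j'[OF i(1)] P'(2) X(1)] X(2) Comp_Zero_left[OF j'[OF i(1)] XO] by simp
      then show "t \<in> {v \<in> hom_set C M P. q \<cdot> v \<in> {Zero C M X}}" using t T(2) by auto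
    qed
    then show ?thesis using v by auto
  qed
  \<comment> \<open>Elements killed by q are relations up to torsion. Such a v factors through the
    image of \<open>\<rho>\<close>, and by F-projectivity its multiples by an ideal in F lift along
    the epimorphism onto that image, hence are relations.\<close>
  have tors: "\<psi> v \<in> tors Q" if v: "v \<in> hom_set C M P" "q \<cdot> v = Zero C M X" for v
  proof -
    obtain k where k: "is_kernel C q k" using kernels hom_setD(1)[OF X(1)] by blast
    obtain K where K: "k \<in> hom_set C K P" "q \<cdot> k = Zero C K X"
      "\<forall>W. \<forall>g\<in>hom_set C W P. q \<cdot> g = Zero C W X \<longrightarrow> (\<exists>!h. h \<in> hom_set C W K \<and> k \<cdot> h = g)"
      using is_kernelE[OF k X(1)] .
    obtain \<rho>' where \<rho>': "\<rho>' \<in> hom_set C P' K" "k \<cdot> \<rho>' = \<rho>" using K(3) P'(2) X(2) by blast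
    obtain v' where v': "v' \<in> hom_set C M K" "k \<cdot> v' = v" using K(3) v by blast
    have epi: "is_epi C \<rho>'" by (rule image_factor_epi[OF P'(2) q k K(1) \<rho>'])
    obtain I where I: "I \<in> F" "\<forall>a\<in>I. \<exists>x\<in>hom_set C M P'. v' \<cdot> a = \<rho>' \<cdot> x"
      using projective[OF \<rho>'(1) epi v'(1)] .
    have "submodule EM (H P') {w \<in> hom_set C M P'. \<rho> \<cdot> w \<in> ?Z}"
      using submodule_vimage[OF linear_postcomp[OF M P'(2)] rP' rP Z] by simp
    then have all: "hom_set C M P' \<subseteq> {w \<in> hom_set C M P'. \<rho> \<cdot> w \<in> ?Z}"
    proof (rule coproduct_generated[OF P'(1)])
      fix i assume i: "i < length rs"
      then have "\<rho> \<cdot> j' i \<in> ?Z" using P'(3) rs T(2) nth_mem[OF i] by auto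
      then show "j' i \<in> {w \<in> hom_set C M P'. \<rho> \<cdot> w \<in> ?Z}" using j'[OF i] by simp
    qed
    show ?thesis
    proof (rule satI[OF _ I(1)])
      show "\<psi> v \<in> carrier Q" using linearD(1)[OF \<psi>(1)] v by simp
      fix a assume a: "a \<in> I"
      then obtain w where w: "w \<in> hom_set C M P'" "v' \<cdot> a = \<rho>' \<cdot> w" using I(2) by blast
      have aM: "a \<in> hom_set C M M" by (rule F_hom[OF I(1) a])
      have "v \<cdot> a = \<rho> \<cdot> w"
        using Comp_assoc[OF aM v'(1) K(1)] Comp_assoc[OF w(1) \<rho>'(1) K(1)] v'(2) \<rho>'(2) w(2) by simp
      moreover have "\<rho> \<cdot> w \<in> ?Z" using all w(1) by auto
      ultimately have "\<psi> (v \<cdot> a) = \<zero>\<^bsub>Q\<^esub>" by simp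
      then show "\<psi> v \<triangleleft>\<^bsub>Q\<^esub> a \<in> {\<zero>\<^bsub>Q\<^esub>}" using linearD(3)[OF \<psi>(1), of v a] v aM by simp
    qed
  qed
  have lq: "linear (H P) (H X) (\<lambda>v. q \<cdot> v)" by (rule linear_postcomp[OF M X(1)])
  \<comment> \<open>Hom(M, P) maps onto Q by \<open>\<psi>\<close> and densely to Hom(M, X) by q,
    with kernels that agree up to torsion by \<open>kill\<close> and \<open>tors\<close>. This
    relation through Hom(M, P) is therefore a morphism in both directions.\<close>
  let ?G = "{(u, \<psi> v) | u v. u \<in> carrier (rep X) \<and> v \<in> hom_set C M P \<and> incl X u = q \<cdot> v}"
  have sub: "submodule EM (prod_mod (rep X) Q) ?G"
    unfolding rel_submodule_iff[OF r rQ]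
  proof (intro conjI allI impI)
    have "incl X \<zero>\<^bsub>rep X\<^esub> = q \<cdot> Zero C M P"
      using linear_zero[OF rep(2)[OF XO] r rH[OF XO]] linear_zero[OF lq rP rH[OF XO]] by simp
    then show "(\<zero>\<^bsub>rep X\<^esub>, \<zero>\<^bsub>Q\<^esub>) \<in> ?G"
      using linear_zero[OF \<psi>(1) rP rQ] r Zero_in[OF M PO] by force
  next
    fix u y u' y' assume "(u, y) \<in> ?G" "(u', y') \<in> ?G"
    then obtain v v' where v: "u \<in> carrier (rep X)" "v \<in> hom_set C M P" "incl X u = q \<cdot> v" "y = \<psi> v"
      "u' \<in> carrier (rep X)" "v' \<in> hom_set C M P" "incl X u' = q \<cdot> v'" "y' = \<psi> v'" by blast
    then have "incl X (u \<oplus>\<^bsub>rep X\<^esub> u') = q \<cdot> Add C v v'" "y \<oplus>\<^bsub>Q\<^esub> y' = \<psi> (Add C v v')"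
      using linearD(2)[OF rep(2)[OF XO] v(1,5)] linearD(2)[OF lq, of v v'] linearD(2)[OF \<psi>(1), of v v'] by simp_all
    then show "(u \<oplus>\<^bsub>rep X\<^esub> u', y \<oplus>\<^bsub>Q\<^esub> y') \<in> ?G"
      using v r Add_in[OF M PO v(2,6)] by auto
  next
    fix u y a assume "(u, y) \<in> ?G" and a: "a \<in> carrier EM"
    then obtain v where v: "u \<in> carrier (rep X)" "v \<in> hom_set C M P" "incl X u = q \<cdot> v" "y = \<psi> v" by blast
    then have "incl X (u \<triangleleft>\<^bsub>rep X\<^esub> a) = q \<cdot> (v \<cdot> a)" "y \<triangleleft>\<^bsub>Q\<^esub> a = \<psi> (v \<cdot> a)"
      using linearD(3)[OF rep(2)[OF XO] v(1) a] linearD(3)[OF lq, of v a] linearD(3)[OF \<psi>(1), of v a] a by simp_all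
    moreover have "v \<cdot> a \<in> hom_set C M P" using Comp_in[of a M M v P] a v by simp
    ultimately show "(u \<triangleleft>\<^bsub>rep X\<^esub> a, y \<triangleleft>\<^bsub>Q\<^esub> a) \<in> ?G"
      using v(1) a r by auto
  qed (use linearD(1)[OF \<psi>(1)] in auto)
  have pre1: "pre_mor (rep X) Q ?G"
  proof -
    have "dense (rep X) (Domain ?G)"
      unfolding dense_def
    proof
      fix u assume u: "u \<in> carrier (rep X)"
      obtain I where I: "I \<in> F" "\<forall>a\<in>I. \<exists>v\<in>hom_set C M P. incl X u \<cdot> a = q \<cdot> v"
        using projective[OF X(1) cokernel_epi[OF q] incl_in[OF XO u]] .
      show "u \<in> sat (rep X) (Domain ?G)"
      proof (rule satI[OF u I(1)])
        fix a assume a: "a \<in> I"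
        obtain v where v: "v \<in> hom_set C M P" "incl X u \<cdot> a = q \<cdot> v" using I(2) a by blast
        have aE: "a \<in> carrier EM" by (rule F_carrierD[OF I(1) a])
        have "incl X (u \<triangleleft>\<^bsub>rep X\<^esub> a) = q \<cdot> v" using linearD(3)[OF rep(2)[OF XO] u aE] v(2) by simp
        then have "(u \<triangleleft>\<^bsub>rep X\<^esub> a, \<psi> v) \<in> ?G" using v(1) u aE r by auto
        then show "u \<triangleleft>\<^bsub>rep X\<^esub> a \<in> Domain ?G" by blast
      qed
    qed
    moreover have "y \<in> tors Q" if "(\<zero>\<^bsub>rep X\<^esub>, y) \<in> ?G" for y
      using that tors linear_zero[OF rep(2)[OF XO] r rH[OF XO]] by auto
    ultimately show ?thesis using sub by (simp add: pre_mor_def)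
  qed
  have pre2: "pre_mor Q (rep X) (?G\<inverse>)"
  proof -
    have "dense Q (Domain (?G\<inverse>))"
      unfolding dense_def
    proof
      fix y assume y: "y \<in> carrier Q"
      then obtain v where v: "v \<in> hom_set C M P" "y = \<psi> v" using surj by auto
      have "q \<cdot> v \<in> carrier (H X)" using Comp_in[OF v(1) X(1)] by simp
      from rep(4)[OF XO] this obtain I where I: "I \<in> F" "\<And>a. a \<in> I \<Longrightarrow> a \<in> carrier EM"
        "\<And>a. a \<in> I \<Longrightarrow> (q \<cdot> v) \<triangleleft>\<^bsub>H X\<^esub> a \<in> incl X ` carrier (rep X)" by (rule denseE) blast
      show "y \<in> sat Q (Domain (?G\<inverse>))"
      proof (rule satI[OF y I(1)])
        fix a assume a: "a \<in> I"
        obtain u where u: "u \<in> carrier (rep X)" "(q \<cdot> v) \<triangleleft>\<^bsub>H X\<^esub> a = incl X u" using I(3)[OF a] by auto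
        have "incl X u = q \<cdot> (v \<cdot> a)" using u(2) linearD(3)[OF lq, of v a] v(1) I(2)[OF a] by simp
        moreover have "v \<cdot> a \<in> hom_set C M P" using Comp_in[of a M M v P] I(2)[OF a] v(1) by simp
        moreover have "y \<triangleleft>\<^bsub>Q\<^esub> a = \<psi> (v \<cdot> a)" using v linearD(3)[OF \<psi>(1), of v a] I(2)[OF a] by simp
        ultimately have "(u, y \<triangleleft>\<^bsub>Q\<^esub> a) \<in> ?G" using u(1) by blast
        then show "y \<triangleleft>\<^bsub>Q\<^esub> a \<in> Domain (?G\<inverse>)" by blast
      qed
    qed
    moreover have "u \<in> tors (rep X)" if u: "(\<zero>\<^bsub>Q\<^esub>, u) \<in> ?G\<inverse>" for u
    proof -
      obtain v where "u \<in> carrier (rep X)" "v \<in> hom_set C M P" "incl X u = q \<cdot> v" "\<psi> v = \<zero>\<^bsub>Q\<^esub>"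
        using u by auto
      then have "u = \<zero>\<^bsub>rep X\<^esub>" using kill[of v] incl_zero_iff[OF XO, of u] by simp
      then show ?thesis using subset_sat[OF r submodule_zero[OF r]] by simp
    qed
    ultimately show ?thesis using submodule_converse[OF sub r rQ] by (simp add: pre_mor_def)
  qed
  show ?thesis
    using XO is_iso_qarr[OF rep(1)[OF XO] Q pre1 pre2] hom_quotI[OF rep(1)[OF XO] Q qmor_sat[OF r rQ pre1]] by blast
qed

lemma equivalence: "equivalent_cats C quot"
proof (rule equivalent_catsI[OF is_functor_hom], unfold hom_functor_obj)
  fix X Y g assume X: "X \<in> Obj C" and Y: "Y \<in> Obj C" and g: "g \<in> hom_set quot (rep X) (rep Y)"
  obtain G where G: "qmor (rep X) (rep Y) G" "g = qarr (rep X) (rep Y) G" using hom_quotE[OF g] .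
  obtain f where f: "f \<in> hom_set C X Y" "rel X Y f = G" using hom_functor_full[OF X Y G(1)] .
  show "\<exists>!f. f \<in> hom_set C X Y \<and> arr_map hom_functor f = g"
  proof (intro ex1I conjI)
    show "f \<in> hom_set C X Y" "arr_map hom_functor f = g" using f G(2) by (simp_all add: hom_functor_arr)
    fix f' assume f': "f' \<in> hom_set C X Y \<and> arr_map hom_functor f' = g"
    then have "qarr (rep X) (rep Y) G = qarr (rep X) (rep Y) (rel X Y f')" using G(2) hom_functor_arr[of f' X Y] by simp
    then have "G = rel X Y f'" by (rule qarr_inject[OF rep(1)[OF X] rep(1)[OF Y] G(1)])
    then show "f' = f" using hom_functor_faithful[of f' X Y f] f' f by simp
  qed
qed (simp add: Obj_quot hom_functor_surjective)

lemma eclosed_reg: "eclosed (reg e EM)"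
proof (rule eclosed_iso[OF eclosed_H[OF M] rmod_reg[OF inj_e]])
  show "linear (H M) (reg e EM) e" using linear_reg[OF inj_e] by (simp add: linear_def)
  show "bij_betw e (carrier (H M)) (carrier (reg e EM))"
    using inj_e by (simp add: carrier_reg[OF inj_e] inj_on_imp_bij_betw)
qed

lemma ample_imp_closed_and_equivalent:
  "F_closed EM F (reg e EM)" "equivalent_cats C (fgmod_quot EM F :: ('m, 'u) rmod_quot_cat)"
  using F_closedI[OF noetherian e eclosed_reg] equivalence by (simp_all add: quotient_data_fin_gen(2))

end

theorem theorem1p1:
  fixes C :: "('o, 'm) addcat" and M :: 'o and F :: "'m set set" and e :: "'m \<Rightarrow> 'u"
    and A :: "'a ring" and F' :: "'a set set" and e' :: "'a \<Rightarrow> 'v"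
  shows
    "(abelian_category C \<and> M \<in> Obj C \<and> right_noetherian (End_ring C M) \<and>
      gabriel_topology (End_ring C M) F \<and> ample C M F \<and>
      universe_embedding (End_ring C M) e
      \<longrightarrow> F_closed (End_ring C M) F (reg e (End_ring C M)) \<and>
          equivalent_cats C (fgmod_quot (End_ring C M) F :: ('m, 'u) rmod_quot_cat))
   \<and> (right_noetherian A \<and> gabriel_topology A F' \<and>
      universe_embedding A e' \<and> F_closed A F' (reg e' A)
      \<longrightarrow> (let D = fgmod_quot A F' :: ('a, 'v) rmod_quot_cat;
               N = obj_map (fgmod_pi A F') (reg e' A);
               G = (\<lambda>I. canonical_map e' A F' ` I) ` F'
           in canonical_map e' A F' \<in> ring_iso A (End_ring D N) \<and>
              gabriel_topology (End_ring D N) G \<and>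
              ample D N G))"
proof (intro conjI impI)
  assume *: "abelian_category C \<and> M \<in> Obj C \<and> right_noetherian (End_ring C M) \<and>
      gabriel_topology (End_ring C M) F \<and> ample C M F \<and> universe_embedding (End_ring C M) e"
  then interpret ample_universe C M F e
    by (simp add: ample_universe_def ample_object_def ample_object_axioms_def ample_universe_axioms_def)
  show "F_closed (End_ring C M) F (reg e (End_ring C M))"
    "equivalent_cats C (fgmod_quot (End_ring C M) F :: ('m, 'u) rmod_quot_cat)"
    by (rule ample_imp_closed_and_equivalent)+
next
  assume *: "right_noetherian A \<and> gabriel_topology A F' \<and>
      universe_embedding A e' \<and> F_closed A F' (reg e' A)"
  then have ring: "ring A" by (simp add: right_noetherian_def)
  then interpret gabriel A F' using * by (simp add: gabriel_def right_modules_def gabriel_axioms_def)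
  have inf: "infinite (UNIV :: 'v set)" and inj: "inj_on e' (carrier A)"
    using * by (auto simp: universe_embedding_def)
  have "eclosed (reg e' A)" using F_closedD * by blast
  then interpret closed_ring A F' "{X :: ('a, 'v) rmodule. fin_gen A X}" e'
    using gabriel_universe_fin_gen[of A F', OF _ _ inf] * inj
    by (simp add: closed_ring_def closed_ring_axioms_def)
  interpret Q: preadditive_category quot by (rule preadditive_quot)
  have "R \<in> Obj quot" using obR by (simp add: Obj_quot)
  then have "gabriel_topology (End_ring quot R) G"
    using gabriel_topology_ring_iso[OF ring Q.ring_End canonical_map_iso] * by blast
  then show "let D = fgmod_quot A F' :: ('a, 'v) rmod_quot_cat;
               N = obj_map (fgmod_pi A F') (reg e' A);
               G = (\<lambda>I. canonical_map e' A F' ` I) ` F'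
           in canonical_map e' A F' \<in> ring_iso A (End_ring D N) \<and>
              gabriel_topology (End_ring D N) G \<and> ample D N G"
    using canonical_map_iso ample_R by (simp add: quotient_data_fin_gen[OF refl] Let_def)
qed

end
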